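(* Let $f\in H^{-1}(\mathbb{R}^3)$ and fix $\mu>0$. For (sufficiently small) $r>0$ let $d=d(r)>0$ be determined by $\mu=\frac{4\pi r}{d^3}$ and let $$K_r=\bigcup_{x\in(d\mathbb{Z})^3}\overline{B_r(x)}.$$ Then the problems $$-\Delta u_r=f\ \text{ in }\mathbb{R}^3\setminus K_r,\qquad u_r=0\ \text{ in }K_r,$$ have unique solutions $u_r\in H^1(\mathbb{R}^3)$. In the limit $r\to0$ (with $\mu$ constant), $u_r$ converges weakly in $H^1(\mathbb{R}^3)$ to the unique solution $u\in H^1(\mathbb{R}^3)$ of $$-\Delta u+\mu u=f\ \text{ in }\mathbb{R}^3.$$
   Context: Solutions are weak solutions: $u_r\in H^1(\mathbb{R}^3)$ with $u_r=0$ in $K_r$ and $\int\nabla u_r\cdot\nabla v=\langle f,v\rangle$ for all $v\in H^1(\mathbb{R}^3)$ with $v=0$ in $K_r$; $u\in H^1(\mathbb{R}^3)$ with $\int\nabla u\cdot\nabla v+\mu\int uv=\langle f,v\rangle$ for all $v\in H^1(\mathbb{R}^3)$. The radius $r$ is taken small enough (for given $\mu$) that the balls are mutually disjoint and well separated. *)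

theory Defs
  imports "HOL-Analysis.Analysis"
begin

text \<open>Elements of Sobolev spaces are represented by Borel measurable functions; two functions that
  agree almost everywhere represent the same element (every Lebesgue measurable function agrees
  almost everywhere with a Borel measurable one).\<close>

primrec Ck :: "nat \<Rightarrow> ('a::euclidean_space \<Rightarrow> real) \<Rightarrow> bool" where
  "Ck 0 \<phi> \<longleftrightarrow> continuous_on UNIV \<phi>"
| "Ck (Suc k) \<phi> \<longleftrightarrow> (\<forall>x. \<phi> differentiable (at x)) \<and>
     (\<forall>i\<in>Basis. Ck k (\<lambda>x. frechet_derivative \<phi> (at x) i))"

definition test_functions :: "('a::euclidean_space \<Rightarrow> real) set" where
  "test_functions = {\<phi>. (\<forall>k. Ck k \<phi>) \<and> compact (closure {x. \<phi> x \<noteq> 0})}"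

definition L2 :: "('a::euclidean_space \<Rightarrow> 'b::euclidean_space) set" where
  "L2 = {g \<in> borel_measurable lborel. integrable lborel (\<lambda>x. (norm (g x))\<^sup>2)}"

definition has_weak_gradient ::
    "('a::euclidean_space \<Rightarrow> real) \<Rightarrow> ('a \<Rightarrow> 'a) \<Rightarrow> bool" where
  "has_weak_gradient u G \<longleftrightarrow> (\<forall>\<phi>\<in>test_functions. \<forall>i\<in>Basis.
     (\<integral>x. u x * frechet_derivative \<phi> (at x) i \<partial>lborel) = - (\<integral>x. (G x \<bullet> i) * \<phi> x \<partial>lborel))"

definition H1 :: "('a::euclidean_space \<Rightarrow> real) set" where
  "H1 = {u \<in> L2. \<exists>G\<in>L2. has_weak_gradient u G}"

text \<open>The weak gradient is unique only almost everywhere. The choice made here does not affect the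
  integrals below.\<close>

definition weak_gradient :: "('a::euclidean_space \<Rightarrow> real) \<Rightarrow> ('a \<Rightarrow> 'a)" where
  "weak_gradient u = (SOME G. G \<in> L2 \<and> has_weak_gradient u G)"

definition H1_norm :: "('a::euclidean_space \<Rightarrow> real) \<Rightarrow> real" where
  "H1_norm u = sqrt ((\<integral>x. (u x)\<^sup>2 \<partial>lborel) + (\<integral>x. (norm (weak_gradient u x))\<^sup>2 \<partial>lborel))"

text \<open>The space \<open>H\<^sup>-\<^sup>1\<close>, the dual of \<open>H\<^sup>1\<close> on the whole space. The bound forces
  \<open>F\<close> to take the same value on functions in \<open>H1\<close> that agree almost everywhere; values outside
  \<open>H1\<close> are irrelevant.\<close>

definition H_minus1 :: "(('a::euclidean_space \<Rightarrow> real) \<Rightarrow> real) set" where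
  "H_minus1 = {F.
     (\<forall>u\<in>H1. \<forall>v\<in>H1. F (\<lambda>x. u x + v x) = F u + F v) \<and>
     (\<forall>c. \<forall>u\<in>H1. F (\<lambda>x. c * u x) = c * F u) \<and>
     (\<exists>C. \<forall>u\<in>H1. \<bar>F u\<bar> \<le> C * H1_norm u)}"

definition H1_weakly_tendsto ::
    "('i \<Rightarrow> 'a::euclidean_space \<Rightarrow> real) \<Rightarrow> ('a \<Rightarrow> real) \<Rightarrow> 'i filter \<Rightarrow> bool" where
  "H1_weakly_tendsto w u \<F> \<longleftrightarrow> (\<forall>F\<in>H_minus1. ((\<lambda>r. F (w r)) \<longlongrightarrow> F u) \<F>)"

definition cubic_lattice :: "real \<Rightarrow> (real ^ 'n) set" where
  "cubic_lattice d = {x. \<forall>i. \<exists>k::int. x $ i = d * of_int k}"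

definition holes :: "real \<Rightarrow> real \<Rightarrow> (real ^ 'n) set" where
  "holes d r = (\<Union>x\<in>cubic_lattice d. cball x r)"

definition H1_vanishing_in :: "'a::euclidean_space set \<Rightarrow> ('a \<Rightarrow> real) set" where
  "H1_vanishing_in K = {v \<in> H1. AE x in lborel. x \<in> K \<longrightarrow> v x = 0}"

definition weak_solution_outside ::
    "'a::euclidean_space set \<Rightarrow> (('a \<Rightarrow> real) \<Rightarrow> real) \<Rightarrow> ('a \<Rightarrow> real) \<Rightarrow> bool" where
  "weak_solution_outside K f u \<longleftrightarrow> u \<in> H1_vanishing_in K \<and>
     (\<forall>v\<in>H1_vanishing_in K.
        (\<integral>x. weak_gradient u x \<bullet> weak_gradient v x \<partial>lborel) = f v)"

definition weak_solution_limit ::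
    "real \<Rightarrow> (('a::euclidean_space \<Rightarrow> real) \<Rightarrow> real) \<Rightarrow> ('a \<Rightarrow> real) \<Rightarrow> bool" where
  "weak_solution_limit \<mu> f u \<longleftrightarrow> u \<in> H1 \<and>
     (\<forall>v\<in>H1. (\<integral>x. weak_gradient u x \<bullet> weak_gradient v x \<partial>lborel)
        + \<mu> * (\<integral>x. u x * v x \<partial>lborel) = f v)"

text \<open>Existence and uniqueness, where functions equal almost everywhere are identified.\<close>

definition Ex1_ae :: "(('a::euclidean_space \<Rightarrow> real) \<Rightarrow> bool) \<Rightarrow> bool" where
  "Ex1_ae P \<longleftrightarrow> (\<exists>u. P u) \<and> (\<forall>u v. P u \<longrightarrow> P v \<longrightarrow> (AE x in lborel. u x = v x))"

end

theory Submission
  imports Defs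
begin

text \<open>The existence statements follow from the Riesz representation theorem in \<open>H\<^sup>1\<close>; coercivity of
  the perforated problems, uniformly in \<open>r\<close>, comes from a Poincare inequality with a constant of order
  \<open>d\<^sup>3/r\<close> for functions on a cell that vanish in its hole. This also bounds \<open>u\<^sub>r\<close> in \<open>H\<^sup>1\<close>.

  For the limit, every functional in \<open>H\<^sup>-\<^sup>1\<close> is \<open>v \<mapsto> \<integral>\<nabla>p\<bullet>\<nabla>v + \<mu>\<integral>pv\<close> for some \<open>p\<close> that test functions
  approximate, so it suffices that \<open>\<integral>\<nabla>\<phi>\<bullet>\<nabla>u\<^sub>r + \<mu>\<integral>\<phi>u\<^sub>r \<rightarrow> f(\<phi>)\<close> for each test function \<open>\<phi>\<close>. The equation for
  \<open>u\<^sub>r\<close> is tested with \<open>(1 - S)\<phi>\<close>, where \<open>S\<close> is the sum of the capacitary potentials of the holes in balls of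
  an intermediate radius \<open>a\<close>, \<open>r \<lless> a \<lless> d\<close>. The flux of \<open>\<nabla>S\<close> through the spheres of radius \<open>a\<close> is spread
  over the balls of radius \<open>d/2\<close> by an explicit radial field; its divergence is constant there, and
  averaging over the lattice turns \<open>\<integral>\<phi>\<nabla>S\<bullet>\<nabla>u\<^sub>r\<close> into \<open>-4\<pi>r/d\<^sup>3 \<integral>\<phi>u\<^sub>r\<close> up to vanishing errors.\<close>

section \<open>Test functions\<close>

text \<open>No compact embedding is used: the limit is identified on a dense class with explicit
  errors, and translation estimates in H1 take the place of a Rellich argument. Two obstacles shape
  the corrector. Its gradient stays bounded in L2 but does not tend to 0, since the capacitary
  energy per unit volume is about \<mu>. So \<open>f\<close> applied to \<open>S \<phi>\<close>
  cannot be controlled by a norm; it is written through a representative with gradient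
  \<open>Q\<close>, and the smallness comes from absolute continuity of the integral of |Q|^2 over
  the shrinking balls of radius a. Secondly, d^3 is proportional to r, and the spread flux misses
  the gradient of S by a multiple of a + r/a^2, so a must lie well above the square root of r; the
  balls fill a volume fraction of order a^3/d^3, so a must also lie well below r^(1/3). An exponent
  such as 2/5, between 1/3 and 1/2, satisfies both. Surface integrals and polar coordinates are
  avoided: every identity on balls or annuli comes from integrating a compactly supported Lipschitz
  field over the whole space, its radial profile being frozen inside the inner radius.\<close>

abbreviation pd :: "('a::euclidean_space \<Rightarrow> real) \<Rightarrow> 'a \<Rightarrow> 'a \<Rightarrow> real" where
  "pd f i x \<equiv> frechet_derivative f (at x) i"

lemma pd_eqI: "(f has_derivative D) (at x) \<Longrightarrow> pd f i x = D i"
  using frechet_derivative_at by metis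

text \<open>A class of differentiable functions closed under partial derivatives is contained in
  every \<open>Ck k\<close>. The bump function and the convolutions are shown to be smooth by
  exhibiting such a class, without computing higher derivatives.\<close>

lemma Ck_coinduct:
  assumes "\<And>f x. f \<in> S \<Longrightarrow> f differentiable (at x)"
    and "\<And>f i. f \<in> S \<Longrightarrow> i \<in> Basis \<Longrightarrow> pd f i \<in> S"
    and "f \<in> S"
  shows "Ck k f"
  using assms(3)
proof (induction k arbitrary: f)
  case 0
  then show ?case
    using assms(1) by (auto simp: continuous_on_eq_continuous_at intro: differentiable_imp_continuous_within)
next
  case (Suc k)
  then show ?case using assms(1,2) by auto
qed

text \<open>\<open>Ck (Suc k)\<close> speaks only of differentiability and of the partial
  derivatives, so continuity has to be recovered from differentiability at the bottom of the
  induction.\<close>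

lemma Ck_Suc_imp: "Ck (Suc k) f \<Longrightarrow> Ck k f"
proof (induction k arbitrary: f)
  case 0
  then show ?case
    by (auto simp: continuous_on_eq_continuous_at intro: differentiable_imp_continuous_within)
next
  case (Suc k)
  then show ?case by (metis Ck.simps(2))
qed

lemma Ck_const: "Ck k (\<lambda>_::'a::euclidean_space. c)"
  by (rule Ck_coinduct[of "range (\<lambda>c (_::'a). c)"]) auto

lemma Ck_add:
  assumes "Ck k f" "Ck k g" shows "Ck k (\<lambda>x. f x + g x)"
  using assms
proof (induction k arbitrary: f g)
  case 0
  then show ?case by (auto intro: continuous_intros)
next
  case (Suc k)
  have eq: "pd (\<lambda>x. f x + g x) i x = pd f i x + pd g i x" for i x
    using Suc.prems by (intro pd_eqI) (auto intro!: derivative_eq_intros simp flip: frechet_derivative_works)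
  show ?case using Suc by (auto simp: eq)
qed

lemma Ck_mult:
  assumes "Ck k f" "Ck k g" shows "Ck k (\<lambda>x. f x * g x)"
  using assms
proof (induction k arbitrary: f g)
  case 0
  then show ?case by (auto intro: continuous_intros)
next
  case (Suc k)
  have d: "(f has_derivative (\<lambda>i. pd f i x)) (at x)" "(g has_derivative (\<lambda>i. pd g i x)) (at x)" for x
    using Suc.prems by (auto simp flip: frechet_derivative_works)
  have eq: "pd (\<lambda>x. f x * g x) i x = f x * pd g i x + pd f i x * g x" for i x
    by (rule pd_eqI) (rule has_derivative_mult[OF d])
  have "Ck k f" "Ck k g" using Suc.prems Ck_Suc_imp by blast+
  then show ?case using Suc by (auto simp: eq intro!: Ck_add Suc.IH)
qed

lemma Ck_affine:
  assumes "Ck k f" shows "Ck k (\<lambda>x. f (c *\<^sub>R x + b))"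
  using assms
proof (induction k arbitrary: f)
  case 0
  then show ?case by (auto intro!: continuous_intros intro: continuous_on_compose2)
next
  case (Suc k)
  have d: "(f has_derivative (\<lambda>i. pd f i y)) (at y)" for y
    using Suc.prems by (auto simp flip: frechet_derivative_works)
  have d': "((\<lambda>x. f (c *\<^sub>R x + b)) has_derivative (\<lambda>h. pd f (c *\<^sub>R h) (c *\<^sub>R x + b))) (at x)" for x
    by (rule has_derivative_compose[OF _ d]) (auto intro!: derivative_eq_intros)
  have "pd f (c *\<^sub>R i) y = c * pd f i y" for i y
    using linear_scale[OF has_derivative_linear[OF d]] by simp
  then have eq: "pd (\<lambda>x. f (c *\<^sub>R x + b)) i x = c * pd f i (c *\<^sub>R x + b)" for i x
    using pd_eqI[OF d'] by simp
  have "(\<lambda>x. f (c *\<^sub>R x + b)) differentiable (at x)" for x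
    using d' differentiable_def by blast
  then show ?case using Suc by (auto simp: eq intro!: Ck_mult Ck_const Suc.IH)
qed

lemma test_functions_iff:
  "\<phi> \<in> test_functions \<longleftrightarrow> (\<forall>k. Ck k \<phi>) \<and> bounded {x. \<phi> x \<noteq> 0}"
  by (simp add: test_functions_def)

lemma test_differentiable: "\<phi> \<in> test_functions \<Longrightarrow> \<phi> differentiable (at x)"
  unfolding test_functions_iff using Ck.simps(2) by blast

lemma test_derivative: "\<phi> \<in> test_functions \<Longrightarrow> (\<phi> has_derivative (\<lambda>h. pd \<phi> h x)) (at x)"
  using test_differentiable frechet_derivative_works by blast

lemma test_continuous: "\<phi> \<in> test_functions \<Longrightarrow> continuous_on S \<phi>"
  unfolding test_functions_iff using Ck.simps(1) continuous_on_subset by blast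

lemma test_support: 
  assumes "\<phi> \<in> test_functions"
  obtains R where "R > 0" "\<And>x. R \<le> norm x \<Longrightarrow> \<phi> x = 0"
proof -
  from assms obtain B where "\<And>x. \<phi> x \<noteq> 0 \<Longrightarrow> norm x \<le> B"
    unfolding test_functions_iff bounded_iff by blast
  then show ?thesis by (intro that[of "\<bar>B\<bar> + 1"]) fastforce+
qed

lemma test_bounded:
  assumes "\<phi> \<in> test_functions" 
  obtains M where "M > 0" "\<And>x. \<bar>\<phi> x\<bar> \<le> M"
proof -
  from test_support[OF assms] obtain R where R: "R > 0" "\<And>x. R \<le> norm x \<Longrightarrow> \<phi> x = 0" by auto
  have "compact (\<phi> ` cball 0 R)"
    using assms by (intro compact_continuous_image test_continuous) auto
  then obtain M where M: "\<forall>y\<in>\<phi> ` cball 0 R. norm y \<le> M"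
    using compact_imp_bounded bounded_iff by blast
  have "\<bar>\<phi> x\<bar> \<le> max M 1" for x
  proof (cases "norm x \<le> R")
    case True
    then show ?thesis using M by force
  next
    case False
    then show ?thesis using R(2)[of x] by simp
  qed
  then show ?thesis by (intro that[of "max M 1"]) auto
qed

lemma test_zero: "(\<lambda>_. 0) \<in> test_functions"
  by (auto simp: test_functions_iff Ck_const)

lemma test_pd:
  assumes "\<phi> \<in> test_functions" "i \<in> Basis" shows "pd \<phi> i \<in> test_functions"
proof -
  have zero: "pd \<phi> i x = 0" if x: "x \<notin> closure {x. \<phi> x \<noteq> 0}" for x
  proof -
    have "(\<phi> has_derivative (\<lambda>_. 0)) (at x)"
    proof (rule has_derivative_transform_within_open[of "\<lambda>_. 0"])
      show "open (- closure {x. \<phi> x \<noteq> 0})" by auto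
      show "0 = \<phi> y" if "y \<in> - closure {x. \<phi> x \<noteq> 0}" for y
        using that closure_subset[of "{x. \<phi> x \<noteq> 0}"] by auto
    qed (use x in auto)
    from pd_eqI[OF this, of i] show ?thesis .
  qed
  have "bounded {x. \<phi> x \<noteq> 0}" using assms(1) by (simp only: test_functions_iff)
  then have "bounded (closure {x. \<phi> x \<noteq> 0})" by (rule bounded_closure)
  then have "bounded {x. pd \<phi> i x \<noteq> 0}"
    by (rule bounded_subset) (use zero in blast)
  moreover have "Ck k (pd \<phi> i)" for k
  proof -
    have "Ck (Suc k) \<phi>" using assms(1) by (simp only: test_functions_iff)
    then show ?thesis using assms(2) by simp
  qed
  ultimately show ?thesis by (simp add: test_functions_iff)
qed

lemma test_mult:
  assumes "\<phi> \<in> test_functions" "\<psi> \<in> test_functions"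
  shows "(\<lambda>x. \<phi> x * \<psi> x) \<in> test_functions"
proof -
  have "{x. \<phi> x * \<psi> x \<noteq> 0} \<subseteq> {x. \<phi> x \<noteq> 0}" by auto
  then have "bounded {x. \<phi> x * \<psi> x \<noteq> 0}"
    using assms bounded_subset unfolding test_functions_iff by blast
  then show ?thesis using assms by (simp add: test_functions_iff Ck_mult)
qed

lemma test_scale:
  assumes "\<phi> \<in> test_functions"
  shows "(\<lambda>x. c * \<phi> x) \<in> test_functions"
proof -
  have "{x. c * \<phi> x \<noteq> 0} \<subseteq> {x. \<phi> x \<noteq> 0}" by auto
  then have "bounded {x. c * \<phi> x \<noteq> 0}"
    using assms bounded_subset unfolding test_functions_iff by blast
  then show ?thesis using assms by (simp add: test_functions_iff Ck_mult Ck_const)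
qed

lemma test_affine:
  assumes "\<phi> \<in> test_functions" "c \<noteq> 0"
  shows "(\<lambda>x. \<phi> (c *\<^sub>R x + b)) \<in> test_functions"
proof -
  obtain R where R: "R > 0" "\<And>x. R \<le> norm x \<Longrightarrow> \<phi> x = 0"
    using test_support[OF assms(1)] by auto
  have "norm x \<le> (R + norm b) / \<bar>c\<bar>" if "\<phi> (c *\<^sub>R x + b) \<noteq> 0" for x
  proof -
    have "norm (c *\<^sub>R x + b) < R" using R(2) that by force
    then have "norm (c *\<^sub>R x) \<le> R + norm b" by (smt (verit) norm_diff_ineq)
    then show ?thesis using assms(2) by (simp add: field_simps)
  qed
  then have "bounded {x. \<phi> (c *\<^sub>R x + b) \<noteq> 0}" unfolding bounded_iff by blast
  then show ?thesis using assms by (simp add: test_functions_iff Ck_affine)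
qed

lemma pd_affine:
  assumes "\<phi> \<in> test_functions"
  shows "pd (\<lambda>x. \<phi> (c *\<^sub>R x + b)) i x = c * pd \<phi> i (c *\<^sub>R x + b)"
proof -
  have d': "((\<lambda>x. \<phi> (c *\<^sub>R x + b)) has_derivative (\<lambda>h. pd \<phi> (c *\<^sub>R h) (c *\<^sub>R x + b))) (at x)" for x
    by (rule has_derivative_compose[OF _ test_derivative[OF assms]]) (auto intro!: derivative_eq_intros)
  have "pd \<phi> (c *\<^sub>R i) y = c * pd \<phi> i y" for i y
    using linear_scale[OF has_derivative_linear[OF test_derivative[OF assms]]] by simp
  then show ?thesis using pd_eqI[OF d'] by simp
qed

lemma pd_mult:
  assumes "\<phi> \<in> test_functions" "\<psi> \<in> test_functions"
  shows "pd (\<lambda>x. \<phi> x * \<psi> x) i x = \<phi> x * pd \<psi> i x + pd \<phi> i x * \<psi> x"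
  by (rule pd_eqI) (rule has_derivative_mult[OF test_derivative[OF assms(1)] test_derivative[OF assms(2)]])

definition grad :: "('a::euclidean_space \<Rightarrow> real) \<Rightarrow> 'a \<Rightarrow> 'a" where
  "grad f x = (\<Sum>i\<in>Basis. pd f i x *\<^sub>R i)"

lemma grad_inner_Basis: "i \<in> Basis \<Longrightarrow> grad f x \<bullet> i = pd f i x"
  by (simp add: grad_def inner_sum_left_Basis)

lemma grad_inner:
  assumes "\<phi> \<in> test_functions" shows "grad \<phi> x \<bullet> h = pd \<phi> h x"
proof -
  have "pd \<phi> h x = pd \<phi> (\<Sum>i\<in>Basis. (h \<bullet> i) *\<^sub>R i) x" by (simp add: euclidean_representation)
  also have "\<dots> = (\<Sum>i\<in>Basis. (h \<bullet> i) * pd \<phi> i x)"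
    using has_derivative_linear[OF test_derivative[OF assms]]
    by (simp add: linear_sum linear_scale)
  also have "\<dots> = (\<Sum>i\<in>Basis. (pd \<phi> i x *\<^sub>R i) \<bullet> h)"
    by (intro sum.cong refl) (simp add: inner_commute)
  also have "\<dots> = grad \<phi> x \<bullet> h" by (simp only: grad_def inner_sum_left)
  finally show ?thesis by simp
qed

lemma grad_continuous:
  assumes "\<phi> \<in> test_functions" shows "continuous_on S (grad \<phi>)"
proof -
  have "continuous_on S (\<lambda>x. pd \<phi> i x *\<^sub>R i)" if "i \<in> Basis" for i
    by (rule continuous_on_scaleR[OF test_continuous[OF test_pd[OF assms that]] continuous_on_const])
  then have "continuous_on S (\<lambda>x. \<Sum>i\<in>Basis. pd \<phi> i x *\<^sub>R i)"
    by (rule continuous_on_sum)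
  then show ?thesis
    by (rule continuous_on_eq) (simp only: grad_def)
qed

lemma test_grad_derivative:
  "\<phi> \<in> test_functions \<Longrightarrow> (\<phi> has_derivative (\<lambda>h. grad \<phi> x \<bullet> h)) (at x)"
  by (simp only: grad_inner test_derivative)

lemma grad_bounded:
  assumes "\<phi> \<in> test_functions" 
  obtains M where "M > 0" "\<And>x. norm (grad \<phi> x) \<le> M"
proof -
  have "\<exists>M. \<forall>i\<in>Basis. M i > 0 \<and> (\<forall>x. \<bar>pd \<phi> i x\<bar> \<le> M i)"
    by (intro bchoice ballI) (rule test_bounded[OF test_pd[OF assms]], auto)
  then obtain M where M: "\<And>i. i \<in> Basis \<Longrightarrow> M i > 0" "\<And>i x. i \<in> Basis \<Longrightarrow> \<bar>pd \<phi> i x\<bar> \<le> M i"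
    by blast
  have "norm (grad \<phi> x) \<le> (\<Sum>i\<in>Basis. M i)" for x
    unfolding grad_def by (rule order_trans[OF norm_sum]) (auto intro!: sum_mono M)
  note bound = this
  have "(\<Sum>i\<in>Basis. M i) > 0" by (intro sum_pos M) auto
  from that[OF this bound] show ?thesis .
qed

lemma onorm_inner_left_le:
  fixes a :: "'a::real_inner"
  shows "norm a \<le> L \<Longrightarrow> onorm (\<lambda>h. a \<bullet> h) \<le> L"
proof (rule onorm_bound)
  assume L: "norm a \<le> L"
  show "0 \<le> L" using L norm_ge_zero[of a] by linarith
  fix h
  have "norm (a \<bullet> h) \<le> norm a * norm h" using Cauchy_Schwarz_ineq2 by simp
  also have "\<dots> \<le> L * norm h" using L by (intro mult_right_mono) auto
  finally show "norm (a \<bullet> h) \<le> L * norm h" .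
qed

lemma test_lipschitz:
  assumes "\<phi> \<in> test_functions" 
  obtains L where "L > 0" "\<And>x y. \<bar>\<phi> x - \<phi> y\<bar> \<le> L * norm (x - y)"
proof -
  obtain L where L: "L > 0" "\<And>x. norm (grad \<phi> x) \<le> L" using grad_bounded[OF assms] by blast
  have "norm (\<phi> x - \<phi> y) \<le> L * norm (x - y)" for x y
  proof (rule differentiable_bound[of UNIV \<phi> "\<lambda>x h. grad \<phi> x \<bullet> h"])
    show "onorm (\<lambda>h. grad \<phi> x \<bullet> h) \<le> L" for x
      by (rule onorm_inner_left_le[OF L(2)])
  qed (auto intro: test_grad_derivative[OF assms])
  then have "\<bar>\<phi> x - \<phi> y\<bar> \<le> L * norm (x - y)" for x y by simp
  from that[OF L(1) this] show ?thesis .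
qed

lemma grad_lipschitz:
  assumes "\<phi> \<in> test_functions" 
  obtains L where "L > 0" "\<And>x y. norm (grad \<phi> x - grad \<phi> y) \<le> L * norm (x - y)"
proof -
  have "\<exists>M. \<forall>i\<in>Basis. M i > 0 \<and> (\<forall>x y. \<bar>pd \<phi> i x - pd \<phi> i y\<bar> \<le> M i * norm (x - y))"
    by (intro bchoice ballI) (rule test_lipschitz[OF test_pd[OF assms]], auto)
  then obtain M where M: "\<And>i. i \<in> Basis \<Longrightarrow> M i > 0" 
    "\<And>i x y. i \<in> Basis \<Longrightarrow> \<bar>pd \<phi> i x - pd \<phi> i y\<bar> \<le> M i * norm (x - y)"
    by blast
  have "norm (grad \<phi> x - grad \<phi> y) \<le> (\<Sum>i\<in>Basis. M i) * norm (x - y)" for x y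
  proof -
    have "grad \<phi> x - grad \<phi> y = (\<Sum>i\<in>Basis. (pd \<phi> i x - pd \<phi> i y) *\<^sub>R i)"
      by (simp add: grad_def sum_subtractf scaleR_diff_left)
    also have "norm \<dots> \<le> (\<Sum>i\<in>Basis. M i * norm (x - y))"
      by (rule order_trans[OF norm_sum]) (auto intro!: sum_mono M)
    finally show ?thesis by (simp add: sum_distrib_right)
  qed
  note bound = this
  have "(\<Sum>i\<in>Basis. M i) > 0" by (intro sum_pos M) auto
  from that[OF this bound] show ?thesis .
qed

text \<open>The remainder is quadratic because the gradient is Lipschitz: on the ball of radius
  \<open>norm h\<close> about \<open>x\<close> it deviates from \<open>grad \<phi> x\<close> by at
  most \<open>L * norm h\<close>. The bound is uniform in \<open>x\<close>, as needed to
  differentiate under an integral.\<close>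

lemma test_linearization:
  assumes "\<phi> \<in> test_functions" 
  obtains L where "L > 0" "\<And>x h. \<bar>\<phi> (x + h) - \<phi> x - grad \<phi> x \<bullet> h\<bar> \<le> L * (norm h)\<^sup>2"
proof -
  obtain L where L: "L > 0" "\<And>x y. norm (grad \<phi> x - grad \<phi> y) \<le> L * norm (x - y)"
    using grad_lipschitz[OF assms] by blast
  have "norm (\<phi> (x + h) - \<phi> x - grad \<phi> x \<bullet> (x + h - x)) \<le> norm (x + h - x) * (L * norm h)" for x h
  proof (rule differentiable_bound_linearization[where S = "cball x (norm h)" and f' = "\<lambda>x h. grad \<phi> x \<bullet> h"])
    fix y assume "y \<in> cball x (norm h)"
    then have "norm (y - x) \<le> norm h" by (simp add: dist_norm norm_minus_commute)
    then have "norm (grad \<phi> y - grad \<phi> x) \<le> L * norm h"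
      using L(2)[of y x] mult_left_mono[of "norm (y - x)" "norm h" L] L(1) by linarith
    moreover have "(\<lambda>h. grad \<phi> y \<bullet> h) - (\<lambda>h. grad \<phi> x \<bullet> h) = (\<lambda>h. (grad \<phi> y - grad \<phi> x) \<bullet> h)"
      by (rule ext) (simp add: inner_diff_left)
    ultimately show "onorm ((\<lambda>h. grad \<phi> y \<bullet> h) - (\<lambda>h. grad \<phi> x \<bullet> h)) \<le> L * norm h"
      using onorm_inner_left_le by simp
  next
    fix t :: real assume "t \<in> {0..1}"
    then have "\<bar>t\<bar> * norm h \<le> 1 * norm h" by (intro mult_right_mono) auto
    then show "x + t *\<^sub>R (x + h - x) \<in> cball x (norm h)" by (simp add: dist_norm)
  next
    fix y show "(\<phi> has_derivative (\<lambda>h. grad \<phi> y \<bullet> h)) (at y within cball x (norm h))"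
      by (rule has_derivative_at_withinI[OF test_grad_derivative[OF assms]])
  qed simp
  then have "\<bar>\<phi> (x + h) - \<phi> x - grad \<phi> x \<bullet> h\<bar> \<le> L * (norm h)\<^sup>2" for x h
    by (simp add: power2_eq_square mult_ac)
  from that[OF L(1) this] show ?thesis .
qed

section \<open>A smooth bump function\<close>

definition exp_poly :: "real poly \<Rightarrow> real \<Rightarrow> real" where
  "exp_poly p t = (if t \<le> 0 then 0 else poly p (1 / t) * exp (- (1 / t)))"

lemma poly_exp_tendsto_0:
  fixes p :: "real poly"
  shows "((\<lambda>y. poly p y * exp (- y)) \<longlongrightarrow> 0) at_top"
proof -
  have "((\<lambda>y. \<Sum>i\<le>degree p. coeff p i * (y ^ i / exp y)) \<longlongrightarrow> (\<Sum>i\<le>degree p. coeff p i * 0)) at_top"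
    by (intro tendsto_intros tendsto_power_div_exp_0)
  then show ?thesis
    by (simp add: poly_altdef sum_distrib_right exp_minus divide_inverse mult.assoc)
qed

text \<open>With s = 1/t the derivative of p(s) exp(-s) in t is s^2 (p(s) - p'(s)) exp(-s), so the
  functions \<open>exp_poly p\<close> are closed under differentiation, also across t = 0.\<close>

lemma exp_poly_deriv:
  "(exp_poly p has_real_derivative exp_poly ([:0, 0, 1:] * (p - pderiv p)) t) (at t)"
proof -
  consider "t < 0" | "t > 0" | "t = 0" by linarith
  then show ?thesis
  proof cases
    case 1
    have "((\<lambda>_. 0) has_real_derivative 0) (at t)" by simp
    then have "(exp_poly p has_real_derivative 0) (at t)"
      by (rule has_field_derivative_transform_within_open[of _ _ _ "{..<0}"]) (use 1 in \<open>auto simp: exp_poly_def\<close>)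
    with 1 show ?thesis by (simp add: exp_poly_def)
  next
    case 2
    have "((\<lambda>t. poly p (1 / t) * exp (- (1 / t))) has_real_derivative
        exp_poly ([:0, 0, 1:] * (p - pderiv p)) t) (at t)"
      using 2 by (auto intro!: derivative_eq_intros DERIV_chain2[OF poly_DERIV]
          simp: exp_poly_def field_simps power2_eq_square)
    then show ?thesis
      by (rule has_field_derivative_transform_within_open[of _ _ _ "{0<..}"]) (use 2 in \<open>auto simp: exp_poly_def\<close>)
  next
    case 3
    have "((\<lambda>h. exp_poly p h / h) \<longlongrightarrow> 0) (at_left 0)"
      by (rule tendsto_eventually) (auto simp: eventually_at_filter exp_poly_def)
    moreover have "((\<lambda>h. exp_poly p h / h) \<longlongrightarrow> 0) (at_right 0)"
    proof -
      \<comment> \<open>The difference quotient at 0 carries one more factor 1/h, hence the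
        polynomial \<open>pCons 0 p\<close>; the exponential beats it.\<close>
      have "((\<lambda>h. poly (pCons 0 p) (inverse h) * exp (- inverse h)) \<longlongrightarrow> 0) (at_right (0::real))"
        by (rule filterlim_compose[OF poly_exp_tendsto_0 filterlim_inverse_at_top_right])
      then show ?thesis
        by (rule Lim_transform_eventually)
          (auto simp: eventually_at_filter exp_poly_def field_simps)
    qed
    ultimately have "((\<lambda>h. exp_poly p h / h) \<longlongrightarrow> 0) (at 0)" by (rule filterlim_split_at_real)
    with 3 show ?thesis by (simp add: has_field_derivative_def has_derivative_at DERIV_def exp_poly_def flip: has_field_derivative_def)
  qed
qed

text \<open>A derivative of a base function in direction \<open>i\<close> is -2 times the coordinate
  along \<open>i\<close> times another base function. The remaining clauses are what closure under
  the sum and product rules asks for, so \<open>Ck_coinduct\<close> applies.\<close>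

inductive_set bump_alg :: "('a::euclidean_space \<Rightarrow> real) set" where
  base: "(\<lambda>x. exp_poly p (1 - x \<bullet> x)) \<in> bump_alg"
| scal: "f \<in> bump_alg \<Longrightarrow> (\<lambda>x. c * f x) \<in> bump_alg"
| coord: "f \<in> bump_alg \<Longrightarrow> (\<lambda>x. (x \<bullet> j) * f x) \<in> bump_alg"
| add: "f \<in> bump_alg \<Longrightarrow> g \<in> bump_alg \<Longrightarrow> (\<lambda>x. f x + g x) \<in> bump_alg"

lemma bump_alg_deriv:
  assumes "f \<in> bump_alg"
  shows "(\<forall>x. f differentiable (at x)) \<and> (\<forall>i. pd f i \<in> bump_alg)"
  using assms
proof induction
  case (base p)
  let ?q = "[:0, 0, 1:] * (p - pderiv p)"
  have d: "((\<lambda>x::'a. exp_poly p (1 - x \<bullet> x)) has_derivative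
      (\<lambda>h. exp_poly ?q (1 - x \<bullet> x) * (- (2 * (x \<bullet> h))))) (at x)" for x
    by (rule has_derivative_compose[OF _ exp_poly_deriv[unfolded has_field_derivative_def]])
      (auto intro!: derivative_eq_intros simp: inner_commute)
  have eq: "pd (\<lambda>x::'a. exp_poly p (1 - x \<bullet> x)) i = (\<lambda>x. (-2) * ((x \<bullet> i) * exp_poly ?q (1 - x \<bullet> x)))" for i
    by (rule ext) (simp only: pd_eqI[OF d], simp)
  have "(\<lambda>x::'a. exp_poly p (1 - x \<bullet> x)) differentiable (at x)" for x
    using d differentiable_def by blast
  moreover have "pd (\<lambda>x::'a. exp_poly p (1 - x \<bullet> x)) i \<in> bump_alg" for i
    unfolding eq by (intro bump_alg.intros)
  ultimately show ?case by blast
next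
  case (scal f c)
  then have d: "(f has_derivative (\<lambda>i. pd f i x)) (at x)" for x by (auto simp flip: frechet_derivative_works)
  have "((\<lambda>x. c * f x) has_derivative (\<lambda>h. c * pd f h x)) (at x)" for x
    by (rule has_derivative_mult_right[OF d])
  then have "pd (\<lambda>x. c * f x) i = (\<lambda>x. c * pd f i x)" "(\<lambda>x. c * f x) differentiable (at x)" for i x
    using pd_eqI differentiable_def by blast+
  with scal show ?case by (auto intro: bump_alg.intros)
next
  case (coord f j)
  then have d: "(f has_derivative (\<lambda>i. pd f i x)) (at x)" for x by (auto simp flip: frechet_derivative_works)
  have "((\<lambda>x. (x \<bullet> j) * f x) has_derivative (\<lambda>h. (x \<bullet> j) * pd f h x + (h \<bullet> j) * f x)) (at x)" for x
    by (rule has_derivative_mult[OF _ d]) (auto intro!: derivative_eq_intros)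
  then have "pd (\<lambda>x. (x \<bullet> j) * f x) i = (\<lambda>x. (x \<bullet> j) * pd f i x + (i \<bullet> j) * f x)"
    "(\<lambda>x. (x \<bullet> j) * f x) differentiable (at x)" for i x
    using pd_eqI differentiable_def by blast+
  moreover have "(\<lambda>x. (x \<bullet> j) * pd f i x + (i \<bullet> j) * f x) \<in> bump_alg" for i
    using coord by (intro bump_alg.intros) auto
  ultimately show ?case by simp
next
  case (add f g)
  then have d: "(f has_derivative (\<lambda>i. pd f i x)) (at x)" "(g has_derivative (\<lambda>i. pd g i x)) (at x)" for x
    by (auto simp flip: frechet_derivative_works)
  have "((\<lambda>x. f x + g x) has_derivative (\<lambda>h. pd f h x + pd g h x)) (at x)" for x
    by (rule has_derivative_add[OF d])
  then have "pd (\<lambda>x. f x + g x) i = (\<lambda>x. pd f i x + pd g i x)"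
    "(\<lambda>x. f x + g x) differentiable (at x)" for i x
    using pd_eqI differentiable_def by blast+
  with add show ?case by (auto intro: bump_alg.intros)
qed

lemma ex_bump:
  obtains \<rho> :: "'a::euclidean_space \<Rightarrow> real" where "\<rho> \<in> test_functions"
    "\<And>x. \<rho> x \<ge> 0" "\<rho> 0 = 1" "\<And>x. norm x \<ge> 1 \<Longrightarrow> \<rho> x = 0"
proof
  \<comment> \<open>This is exp (1 - 1 / (1 - |x|^2)) in the unit ball; the factor
    \<open>exp 1\<close> makes its value at the centre equal to 1.\<close>
  let ?\<rho> = "\<lambda>x::'a. exp 1 * exp_poly [:1:] (1 - x \<bullet> x)"
  have 1: "?\<rho> \<in> bump_alg" by (intro bump_alg.intros)
  show z: "?\<rho> x = 0" if "norm x \<ge> 1" for x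
  proof -
    have "x \<bullet> x \<ge> 1" using that by (simp add: dot_square_norm)
    then show ?thesis by (simp add: exp_poly_def)
  qed
  have "Ck k ?\<rho>" for k
    using bump_alg_deriv 1 by (intro Ck_coinduct[of bump_alg]) blast+
  moreover have "bounded {x. ?\<rho> x \<noteq> 0}"
    unfolding bounded_iff using z by (meson linear mem_Collect_eq)
  ultimately show "?\<rho> \<in> test_functions" unfolding test_functions_iff by blast
  show "?\<rho> x \<ge> 0" for x by (simp add: exp_poly_def)
  show "?\<rho> 0 = 1" by (simp add: exp_poly_def exp_minus)
qed

section \<open>Square integrable functions\<close>

text \<open>Informative only for functions in \<open>L2\<close>: where the square is not integrable
  the Bochner integral takes the default value 0. Most estimates therefore carry membership in
  \<open>L2\<close> along.\<close>

definition l2 :: "('a::euclidean_space \<Rightarrow> 'b::euclidean_space) \<Rightarrow> real" where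
  "l2 f = sqrt (\<integral>x. (norm (f x))\<^sup>2 \<partial>lborel)"

lemma L2_borel [measurable_dest]: "f \<in> L2 \<Longrightarrow> f \<in> borel_measurable borel"
  by (simp add: L2_def)

lemma L2_integrable: "f \<in> L2 \<Longrightarrow> integrable lborel (\<lambda>x. (norm (f x))\<^sup>2)"
  by (simp add: L2_def)

lemma L2_I:
  "f \<in> borel_measurable borel \<Longrightarrow> integrable lborel (\<lambda>x. (norm (f x))\<^sup>2) \<Longrightarrow> f \<in> L2"
  by (simp add: L2_def)

lemma L2_integrable_real: "(f :: _ \<Rightarrow> real) \<in> L2 \<Longrightarrow> integrable lborel (\<lambda>x. (f x)\<^sup>2)"
  using L2_integrable[of f] by simp

lemma l2_nonneg: "0 \<le> l2 f"
  by (simp add: l2_def)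

lemma l2_sq: "(l2 f)\<^sup>2 = (\<integral>x. (norm (f x))\<^sup>2 \<partial>lborel)"
  by (simp add: l2_def)

lemma L2_norm: "f \<in> L2 \<Longrightarrow> (\<lambda>x. norm (f x)) \<in> L2"
  by (auto intro!: L2_I dest: L2_borel L2_integrable)

lemma l2_norm: "l2 (\<lambda>x. norm (f x)) = l2 f"
  by (simp add: l2_def)

lemma L2_dominated:
  assumes "g \<in> L2" "f \<in> borel_measurable borel" "\<And>x. norm (f x) \<le> norm (g x)"
  shows "f \<in> L2" "l2 f \<le> l2 g"
proof -
  have le: "(norm (f x))\<^sup>2 \<le> (norm (g x))\<^sup>2" for x using assms(3) by (intro power_mono) auto
  have "integrable lborel (\<lambda>x. (norm (f x))\<^sup>2)"
    by (rule Bochner_Integration.integrable_bound[OF L2_integrable[OF assms(1)]])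
      (use assms(2) le in auto)
  then show "f \<in> L2" using assms(2) by (intro L2_I)
  show "l2 f \<le> l2 g" unfolding l2_def
    using \<open>integrable lborel (\<lambda>x. (norm (f x))\<^sup>2)\<close> L2_integrable[OF assms(1)] le
    by (intro real_sqrt_le_mono integral_mono)
qed

lemma L2_scaleR: "f \<in> L2 \<Longrightarrow> (\<lambda>x. c *\<^sub>R f x) \<in> L2"
  by (rule L2_I) (auto dest: L2_borel L2_integrable simp: power_mult_distrib)

lemma l2_scaleR: "l2 (\<lambda>x. c *\<^sub>R f x) = \<bar>c\<bar> * l2 f"
  by (simp add: l2_def power_mult_distrib real_sqrt_mult)

lemma L2_bounded_scaleR:
  assumes "f \<in> L2" "m \<in> borel_measurable borel" "\<And>x. \<bar>m x\<bar> \<le> M"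
  shows "(\<lambda>x. m x *\<^sub>R f x) \<in> L2" "l2 (\<lambda>x. m x *\<^sub>R f x) \<le> M * l2 f"
proof -
  have M: "M \<ge> 0" using assms(3)[of undefined] by linarith
  have le: "norm (m x *\<^sub>R f x) \<le> norm (M *\<^sub>R f x)" for x
    using assms(3)[of x] M by (simp add: mult_right_mono)
  have b: "(\<lambda>x. m x *\<^sub>R f x) \<in> borel_measurable borel"
    using assms(2) L2_borel[OF assms(1)] by simp
  show "(\<lambda>x. m x *\<^sub>R f x) \<in> L2" by (rule L2_dominated(1)[OF L2_scaleR[OF assms(1)] b le])
  show "l2 (\<lambda>x. m x *\<^sub>R f x) \<le> M * l2 f"
    using L2_dominated(2)[OF L2_scaleR[OF assms(1)] b le] M by (simp add: l2_scaleR)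
qed

lemma L2_bounded_mult:
  fixes f :: "'a::euclidean_space \<Rightarrow> real"
  assumes "f \<in> L2" "m \<in> borel_measurable borel" "\<And>x. \<bar>m x\<bar> \<le> M"
  shows "(\<lambda>x. m x * f x) \<in> L2" "l2 (\<lambda>x. m x * f x) \<le> M * l2 f"
  using L2_bounded_scaleR[OF assms] by simp_all

lemma L2_norm_mult_integrable:
  assumes "f \<in> L2" "g \<in> L2"
  shows "integrable lborel (\<lambda>x. norm (f x) * norm (g x))"
proof (rule Bochner_Integration.integrable_bound)
  show "integrable lborel (\<lambda>x. (norm (f x))\<^sup>2 + (norm (g x))\<^sup>2)"
    using assms by (auto dest: L2_integrable)
  show "(\<lambda>x. norm (f x) * norm (g x)) \<in> borel_measurable lborel"
    using assms by (auto dest: L2_borel)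
  have "norm (f x) * norm (g x) \<le> (norm (f x))\<^sup>2 + (norm (g x))\<^sup>2" for x
  proof -
    have "0 \<le> norm (f x) * norm (g x)" by simp
    with sum_squares_bound[of "norm (f x)" "norm (g x)"] show ?thesis by linarith
  qed
  then show "AE x in lborel. norm (norm (f x) * norm (g x)) \<le> norm ((norm (f x))\<^sup>2 + (norm (g x))\<^sup>2)"
    by simp
qed

lemma L2_inner_integrable:
  assumes "f \<in> L2" "g \<in> L2"
  shows "integrable lborel (\<lambda>x. f x \<bullet> g x)"
  by (rule Bochner_Integration.integrable_bound[OF L2_norm_mult_integrable[OF assms]])
    (use assms in \<open>auto dest: L2_borel intro: Cauchy_Schwarz_ineq2\<close>)

lemma L2_mult_integrable:
  fixes f g :: "'a::euclidean_space \<Rightarrow> real"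
  assumes "f \<in> L2" "g \<in> L2"
  shows "integrable lborel (\<lambda>x. f x * g x)"
  using L2_inner_integrable[OF assms] by simp

lemma L2_add:
  assumes "f \<in> L2" "g \<in> L2" shows "(\<lambda>x. f x + g x) \<in> L2"
proof (rule L2_I)
  show "(\<lambda>x. f x + g x) \<in> borel_measurable borel" using assms by (auto dest: L2_borel)
  have "(norm (f x + g x))\<^sup>2 = (norm (f x))\<^sup>2 + 2 * (f x \<bullet> g x) + (norm (g x))\<^sup>2" for x
    by (simp add: power2_norm_eq_inner algebra_simps inner_commute)
  then show "integrable lborel (\<lambda>x. (norm (f x + g x))\<^sup>2)"
    using L2_integrable[OF assms(1)] L2_integrable[OF assms(2)] L2_inner_integrable[OF assms] by simp
qed

lemma L2_diff:
  assumes "f \<in> L2" "g \<in> L2" shows "(\<lambda>x. f x - g x) \<in> L2"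
  using L2_add[OF assms(1) L2_scaleR[OF assms(2), of "-1"]] by simp

text \<open>Inserting (B, -C) gives B (A B - C^2) >= 0, and symmetrically with A; the degenerate
  cases are settled by the signs of a + b and a - b. No definiteness is assumed, so the lemma also
  serves forms on functions that are not identified almost everywhere.\<close>

lemma quadratic_form_Cauchy_Schwarz:
  fixes A B C :: real
  assumes quad: "\<And>a b. 0 \<le> a\<^sup>2 * A + 2 * a * b * C + b\<^sup>2 * B"
  shows "C\<^sup>2 \<le> A * B"
proof -
  have A: "A \<ge> 0" and B: "B \<ge> 0" using quad[of 1 0] quad[of 0 1] by simp_all
  show ?thesis
  proof (cases "B = 0")
    case False
    have "0 \<le> B * (A * B - C\<^sup>2)" using quad[of B "-C"] by (simp add: power2_eq_square algebra_simps)
    then show ?thesis using False B by (simp add: zero_le_mult_iff)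
  next
    case True
    show ?thesis
    proof (cases "A = 0")
      case True
      show ?thesis using quad[of 1 1] quad[of 1 "-1"] True \<open>B = 0\<close> by simp
    next
      case False
      have "0 \<le> A * (A * B - C\<^sup>2)" using quad[of "-C" A] by (simp add: power2_eq_square algebra_simps)
      then show ?thesis using False A by (simp add: zero_le_mult_iff)
    qed
  qed
qed

lemma L2_inner_Cauchy_Schwarz:
  assumes "f \<in> L2" "g \<in> L2"
  shows "\<bar>\<integral>x. f x \<bullet> g x \<partial>lborel\<bar> \<le> l2 f * l2 g"
proof -
  define A B C where "A = (l2 f)\<^sup>2" and "B = (l2 g)\<^sup>2" and "C = (\<integral>x. f x \<bullet> g x \<partial>lborel)"
  have quad: "0 \<le> a\<^sup>2 * A + 2 * a * b * C + b\<^sup>2 * B" for a b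
  proof -
    have eq: "(norm (a *\<^sub>R f x + b *\<^sub>R g x))\<^sup>2
        = a\<^sup>2 * (norm (f x))\<^sup>2 + (2 * a * b) * (f x \<bullet> g x) + b\<^sup>2 * (norm (g x))\<^sup>2" for x
      unfolding power2_norm_eq_inner
      by (simp add: inner_add_left inner_add_right inner_commute power2_eq_square algebra_simps)
    have "0 \<le> (\<integral>x. (norm (a *\<^sub>R f x + b *\<^sub>R g x))\<^sup>2 \<partial>lborel)"
      by (rule integral_nonneg_AE) simp
    also have "\<dots> = a\<^sup>2 * A + (2 * a * b) * C + b\<^sup>2 * B"
      unfolding eq A_def B_def C_def l2_sq
      using L2_integrable[OF assms(1)] L2_integrable[OF assms(2)] L2_inner_integrable[OF assms] by simp
    finally show ?thesis .
  qed
  have "C\<^sup>2 \<le> A * B" by (rule quadratic_form_Cauchy_Schwarz[OF quad])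
  then have "\<bar>C\<bar>\<^sup>2 \<le> (l2 f * l2 g)\<^sup>2" by (simp add: A_def B_def power_mult_distrib)
  then have "\<bar>C\<bar> \<le> l2 f * l2 g" by (rule power2_le_imp_le) (simp add: l2_nonneg)
  then show ?thesis by (simp add: C_def)
qed

lemma L2_norm_Cauchy_Schwarz:
  assumes "f \<in> L2" "g \<in> L2"
  shows "(\<integral>x. norm (f x) * norm (g x) \<partial>lborel) \<le> l2 f * l2 g"
  using L2_inner_Cauchy_Schwarz[OF L2_norm[OF assms(1)] L2_norm[OF assms(2)]] by (simp add: l2_norm)

lemma L2_mult_Cauchy_Schwarz:
  fixes f g :: "'a::euclidean_space \<Rightarrow> real"
  assumes "f \<in> L2" "g \<in> L2"
  shows "\<bar>\<integral>x. f x * g x \<partial>lborel\<bar> \<le> l2 f * l2 g"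
  using L2_inner_Cauchy_Schwarz[OF assms] by simp

lemma l2_add_le:
  assumes "f \<in> L2" "g \<in> L2" shows "l2 (\<lambda>x. f x + g x) \<le> l2 f + l2 g"
proof (rule power2_le_imp_le)
  have eq: "(norm (f x + g x))\<^sup>2 = (norm (f x))\<^sup>2 + 2 * (f x \<bullet> g x) + (norm (g x))\<^sup>2" for x
    by (simp add: power2_norm_eq_inner algebra_simps inner_commute)
  have "(l2 (\<lambda>x. f x + g x))\<^sup>2 = (l2 f)\<^sup>2 + 2 * (\<integral>x. f x \<bullet> g x \<partial>lborel) + (l2 g)\<^sup>2"
    unfolding l2_sq eq
    using L2_integrable[OF assms(1)] L2_integrable[OF assms(2)] L2_inner_integrable[OF assms] by simp
  also have "\<dots> \<le> (l2 f + l2 g)\<^sup>2"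
    using L2_inner_Cauchy_Schwarz[OF assms] by (simp add: power2_eq_square algebra_simps)
  finally show "(l2 (\<lambda>x. f x + g x))\<^sup>2 \<le> (l2 f + l2 g)\<^sup>2" .
qed (simp add: l2_nonneg)

lemma l2_minus: "l2 (\<lambda>x. f x - g x) = l2 (\<lambda>x. g x - f x)"
  by (simp add: l2_def norm_minus_commute)

lemma l2_triangle:
  assumes "f \<in> L2" "g \<in> L2" "h \<in> L2"
  shows "l2 (\<lambda>x. f x - h x) \<le> l2 (\<lambda>x. f x - g x) + l2 (\<lambda>x. g x - h x)"
  using l2_add_le[OF L2_diff[OF assms(1,2)] L2_diff[OF assms(2,3)]] by simp

lemma l2_le_diff_add:
  assumes "f \<in> L2" "g \<in> L2" shows "l2 f \<le> l2 (\<lambda>x. f x - g x) + l2 g"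
  using l2_add_le[OF L2_diff[OF assms] assms(2)] by simp

lemma l2_eq_0_iff: "f \<in> L2 \<Longrightarrow> l2 f = 0 \<longleftrightarrow> (AE x in lborel. f x = 0)"
  using integral_nonneg_eq_0_iff_AE[OF L2_integrable] by (simp add: l2_def)

lemma l2_nn_integral:
  assumes "f \<in> L2" shows "(\<integral>\<^sup>+x. ennreal ((norm (f x))\<^sup>2) \<partial>lborel) = ennreal ((l2 f)\<^sup>2)"
  unfolding l2_sq using L2_integrable[OF assms] by (intro nn_integral_eq_integral) auto

text \<open>Fatou and Tonelli deliver bounds on nonnegative integrals; this turns them into
  membership and norm estimate at once.\<close>

lemma L2_nn_integral_le:
  assumes "f \<in> borel_measurable borel" "(\<integral>\<^sup>+x. ennreal ((norm (f x))\<^sup>2) \<partial>lborel) \<le> ennreal (c\<^sup>2)" "0 \<le> c"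
  shows "f \<in> L2" "l2 f \<le> c"
proof -
  have "(\<integral>\<^sup>+x. ennreal (norm ((norm (f x))\<^sup>2)) \<partial>lborel) < \<infinity>"
    using assms(2) by (simp add: le_less_trans)
  then have "integrable lborel (\<lambda>x. (norm (f x))\<^sup>2)"
    using assms(1) by (subst integrable_iff_bounded) auto
  with assms(1) show "f \<in> L2" by (rule L2_I)
  from l2_nn_integral[OF this] assms(2) have "(l2 f)\<^sup>2 \<le> c\<^sup>2" by simp
  with assms(3) show "l2 f \<le> c" by (rule power2_le_imp_le[rotated])
qed

lemma L2_zero: "(\<lambda>_. 0) \<in> L2"
  by (simp add: L2_def)

lemma l2_zero: "l2 (\<lambda>_. 0) = 0"
  by (simp add: l2_def)

lemma L2_sum:
  "finite I \<Longrightarrow> (\<And>i. i \<in> I \<Longrightarrow> f i \<in> L2) \<Longrightarrow> (\<lambda>x. \<Sum>i\<in>I. f i x) \<in> L2"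
  by (induction I rule: finite_induct) (auto intro: L2_add L2_zero)

lemma l2_sum_le:
  "finite I \<Longrightarrow> (\<And>i. i \<in> I \<Longrightarrow> f i \<in> L2) \<Longrightarrow> l2 (\<lambda>x. \<Sum>i\<in>I. f i x) \<le> (\<Sum>i\<in>I. l2 (f i))"
proof (induction I rule: finite_induct)
  case (insert a I)
  then have "l2 (\<lambda>x. f a x + (\<Sum>i\<in>I. f i x)) \<le> l2 (f a) + l2 (\<lambda>x. \<Sum>i\<in>I. f i x)"
    by (intro l2_add_le L2_sum) auto
  with insert show ?case by fastforce
qed (simp add: l2_zero)

text \<open>Riesz-Fischer: a subsequence with increments of norm at most 2^-k converges almost
  everywhere, because the sum of the absolute increments is square integrable by monotone
  convergence. Fatou's lemma then upgrades this to convergence of the whole sequence in L2.\<close>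

theorem L2_complete:
  fixes s :: "nat \<Rightarrow> 'a::euclidean_space \<Rightarrow> 'b::euclidean_space"
  assumes s: "\<And>n. s n \<in> L2"
    and Cauchy: "\<And>e. e > 0 \<Longrightarrow> \<exists>N. \<forall>m\<ge>N. \<forall>n\<ge>N. l2 (\<lambda>x. s m x - s n x) < e"
  shows "\<exists>g\<in>L2. (\<lambda>n. l2 (\<lambda>x. s n x - g x)) \<longlonglongrightarrow> 0"
proof -
  have "\<forall>k. \<exists>N. \<forall>m\<ge>N. \<forall>n\<ge>N. l2 (\<lambda>x. s m x - s n x) < (1/2) ^ k"
    using Cauchy by simp
  then obtain N where N: "\<And>k m n. m \<ge> N k \<Longrightarrow> n \<ge> N k \<Longrightarrow> l2 (\<lambda>x. s m x - s n x) < (1/2) ^ k"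
    by metis
  \<comment> \<open>The partial sums of \<open>N\<close> make \<open>r\<close> increasing and at
    least \<open>N k\<close>; the summand \<open>k\<close> forces \<open>r k\<close> to tend to
    infinity.\<close>
  define r where "r k = k + (\<Sum>j\<le>k. N j)" for k
  have r_ge: "r k \<ge> N k" for k
    using member_le_sum[of k "{..k}" N] by (simp add: r_def trans_le_add2)
  have r_k: "r k \<ge> k" for k by (simp add: r_def)
  have r_mono: "r k \<le> r (Suc k)" for k by (simp add: r_def)
  define d where "d k x = norm (s (r (Suc k)) x - s (r k) x)" for k x
  have d_L2: "d k \<in> L2" for k unfolding d_def[abs_def] by (intro L2_norm L2_diff s)
  have d_l2: "l2 (d k) \<le> (1/2) ^ k" for k
    unfolding d_def[abs_def] l2_norm using N[of k "r (Suc k)" "r k"] r_ge[of k] r_mono[of k] by simp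
  define D where "D n x = (\<Sum>k<n. d k x)" for n x
  have D_L2: "D n \<in> L2" for n unfolding D_def[abs_def] by (intro L2_sum d_L2) auto
  have D_l2: "l2 (D n) \<le> 2" for n
  proof -
    have "l2 (D n) \<le> (\<Sum>k<n. l2 (d k))" unfolding D_def[abs_def] by (intro l2_sum_le d_L2) auto
    also have "\<dots> \<le> (\<Sum>k<n. (1/2) ^ k)" by (intro sum_mono d_l2)
    also have "\<dots> \<le> 2" by (simp add: sum_gp_strict)
    finally show ?thesis .
  qed
  have D_nonneg: "0 \<le> D n x" for n x by (simp add: D_def d_def sum_nonneg)
  have D_mono: "D m x \<le> D n x" if "m \<le> n" for m n x
    unfolding D_def using that by (intro sum_mono2) (auto simp: d_def)
  have meas: "D n \<in> borel_measurable lborel" for n using L2_borel[OF D_L2] by simp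
  have "(\<integral>\<^sup>+x. (SUP n. ennreal ((D n x)\<^sup>2)) \<partial>lborel) = (SUP n. \<integral>\<^sup>+x. ennreal ((D n x)\<^sup>2) \<partial>lborel)"
    using meas by (intro nn_integral_monotone_convergence_SUP)
      (auto simp: incseq_def le_fun_def intro!: ennreal_leI power_mono D_mono D_nonneg)
  also have "\<dots> \<le> ennreal (2\<^sup>2)"
  proof (rule SUP_least)
    fix n
    have "(\<integral>\<^sup>+x. ennreal ((D n x)\<^sup>2) \<partial>lborel) = ennreal ((l2 (D n))\<^sup>2)"
      using l2_nn_integral[OF D_L2] by simp
    also have "\<dots> \<le> ennreal (2\<^sup>2)" using D_l2 l2_nonneg by (intro ennreal_leI power_mono)
    finally show "(\<integral>\<^sup>+x. ennreal ((D n x)\<^sup>2) \<partial>lborel) \<le> ennreal (2\<^sup>2)" .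
  qed
  also have "\<dots> < \<infinity>" by simp
  finally have "(\<integral>\<^sup>+x. (SUP n. ennreal ((D n x)\<^sup>2)) \<partial>lborel) \<noteq> \<infinity>" by simp
  then have fin: "AE x in lborel. (SUP n. ennreal ((D n x)\<^sup>2)) \<noteq> \<infinity>"
    using meas by (intro nn_integral_PInf_AE) auto
  have conv: "AE x in lborel. convergent (\<lambda>k. s (r k) x)"
    using fin
  proof eventually_elim
    case (elim x)
    then obtain c where c: "0 \<le> c" "(SUP n. ennreal ((D n x)\<^sup>2)) = ennreal c"
      by (cases "SUP n. ennreal ((D n x)\<^sup>2)") auto
    have "(D n x)\<^sup>2 \<le> c" for n
    proof -
      have "ennreal ((D n x)\<^sup>2) \<le> ennreal c" unfolding c(2)[symmetric] by (rule SUP_upper) simp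
      then show ?thesis using c(1) by simp
    qed
    then have "D n x \<le> sqrt c" for n using D_nonneg by (simp add: real_le_rsqrt)
    then have "summable (\<lambda>k. d k x)"
      unfolding D_def by (intro summableI_nonneg_bounded[where x = "sqrt c"]) (auto simp: d_def)
    then have "summable (\<lambda>k. s (r (Suc k)) x - s (r k) x)"
      unfolding d_def by (rule summable_norm_cancel)
    then have "convergent (\<lambda>n. \<Sum>k<n. s (r (Suc k)) x - s (r k) x)"
      by (simp add: summable_iff_convergent)
    then have "convergent (\<lambda>n. s (r n) x - s (r 0) x)"
      by (simp only: sum_lessThan_telescope[of "\<lambda>k. s (r k) x"])
    then have "convergent (\<lambda>n. s (r n) x - s (r 0) x + s (r 0) x)"
      by (intro convergent_add convergent_const)
    then show ?case by simp
  qed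
  \<comment> \<open>\<open>lim\<close> is total, so \<open>g\<close> is a Borel function on the
    whole space; its values where the subsequence diverges lie on a null set.\<close>
  define g where "g x = lim (\<lambda>k. s (r k) x)" for x
  have g_meas: "g \<in> borel_measurable borel"
    unfolding g_def[abs_def] by (rule borel_measurable_lim_metric) (rule L2_borel[OF s])
  have lim: "AE x in lborel. (\<lambda>k. s (r k) x) \<longlonglongrightarrow> g x"
    using conv by eventually_elim (simp add: g_def convergent_LIMSEQ_iff)
  have key: "(\<lambda>x. s m x - g x) \<in> L2 \<and> l2 (\<lambda>x. s m x - g x) \<le> e"
    if e: "e > 0" and M: "\<And>m n. m \<ge> M \<Longrightarrow> n \<ge> M \<Longrightarrow> l2 (\<lambda>x. s m x - s n x) < e" and m: "m \<ge> M" for e M m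
  proof -
    have "(\<integral>\<^sup>+x. ennreal ((norm (s m x - g x))\<^sup>2) \<partial>lborel)
        = (\<integral>\<^sup>+x. liminf (\<lambda>k. ennreal ((norm (s m x - s (r k) x))\<^sup>2)) \<partial>lborel)"
    proof (rule nn_integral_cong_AE)
      show "AE x in lborel. ennreal ((norm (s m x - g x))\<^sup>2) = liminf (\<lambda>k. ennreal ((norm (s m x - s (r k) x))\<^sup>2))"
        using lim
      proof eventually_elim
        case (elim x)
        have "(\<lambda>k. ennreal ((norm (s m x - s (r k) x))\<^sup>2)) \<longlonglongrightarrow> ennreal ((norm (s m x - g x))\<^sup>2)"
          by (intro tendsto_intros elim tendsto_ennrealI)
        from lim_imp_Liminf[OF _ this] show ?case by simp
      qed
    qed
    also have "\<dots> \<le> liminf (\<lambda>k. \<integral>\<^sup>+x. ennreal ((norm (s m x - s (r k) x))\<^sup>2) \<partial>lborel)"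
    proof (rule nn_integral_liminf)
      fix k show "(\<lambda>x. ennreal ((norm (s m x - s (r k) x))\<^sup>2)) \<in> borel_measurable lborel"
        using L2_borel[OF L2_diff[OF s s]] by simp
    qed
    also have "\<dots> \<le> ennreal (e\<^sup>2)"
    proof (rule Liminf_le)
      show "\<forall>\<^sub>F k in sequentially. (\<integral>\<^sup>+x. ennreal ((norm (s m x - s (r k) x))\<^sup>2) \<partial>lborel) \<le> ennreal (e\<^sup>2)"
        using eventually_ge_at_top[of M]
      proof eventually_elim
        case (elim k)
        have "l2 (\<lambda>x. s m x - s (r k) x) \<le> e" using M[OF m, of "r k"] r_k[of k] elim by simp
        then have "(l2 (\<lambda>x. s m x - s (r k) x))\<^sup>2 \<le> e\<^sup>2" using l2_nonneg by (intro power_mono)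
        then show ?case unfolding l2_nn_integral[OF L2_diff[OF s s]] by (rule ennreal_leI)
      qed
    qed simp
    finally have le: "(\<integral>\<^sup>+x. ennreal ((norm (s m x - g x))\<^sup>2) \<partial>lborel) \<le> ennreal (e\<^sup>2)" .
    have b: "(\<lambda>x. s m x - g x) \<in> borel_measurable borel" using g_meas L2_borel[OF s] by simp
    show ?thesis using L2_nn_integral_le[OF b le] e by simp
  qed
  obtain M where M: "\<And>m n. m \<ge> M \<Longrightarrow> n \<ge> M \<Longrightarrow> l2 (\<lambda>x. s m x - s n x) < 1"
    using Cauchy[of 1] by auto
  have "(\<lambda>x. s M x - g x) \<in> L2" using key[OF _ M] by simp
  from L2_diff[OF s[of M] this] have "g \<in> L2" by simp
  moreover have "(\<lambda>n. l2 (\<lambda>x. s n x - g x)) \<longlonglongrightarrow> 0"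
  proof (rule LIMSEQ_I)
    fix e :: real assume e: "0 < e"
    obtain M where M: "\<And>m n. m \<ge> M \<Longrightarrow> n \<ge> M \<Longrightarrow> l2 (\<lambda>x. s m x - s n x) < e / 2"
      using Cauchy[of "e / 2"] e by auto
    have "l2 (\<lambda>x. s n x - g x) \<le> e / 2" if "n \<ge> M" for n
      using key[OF _ M that] e by simp
    then have "norm (l2 (\<lambda>x. s n x - g x) - 0) < e" if "n \<ge> M" for n
      using that e l2_nonneg[of "\<lambda>x. s n x - g x"] by fastforce
    then show "\<exists>no. \<forall>n\<ge>no. norm (l2 (\<lambda>x. s n x - g x) - 0) < e" by blast
  qed
  ultimately show ?thesis by blast
qed

section \<open>Translation invariance\<close>

lemma lborel_distr_shift: "distr lborel borel (\<lambda>x. x + a) = (lborel :: 'a::euclidean_space measure)"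
proof -
  have "(\<lambda>x. x + a) = (+) a" by (rule ext) (rule add.commute)
  then show ?thesis by (simp only: lborel_distr_plus)
qed

lemma nn_integral_shift:
  fixes f :: "'a::euclidean_space \<Rightarrow> ennreal"
  assumes "f \<in> borel_measurable borel"
  shows "(\<integral>\<^sup>+x. f (x + a) \<partial>lborel) = (\<integral>\<^sup>+x. f x \<partial>lborel)"
proof -
  have "(\<integral>\<^sup>+x. f x \<partial>lborel) = (\<integral>\<^sup>+x. f x \<partial>distr lborel borel (\<lambda>x. x + a))"
    by (simp only: lborel_distr_shift)
  also have "\<dots> = (\<integral>\<^sup>+x. f (x + a) \<partial>lborel)" using assms by (intro nn_integral_distr) auto
  finally show ?thesis by simp
qed

lemma integral_shift:
  fixes f :: "'a::euclidean_space \<Rightarrow> 'b::euclidean_space"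
  assumes "f \<in> borel_measurable borel"
  shows "(\<integral>x. f (x + a) \<partial>lborel) = (\<integral>x. f x \<partial>lborel)"
proof -
  have "(\<integral>x. f x \<partial>lborel) = (\<integral>x. f x \<partial>distr lborel borel (\<lambda>x. x + a))"
    by (simp only: lborel_distr_shift)
  also have "\<dots> = (\<integral>x. f (x + a) \<partial>lborel)" using assms by (intro integral_distr) auto
  finally show ?thesis by simp
qed

lemma integrable_shift:
  fixes f :: "'a::euclidean_space \<Rightarrow> 'b::euclidean_space"
  assumes "integrable lborel f"
  shows "integrable lborel (\<lambda>x. f (x + a))"
proof -
  have "integrable (distr lborel borel (\<lambda>x. x + a)) f" using assms by (simp only: lborel_distr_shift)
  then show ?thesis by (rule integrable_distr[rotated]) simp
qed

lemma L2_shift: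
  assumes "f \<in> L2" shows "(\<lambda>x. f (x + a)) \<in> L2"
proof (rule L2_I)
  show "(\<lambda>x. f (x + a)) \<in> borel_measurable borel"
    by (rule measurable_compose[OF _ L2_borel[OF assms]]) simp
qed (rule integrable_shift[OF L2_integrable[OF assms]])

lemma l2_shift: "f \<in> L2 \<Longrightarrow> l2 (\<lambda>x. f (x + a)) = l2 f"
  unfolding l2_def using integral_shift[of "\<lambda>x. (norm (f x))\<^sup>2" a] L2_borel by simp

section \<open>Continuity of translations\<close>

text \<open>Continuity of translations is established first in L1, where the induction principle for
  integrable functions reduces it to indicators. The L2 version is derived from it by means of
  signed squares.\<close>

definition L1_cont :: "('a::euclidean_space \<Rightarrow> real) \<Rightarrow> bool" where
  "L1_cont f \<longleftrightarrow> (\<forall>e>0. \<exists>\<delta>>0. \<forall>h. norm h < \<delta> \<longrightarrow> (\<integral>x. \<bar>f (x + h) - f x\<bar> \<partial>lborel) < e)"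

lemma L1_contE:
  assumes "L1_cont f" "e > 0"
  obtains \<delta> where "\<delta> > 0" "\<And>h. norm h < \<delta> \<Longrightarrow> (\<integral>x. \<bar>f (x + h) - f x\<bar> \<partial>lborel) < e"
proof -
  have "\<exists>\<delta>>0. \<forall>h. norm h < \<delta> \<longrightarrow> (\<integral>x. \<bar>f (x + h) - f x\<bar> \<partial>lborel) < e"
    using assms(1)[unfolded L1_cont_def, rule_format, OF assms(2)] .
  then obtain \<delta> where \<delta>: "\<delta> > 0" "\<forall>h. norm h < \<delta> \<longrightarrow> (\<integral>x. \<bar>f (x + h) - f x\<bar> \<partial>lborel) < e"
    by (elim exE conjE)
  show ?thesis by (rule that[OF \<delta>(1)]) (rule \<delta>(2)[rule_format])
qed

text \<open>The usual three-term argument: translation is an isometry of L1, so the approximation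
  error enters twice and the increment of \<open>g\<close> once.\<close>

lemma L1_cont_limit:
  assumes f: "integrable lborel f"
    and approx: "\<And>e. e > 0 \<Longrightarrow> \<exists>g. integrable lborel g \<and> L1_cont g \<and> (\<integral>x. \<bar>f x - g x\<bar> \<partial>lborel) < e"
  shows "L1_cont f"
  unfolding L1_cont_def
proof (intro allI impI)
  fix e :: real assume e: "e > 0"
  obtain g where g: "integrable lborel g" "L1_cont g" "(\<integral>x. \<bar>f x - g x\<bar> \<partial>lborel) < e / 3"
    using approx[of "e / 3"] e by auto
  obtain \<delta> where \<delta>: "\<delta> > 0" "\<And>h. norm h < \<delta> \<Longrightarrow> (\<integral>x. \<bar>g (x + h) - g x\<bar> \<partial>lborel) < e / 3"
    using L1_contE[OF g(2), of "e / 3"] e by auto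
  have "(\<integral>x. \<bar>f (x + h) - f x\<bar> \<partial>lborel) < e" if h: "norm h < \<delta>" for h
  proof -
    have i1: "integrable lborel (\<lambda>x. \<bar>f x - g x\<bar>)" using f g(1) by auto
    have i2: "integrable lborel (\<lambda>x. \<bar>f (x + h) - g (x + h)\<bar>)" by (rule integrable_shift[OF i1])
    have i3: "integrable lborel (\<lambda>x. \<bar>g (x + h) - g x\<bar>)" using integrable_shift[OF g(1), of h] g(1) by auto
    have i4: "integrable lborel (\<lambda>x. \<bar>f (x + h) - f x\<bar>)" using integrable_shift[OF f, of h] f by auto
    have "(\<integral>x. \<bar>f (x + h) - f x\<bar> \<partial>lborel)
        \<le> (\<integral>x. \<bar>f (x + h) - g (x + h)\<bar> + \<bar>g (x + h) - g x\<bar> + \<bar>f x - g x\<bar> \<partial>lborel)"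
      using i1 i2 i3 i4 by (intro integral_mono) auto
    also have "\<dots> = (\<integral>x. \<bar>f (x + h) - g (x + h)\<bar> \<partial>lborel) + (\<integral>x. \<bar>g (x + h) - g x\<bar> \<partial>lborel)
        + (\<integral>x. \<bar>f x - g x\<bar> \<partial>lborel)"
      using i1 i2 i3 by simp
    also have "(\<integral>x. \<bar>f (x + h) - g (x + h)\<bar> \<partial>lborel) = (\<integral>x. \<bar>f x - g x\<bar> \<partial>lborel)"
      using f g(1) by (intro integral_shift) auto
    finally show ?thesis using g(3) \<delta>(2)[OF h] by linarith
  qed
  with \<delta>(1) show "\<exists>\<delta>>0. \<forall>h. norm h < \<delta> \<longrightarrow> (\<integral>x. \<bar>f (x + h) - f x\<bar> \<partial>lborel) < e" by blast
qed

text \<open>The increment vanishes unless \<open>x\<close> or \<open>x + h\<close> lies in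
  \<open>T\<close>, and there it is at most \<open>L * norm h\<close>. Finite measure of
  \<open>T\<close> replaces bounded support.\<close>

lemma L1_cont_Lipschitz:
  fixes f :: "'a::euclidean_space \<Rightarrow> real"
  assumes T: "T \<in> sets borel" "emeasure lborel T < \<infinity>"
    and f: "\<And>x. x \<notin> T \<Longrightarrow> f x = 0" "\<And>x y. \<bar>f x - f y\<bar> \<le> L * norm (x - y)" "integrable lborel f"
  shows "L1_cont f"
  unfolding L1_cont_def
proof (intro allI impI)
  fix e :: real assume e: "e > 0"
  have L: "L \<ge> 0"
  proof -
    obtain b :: 'a where "b \<in> Basis" using nonempty_Basis by blast
    then have "\<bar>f b - f 0\<bar> \<le> L" using f(2)[of b 0] by simp
    then show ?thesis by linarith
  qed
  have iT: "integrable lborel (indicator T :: 'a \<Rightarrow> real)" using T by simp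
  define \<delta> where "\<delta> = e / (2 * L * measure lborel T + 1)"
  have pos: "2 * L * measure lborel T + 1 > 0" using L by (simp add: add_nonneg_pos)
  have "(\<integral>x. \<bar>f (x + h) - f x\<bar> \<partial>lborel) < e" if h: "norm h < \<delta>" for h
  proof -
    have "\<bar>f (x + h) - f x\<bar> \<le> (L * norm h) * (indicator T x + indicator T (x + h))" for x
    proof (cases "x \<in> T \<or> x + h \<in> T")
      case True
      then have "1 \<le> indicator T x + (indicator T (x + h) :: real)" by (auto simp: indicator_def)
      then have "(L * norm h) * 1 \<le> (L * norm h) * (indicator T x + indicator T (x + h))"
        using L by (intro mult_left_mono) auto
      then show ?thesis using f(2)[of "x + h" x] by simp
    next
      case False
      then show ?thesis using f(1) by simp
    qed
    then have "(\<integral>x. \<bar>f (x + h) - f x\<bar> \<partial>lborel)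
        \<le> (\<integral>x. (L * norm h) * (indicator T x + indicator T (x + h)) \<partial>lborel)"
      using integrable_shift[OF f(3), of h] f(3) iT integrable_shift[OF iT, of h]
      by (intro integral_mono) auto
    also have "\<dots> = (L * norm h) * ((\<integral>x. indicator T x \<partial>lborel) + (\<integral>x. indicator T (x + h) \<partial>lborel))"
      using iT integrable_shift[OF iT, of h] by simp
    also have "(\<integral>x. indicator T (x + h) \<partial>lborel) = (\<integral>x. indicator T x \<partial>(lborel :: 'a measure) :: real)"
      using T by (intro integral_shift) auto
    also have "(L * norm h) * ((\<integral>x. indicator T x \<partial>lborel) + (\<integral>x. indicator T x \<partial>lborel))
        = norm h * (2 * L * measure lborel T)"
      using T by simp
    also have "\<dots> \<le> norm h * (2 * L * measure lborel T + 1)"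
      by (intro mult_left_mono) auto
    also have "\<dots> < e" using h pos by (simp add: \<delta>_def pos_less_divide_eq)
    finally show ?thesis .
  qed
  moreover have "\<delta> > 0" using e pos by (simp add: \<delta>_def)
  ultimately show "\<exists>\<delta>>0. \<forall>h. norm h < \<delta> \<longrightarrow> (\<integral>x. \<bar>f (x + h) - f x\<bar> \<partial>lborel) < e" by blast
qed

text \<open>The indicator of an open set is the monotone limit of the Lipschitz functions min (1, n
  dist(x, complement of T)).\<close>

lemma L1_cont_open:
  fixes T :: "'a::euclidean_space set"
  assumes T: "open T" "emeasure lborel T < \<infinity>"
  shows "L1_cont (indicator T)"
proof (rule L1_cont_limit)
  have TB: "T \<in> sets borel" using T by simp
  show iT: "integrable lborel (indicator T :: 'a \<Rightarrow> real)" using T TB by simp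
  \<comment> \<open>The distance to the empty set is 0 by convention, which would make the
    approximating functions vanish; finite measure excludes that case.\<close>
  have ne: "- T \<noteq> {}"
  proof
    assume "- T = {}"
    then have "T = UNIV" by auto
    then show False using T(2) by simp
  qed
  define f :: "nat \<Rightarrow> 'a \<Rightarrow> real" where "f n x = min 1 (real n * infdist x (- T))" for n x
  have z: "f n x = 0" if "x \<notin> T" for n x using that by (simp add: f_def)
  have lip: "\<bar>f n x - f n y\<bar> \<le> real n * norm (x - y)" for n x y
  proof -
    have "\<bar>infdist x (- T) - infdist y (- T)\<bar> \<le> norm (x - y)"
      using infdist_triangle_abs[of x "- T" y] by (simp add: dist_norm)
    then have "real n * \<bar>infdist x (- T) - infdist y (- T)\<bar> \<le> real n * norm (x - y)"
      by (intro mult_left_mono) auto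
    then have "\<bar>real n * infdist x (- T) - real n * infdist y (- T)\<bar> \<le> real n * norm (x - y)"
      by (simp add: abs_mult flip: right_diff_distrib)
    then show ?thesis unfolding f_def by linarith
  qed
  have meas: "f n \<in> borel_measurable borel" for n 
    unfolding f_def[abs_def] by (intro borel_measurable_continuous_onI continuous_intros)
  have le: "\<bar>f n x\<bar> \<le> indicator T x" for n x
    using z[of x n] infdist_nonneg[of x "- T"] by (cases "x \<in> T") (auto simp: f_def)
  have if': "integrable lborel (f n)" for n
    by (rule Bochner_Integration.integrable_bound[OF iT]) (use meas le in auto)
  have Lf: "L1_cont (f n)" for n by (rule L1_cont_Lipschitz[OF TB T(2) z lip if'])
  have lim: "(\<lambda>n. \<integral>x. \<bar>indicator T x - f n x\<bar> \<partial>lborel) \<longlonglongrightarrow> (\<integral>x. 0 \<partial>(lborel :: 'a measure))"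
  proof (rule integral_dominated_convergence)
    show "integrable lborel (indicator T :: 'a \<Rightarrow> real)" by (rule iT)
    show "AE x in lborel. (\<lambda>n. \<bar>indicator T x - f n x\<bar>) \<longlonglongrightarrow> 0"
    proof (rule AE_I2)
      fix x
      show "(\<lambda>n. \<bar>indicator T x - f n x\<bar>) \<longlonglongrightarrow> 0"
      proof (cases "x \<in> T")
        case True
        have "infdist x (- T) \<noteq> 0"
          using in_closed_iff_infdist_zero[of "- T" x] T(1) ne True by auto
        then have p: "infdist x (- T) > 0" using infdist_nonneg[of x "- T"] by linarith
        obtain N where N: "1 < real N * infdist x (- T)" using reals_Archimedean3[OF p] by blast
        have "\<forall>\<^sub>F n in sequentially. \<bar>indicator T x - f n x\<bar> = 0"
          using eventually_ge_at_top[of N]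
        proof eventually_elim
          case (elim n)
          then have "real N * infdist x (- T) \<le> real n * infdist x (- T)"
            using p by (intro mult_right_mono) auto
          with N True show ?case by (simp add: f_def)
        qed
        then show ?thesis by (rule tendsto_eventually)
      next
        case False
        then show ?thesis using z by simp
      qed
    qed
    show "AE x in lborel. norm \<bar>indicator T x - f n x\<bar> \<le> indicator T x" for n
      using le[of n] z infdist_nonneg[of _ "- T"]
      by (intro AE_I2) (auto simp: indicator_def f_def)
  qed (use TB meas in auto)
  show "\<exists>g. integrable lborel g \<and> L1_cont g \<and> (\<integral>x. \<bar>indicator T x - g x\<bar> \<partial>lborel) < e" if "e > 0" for e
  proof -
    have "\<forall>\<^sub>F n in sequentially. (\<integral>x. \<bar>indicator T x - f n x\<bar> \<partial>lborel) < e"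
      using order_tendstoD(2)[OF lim, of e] that by simp
    then obtain n where "(\<integral>x. \<bar>indicator T x - f n x\<bar> \<partial>lborel) < e"
      by (auto simp: eventually_sequentially)
    with if' Lf show ?thesis by blast
  qed
qed

lemma L1_cont_scale:
  assumes "L1_cont f" shows "L1_cont (\<lambda>x. c * f x)"
  unfolding L1_cont_def
proof (intro allI impI)
  fix e :: real assume e: "e > 0"
  obtain \<delta> where \<delta>: "\<delta> > 0" "\<And>h. norm h < \<delta> \<Longrightarrow> (\<integral>x. \<bar>f (x + h) - f x\<bar> \<partial>lborel) < e / (\<bar>c\<bar> + 1)"
    using L1_contE[OF assms, of "e / (\<bar>c\<bar> + 1)"] e by (auto simp: add_nonneg_pos)
  have "(\<integral>x. \<bar>c * f (x + h) - c * f x\<bar> \<partial>lborel) < e" if h: "norm h < \<delta>" for h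
  proof -
    have "(\<integral>x. \<bar>c * f (x + h) - c * f x\<bar> \<partial>lborel) = \<bar>c\<bar> * (\<integral>x. \<bar>f (x + h) - f x\<bar> \<partial>lborel)"
      by (simp add: abs_mult flip: right_diff_distrib)
    also have "\<dots> \<le> (\<bar>c\<bar> + 1) * (\<integral>x. \<bar>f (x + h) - f x\<bar> \<partial>lborel)"
      by (intro mult_right_mono) auto
    also have "\<dots> < e" using \<delta>(2)[OF h] by (simp add: field_simps add_nonneg_pos)
    finally show ?thesis .
  qed
  with \<delta>(1) show "\<exists>\<delta>>0. \<forall>h. norm h < \<delta> \<longrightarrow> (\<integral>x. \<bar>c * f (x + h) - c * f x\<bar> \<partial>lborel) < e" by blast
qed

text \<open>Outer regularity of Lebesgue measure encloses \<open>A\<close> in an open set of only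
  slightly larger measure.\<close>

lemma L1_cont_indicator:
  fixes A :: "'a::euclidean_space set"
  assumes A: "A \<in> sets borel" "emeasure lborel A < \<infinity>"
  shows "L1_cont (indicator A)"
proof (rule L1_cont_limit)
  show iA: "integrable lborel (indicator A :: 'a \<Rightarrow> real)" using A by simp
  fix e :: real assume e: "e > 0"
  obtain T where T: "open T" "A \<subseteq> T" "T - A \<in> lmeasurable" "emeasure lebesgue (T - A) < ennreal e"
  proof (rule sets_lebesgue_outer_open)
    show "A \<in> sets lebesgue" using A(1) by (simp add: sets_completionI_sets)
    show "0 < e" by (rule e)
  qed
  have TB: "T \<in> sets borel" "T - A \<in> sets borel" using T(1) A(1) by auto
  have le: "emeasure lborel (T - A) < ennreal e" using T(4) TB(2) by simp
  have "emeasure lborel T = emeasure lborel A + emeasure lborel (T - A)"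
    using A(1) TB T(2) by (subst plus_emeasure) (auto simp: Un_absorb1)
  moreover have finD: "emeasure lborel (T - A) < \<infinity>" using le by (rule order_less_trans) simp
  ultimately have fin: "emeasure lborel T < \<infinity>" using A(2) by simp
  have "(\<integral>x. \<bar>indicator A x - indicator T x\<bar> \<partial>lborel) = (\<integral>x. indicator (T - A) x \<partial>(lborel :: 'a measure) :: real)"
    using T(2) by (intro Bochner_Integration.integral_cong) (auto simp: indicator_def)
  also have "\<dots> = measure lborel (T - A)" using TB(2) finD by simp
  also have "\<dots> < e"
    using le finD e by (simp add: emeasure_eq_ennreal_measure ennreal_less_iff)
  finally have "(\<integral>x. \<bar>indicator A x - indicator T x\<bar> \<partial>lborel) < e" .
  moreover have "integrable lborel (indicator T :: 'a \<Rightarrow> real)" using TB(1) fin by simp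
  ultimately show "\<exists>g. integrable lborel g \<and> L1_cont g \<and> (\<integral>x. \<bar>indicator A x - g x\<bar> \<partial>lborel) < e"
    using L1_cont_open[OF T(1) fin] by blast
qed

theorem integrable_L1_cont:
  fixes f :: "'a::euclidean_space \<Rightarrow> real"
  assumes "integrable lborel f"
  shows "L1_cont f"
  using assms
proof (induction rule: integrable_induct)
  case (base A c)
  have "L1_cont (\<lambda>x. c * indicator A x)"
    by (rule L1_cont_scale[OF L1_cont_indicator]) (use base in auto)
  then show ?case by (simp only: real_scaleR_def mult.commute)
next
  case (add f g)
  show ?case unfolding L1_cont_def
  proof (intro allI impI)
    fix e :: real assume e: "e > 0"
    obtain \<delta>1 where d1: "\<delta>1 > 0" "\<And>h. norm h < \<delta>1 \<Longrightarrow> (\<integral>x. \<bar>f (x + h) - f x\<bar> \<partial>lborel) < e / 2"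
      using L1_contE[OF add(3) half_gt_zero[OF e]] by blast
    obtain \<delta>2 where d2: "\<delta>2 > 0" "\<And>h. norm h < \<delta>2 \<Longrightarrow> (\<integral>x. \<bar>g (x + h) - g x\<bar> \<partial>lborel) < e / 2"
      using L1_contE[OF add(4) half_gt_zero[OF e]] by blast
    have "(\<integral>x. \<bar>f (x + h) + g (x + h) - (f x + g x)\<bar> \<partial>lborel) < e" if h: "norm h < min \<delta>1 \<delta>2" for h
    proof -
      have i: "integrable lborel (\<lambda>x. \<bar>f (x + h) - f x\<bar>)" "integrable lborel (\<lambda>x. \<bar>g (x + h) - g x\<bar>)"
        "integrable lborel (\<lambda>x. \<bar>f (x + h) + g (x + h) - (f x + g x)\<bar>)"
        using integrable_shift[OF add(1), of h] integrable_shift[OF add(2), of h] add(1,2) by auto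
      have "(\<integral>x. \<bar>f (x + h) + g (x + h) - (f x + g x)\<bar> \<partial>lborel)
          \<le> (\<integral>x. \<bar>f (x + h) - f x\<bar> + \<bar>g (x + h) - g x\<bar> \<partial>lborel)"
        using i by (intro integral_mono) auto
      also have "\<dots> < e" using i d1(2)[of h] d2(2)[of h] h by simp
      finally show ?thesis .
    qed
    moreover have "min \<delta>1 \<delta>2 > 0" using d1 d2 by simp
    ultimately show "\<exists>\<delta>>0. \<forall>h. norm h < \<delta> \<longrightarrow> (\<integral>x. \<bar>f (x + h) + g (x + h) - (f x + g x)\<bar> \<partial>lborel) < e"
      by blast
  qed
next
  case (lim f s)
  show ?case
  proof (rule L1_cont_limit)
    show "integrable lborel f" by fact
    fix e :: real assume e: "e > 0"
    have "(\<lambda>i. \<integral>x. \<bar>f x - s i x\<bar> \<partial>lborel) \<longlonglongrightarrow> (\<integral>x. 0 \<partial>(lborel :: 'a measure))"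
    proof (rule integral_dominated_convergence)
      \<comment> \<open>The approximating simple functions are bounded by 2|f|, so their distance
        from f is at most 3|f|.\<close>
      show "integrable lborel (\<lambda>x. 3 * \<bar>f x\<bar>)" using lim(4) by simp
      show "AE x in lborel. (\<lambda>i. \<bar>f x - s i x\<bar>) \<longlonglongrightarrow> 0"
      proof (rule AE_I2)
        fix x :: 'a
        have "(\<lambda>i. \<bar>f x - s i x\<bar>) \<longlonglongrightarrow> \<bar>f x - f x\<bar>" using lim(2)[of x] by (intro tendsto_intros) auto
        then show "(\<lambda>i. \<bar>f x - s i x\<bar>) \<longlonglongrightarrow> 0" by simp
      qed
      show "AE x in lborel. norm \<bar>f x - s i x\<bar> \<le> 3 * \<bar>f x\<bar>" for i
      proof (rule AE_I2)
        fix x :: 'a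
        show "norm \<bar>f x - s i x\<bar> \<le> 3 * \<bar>f x\<bar>" using lim(3)[of x i] by simp
      qed
    qed (use lim(1,4) in auto)
    then have "\<forall>\<^sub>F i in sequentially. (\<integral>x. \<bar>f x - s i x\<bar> \<partial>lborel) < e"
      using e by (intro order_tendstoD(2)) auto
    then obtain i where "(\<integral>x. \<bar>f x - s i x\<bar> \<partial>lborel) < e" by (auto simp: eventually_sequentially)
    then show "\<exists>g. integrable lborel g \<and> L1_cont g \<and> (\<integral>x. \<bar>f x - g x\<bar> \<partial>lborel) < e"
      using lim(1,5) by blast
  qed
qed

text \<open>The map t |t| turns an L2 function into an L1 function while keeping the sign. For equal
  signs |a - b| is at most |a + b|; for opposite signs the signed squares add up.\<close>

lemma square_diff_le_signed_squares:
  fixes a b :: real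
  shows "(a - b)\<^sup>2 \<le> 2 * \<bar>a * \<bar>a\<bar> - b * \<bar>b\<bar>\<bar>"
proof -
  have same: "(x - y)\<^sup>2 \<le> 2 * \<bar>x * x - y * y\<bar>" if "x \<ge> 0" "y \<ge> 0" for x y :: real
  proof -
    have "(x - y)\<^sup>2 = \<bar>x - y\<bar> * \<bar>x - y\<bar>" by (simp add: power2_eq_square)
    also have "\<dots> \<le> \<bar>x - y\<bar> * (x + y)" using that by (intro mult_left_mono) auto
    also have "\<dots> = \<bar>(x - y) * (x + y)\<bar>" using that by (simp add: abs_mult)
    also have "(x - y) * (x + y) = x * x - y * y" by (simp add: algebra_simps)
    finally show ?thesis by (rule order_trans) simp
  qed
  have opp: "(x + y)\<^sup>2 \<le> 2 * (x * x + y * y)" for x y :: real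
    using sum_squares_bound[of x y] by (simp add: power2_eq_square algebra_simps)
  consider "a \<ge> 0" "b \<ge> 0" | "a \<ge> 0" "b \<le> 0" | "a \<le> 0" "b \<ge> 0" | "a \<le> 0" "b \<le> 0" by linarith
  then show ?thesis
  proof cases
    case 1 then show ?thesis using same by simp
  next
    case 2 then show ?thesis using opp[of a "- b"] by simp
  next
    case 3
    have "\<bar>a * \<bar>a\<bar> - b * \<bar>b\<bar>\<bar> = a * a + b * b"
    proof -
      have "a * \<bar>a\<bar> = - (a * a)" "b * \<bar>b\<bar> = b * b" using 3 by simp_all
      then show ?thesis using sum_squares_ge_zero[of a b] by linarith
    qed
    then show ?thesis using opp[of "- a" b] by (simp add: power2_eq_square algebra_simps)
  next
    case 4 then show ?thesis
      using same[of "- a" "- b"] abs_minus_commute[of "a * a" "b * b"] by (simp add: power2_commute)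
  qed
qed

theorem L2_translation_continuous:
  fixes v :: "'a::euclidean_space \<Rightarrow> real"
  assumes v: "v \<in> L2" and e: "e > 0"
  shows "\<exists>\<delta>>0. \<forall>h. norm h < \<delta> \<longrightarrow> l2 (\<lambda>x. v (x + h) - v x) < e"
proof -
  define g where "g x = v x * \<bar>v x\<bar>" for x
  have g: "integrable lborel g"
  proof (rule Bochner_Integration.integrable_bound[OF L2_integrable[OF v]])
    show "g \<in> borel_measurable lborel" unfolding g_def[abs_def] using L2_borel[OF v] by simp
    show "AE x in lborel. norm (g x) \<le> norm ((norm (v x))\<^sup>2)"
      by (simp add: g_def abs_mult power2_eq_square)
  qed
  obtain \<delta> where \<delta>: "\<delta> > 0" "\<And>h. norm h < \<delta> \<Longrightarrow> (\<integral>x. \<bar>g (x + h) - g x\<bar> \<partial>lborel) < e\<^sup>2 / 2"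
    using L1_contE[OF integrable_L1_cont[OF g] half_gt_zero[OF zero_less_power[OF e, of 2]]] by blast
  have "l2 (\<lambda>x. v (x + h) - v x) < e" if h: "norm h < \<delta>" for h
  proof -
    have "(l2 (\<lambda>x. v (x + h) - v x))\<^sup>2 = (\<integral>x. (v (x + h) - v x)\<^sup>2 \<partial>lborel)"
      by (simp add: l2_sq)
    also have "\<dots> \<le> (\<integral>x. 2 * \<bar>g (x + h) - g x\<bar> \<partial>lborel)"
    proof (rule integral_mono)
      show "integrable lborel (\<lambda>x. (v (x + h) - v x)\<^sup>2)"
        by (rule L2_integrable_real[OF L2_diff[OF L2_shift[OF v] v]])
      show "integrable lborel (\<lambda>x. 2 * \<bar>g (x + h) - g x\<bar>)"
        using integrable_shift[OF g, of h] g by auto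
      show "(v (x + h) - v x)\<^sup>2 \<le> 2 * \<bar>g (x + h) - g x\<bar>" for x
        unfolding g_def by (rule square_diff_le_signed_squares)
    qed
    also have "\<dots> < e\<^sup>2" using \<delta>(2)[OF h] by simp
    finally show ?thesis by (rule power2_less_imp_less) (use e in simp)
  qed
  with \<delta>(1) show ?thesis by blast
qed

section \<open>Mollification\<close>

lemma test_borel: "\<phi> \<in> test_functions \<Longrightarrow> \<phi> \<in> borel_measurable borel"
  by (rule borel_measurable_continuous_onI[OF test_continuous])

lemma grad_borel: "\<phi> \<in> test_functions \<Longrightarrow> grad \<phi> \<in> borel_measurable borel"
  by (rule borel_measurable_continuous_onI[OF grad_continuous])

lemma integrable_bounded_support:
  fixes f :: "'a::euclidean_space \<Rightarrow> real"
  assumes "f \<in> borel_measurable borel" "\<And>x. \<bar>f x\<bar> \<le> M" "\<And>x. R \<le> norm x \<Longrightarrow> f x = 0"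
  shows "integrable lborel f"
proof (rule Bochner_Integration.integrable_bound)
  show "integrable lborel (\<lambda>x. M * indicator (cball (0::'a) R) x)"
    by (intro integrable_mult_right integrable_real_indicator) (simp_all add: emeasure_lborel_cball_finite[unfolded infinity_ennreal_def] emeasure_lborel_cball_finite)
  show "AE x in lborel. norm (f x) \<le> norm (M * indicator (cball 0 R) x)"
  proof (rule AE_I2)
    fix x
    show "norm (f x) \<le> norm (M * indicator (cball 0 R) x)"
      using assms(2)[of x] assms(3)[of x] by (cases "norm x \<le> R") (auto simp: indicator_def)
  qed
qed (use assms(1) in simp)

lemma test_integrable:
  assumes "\<phi> \<in> test_functions" shows "integrable lborel \<phi>"
proof -
  obtain M where "\<And>x. \<bar>\<phi> x\<bar> \<le> M" using test_bounded[OF assms] by blast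
  moreover obtain R where "\<And>x. R \<le> norm x \<Longrightarrow> \<phi> x = 0" using test_support[OF assms] by blast
  ultimately show ?thesis by (rule integrable_bounded_support[OF test_borel[OF assms]])
qed

lemma test_L2:
  assumes "\<phi> \<in> test_functions" shows "\<phi> \<in> L2"
  using test_integrable[OF test_mult[OF assms assms]] test_borel[OF assms]
  by (intro L2_I) (simp_all add: power2_eq_square)

lemma grad_L2:
  assumes "\<phi> \<in> test_functions" shows "grad \<phi> \<in> L2"
proof -
  have "(\<lambda>x. pd \<phi> i x *\<^sub>R i) \<in> L2" if "i \<in> Basis" for i
  proof (rule L2_dominated(1)[OF test_L2[OF test_pd[OF assms that]]])
    show "(\<lambda>x. pd \<phi> i x *\<^sub>R i) \<in> borel_measurable borel"
      using test_borel[OF test_pd[OF assms that]] by simp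
  qed (use that in simp)
  then have "(\<lambda>x. \<Sum>i\<in>Basis. pd \<phi> i x *\<^sub>R i) \<in> L2" by (intro L2_sum) auto
  moreover have "grad \<phi> = (\<lambda>x. \<Sum>i\<in>Basis. pd \<phi> i x *\<^sub>R i)" by (rule ext) (rule grad_def)
  ultimately show ?thesis by simp
qed

lemma integrable_bounded_mult:
  fixes f m :: "'a::euclidean_space \<Rightarrow> real"
  assumes "integrable lborel f" "m \<in> borel_measurable borel" "\<And>x. \<bar>m x\<bar> \<le> M"
  shows "integrable lborel (\<lambda>x. m x * f x)"
proof (rule Bochner_Integration.integrable_bound[OF integrable_mult_right[OF assms(1), of M]])
  show "AE x in lborel. norm (m x * f x) \<le> norm (M * f x)"
  proof (rule AE_I2)
    fix x
    have "\<bar>m x\<bar> \<le> \<bar>M\<bar>" using assms(3)[of x] by linarith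
    then show "norm (m x * f x) \<le> norm (M * f x)" by (simp add: abs_mult mult_right_mono)
  qed
qed (use assms in simp)

text \<open>The kernel is reflected in comparison with the usual convolution: \<open>v\<close> is
  paired with the translate of \<open>k\<close> to \<open>x\<close>, which is itself a test function
  and can be inserted directly into weak identities. The price is the minus sign in
  \<open>pd_conv\<close>.\<close>

definition conv :: "('a::euclidean_space \<Rightarrow> real) \<Rightarrow> ('a \<Rightarrow> real) \<Rightarrow> 'a \<Rightarrow> real" where
  "conv k v x = (\<integral>y. k (y - x) * v y \<partial>lborel)"

lemma shift_test: "k \<in> test_functions \<Longrightarrow> (\<lambda>y. k (y - x)) \<in> test_functions"
  using test_affine[of k 1 "- x"] by simp

lemma pd_shift:
  assumes "k \<in> test_functions" shows "pd (\<lambda>y. k (y - x)) i y = pd k i (y - x)"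
proof -
  have "pd (\<lambda>y. k (1 *\<^sub>R y + - x)) i y = 1 * pd k i (1 *\<^sub>R y + - x)"
    by (rule pd_affine[OF assms])
  then show ?thesis by simp
qed

lemma conv_borel:
  assumes "k \<in> test_functions" "v \<in> borel_measurable borel"
  shows "conv k v \<in> borel_measurable borel"
proof -
  note [measurable] = assms(2) test_borel[OF assms(1)]
  show ?thesis unfolding conv_def[abs_def] by measurable
qed

lemma conv_integrable:
  assumes "k \<in> test_functions" "integrable lborel v"
  shows "integrable lborel (\<lambda>y. k (y - x) * v y)"
proof -
  obtain M where M: "\<And>z. \<bar>k z\<bar> \<le> M" using test_bounded[OF assms(1)] by blast
  show ?thesis
    by (rule integrable_bounded_mult[OF assms(2) test_borel[OF shift_test[OF assms(1)]] M])
qed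

lemma grad_conv_integrable:
  assumes k: "k \<in> test_functions" and v: "integrable lborel v"
  shows "integrable lborel (\<lambda>y. v y *\<^sub>R grad k (y - x))"
proof -
  obtain M where M: "\<And>z. norm (grad k z) \<le> M" using grad_bounded[OF k] by blast
  note [measurable] = grad_borel[OF k] borel_measurable_integrable[OF v]
  show ?thesis
  proof (rule Bochner_Integration.integrable_bound[OF integrable_mult_right[OF v, of M]])
    show "AE y in lborel. norm (v y *\<^sub>R grad k (y - x)) \<le> norm (M * v y)"
    proof (rule AE_I2)
      fix y
      have "norm (grad k (y - x)) \<le> \<bar>M\<bar>" using M[of "y - x"] by linarith
      then have "norm (grad k (y - x)) * \<bar>v y\<bar> \<le> \<bar>M\<bar> * \<bar>v y\<bar>" by (rule mult_right_mono) simp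
      then show "norm (v y *\<^sub>R grad k (y - x)) \<le> norm (M * v y)"
        by (simp add: abs_mult mult.commute)
    qed
  qed measurable
qed

text \<open>The quadratic remainder of \<open>k\<close>, uniform in the base point, is integrated
  against |v|. Integrability of \<open>v\<close> is all that is used about it.\<close>

lemma conv_has_derivative:
  assumes k: "k \<in> test_functions" and v: "integrable lborel v"
  shows "(conv k v has_derivative (\<lambda>h. - ((\<integral>y. v y *\<^sub>R grad k (y - x) \<partial>lborel) \<bullet> h))) (at x)"
proof -
  define a where "a = (\<integral>y. v y *\<^sub>R grad k (y - x) \<partial>lborel)"
  note ig = grad_conv_integrable[OF k v]
  obtain L where L: "L > 0" "\<And>z h. \<bar>k (z + h) - k z - grad k z \<bullet> h\<bar> \<le> L * (norm h)\<^sup>2"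
    using test_linearization[OF k] by blast
  define C where "C = L * (\<integral>y. \<bar>v y\<bar> \<partial>lborel)"
  have est: "\<bar>conv k v z - conv k v x - - (a \<bullet> (z - x))\<bar> \<le> C * (norm (z - x))\<^sup>2" for z
  proof -
    have ii: "integrable lborel (\<lambda>y. v y * (grad k (y - x) \<bullet> (z - x)))"
      using integrable_inner_left[OF ig[of x], of "z - x"] by simp
    have "a \<bullet> (z - x) = (\<integral>y. v y * (grad k (y - x) \<bullet> (z - x)) \<partial>lborel)"
      unfolding a_def using integral_inner_left[OF ig[of x], of "z - x"] by simp
    then have "conv k v z - conv k v x - - (a \<bullet> (z - x))
        = (\<integral>y. k (y - z) * v y - k (y - x) * v y + v y * (grad k (y - x) \<bullet> (z - x)) \<partial>lborel)"
      unfolding conv_def using conv_integrable[OF k v] ii by simp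
    also have "\<bar>\<dots>\<bar> \<le> (\<integral>y. (L * (norm (z - x))\<^sup>2) * \<bar>v y\<bar> \<partial>lborel)"
    proof (rule integral_abs_bound[THEN order_trans], rule integral_mono)
      show "integrable lborel (\<lambda>y. \<bar>k (y - z) * v y - k (y - x) * v y + v y * (grad k (y - x) \<bullet> (z - x))\<bar>)"
        using conv_integrable[OF k v] ii by auto
      show "integrable lborel (\<lambda>y. (L * (norm (z - x))\<^sup>2) * \<bar>v y\<bar>)" using v by auto
      fix y
      have "\<bar>k (y - z) - k (y - x) - grad k (y - x) \<bullet> (x - z)\<bar> \<le> L * (norm (x - z))\<^sup>2"
        using L(2)[of "y - x" "x - z"] by (simp add: algebra_simps)
      then have "\<bar>k (y - z) - k (y - x) + grad k (y - x) \<bullet> (z - x)\<bar> \<le> L * (norm (z - x))\<^sup>2"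
        by (simp add: inner_diff_right norm_minus_commute)
      then have "\<bar>k (y - z) - k (y - x) + grad k (y - x) \<bullet> (z - x)\<bar> * \<bar>v y\<bar> \<le> L * (norm (z - x))\<^sup>2 * \<bar>v y\<bar>"
        by (rule mult_right_mono) simp
      then show "\<bar>k (y - z) * v y - k (y - x) * v y + v y * (grad k (y - x) \<bullet> (z - x))\<bar> \<le> (L * (norm (z - x))\<^sup>2) * \<bar>v y\<bar>"
        by (simp add: algebra_simps flip: abs_mult)
    qed
    also have "\<dots> = C * (norm (z - x))\<^sup>2" by (simp add: C_def)
    finally show ?thesis .
  qed
  have "(conv k v has_derivative (\<lambda>h. - (a \<bullet> h))) (at x)"
  proof (rule has_derivativeI_sandwich[of 1])
    show "bounded_linear (\<lambda>h. - (a \<bullet> h))"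
      by (intro bounded_linear_minus bounded_linear_inner_right)
    show "norm (conv k v z - conv k v x - - (a \<bullet> (z - x))) / norm (z - x) \<le> C * norm (z - x)"
      if "z \<noteq> x" for z
      using est[of z] that by (simp add: divide_le_eq power2_eq_square mult.assoc)
    have "((\<lambda>z. C * norm (z - x)) \<longlongrightarrow> C * norm (x - x)) (at x)" by (intro tendsto_intros)
    then show "((\<lambda>z. C * norm (z - x)) \<longlongrightarrow> 0) (at x)" by simp
  qed simp
  then show ?thesis by (simp add: a_def)
qed

lemma pd_conv:
  assumes k: "k \<in> test_functions" and v: "integrable lborel v" and i: "i \<in> Basis"
  shows "pd (conv k v) i x = - conv (pd k i) v x"
proof -
  note ig = grad_conv_integrable[OF k v]
  have "pd (conv k v) i x = - ((\<integral>y. v y *\<^sub>R grad k (y - x) \<partial>lborel) \<bullet> i)"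
    using pd_eqI[OF conv_has_derivative[OF k v, of x], of i] .
  also have "(\<integral>y. v y *\<^sub>R grad k (y - x) \<partial>lborel) \<bullet> i = (\<integral>y. v y * (grad k (y - x) \<bullet> i) \<partial>lborel)"
    using integral_inner_left[OF ig[of x], of i] by simp
  also have "\<dots> = conv (pd k i) v x"
    unfolding conv_def using i by (simp add: grad_inner_Basis mult.commute)
  finally show ?thesis .
qed

lemma conv_test:
  assumes k: "k \<in> test_functions" and v: "integrable lborel v" "\<And>x. R \<le> norm x \<Longrightarrow> v x = 0"
  shows "conv k v \<in> test_functions"
proof -
  \<comment> \<open>Differentiating only replaces the kernel by one of its derivatives and changes
    the sign; allowing a constant factor makes the class closed.\<close>
  define S where "S = {\<lambda>x. c * conv k v x | c k. k \<in> test_functions}"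
  have "Ck n (conv k v)" for n
  proof (rule Ck_coinduct[of S])
    have "(\<lambda>x. 1 * conv k v x) \<in> S" unfolding S_def using k by blast
    then show "conv k v \<in> S" by simp
  next
    fix f x assume "f \<in> S"
    then obtain c k where f: "f = (\<lambda>x. c * conv k v x)" "k \<in> test_functions" unfolding S_def by blast
    then have "conv k v differentiable (at x)"
      using conv_has_derivative[OF f(2) v(1)] differentiable_def by blast
    then show "f differentiable (at x)" unfolding f(1) by simp
  next
    fix f :: "'a \<Rightarrow> real" and i :: 'a assume "f \<in> S" and i: "i \<in> Basis"
    then obtain c k where f: "f = (\<lambda>x. c * conv k v x)" and k: "k \<in> test_functions" unfolding S_def by blast
    have "pd f i x = - c * conv (pd k i) v x" for x
    proof -
      have "(f has_derivative (\<lambda>h. c * - ((\<integral>y. v y *\<^sub>R grad k (y - x) \<partial>lborel) \<bullet> h))) (at x)"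
        unfolding f by (rule has_derivative_mult_right[OF conv_has_derivative[OF k v(1)]])
      from pd_eqI[OF this, of i] have "pd f i x = c * pd (conv k v) i x"
        using pd_eqI[OF conv_has_derivative[OF k v(1), of x], of i] by simp
      then show ?thesis using pd_conv[OF k v(1) i] by simp
    qed
    then have "pd f i = (\<lambda>x. - c * conv (pd k i) v x)" by (rule ext)
    then show "pd f i \<in> S" unfolding S_def using test_pd[OF k i] by blast
  qed
  moreover have "bounded {x. conv k v x \<noteq> 0}"
  proof -
    obtain R' where R': "R' > 0" "\<And>x. R' \<le> norm x \<Longrightarrow> k x = 0" using test_support[OF k] by blast
    have "conv k v x = 0" if "norm x > R + R'" for x
    proof -
      have "k (y - x) * v y = 0" for y
      proof (cases "R \<le> norm y")
        case False
        then have "R' \<le> norm (y - x)" using that norm_triangle_ineq2[of x y] by (simp add: norm_minus_commute)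
        then show ?thesis using R'(2) by simp
      qed (use v(2) in simp)
      then have "conv k v x = (\<integral>y. 0 \<partial>(lborel :: 'a measure))" by (simp only: conv_def)
      then show ?thesis by simp
    qed
    then have "norm x \<le> R + R'" if "conv k v x \<noteq> 0" for x using that by force
    then show ?thesis unfolding bounded_iff by blast
  qed
  ultimately show ?thesis by (simp add: test_functions_iff)
qed

lemma ex_mollifier:
  assumes "\<delta> > 0"
  obtains \<rho> :: "'a::euclidean_space \<Rightarrow> real" where "\<rho> \<in> test_functions"
    "\<And>x. \<rho> x \<ge> 0" "(\<integral>x. \<rho> x \<partial>lborel) = 1" "\<And>x. \<delta> \<le> norm x \<Longrightarrow> \<rho> x = 0"
proof -
  obtain \<beta> :: "'a \<Rightarrow> real" where \<beta>: "\<beta> \<in> test_functions"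
    "\<And>x. \<beta> x \<ge> 0" "\<beta> 0 = 1" "\<And>x. norm x \<ge> 1 \<Longrightarrow> \<beta> x = 0" using ex_bump by blast
  define k where "k x = \<beta> ((1 / \<delta>) *\<^sub>R x + 0)" for x
  have k: "k \<in> test_functions" unfolding k_def[abs_def] using assms by (intro test_affine \<beta>) auto
  have k0: "k x \<ge> 0" for x by (simp add: k_def \<beta>)
  have kz: "k x = 0" if "\<delta> \<le> norm x" for x
    using that assms \<beta>(4)[of "(1 / \<delta>) *\<^sub>R x"] by (simp add: k_def field_simps)
  have "isCont k 0" using test_continuous[OF k, of UNIV] by (simp add: continuous_on_eq_continuous_at)
  then have "\<forall>\<^sub>F x in at 0. k x > 1/2"
    using order_tendstoD(1)[of k "k 0" "at 0" "1/2"] \<beta>(3) by (simp add: isCont_def k_def)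
  then obtain e where e: "e > 0" "\<And>x. x \<noteq> 0 \<Longrightarrow> dist x 0 < e \<Longrightarrow> k x > 1/2"
    unfolding eventually_at by blast
  \<comment> \<open>Near 0 the kernel exceeds 1/2, so its integral is positive and can be normalised
    to 1.\<close>
  have ge: "k x \<ge> 1/2 * indicator (ball 0 e) x" for x
    using e(2)[of x] k0[of x] \<beta>(3) by (cases "x = 0") (auto simp: indicator_def k_def)
  have "0 < 1/2 * measure lborel (ball (0::'a) e)" using e(1) content_ball_pos by simp
  also have "\<dots> = (\<integral>x. 1/2 * indicator (ball (0::'a) e) x \<partial>lborel)"
    using emeasure_lborel_ball_finite[of "0::'a" e] by simp
  also have "\<dots> \<le> (\<integral>x. k x \<partial>lborel)"
    using emeasure_lborel_ball_finite[of "0::'a" e] ge test_integrable[OF k]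
    by (intro integral_mono) auto
  finally have pos: "(\<integral>x. k x \<partial>lborel) > 0" .
  show ?thesis
  proof (rule that)
    show "(\<lambda>x. (1 / (\<integral>x. k x \<partial>lborel)) * k x) \<in> test_functions" by (rule test_scale[OF k])
    show "(\<integral>x. (1 / (\<integral>x. k x \<partial>lborel)) * k x \<partial>lborel) = 1" using pos by simp
  qed (use pos k0 kz in auto)
qed

lemma conv_shift_eq:
  assumes "k \<in> test_functions" "v \<in> borel_measurable borel"
  shows "conv k v x = (\<integral>z. k z * v (z + x) \<partial>lborel)"
proof -
  note [measurable] = assms(2) test_borel[OF assms(1)]
  have "(\<lambda>y. k (y - x) * v y) \<in> borel_measurable borel" by measurable
  from integral_shift[OF this, of x] show ?thesis by (simp add: conv_def)
qed

text \<open>Jensen's inequality for the probability density \<open>\<rho>\<close>, followed by Tonelli.\<close>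

lemma conv_approx:
  assumes v: "v \<in> L2" and \<rho>: "\<rho> \<in> test_functions" "\<And>x. \<rho> x \<ge> 0" "(\<integral>x. \<rho> x \<partial>lborel) = 1"
      "\<And>x. \<delta> \<le> norm x \<Longrightarrow> \<rho> x = 0"
    and e: "e \<ge> 0" "\<And>h. norm h < \<delta> \<Longrightarrow> l2 (\<lambda>x. v (x + h) - v x) \<le> e"
  shows "(\<lambda>x. conv \<rho> v x - v x) \<in> L2" "l2 (\<lambda>x. conv \<rho> v x - v x) \<le> e"
proof -
  note [measurable] = L2_borel[OF v] test_borel[OF \<rho>(1)]
  have i\<rho>: "integrable lborel \<rho>" by (rule test_integrable[OF \<rho>(1)])
  obtain M where M: "\<And>x. \<bar>\<rho> x\<bar> \<le> M" using test_bounded[OF \<rho>(1)] by blast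
  have pw: "ennreal ((conv \<rho> v x - v x)\<^sup>2) \<le> (\<integral>\<^sup>+z. ennreal (\<rho> z * (v (z + x) - v x)\<^sup>2) \<partial>lborel)" for x
  proof -
    define k where "k z = v (z + x) - v x" for z
    have sh: "(\<lambda>z. v (z + x)) \<in> L2" by (rule L2_shift[OF v])
    have i1: "integrable lborel (\<lambda>z. \<rho> z * v (z + x))"
      by (rule L2_mult_integrable[OF test_L2[OF \<rho>(1)] sh])
    have i2: "integrable lborel (\<lambda>z. \<rho> z * (v (z + x))\<^sup>2)"
      by (rule integrable_bounded_mult[OF L2_integrable_real[OF sh] _ M]) simp
    have ik: "integrable lborel (\<lambda>z. \<rho> z * k z)"
      unfolding k_def right_diff_distrib using i1 i\<rho> by auto
    have ik2: "integrable lborel (\<lambda>z. \<rho> z * (k z)\<^sup>2)"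
    proof -
      have "\<rho> z * (k z)\<^sup>2 = \<rho> z * (v (z + x))\<^sup>2 - (2 * v x) * (\<rho> z * v (z + x)) + (v x)\<^sup>2 * \<rho> z" for z
        by (simp add: k_def power2_eq_square algebra_simps)
      then show ?thesis using i1 i2 i\<rho> by simp
    qed
    define a where "a = (\<integral>z. \<rho> z * k z \<partial>lborel)"
    have a: "conv \<rho> v x - v x = a"
      unfolding a_def k_def right_diff_distrib conv_shift_eq[OF \<rho>(1) L2_borel[OF v]]
      using i1 i\<rho> \<rho>(3) by simp
    \<comment> \<open>Jensen's inequality for the square is the nonnegativity of the variance of
      \<open>k\<close> under the density \<rho>.\<close>
    have "0 \<le> (\<integral>z. \<rho> z * (k z - a)\<^sup>2 \<partial>lborel)"
      using \<rho>(2) by (intro integral_nonneg_AE) simp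
    also have "(\<lambda>z. \<rho> z * (k z - a)\<^sup>2) = (\<lambda>z. \<rho> z * (k z)\<^sup>2 - (2 * a) * (\<rho> z * k z) + a\<^sup>2 * \<rho> z)"
      by (rule ext) (simp add: power2_eq_square algebra_simps)
    also have "(\<integral>z. \<rho> z * (k z)\<^sup>2 - (2 * a) * (\<rho> z * k z) + a\<^sup>2 * \<rho> z \<partial>lborel)
        = (\<integral>z. \<rho> z * (k z)\<^sup>2 \<partial>lborel) - a\<^sup>2"
      using ik ik2 i\<rho> \<rho>(3) by (simp add: a_def[symmetric] power2_eq_square)
    finally have "(conv \<rho> v x - v x)\<^sup>2 \<le> (\<integral>z. \<rho> z * (k z)\<^sup>2 \<partial>lborel)" by (simp add: a)
    then have "ennreal ((conv \<rho> v x - v x)\<^sup>2) \<le> ennreal (\<integral>z. \<rho> z * (k z)\<^sup>2 \<partial>lborel)" by (rule ennreal_leI)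
    also have "\<dots> = (\<integral>\<^sup>+z. ennreal (\<rho> z * (k z)\<^sup>2) \<partial>lborel)"
      using ik2 \<rho>(2) by (intro nn_integral_eq_integral[symmetric]) auto
    finally show ?thesis by (simp add: k_def)
  qed
  have "(\<integral>\<^sup>+x. ennreal ((norm (conv \<rho> v x - v x))\<^sup>2) \<partial>lborel)
      \<le> (\<integral>\<^sup>+x. (\<integral>\<^sup>+z. ennreal (\<rho> z * (v (z + x) - v x)\<^sup>2) \<partial>lborel) \<partial>lborel)"
    using pw by (intro nn_integral_mono) simp
  also have "\<dots> = (\<integral>\<^sup>+z. (\<integral>\<^sup>+x. ennreal (\<rho> z * (v (z + x) - v x)\<^sup>2) \<partial>lborel) \<partial>lborel)"
    by (rule lborel_pair.Fubini') measurable
  also have "\<dots> \<le> (\<integral>\<^sup>+z. ennreal (\<rho> z) * ennreal (e\<^sup>2) \<partial>lborel)"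
  proof (rule nn_integral_mono)
    fix z
    show "(\<integral>\<^sup>+x. ennreal (\<rho> z * (v (z + x) - v x)\<^sup>2) \<partial>lborel) \<le> ennreal (\<rho> z) * ennreal (e\<^sup>2)"
    proof (cases "norm z < \<delta>")
      case False
      then show ?thesis using \<rho>(4)[of z] by simp
    next
      case True
      have "(\<integral>\<^sup>+x. ennreal (\<rho> z * (v (z + x) - v x)\<^sup>2) \<partial>lborel)
          = ennreal (\<rho> z) * (\<integral>\<^sup>+x. ennreal ((norm (v (x + z) - v x))\<^sup>2) \<partial>lborel)"
        using \<rho>(2) by (simp add: ennreal_mult nn_integral_cmult add.commute)
      also have "\<dots> = ennreal (\<rho> z) * ennreal ((l2 (\<lambda>x. v (x + z) - v x))\<^sup>2)"
        by (subst l2_nn_integral[OF L2_diff[OF L2_shift[OF v] v]]) (rule refl)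
      also have "\<dots> \<le> ennreal (\<rho> z) * ennreal (e\<^sup>2)"
        using e(2)[OF True] l2_nonneg by (intro mult_left_mono ennreal_leI power_mono) auto
      finally show ?thesis .
    qed
  qed
  also have "\<dots> = (\<integral>\<^sup>+z. ennreal (\<rho> z) \<partial>lborel) * ennreal (e\<^sup>2)"
    by (rule nn_integral_multc) measurable
  also have "(\<integral>\<^sup>+z. ennreal (\<rho> z) \<partial>lborel) = 1"
    using nn_integral_eq_integral[OF i\<rho>] \<rho>(2,3) by simp
  finally have le: "(\<integral>\<^sup>+x. ennreal ((norm (conv \<rho> v x - v x))\<^sup>2) \<partial>lborel) \<le> ennreal (e\<^sup>2)" by simp
  have b: "(\<lambda>x. conv \<rho> v x - v x) \<in> borel_measurable borel"
    using conv_borel[OF \<rho>(1) L2_borel[OF v]] L2_borel[OF v] by simp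
  show "(\<lambda>x. conv \<rho> v x - v x) \<in> L2" "l2 (\<lambda>x. conv \<rho> v x - v x) \<le> e"
    using L2_nn_integral_le[OF b le e(1)] by blast+
qed

text \<open>The hypothesis makes every mollification of \<open>v\<close> vanish identically, whereas
  mollifications approximate \<open>v\<close> in L2.\<close>

theorem L2_fundamental_lemma:
  fixes v :: "'a::euclidean_space \<Rightarrow> real"
  assumes v: "v \<in> L2" and z: "\<And>\<phi>. \<phi> \<in> test_functions \<Longrightarrow> (\<integral>x. v x * \<phi> x \<partial>lborel) = 0"
  shows "AE x in lborel. v x = 0"
proof -
  have "l2 v \<le> e" if e: "e > 0" for e
  proof -
    obtain \<delta> where \<delta>: "\<delta> > 0" "\<forall>h. norm h < \<delta> \<longrightarrow> l2 (\<lambda>x. v (x + h) - v x) < e"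
      using L2_translation_continuous[OF v e] by (elim exE conjE)
    have \<delta>': "\<And>h. norm h < \<delta> \<Longrightarrow> l2 (\<lambda>x. v (x + h) - v x) \<le> e"
      using \<delta>(2) by (simp add: less_imp_le)
    obtain \<rho> :: "'a \<Rightarrow> real" where \<rho>: "\<rho> \<in> test_functions" "\<And>x. \<rho> x \<ge> 0" "(\<integral>x. \<rho> x \<partial>lborel) = 1"
      "\<And>x. \<delta> \<le> norm x \<Longrightarrow> \<rho> x = 0"
      using ex_mollifier[OF \<delta>(1)] by blast
    have "conv \<rho> v x = 0" for x
      using z[OF shift_test[OF \<rho>(1)], of x] by (simp add: conv_def mult.commute)
    moreover have "l2 (\<lambda>x. conv \<rho> v x - v x) \<le> e"
      by (rule conv_approx(2)[OF v \<rho> less_imp_le[OF e] \<delta>'])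
    ultimately show ?thesis using l2_scaleR[of "-1" v] by simp
  qed
  then have "l2 v \<le> 0" by (rule field_le_epsilon[of _ 0, simplified])
  then show ?thesis using l2_eq_0_iff[OF v] l2_nonneg[of v] by simp
qed

lemma L2_inner_Basis: "G \<in> L2 \<Longrightarrow> (\<lambda>x. G x \<bullet> i) \<in> L2"
proof -
  assume G: "G \<in> L2"
  show ?thesis
  proof (rule L2_dominated(1)[OF L2_scaleR[OF G, of "norm i"]])
    show "(\<lambda>x. G x \<bullet> i) \<in> borel_measurable borel" using L2_borel[OF G] by simp
    show "norm (G x \<bullet> i) \<le> norm (norm i *\<^sub>R G x)" for x
      using Cauchy_Schwarz_ineq2[of "G x" i] by (simp add: mult.commute)
  qed
qed

text \<open>The error splits into one product of two small factors and two products with one small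
  factor. This is the device that carries identities from test functions to H1: two strongly
  convergent factors and a fixed bounded weight.\<close>

lemma L2_trilinear_tendsto:
  assumes f: "\<And>n. f n \<in> L2" "f' \<in> L2" "(\<lambda>n. l2 (\<lambda>x. f n x - f' x)) \<longlonglongrightarrow> 0"
    and g: "\<And>n. g n \<in> L2" "g' \<in> L2" "(\<lambda>n. l2 (\<lambda>x. g n x - g' x)) \<longlonglongrightarrow> 0"
    and m: "m \<in> borel_measurable borel" "\<And>x. \<bar>m x\<bar> \<le> M"
  shows "(\<lambda>n. \<integral>x. m x * (f n x \<bullet> g n x) \<partial>lborel) \<longlonglongrightarrow> (\<integral>x. m x * (f' x \<bullet> g' x) \<partial>lborel)"
proof -
  have est: "norm ((\<integral>x. m x * (f n x \<bullet> g n x) \<partial>lborel) - (\<integral>x. m x * (f' x \<bullet> g' x) \<partial>lborel))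
     \<le> (M * l2 (\<lambda>x. f n x - f' x)) * l2 (\<lambda>x. g n x - g' x) + (M * l2 (\<lambda>x. f n x - f' x)) * l2 g'
       + (M * l2 f') * l2 (\<lambda>x. g n x - g' x)" for n
  proof -
    have a: "(\<lambda>x. f n x - f' x) \<in> L2" "(\<lambda>x. g n x - g' x) \<in> L2" using f g by (auto intro: L2_diff)
    have ma: "(\<lambda>x. m x *\<^sub>R (f n x - f' x)) \<in> L2" "l2 (\<lambda>x. m x *\<^sub>R (f n x - f' x)) \<le> M * l2 (\<lambda>x. f n x - f' x)"
      by (rule L2_bounded_scaleR[OF a(1) m])+
    have mf: "(\<lambda>x. m x *\<^sub>R f' x) \<in> L2" "l2 (\<lambda>x. m x *\<^sub>R f' x) \<le> M * l2 f'"
      by (rule L2_bounded_scaleR[OF f(2) m])+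
    have mfn: "(\<lambda>x. m x *\<^sub>R f n x) \<in> L2" by (rule L2_bounded_scaleR[OF f(1) m])
    have e: "(\<integral>x. m x * (f n x \<bullet> g n x) \<partial>lborel) - (\<integral>x. m x * (f' x \<bullet> g' x) \<partial>lborel)
       = (\<integral>x. (m x *\<^sub>R (f n x - f' x)) \<bullet> (g n x - g' x) \<partial>lborel)
        + (\<integral>x. (m x *\<^sub>R (f n x - f' x)) \<bullet> g' x \<partial>lborel)
        + (\<integral>x. (m x *\<^sub>R f' x) \<bullet> (g n x - g' x) \<partial>lborel)"
    proof -
      have "(\<integral>x. m x * (f n x \<bullet> g n x) \<partial>lborel) - (\<integral>x. m x * (f' x \<bullet> g' x) \<partial>lborel)
          = (\<integral>x. m x * (f n x \<bullet> g n x) - m x * (f' x \<bullet> g' x) \<partial>lborel)"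
        using L2_inner_integrable[OF mfn g(1)] L2_inner_integrable[OF mf(1) g(2)] by simp
      also have "\<dots> = (\<integral>x. ((m x *\<^sub>R (f n x - f' x)) \<bullet> (g n x - g' x) + (m x *\<^sub>R (f n x - f' x)) \<bullet> g' x)
          + (m x *\<^sub>R f' x) \<bullet> (g n x - g' x) \<partial>lborel)"
        by (intro Bochner_Integration.integral_cong refl)
          (simp add: inner_diff_left inner_diff_right algebra_simps)
      also have "\<dots> = (\<integral>x. (m x *\<^sub>R (f n x - f' x)) \<bullet> (g n x - g' x) \<partial>lborel)
        + (\<integral>x. (m x *\<^sub>R (f n x - f' x)) \<bullet> g' x \<partial>lborel)
        + (\<integral>x. (m x *\<^sub>R f' x) \<bullet> (g n x - g' x) \<partial>lborel)"
        using L2_inner_integrable[OF ma(1) a(2)] L2_inner_integrable[OF ma(1) g(2)]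
          L2_inner_integrable[OF mf(1) a(2)]
        by (simp only: Bochner_Integration.integral_add Bochner_Integration.integrable_add)
      finally show ?thesis .
    qed
    have "\<bar>\<integral>x. (m x *\<^sub>R (f n x - f' x)) \<bullet> (g n x - g' x) \<partial>lborel\<bar> \<le> (M * l2 (\<lambda>x. f n x - f' x)) * l2 (\<lambda>x. g n x - g' x)"
      by (rule order_trans[OF L2_inner_Cauchy_Schwarz[OF ma(1) a(2)]]) (intro mult_right_mono ma(2) l2_nonneg)
    moreover have "\<bar>\<integral>x. (m x *\<^sub>R (f n x - f' x)) \<bullet> g' x \<partial>lborel\<bar> \<le> (M * l2 (\<lambda>x. f n x - f' x)) * l2 g'"
      by (rule order_trans[OF L2_inner_Cauchy_Schwarz[OF ma(1) g(2)]]) (intro mult_right_mono ma(2) l2_nonneg)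
    moreover have "\<bar>\<integral>x. (m x *\<^sub>R f' x) \<bullet> (g n x - g' x) \<partial>lborel\<bar> \<le> (M * l2 f') * l2 (\<lambda>x. g n x - g' x)"
      by (rule order_trans[OF L2_inner_Cauchy_Schwarz[OF mf(1) a(2)]]) (intro mult_right_mono mf(2) l2_nonneg)
    ultimately show ?thesis unfolding e real_norm_def by linarith
  qed
  have "(\<lambda>n. (M * l2 (\<lambda>x. f n x - f' x)) * l2 (\<lambda>x. g n x - g' x) + (M * l2 (\<lambda>x. f n x - f' x)) * l2 g'
       + (M * l2 f') * l2 (\<lambda>x. g n x - g' x)) \<longlonglongrightarrow> (M * 0) * 0 + (M * 0) * l2 g' + (M * l2 f') * 0"
    by (intro tendsto_intros f g)
  then have "(\<lambda>n. (M * l2 (\<lambda>x. f n x - f' x)) * l2 (\<lambda>x. g n x - g' x) + (M * l2 (\<lambda>x. f n x - f' x)) * l2 g'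
       + (M * l2 f') * l2 (\<lambda>x. g n x - g' x)) \<longlonglongrightarrow> 0" by simp
  from Lim_null_comparison[OF always_eventually[OF allI[OF est]] this]
  show ?thesis by (rule LIM_zero_cancel)
qed

lemma L2_inner_tendsto:
  assumes "\<And>n. f n \<in> L2" "f' \<in> L2" "(\<lambda>n. l2 (\<lambda>x. f n x - f' x)) \<longlonglongrightarrow> 0" "g \<in> L2"
  shows "(\<lambda>n. \<integral>x. f n x \<bullet> g x \<partial>lborel) \<longlonglongrightarrow> (\<integral>x. f' x \<bullet> g x \<partial>lborel)"
proof -
  have "(\<lambda>n. l2 (\<lambda>x. g x - g x)) \<longlonglongrightarrow> 0" by (simp add: l2_zero)
  from L2_trilinear_tendsto[OF assms(1,2,3,4,4) this, of "\<lambda>_. 1" 1]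
  show ?thesis by simp
qed

lemma l2_tendsto:
  assumes "\<And>n. f n \<in> L2" "f' \<in> L2" "(\<lambda>n. l2 (\<lambda>x. f n x - f' x)) \<longlonglongrightarrow> 0"
  shows "(\<lambda>n. l2 (f n)) \<longlonglongrightarrow> l2 f'"
proof (rule metric_tendsto_imp_tendsto[OF assms(3)])
  have "\<bar>l2 (f n) - l2 f'\<bar> \<le> l2 (\<lambda>x. f n x - f' x)" for n
    using l2_le_diff_add[OF assms(1,2), of n] l2_le_diff_add[OF assms(2,1), of n]
      l2_minus[of "f n" f'] by linarith
  then show "\<forall>\<^sub>F n in sequentially. dist (l2 (f n)) (l2 f') \<le> dist (l2 (\<lambda>x. f n x - f' x)) 0"
    by (simp add: dist_real_def l2_nonneg)
qed

section \<open>Weak gradients\<close>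

text \<open>The gradient is carried as an argument, because \<open>weak_gradient\<close> is an
  arbitrary choice up to null sets. Explicit gradients, such as \<open>grad \<phi>\<close> or those
  given by product rules, can then be used without passing to that choice.\<close>

definition H1_pair :: "('a::euclidean_space \<Rightarrow> real) \<Rightarrow> ('a \<Rightarrow> 'a) \<Rightarrow> bool" where
  "H1_pair u G \<longleftrightarrow> u \<in> L2 \<and> G \<in> L2 \<and> has_weak_gradient u G"

lemma H1_pair_L2: "H1_pair u G \<Longrightarrow> u \<in> L2" "H1_pair u G \<Longrightarrow> G \<in> L2"
  by (simp_all add: H1_pair_def)

lemma H1_pair_eq:
  "H1_pair u G \<Longrightarrow> \<phi> \<in> test_functions \<Longrightarrow> i \<in> Basis \<Longrightarrow>
    (\<integral>x. u x * pd \<phi> i x \<partial>lborel) = - (\<integral>x. (G x \<bullet> i) * \<phi> x \<partial>lborel)"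
  unfolding H1_pair_def has_weak_gradient_def by blast

lemma H1_pair_I:
  assumes "u \<in> L2" "G \<in> L2"
    "\<And>\<phi> i. \<phi> \<in> test_functions \<Longrightarrow> i \<in> Basis \<Longrightarrow>
      (\<integral>x. u x * pd \<phi> i x \<partial>lborel) = - (\<integral>x. (G x \<bullet> i) * \<phi> x \<partial>lborel)"
  shows "H1_pair u G"
  unfolding H1_pair_def has_weak_gradient_def by (intro conjI ballI assms)

lemma H1_pair_H1: "H1_pair u G \<Longrightarrow> u \<in> H1"
  unfolding H1_pair_def H1_def by auto

lemma H1_pair_weak_gradient:
  assumes "u \<in> H1" shows "H1_pair u (weak_gradient u)"
proof -
  have "\<exists>G. G \<in> L2 \<and> has_weak_gradient u G" using assms unfolding H1_def by auto
  then have "weak_gradient u \<in> L2 \<and> has_weak_gradient u (weak_gradient u)"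
    unfolding weak_gradient_def by (rule someI_ex)
  then show ?thesis using assms by (simp add: H1_pair_def H1_def)
qed

lemma H1_pair_unique:
  fixes u :: "'a::euclidean_space \<Rightarrow> real"
  assumes "H1_pair u G" "H1_pair u G'"
  shows "AE x in lborel. G x = G' x"
proof -
  have "AE x in lborel. G x \<bullet> i - G' x \<bullet> i = 0" if i: "i \<in> Basis" for i
  proof (rule L2_fundamental_lemma)
    have L: "(\<lambda>x. G x \<bullet> i) \<in> L2" "(\<lambda>x. G' x \<bullet> i) \<in> L2"
      using assms by (auto intro: L2_inner_Basis H1_pair_L2)
    then show "(\<lambda>x. G x \<bullet> i - G' x \<bullet> i) \<in> L2" by (rule L2_diff)
    fix \<phi> :: "'a \<Rightarrow> real" assume \<phi>: "\<phi> \<in> test_functions"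
    show "(\<integral>x. (G x \<bullet> i - G' x \<bullet> i) * \<phi> x \<partial>lborel) = 0"
      unfolding left_diff_distrib
      using L2_mult_integrable[OF L(1) test_L2[OF \<phi>]] L2_mult_integrable[OF L(2) test_L2[OF \<phi>]]
        H1_pair_eq[OF assms(1) \<phi> i] H1_pair_eq[OF assms(2) \<phi> i] by simp
  qed
  then have "AE x in lborel. \<forall>i\<in>Basis. G x \<bullet> i - G' x \<bullet> i = 0"
    by (intro AE_finite_allI) auto
  then show ?thesis
  proof eventually_elim
    case (elim x)
    show ?case by (rule euclidean_eqI) (use elim in simp)
  qed
qed

lemma weak_gradient_AE:
  assumes "H1_pair u G" shows "AE x in lborel. weak_gradient u x = G x"
  by (rule H1_pair_unique[OF H1_pair_weak_gradient[OF H1_pair_H1[OF assms]] assms])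

lemma weak_gradient_inner:
  assumes "H1_pair u G" "H1_pair v H"
  shows "(\<integral>x. weak_gradient u x \<bullet> weak_gradient v x \<partial>lborel) = (\<integral>x. G x \<bullet> H x \<partial>lborel)"
proof (rule integral_cong_AE)
  note w = H1_pair_weak_gradient[OF H1_pair_H1]
  show "(\<lambda>x. weak_gradient u x \<bullet> weak_gradient v x) \<in> borel_measurable lborel"
    using L2_borel[OF H1_pair_L2(2)[OF w[OF assms(1)]]] L2_borel[OF H1_pair_L2(2)[OF w[OF assms(2)]]] by simp
  show "(\<lambda>x. G x \<bullet> H x) \<in> borel_measurable lborel"
    using L2_borel[OF H1_pair_L2(2)[OF assms(1)]] L2_borel[OF H1_pair_L2(2)[OF assms(2)]] by simp
  show "AE x in lborel. weak_gradient u x \<bullet> weak_gradient v x = G x \<bullet> H x"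
    using weak_gradient_AE[OF assms(1)] weak_gradient_AE[OF assms(2)] by eventually_elim simp
qed

lemma H1_norm_pair:
  assumes "H1_pair u G" shows "H1_norm u = sqrt ((l2 u)\<^sup>2 + (l2 G)\<^sup>2)"
proof -
  have "(\<integral>x. (norm (weak_gradient u x))\<^sup>2 \<partial>lborel) = (\<integral>x. (norm (G x))\<^sup>2 \<partial>lborel)"
    unfolding power2_norm_eq_inner by (rule weak_gradient_inner[OF assms assms])
  then show ?thesis by (simp add: H1_norm_def l2_sq)
qed

lemma H1_pair_lincomb:
  assumes "H1_pair u G" "H1_pair v H"
  shows "H1_pair (\<lambda>x. u x + c * v x) (\<lambda>x. G x + c *\<^sub>R H x)"
proof (rule H1_pair_I)
  note L = H1_pair_L2[OF assms(1)] H1_pair_L2[OF assms(2)]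
  show "(\<lambda>x. u x + c * v x) \<in> L2" using L2_add[OF L(1) L2_scaleR[OF L(3), of c]] by simp
  show "(\<lambda>x. G x + c *\<^sub>R H x) \<in> L2" by (rule L2_add[OF L(2) L2_scaleR[OF L(4)]])
  fix \<phi> :: "'a \<Rightarrow> real" and i :: 'a assume \<phi>: "\<phi> \<in> test_functions" and i: "i \<in> Basis"
  note T = test_L2[OF test_pd[OF \<phi> i]] test_L2[OF \<phi>]
  have "(\<integral>x. (u x + c * v x) * pd \<phi> i x \<partial>lborel)
      = (\<integral>x. u x * pd \<phi> i x + c * (v x * pd \<phi> i x) \<partial>lborel)"
    by (simp add: algebra_simps)
  also have "\<dots> = (\<integral>x. u x * pd \<phi> i x \<partial>lborel) + c * (\<integral>x. v x * pd \<phi> i x \<partial>lborel)"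
    using L2_mult_integrable[OF L(1) T(1)] L2_mult_integrable[OF L(3) T(1)] by simp
  also have "\<dots> = - ((\<integral>x. (G x \<bullet> i) * \<phi> x \<partial>lborel) + c * (\<integral>x. (H x \<bullet> i) * \<phi> x \<partial>lborel))"
    using H1_pair_eq[OF assms(1) \<phi> i] H1_pair_eq[OF assms(2) \<phi> i] by simp
  also have "(\<integral>x. (G x \<bullet> i) * \<phi> x \<partial>lborel) + c * (\<integral>x. (H x \<bullet> i) * \<phi> x \<partial>lborel)
      = (\<integral>x. (G x \<bullet> i) * \<phi> x + c * ((H x \<bullet> i) * \<phi> x) \<partial>lborel)"
    using L2_mult_integrable[OF L2_inner_Basis[OF L(2)] T(2)] L2_mult_integrable[OF L2_inner_Basis[OF L(4)] T(2)] by simp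
  also have "\<dots> = (\<integral>x. ((G x + c *\<^sub>R H x) \<bullet> i) * \<phi> x \<partial>lborel)"
    by (simp add: inner_add_left algebra_simps)
  finally show "(\<integral>x. (u x + c * v x) * pd \<phi> i x \<partial>lborel) = - (\<integral>x. ((G x + c *\<^sub>R H x) \<bullet> i) * \<phi> x \<partial>lborel)" .
qed

text \<open>The weak gradient is a closed operator: for a fixed test function both sides of its
  defining identity are continuous in L2. Completeness of H1 follows.\<close>

lemma H1_pair_limit:
  assumes p: "\<And>n. H1_pair (u n) (G n)" and L: "u' \<in> L2" "G' \<in> L2"
    and lim: "(\<lambda>n. l2 (\<lambda>x. u n x - u' x)) \<longlonglongrightarrow> 0" "(\<lambda>n. l2 (\<lambda>x. G n x - G' x)) \<longlonglongrightarrow> 0"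
  shows "H1_pair u' G'"
proof (rule H1_pair_I[OF L])
  fix \<phi> :: "'a \<Rightarrow> real" and i :: 'a assume \<phi>: "\<phi> \<in> test_functions" and i: "i \<in> Basis"
  have 1: "(\<lambda>n. \<integral>x. u n x * pd \<phi> i x \<partial>lborel) \<longlonglongrightarrow> (\<integral>x. u' x * pd \<phi> i x \<partial>lborel)"
    using L2_inner_tendsto[OF H1_pair_L2(1)[OF p] L(1) lim(1) test_L2[OF test_pd[OF \<phi> i]]] by simp
  have "(\<lambda>x. \<phi> x *\<^sub>R i) \<in> L2"
    by (rule L2_dominated(1)[OF test_L2[OF \<phi>]]) (use test_borel[OF \<phi>] i in auto)
  from L2_inner_tendsto[OF H1_pair_L2(2)[OF p] L(2) lim(2) this]
  have 2: "(\<lambda>n. \<integral>x. (G n x \<bullet> i) * \<phi> x \<partial>lborel) \<longlonglongrightarrow> (\<integral>x. (G' x \<bullet> i) * \<phi> x \<partial>lborel)"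
    by (simp add: mult.commute)
  have "(\<lambda>n. \<integral>x. u n x * pd \<phi> i x \<partial>lborel) \<longlonglongrightarrow> - (\<integral>x. (G' x \<bullet> i) * \<phi> x \<partial>lborel)"
    unfolding H1_pair_eq[OF p \<phi> i] by (rule tendsto_minus[OF 2])
  from LIMSEQ_unique[OF 1 this] show "(\<integral>x. u' x * pd \<phi> i x \<partial>lborel) = - (\<integral>x. (G' x \<bullet> i) * \<phi> x \<partial>lborel)" .
qed

section \<open>Lipschitz multipliers\<close>

text \<open>The radial functions used below have kinks on spheres, so the derivative is required
  only almost everywhere, with a bounded Borel representative \<open>D\<close>. Compact support
  makes integration by parts free of boundary terms.\<close>

definition lip_deriv :: "('a::euclidean_space \<Rightarrow> real) \<Rightarrow> ('a \<Rightarrow> 'a) \<Rightarrow> bool" where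
  "lip_deriv s D \<longleftrightarrow> (\<exists>L. \<forall>x y. \<bar>s x - s y\<bar> \<le> L * norm (x - y)) \<and> (\<exists>R>0. \<forall>x. R \<le> norm x \<longrightarrow> s x = 0) \<and>
     D \<in> borel_measurable borel \<and> (\<exists>M. \<forall>x. norm (D x) \<le> M) \<and>
     (AE x in lborel. (s has_derivative (\<lambda>h. D x \<bullet> h)) (at x))"

lemma lip_derivE:
  assumes "lip_deriv s D"
  obtains L R M where "\<And>x y. \<bar>s x - s y\<bar> \<le> L * norm (x - y)" "R > 0" "\<And>x. R \<le> norm x \<Longrightarrow> s x = 0"
    "\<And>x. norm (D x) \<le> M"
proof -
  from assms obtain L R M where "\<forall>x y. \<bar>s x - s y\<bar> \<le> L * norm (x - y)" "R > 0"
      "\<forall>x. R \<le> norm x \<longrightarrow> s x = 0" "\<forall>x. norm (D x) \<le> M"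
    unfolding lip_deriv_def by (elim conjE exE)
  then show ?thesis by (intro that[of L R M]) simp_all
qed

lemma lip_deriv_AE: "lip_deriv s D \<Longrightarrow> AE x in lborel. (s has_derivative (\<lambda>h. D x \<bullet> h)) (at x)"
  by (simp add: lip_deriv_def)

lemma lip_deriv_borel_D: "lip_deriv s D \<Longrightarrow> D \<in> borel_measurable borel"
  by (simp add: lip_deriv_def)

lemma lip_deriv_continuous:
  assumes "lip_deriv s D" shows "continuous_on UNIV s"
proof -
  obtain L where L: "\<And>x y. \<bar>s x - s y\<bar> \<le> L * norm (x - y)" using assms unfolding lip_deriv_def by blast
  have "\<bar>s x - s y\<bar> \<le> \<bar>L\<bar> * norm (x - y)" for x y
    by (rule order_trans[OF L]) (intro mult_right_mono; simp)
  then have "\<bar>L\<bar>-lipschitz_on UNIV s" by (intro lipschitz_onI) (auto simp: dist_norm)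
  then show ?thesis by (rule lipschitz_on_continuous_on)
qed

lemma lip_deriv_borel: "lip_deriv s D \<Longrightarrow> s \<in> borel_measurable borel"
  by (rule borel_measurable_continuous_onI[OF lip_deriv_continuous])

lemma lip_deriv_bounded:
  assumes "lip_deriv s D" obtains M where "\<And>x. \<bar>s x\<bar> \<le> M"
proof -
  obtain R where R: "R > 0" "\<And>x. R \<le> norm x \<Longrightarrow> s x = 0" using assms unfolding lip_deriv_def by blast
  have "compact (s ` cball 0 R)"
    using lip_deriv_continuous[OF assms] by (intro compact_continuous_image) (auto intro: continuous_on_subset)
  then obtain M where M: "\<forall>y\<in>s ` cball 0 R. norm y \<le> M" using compact_imp_bounded bounded_iff by blast
  have "\<bar>s x\<bar> \<le> max M 0" for x
  proof (cases "norm x \<le> R")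
    case True
    then have "norm (s x) \<le> M" using M by simp
    then show ?thesis by simp
  next
    case False
    then show ?thesis using R(2)[of x] by simp
  qed
  then show ?thesis by (rule that)
qed

lemma lip_deriv_test:
  assumes "\<phi> \<in> test_functions" shows "lip_deriv \<phi> (grad \<phi>)"
  unfolding lip_deriv_def
proof (intro conjI)
  obtain L where L: "L > 0" "\<And>x y. \<bar>\<phi> x - \<phi> y\<bar> \<le> L * norm (x - y)"
    using test_lipschitz[OF assms] by blast
  from L(2) show "\<exists>L. \<forall>x y. \<bar>\<phi> x - \<phi> y\<bar> \<le> L * norm (x - y)" by (intro exI allI)
  obtain R where "R > 0" "\<And>x. R \<le> norm x \<Longrightarrow> \<phi> x = 0" using test_support[OF assms] by blast
  then show "\<exists>R>0. \<forall>x. R \<le> norm x \<longrightarrow> \<phi> x = 0" by (intro exI allI conjI impI)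
  obtain M where M: "M > 0" "\<And>x. norm (grad \<phi> x) \<le> M" using grad_bounded[OF assms] by blast
  from M(2) show "\<exists>M. \<forall>x. norm (grad \<phi> x) \<le> M" by (intro exI allI)
  show "grad \<phi> \<in> borel_measurable borel" by (rule grad_borel[OF assms])
  show "AE x in lborel. (\<phi> has_derivative (\<lambda>h. grad \<phi> x \<bullet> h)) (at x)"
    by (rule AE_I2) (rule test_grad_derivative[OF assms])
qed

lemma lip_deriv_mult:
  assumes s: "lip_deriv s D" and t: "lip_deriv t E"
  shows "lip_deriv (\<lambda>x. s x * t x) (\<lambda>x. s x *\<^sub>R E x + t x *\<^sub>R D x)"
  unfolding lip_deriv_def
proof (intro conjI)
  obtain L R N where s1: "\<And>x y. \<bar>s x - s y\<bar> \<le> L * norm (x - y)" "R > 0" "\<And>x. R \<le> norm x \<Longrightarrow> s x = 0"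
    "\<And>x. norm (D x) \<le> N" using lip_derivE[OF s] by blast
  obtain L' R' N' where t1: "\<And>x y. \<bar>t x - t y\<bar> \<le> L' * norm (x - y)" "R' > 0" "\<And>x. R' \<le> norm x \<Longrightarrow> t x = 0"
    "\<And>x. norm (E x) \<le> N'" using lip_derivE[OF t] by blast
  obtain M where M: "\<And>x. \<bar>s x\<bar> \<le> M" using lip_deriv_bounded[OF s] by blast
  obtain M' where M': "\<And>x. \<bar>t x\<bar> \<le> M'" using lip_deriv_bounded[OF t] by blast
  have pos: "0 \<le> M" "0 \<le> M'" "0 \<le> N" "0 \<le> N'"
    using M[of 0] M'[of 0] norm_ge_zero[of "D 0"] norm_ge_zero[of "E 0"] s1(4)[of 0] t1(4)[of 0] by linarith+
  have "\<bar>s x * t x - s y * t y\<bar> \<le> (M * L' + M' * L) * norm (x - y)" for x y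
  proof -
    have "s x * t x - s y * t y = s x * (t x - t y) + t y * (s x - s y)" by (simp add: algebra_simps)
    then have "\<bar>s x * t x - s y * t y\<bar> \<le> \<bar>s x\<bar> * \<bar>t x - t y\<bar> + \<bar>t y\<bar> * \<bar>s x - s y\<bar>"
      by (simp add: abs_triangle_ineq flip: abs_mult)
    also have "\<dots> \<le> M * (L' * norm (x - y)) + M' * (L * norm (x - y))"
      using pos by (intro add_mono mult_mono M M' t1 s1) auto
    finally show ?thesis by (simp add: algebra_simps)
  qed
  then show "\<exists>L. \<forall>x y. \<bar>s x * t x - s y * t y\<bar> \<le> L * norm (x - y)" by blast
  have "norm (s x *\<^sub>R E x + t x *\<^sub>R D x) \<le> M * N' + M' * N" for x
    using pos by (intro norm_triangle_le add_mono) (auto intro!: mult_mono M M' s1 t1)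
  then show "\<exists>M. \<forall>x. norm (s x *\<^sub>R E x + t x *\<^sub>R D x) \<le> M" by blast
  show "\<exists>R>0. \<forall>x. R \<le> norm x \<longrightarrow> s x * t x = 0" using s1(2,3) by (intro exI[of _ R]) simp
  show "(\<lambda>x. s x *\<^sub>R E x + t x *\<^sub>R D x) \<in> borel_measurable borel"
    using lip_deriv_borel[OF s] lip_deriv_borel[OF t] lip_deriv_borel_D[OF s] lip_deriv_borel_D[OF t] by simp
  show "AE x in lborel. ((\<lambda>x. s x * t x) has_derivative (\<lambda>h. (s x *\<^sub>R E x + t x *\<^sub>R D x) \<bullet> h)) (at x)"
    using lip_deriv_AE[OF s] lip_deriv_AE[OF t]
  proof eventually_elim
    case (elim x)
    from has_derivative_mult[OF elim] show ?case
      by (simp add: inner_add_left mult.commute)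
  qed
qed

text \<open>The one form of the divergence theorem that is needed. Difference quotients integrate to
  0 by translation invariance, and the Lipschitz bound together with the bounded support dominates
  them.\<close>

lemma lip_deriv_integral_zero:
  fixes h :: "'a::euclidean_space"
  assumes s: "lip_deriv s D"
  shows "(\<integral>x. D x \<bullet> h \<partial>lborel) = 0"
proof -
  obtain L R N where s1: "\<And>x y. \<bar>s x - s y\<bar> \<le> L * norm (x - y)" "R > 0" "\<And>x. R \<le> norm x \<Longrightarrow> s x = 0"
    "\<And>x. norm (D x) \<le> N" using lip_derivE[OF s] by blast
  obtain M where M: "\<And>x. \<bar>s x\<bar> \<le> M" using lip_deriv_bounded[OF s] by blast
  note [measurable] = lip_deriv_borel[OF s] lip_deriv_borel_D[OF s]
  have ints: "integrable lborel s" by (rule integrable_bounded_support[OF lip_deriv_borel[OF s] M s1(3)])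
  define t where "t n = 1 / real (Suc n)" for n
  have t: "t n > 0" "t n \<le> 1" for n by (simp_all add: t_def)
  have t0: "t \<longlonglongrightarrow> 0" unfolding t_def[abs_def] by (rule LIMSEQ_Suc[OF lim_1_over_n])
  define f where "f n x = (s (x + t n *\<^sub>R h) - s x) / t n" for n x
  have z: "(\<integral>x. f n x \<partial>lborel) = 0" for n
    unfolding f_def using integrable_shift[OF ints, of "t n *\<^sub>R h"] ints integral_shift[OF lip_deriv_borel[OF s], of "t n *\<^sub>R h"]
    by simp
  have "(\<lambda>n. \<integral>x. f n x \<partial>lborel) \<longlonglongrightarrow> (\<integral>x. D x \<bullet> h \<partial>lborel)"
  proof (rule integral_dominated_convergence)
    show "integrable lborel (\<lambda>x. \<bar>L\<bar> * norm h * indicator (cball (0::'a) (R + norm h)) x)"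
      by (intro integrable_mult_right integrable_real_indicator)
        (simp_all add: emeasure_lborel_cball_finite[unfolded infinity_ennreal_def] emeasure_lborel_cball_finite)
    show "(\<lambda>x. D x \<bullet> h) \<in> borel_measurable lborel" by measurable
    show "f n \<in> borel_measurable lborel" for n unfolding f_def[abs_def] by measurable
    show "AE x in lborel. (\<lambda>n. f n x) \<longlonglongrightarrow> D x \<bullet> h"
      using lip_deriv_AE[OF s]
    proof eventually_elim
      case (elim x)
      have "((\<lambda>\<tau>. s (x + \<tau> *\<^sub>R h)) has_derivative (\<lambda>\<tau>. D x \<bullet> (\<tau> *\<^sub>R h))) (at 0)"
        by (rule has_derivative_compose[of "\<lambda>\<tau>. x + \<tau> *\<^sub>R h" "\<lambda>\<tau>. \<tau> *\<^sub>R h"])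
          (use elim in \<open>auto intro!: derivative_eq_intros\<close>)
      then have "((\<lambda>\<tau>. s (x + \<tau> *\<^sub>R h)) has_real_derivative (D x \<bullet> h)) (at 0)"
        unfolding has_field_derivative_def by (rule has_derivative_eq_rhs) (simp add: fun_eq_iff)
      then have lim: "((\<lambda>\<tau>. (s (x + \<tau> *\<^sub>R h) - s x) / \<tau>) \<longlongrightarrow> D x \<bullet> h) (at 0)"
        by (simp add: DERIV_def)
      have "filterlim t (at 0) sequentially"
        using t0 t(1) by (intro filterlim_atI) (auto simp: less_imp_neq[symmetric])
      from filterlim_compose[OF lim this] show ?case by (simp add: f_def)
    qed
    show "AE x in lborel. norm (f n x) \<le> \<bar>L\<bar> * norm h * indicator (cball 0 (R + norm h)) x" for n
    proof (rule AE_I2)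
      fix x :: 'a
      show "norm (f n x) \<le> \<bar>L\<bar> * norm h * indicator (cball 0 (R + norm h)) x"
      proof (cases "norm x \<le> R + norm h")
        case True
        have "\<bar>s (x + t n *\<^sub>R h) - s x\<bar> \<le> L * (t n * norm h)"
          using s1(1)[of "x + t n *\<^sub>R h" x] t(1)[of n] by simp
        also have "\<dots> \<le> \<bar>L\<bar> * (t n * norm h)" using t(1)[of n] by (intro mult_right_mono) auto
        finally show ?thesis using True t(1)[of n] by (simp add: f_def abs_divide divide_le_eq mult_ac)
      next
        case False
        have "norm (t n *\<^sub>R h) \<le> norm h" using t[of n] by (simp add: mult_left_le_one_le)
        then have "R \<le> norm (x + t n *\<^sub>R h)" using False norm_diff_ineq[of x "t n *\<^sub>R h"] by linarith
        moreover have "R \<le> norm x" using False norm_ge_zero[of h] by linarith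
        ultimately show ?thesis using s1(3) by (simp add: f_def)
      qed
    qed
  qed
  then show ?thesis by (simp add: z LIMSEQ_const_iff)
qed

lemma H1_pair_test:
  assumes "\<phi> \<in> test_functions" shows "H1_pair \<phi> (grad \<phi>)"
proof (rule H1_pair_I[OF test_L2[OF assms] grad_L2[OF assms]])
  fix \<psi> :: "'a \<Rightarrow> real" and i :: 'a assume \<psi>: "\<psi> \<in> test_functions" and i: "i \<in> Basis"
  have "0 = (\<integral>x. grad (\<lambda>x. \<phi> x * \<psi> x) x \<bullet> i \<partial>lborel)"
    by (rule lip_deriv_integral_zero[symmetric, OF lip_deriv_test[OF test_mult[OF assms \<psi>]]])
  also have "\<dots> = (\<integral>x. \<phi> x * pd \<psi> i x + (grad \<phi> x \<bullet> i) * \<psi> x \<partial>lborel)"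
    using i by (simp add: grad_inner_Basis pd_mult[OF assms \<psi>])
  also have "\<dots> = (\<integral>x. \<phi> x * pd \<psi> i x \<partial>lborel) + (\<integral>x. (grad \<phi> x \<bullet> i) * \<psi> x \<partial>lborel)"
    using L2_mult_integrable[OF test_L2[OF assms] test_L2[OF test_pd[OF \<psi> i]]]
      L2_mult_integrable[OF L2_inner_Basis[OF grad_L2[OF assms]] test_L2[OF \<psi>]] by simp
  finally show "(\<integral>x. \<phi> x * pd \<psi> i x \<partial>lborel) = - (\<integral>x. (grad \<phi> x \<bullet> i) * \<psi> x \<partial>lborel)" by linarith
qed

section \<open>Density of test functions\<close>

lemma L2_cutoff_tendsto:
  fixes f :: "'a::euclidean_space \<Rightarrow> 'b::euclidean_space"
  assumes f: "f \<in> L2" and m: "\<And>n. m n \<in> borel_measurable borel" "\<And>n x. \<bar>m n x\<bar> \<le> M"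
    "\<And>x. (\<lambda>n. m n x) \<longlonglongrightarrow> 1"
  shows "(\<lambda>n. l2 (\<lambda>x. m n x *\<^sub>R f x - f x)) \<longlonglongrightarrow> 0"
proof -
  have [measurable]: "f \<in> borel_measurable borel" by (rule L2_borel[OF f])
  have "(\<lambda>n. \<integral>x. (norm (m n x *\<^sub>R f x - f x))\<^sup>2 \<partial>lborel) \<longlonglongrightarrow> (\<integral>x. 0 \<partial>(lborel :: 'a measure))"
  proof (rule integral_dominated_convergence)
    show "integrable lborel (\<lambda>x. (M + 1)\<^sup>2 * (norm (f x))\<^sup>2)"
      by (intro integrable_mult_right L2_integrable f)
    show "AE x in lborel. (\<lambda>n. (norm (m n x *\<^sub>R f x - f x))\<^sup>2) \<longlonglongrightarrow> 0"
    proof (rule AE_I2)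
      fix x
      have "(\<lambda>n. (norm (m n x *\<^sub>R f x - f x))\<^sup>2) \<longlonglongrightarrow> (norm (1 *\<^sub>R f x - f x))\<^sup>2"
        by (intro tendsto_intros m)
      then show "(\<lambda>n. (norm (m n x *\<^sub>R f x - f x))\<^sup>2) \<longlonglongrightarrow> 0" by simp
    qed
    show "AE x in lborel. norm ((norm (m n x *\<^sub>R f x - f x))\<^sup>2) \<le> (M + 1)\<^sup>2 * (norm (f x))\<^sup>2" for n
    proof (rule AE_I2)
      fix x
      have "m n x *\<^sub>R f x - f x = (m n x - 1) *\<^sub>R f x" by (simp add: algebra_simps)
      then have "norm (m n x *\<^sub>R f x - f x) = \<bar>m n x - 1\<bar> * norm (f x)" by simp
      also have "\<dots> \<le> (M + 1) * norm (f x)" using m(2)[of n x] by (intro mult_right_mono) auto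
      finally have "(norm (m n x *\<^sub>R f x - f x))\<^sup>2 \<le> ((M + 1) * norm (f x))\<^sup>2" by (rule power_mono) simp
      then show "norm ((norm (m n x *\<^sub>R f x - f x))\<^sup>2) \<le> (M + 1)\<^sup>2 * (norm (f x))\<^sup>2"
        by (simp add: power_mult_distrib)
    qed
  qed (use m(1) in auto)
  from tendsto_real_sqrt[OF this] show ?thesis by (simp add: l2_def)
qed

text \<open>The smooth case is proved straight from the definition, since the density theorem cuts
  off with it. The Lipschitz version \<open>H1_pair_mult_lip\<close> rests on density in
  turn.\<close>

lemma H1_pair_mult_test:
  assumes p: "H1_pair u G" and \<zeta>: "\<zeta> \<in> test_functions"
  shows "H1_pair (\<lambda>x. \<zeta> x * u x) (\<lambda>x. \<zeta> x *\<^sub>R G x + u x *\<^sub>R grad \<zeta> x)"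
proof (rule H1_pair_I)
  note L = H1_pair_L2[OF p]
  obtain M where M: "M > 0" "\<And>x. \<bar>\<zeta> x\<bar> \<le> M" using test_bounded[OF \<zeta>] by blast
  obtain N where N: "N > 0" "\<And>x. norm (grad \<zeta> x) \<le> N" using grad_bounded[OF \<zeta>] by blast
  note mb = test_borel[OF \<zeta>]
  show Lu: "(\<lambda>x. \<zeta> x * u x) \<in> L2" by (rule L2_bounded_mult(1)[OF L(1) mb M(2)])
  have L1: "(\<lambda>x. \<zeta> x *\<^sub>R G x) \<in> L2" by (rule L2_bounded_scaleR(1)[OF L(2) mb M(2)])
  have L2': "(\<lambda>x. u x *\<^sub>R grad \<zeta> x) \<in> L2"
  proof (rule L2_dominated(1)[OF L2_scaleR[OF L(1), of N]])
    show "(\<lambda>x. u x *\<^sub>R grad \<zeta> x) \<in> borel_measurable borel" using L2_borel[OF L(1)] grad_borel[OF \<zeta>] by simp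
    fix x show "norm (u x *\<^sub>R grad \<zeta> x) \<le> norm (N *\<^sub>R u x)"
      using mult_left_mono[OF N(2)[of x], of "\<bar>u x\<bar>"] N(1) by (simp add: abs_mult mult.commute)
  qed
  show "(\<lambda>x. \<zeta> x *\<^sub>R G x + u x *\<^sub>R grad \<zeta> x) \<in> L2" by (rule L2_add[OF L1 L2'])
  fix \<phi> :: "'a \<Rightarrow> real" and i :: 'a assume \<phi>: "\<phi> \<in> test_functions" and i: "i \<in> Basis"
  note T = test_L2[OF \<phi>] test_L2[OF test_pd[OF \<phi> i]]
  have c: "(\<lambda>x. \<zeta> x * \<phi> x) \<in> test_functions" by (rule test_mult[OF \<zeta> \<phi>])
  have i1: "integrable lborel (\<lambda>x. u x * (\<zeta> x * pd \<phi> i x))"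
    by (rule L2_mult_integrable[OF L(1) test_L2[OF test_mult[OF \<zeta> test_pd[OF \<phi> i]]]])
  have i2: "integrable lborel (\<lambda>x. u x * (pd \<zeta> i x * \<phi> x))"
    by (rule L2_mult_integrable[OF L(1) test_L2[OF test_mult[OF test_pd[OF \<zeta> i] \<phi>]]])
  have i3: "integrable lborel (\<lambda>x. (G x \<bullet> i) * (\<zeta> x * \<phi> x))"
    by (rule L2_mult_integrable[OF L2_inner_Basis[OF L(2)] test_L2[OF c]])
  have "(\<integral>x. u x * (\<zeta> x * pd \<phi> i x) \<partial>lborel) + (\<integral>x. u x * (pd \<zeta> i x * \<phi> x) \<partial>lborel)
      = (\<integral>x. u x * pd (\<lambda>x. \<zeta> x * \<phi> x) i x \<partial>lborel)"
    using i1 i2 by (simp add: pd_mult[OF \<zeta> \<phi>] distrib_left)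
  also have "\<dots> = - (\<integral>x. (G x \<bullet> i) * (\<zeta> x * \<phi> x) \<partial>lborel)" by (rule H1_pair_eq[OF p c i])
  finally have "(\<integral>x. u x * (\<zeta> x * pd \<phi> i x) \<partial>lborel)
      = - ((\<integral>x. (G x \<bullet> i) * (\<zeta> x * \<phi> x) \<partial>lborel) + (\<integral>x. u x * (pd \<zeta> i x * \<phi> x) \<partial>lborel))" by linarith
  also have "(\<integral>x. (G x \<bullet> i) * (\<zeta> x * \<phi> x) \<partial>lborel) + (\<integral>x. u x * (pd \<zeta> i x * \<phi> x) \<partial>lborel)
      = (\<integral>x. (G x \<bullet> i) * (\<zeta> x * \<phi> x) + u x * (pd \<zeta> i x * \<phi> x) \<partial>lborel)"
    using i2 i3 by simp
  also have "\<dots> = (\<integral>x. ((\<zeta> x *\<^sub>R G x + u x *\<^sub>R grad \<zeta> x) \<bullet> i) * \<phi> x \<partial>lborel)"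
    using i by (intro Bochner_Integration.integral_cong) (simp_all add: inner_add_left grad_inner_Basis algebra_simps)
  finally show "(\<integral>x. (\<zeta> x * u x) * pd \<phi> i x \<partial>lborel) = - (\<integral>x. ((\<zeta> x *\<^sub>R G x + u x *\<^sub>R grad \<zeta> x) \<bullet> i) * \<phi> x \<partial>lborel)"
    by (simp only: mult.assoc mult.left_commute)
qed

text \<open>Mollification commutes with weak differentiation: the translated kernel is itself an
  admissible test function. The gradient of \<open>conv \<rho> u\<close> therefore consists of
  mollified components of \<open>G\<close>, to which \<open>conv_approx\<close> applies
  separately.\<close>

lemma H1_density_bounded_support:
  fixes u :: "'a::euclidean_space \<Rightarrow> real"
  assumes p: "H1_pair u G" and R: "\<And>x. R \<le> norm x \<Longrightarrow> u x = 0" and e: "e > 0"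
  shows "\<exists>\<phi>\<in>test_functions. l2 (\<lambda>x. \<phi> x - u x) \<le> e \<and> l2 (\<lambda>x. grad \<phi> x - G x) \<le> e"
proof -
  note L = H1_pair_L2[OF p]
  \<comment> \<open>Each component of the gradient is allowed this share; the norm of a vector field
    is at most the sum over its components.\<close>
  define \<eta> where "\<eta> = e / real DIM('a)"
  have \<eta>: "\<eta> > 0" using e by (simp add: \<eta>_def)
  obtain \<delta>0 where \<delta>0: "\<delta>0 > 0" "\<forall>h. norm h < \<delta>0 \<longrightarrow> l2 (\<lambda>x. u (x + h) - u x) < e"
    using L2_translation_continuous[OF L(1) e] by (elim exE conjE)
  have "\<forall>i\<in>Basis. \<exists>\<delta>>0. \<forall>h. norm h < \<delta> \<longrightarrow> l2 (\<lambda>x. (G (x + h) \<bullet> i) - (G x \<bullet> i)) < \<eta>"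
    using L2_translation_continuous[OF L2_inner_Basis[OF L(2)] \<eta>] by blast
  from bchoice[OF this] obtain d where d: "\<forall>i\<in>Basis. d i > 0 \<and>
      (\<forall>h. norm h < d i \<longrightarrow> l2 (\<lambda>x. (G (x + h) \<bullet> i) - (G x \<bullet> i)) < \<eta>)" by (elim exE)
  define \<delta> where "\<delta> = min \<delta>0 (Min (d ` Basis))"
  have \<delta>: "\<delta> > 0" "\<delta> \<le> \<delta>0" "\<And>i. i \<in> Basis \<Longrightarrow> \<delta> \<le> d i"
    using \<delta>0(1) d by (auto simp: \<delta>_def min_le_iff_disj)
  obtain \<rho> :: "'a \<Rightarrow> real" where \<rho>: "\<rho> \<in> test_functions" "\<And>x. \<rho> x \<ge> 0" "(\<integral>x. \<rho> x \<partial>lborel) = 1"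
    "\<And>x. \<delta> \<le> norm x \<Longrightarrow> \<rho> x = 0"
    using ex_mollifier[OF \<delta>(1)] by blast
  have iu: "integrable lborel u"
  proof -
    have "integrable lborel (\<lambda>x. indicator (cball 0 R) x * u x)"
    proof (rule L2_mult_integrable[OF _ L(1)])
      show "(indicator (cball 0 R) :: 'a \<Rightarrow> real) \<in> L2"
      proof (rule L2_I)
        have "(norm (indicator (cball 0 R) x :: real))\<^sup>2 = indicator (cball 0 R) x" for x :: 'a
          by (simp add: indicator_def)
        then show "integrable lborel (\<lambda>x :: 'a. (norm (indicator (cball 0 R) x :: real))\<^sup>2)"
          by (simp add: emeasure_lborel_cball_finite[unfolded infinity_ennreal_def])
      qed (rule borel_measurable_indicator, simp)
    qed
    moreover have "(\<lambda>x. indicator (cball 0 R) x * u x) = u"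
    proof
      fix x show "indicator (cball 0 R) x * u x = u x" using R[of x] by (cases "norm x \<le> R") auto
    qed
    ultimately show ?thesis by simp
  qed
  have \<phi>: "conv \<rho> u \<in> test_functions" by (rule conv_test[OF \<rho>(1) iu R])
  have 1: "l2 (\<lambda>x. conv \<rho> u x - u x) \<le> e"
    using \<delta>0(2) \<delta>(2) e by (intro conv_approx(2)[OF L(1) \<rho>]) (auto intro: less_imp_le)
  have gi: "grad (conv \<rho> u) x \<bullet> i = conv \<rho> (\<lambda>x. G x \<bullet> i) x" if i: "i \<in> Basis" for i x
  proof -
    have "grad (conv \<rho> u) x \<bullet> i = - conv (pd \<rho> i) u x"
      using pd_conv[OF \<rho>(1) iu i] i by (simp add: grad_inner_Basis)
    also have "\<dots> = - (\<integral>y. u y * pd (\<lambda>y. \<rho> (y - x)) i y \<partial>lborel)"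
      by (simp add: conv_def pd_shift[OF \<rho>(1)] mult.commute)
    also have "\<dots> = (\<integral>y. (G y \<bullet> i) * \<rho> (y - x) \<partial>lborel)"
      using H1_pair_eq[OF p shift_test[OF \<rho>(1), of x] i] by simp
    finally show ?thesis by (simp add: conv_def mult.commute)
  qed
  have Li: "(\<lambda>x. conv \<rho> (\<lambda>x. G x \<bullet> i) x - G x \<bullet> i) \<in> L2"
      "l2 (\<lambda>x. conv \<rho> (\<lambda>x. G x \<bullet> i) x - G x \<bullet> i) \<le> \<eta>" if i: "i \<in> Basis" for i
  proof -
    have "\<And>h. norm h < \<delta> \<Longrightarrow> l2 (\<lambda>x. (G (x + h) \<bullet> i) - (G x \<bullet> i)) \<le> \<eta>"
      using d \<delta>(3)[OF i] i by (auto intro: less_imp_le)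
    then show "(\<lambda>x. conv \<rho> (\<lambda>x. G x \<bullet> i) x - G x \<bullet> i) \<in> L2"
      "l2 (\<lambda>x. conv \<rho> (\<lambda>x. G x \<bullet> i) x - G x \<bullet> i) \<le> \<eta>"
      using conv_approx[OF L2_inner_Basis[OF L(2)] \<rho> less_imp_le[OF \<eta>]] by blast+
  qed
  have "grad (conv \<rho> u) x - G x = (\<Sum>i\<in>Basis. (conv \<rho> (\<lambda>x. G x \<bullet> i) x - G x \<bullet> i) *\<^sub>R i)" for x
  proof -
    have "grad (conv \<rho> u) x - G x = (\<Sum>i\<in>Basis. ((grad (conv \<rho> u) x - G x) \<bullet> i) *\<^sub>R i)"
      by (rule euclidean_representation[symmetric])
    then show ?thesis by (simp add: inner_diff_left gi)
  qed
  then have "l2 (\<lambda>x. grad (conv \<rho> u) x - G x)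
      = l2 (\<lambda>x. \<Sum>i\<in>Basis. (conv \<rho> (\<lambda>x. G x \<bullet> i) x - G x \<bullet> i) *\<^sub>R i)" by simp
  also have "\<dots> \<le> (\<Sum>i\<in>Basis. l2 (\<lambda>x. (conv \<rho> (\<lambda>x. G x \<bullet> i) x - G x \<bullet> i) *\<^sub>R i))"
  proof (rule l2_sum_le)
    fix i :: 'a assume i: "i \<in> Basis"
    show "(\<lambda>x. (conv \<rho> (\<lambda>x. G x \<bullet> i) x - G x \<bullet> i) *\<^sub>R i) \<in> L2"
      by (rule L2_dominated(1)[OF Li(1)[OF i]]) (use L2_borel[OF Li(1)[OF i]] i in auto)
  qed simp
  also have "\<dots> \<le> (\<Sum>i\<in>(Basis::'a set). \<eta>)"
    using Li(2) by (intro sum_mono) (simp add: l2_def)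
  also have "\<dots> = e" by (simp add: \<eta>_def)
  finally show ?thesis using \<phi> 1 by blast
qed

text \<open>Cut off at radius n + 1, where the gradient of the cutoff is only of order 1/(n + 1),
  and mollify with error 1/(n + 1).\<close>

theorem H1_density:
  fixes u :: "'a::euclidean_space \<Rightarrow> real"
  assumes p: "H1_pair u G"
  obtains \<phi> where "\<And>n. \<phi> n \<in> test_functions" "(\<lambda>n. l2 (\<lambda>x. \<phi> n x - u x)) \<longlonglongrightarrow> 0"
    "(\<lambda>n. l2 (\<lambda>x. grad (\<phi> n) x - G x)) \<longlonglongrightarrow> 0"
proof -
  note L = H1_pair_L2[OF p]
  obtain \<beta> :: "'a \<Rightarrow> real" where \<beta>: "\<beta> \<in> test_functions"
    "\<And>x. \<beta> x \<ge> 0" "\<beta> 0 = 1" "\<And>x. norm x \<ge> 1 \<Longrightarrow> \<beta> x = 0" using ex_bump by blast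
  obtain M where M: "M > 0" "\<And>x. \<bar>\<beta> x\<bar> \<le> M" using test_bounded[OF \<beta>(1)] by blast
  obtain N where N: "N > 0" "\<And>x. norm (grad \<beta> x) \<le> N" using grad_bounded[OF \<beta>(1)] by blast
  define t where "t n = 1 / real (Suc n)" for n
  have t: "t n > 0" for n by (simp add: t_def)
  have t0: "t \<longlonglongrightarrow> 0" unfolding t_def[abs_def] by (rule LIMSEQ_Suc[OF lim_1_over_n])
  define \<zeta> where "\<zeta> n x = \<beta> (t n *\<^sub>R x + 0)" for n x
  have \<zeta>: "\<zeta> n \<in> test_functions" for n
    unfolding \<zeta>_def[abs_def] using t[of n] by (intro test_affine \<beta>) auto
  have \<zeta>M: "\<bar>\<zeta> n x\<bar> \<le> M" for n x by (simp add: \<zeta>_def M)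
  have \<zeta>1: "(\<lambda>n. \<zeta> n x) \<longlonglongrightarrow> 1" for x
  proof -
    have "isCont \<beta> 0" using test_continuous[OF \<beta>(1), of UNIV] by (simp add: continuous_on_eq_continuous_at)
    moreover have "(\<lambda>n. t n *\<^sub>R x + 0) \<longlonglongrightarrow> 0 *\<^sub>R x + 0" by (intro tendsto_intros t0)
    ultimately show ?thesis using isCont_tendsto_compose[of 0 \<beta> "\<lambda>n. t n *\<^sub>R x + 0" sequentially] \<beta>(3)
      by (simp add: \<zeta>_def)
  qed
  have g\<zeta>: "norm (grad (\<zeta> n) x) \<le> t n * N" for n x
  proof -
    have "grad (\<zeta> n) x = t n *\<^sub>R grad \<beta> (t n *\<^sub>R x + 0)"
      unfolding grad_def \<zeta>_def[abs_def] pd_affine[OF \<beta>(1)] by (simp add: scaleR_sum_right)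
    then show ?thesis using N(2)[of "t n *\<^sub>R x + 0"] t[of n] by (simp add: mult_left_mono)
  qed
  define v where "v n x = \<zeta> n x * u x" for n x
  define H where "H n x = \<zeta> n x *\<^sub>R G x + u x *\<^sub>R grad (\<zeta> n) x" for n x
  have pv: "H1_pair (v n) (H n)" for n
    unfolding v_def[abs_def] H_def[abs_def] by (rule H1_pair_mult_test[OF p \<zeta>])
  have "\<exists>\<phi>\<in>test_functions. l2 (\<lambda>x. \<phi> x - v n x) \<le> t n \<and> l2 (\<lambda>x. grad \<phi> x - H n x) \<le> t n" for n
  proof (rule H1_density_bounded_support[OF pv _ t])
    fix x :: 'a assume "real (Suc n) \<le> norm x"
    then have "1 \<le> norm (t n *\<^sub>R x + 0)" by (simp add: t_def)
    then show "v n x = 0" using \<beta>(4) by (simp add: v_def \<zeta>_def)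
  qed
  then have "\<forall>n. \<exists>\<phi>. \<phi> \<in> test_functions \<and> l2 (\<lambda>x. \<phi> x - v n x) \<le> t n \<and> l2 (\<lambda>x. grad \<phi> x - H n x) \<le> t n"
    unfolding Bex_def by (rule allI)
  from choice[OF this] obtain \<phi> where \<phi>: "\<forall>n. \<phi> n \<in> test_functions \<and> l2 (\<lambda>x. \<phi> n x - v n x) \<le> t n \<and> l2 (\<lambda>x. grad (\<phi> n) x - H n x) \<le> t n"
    by (elim exE)
  have \<phi>T: "\<phi> n \<in> test_functions" for n using \<phi> by simp
  have Lv: "v n \<in> L2" "H n \<in> L2" for n using H1_pair_L2[OF pv] by auto
  show ?thesis
  proof (rule that[OF \<phi>T])
    have lim: "(\<lambda>n. l2 (\<lambda>x. \<zeta> n x *\<^sub>R u x - u x)) \<longlonglongrightarrow> 0"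
      by (rule L2_cutoff_tendsto[OF L(1) test_borel[OF \<zeta>] \<zeta>M \<zeta>1])
    have "(\<lambda>n. t n + l2 (\<lambda>x. \<zeta> n x *\<^sub>R u x - u x)) \<longlonglongrightarrow> 0 + 0" by (intro tendsto_add t0 lim)
    then have lim': "(\<lambda>n. t n + l2 (\<lambda>x. \<zeta> n x *\<^sub>R u x - u x)) \<longlonglongrightarrow> 0" by simp
    have "norm (l2 (\<lambda>x. \<phi> n x - u x)) \<le> t n + l2 (\<lambda>x. \<zeta> n x *\<^sub>R u x - u x)" for n
      using l2_triangle[OF test_L2[OF \<phi>T] Lv(1) L(1), of n n] \<phi>[rule_format, of n] l2_nonneg[of "\<lambda>x. \<phi> n x - u x"]
      by (simp add: v_def)
    from Lim_null_comparison[OF always_eventually[OF allI[OF this]] lim']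
    show "(\<lambda>n. l2 (\<lambda>x. \<phi> n x - u x)) \<longlonglongrightarrow> 0" .
  next
    have lim: "(\<lambda>n. l2 (\<lambda>x. \<zeta> n x *\<^sub>R G x - G x)) \<longlonglongrightarrow> 0"
      by (rule L2_cutoff_tendsto[OF L(2) test_borel[OF \<zeta>] \<zeta>M \<zeta>1])
    have "(\<lambda>n. t n + (l2 (\<lambda>x. \<zeta> n x *\<^sub>R G x - G x) + (t n * N) * l2 u)) \<longlonglongrightarrow> 0 + (0 + (0 * N) * l2 u)"
      by (intro tendsto_intros t0 lim)
    then have lim': "(\<lambda>n. t n + (l2 (\<lambda>x. \<zeta> n x *\<^sub>R G x - G x) + (t n * N) * l2 u)) \<longlonglongrightarrow> 0" by simp
    have "norm (l2 (\<lambda>x. grad (\<phi> n) x - G x)) \<le> t n + (l2 (\<lambda>x. \<zeta> n x *\<^sub>R G x - G x) + (t n * N) * l2 u)" for n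
    proof -
      have G1: "(\<lambda>x. \<zeta> n x *\<^sub>R G x) \<in> L2" by (rule L2_bounded_scaleR(1)[OF L(2) test_borel[OF \<zeta>] \<zeta>M])
      have bb: "(\<lambda>x. u x *\<^sub>R grad (\<zeta> n) x) \<in> borel_measurable borel"
        using L2_borel[OF L(1)] grad_borel[OF \<zeta>] by simp
      have le: "norm (u x *\<^sub>R grad (\<zeta> n) x) \<le> norm ((t n * N) *\<^sub>R u x)" for x
        using mult_left_mono[OF g\<zeta>[of n x], of "\<bar>u x\<bar>"] N(1) t[of n] by (simp add: abs_mult mult.commute)
      have G2: "(\<lambda>x. u x *\<^sub>R grad (\<zeta> n) x) \<in> L2" "l2 (\<lambda>x. u x *\<^sub>R grad (\<zeta> n) x) \<le> (t n * N) * l2 u"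
        using L2_dominated[OF L2_scaleR[OF L(1), of "t n * N"] bb le] N(1) t[of n]
        by (simp_all only: l2_scaleR abs_of_pos mult_pos_pos)
      have "l2 (\<lambda>x. H n x - G x) = l2 (\<lambda>x. (\<zeta> n x *\<^sub>R G x - G x) + u x *\<^sub>R grad (\<zeta> n) x)"
        by (simp add: H_def algebra_simps)
      also have "\<dots> \<le> l2 (\<lambda>x. \<zeta> n x *\<^sub>R G x - G x) + (t n * N) * l2 u"
        using l2_add_le[OF L2_diff[OF G1 L(2)] G2(1)] G2(2) by linarith
      finally show ?thesis
        using l2_triangle[OF grad_L2[OF \<phi>T] Lv(2) L(2), of n n] \<phi>[rule_format, of n] l2_nonneg[of "\<lambda>x. grad (\<phi> n) x - G x"]
        by simp
    qed
    from Lim_null_comparison[OF always_eventually[OF allI[OF this]] lim']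
    show "(\<lambda>n. l2 (\<lambda>x. grad (\<phi> n) x - G x)) \<longlonglongrightarrow> 0" .
  qed
qed

section \<open>Integration by parts and translation estimates\<close>

lemma test_integration_by_parts:
  assumes s: "lip_deriv s D" and u: "u \<in> test_functions" and v: "v \<in> test_functions" and i: "i \<in> Basis"
  shows "(\<integral>x. (D x \<bullet> i) * (u x * v x) \<partial>lborel)
    = - ((\<integral>x. s x * (u x * (grad v x \<bullet> i)) \<partial>lborel) + (\<integral>x. s x * ((grad u x \<bullet> i) * v x) \<partial>lborel))"
proof -
  obtain M where M: "\<And>x. \<bar>s x\<bar> \<le> M" using lip_deriv_bounded[OF s] by blast
  obtain L R N where s1: "\<And>x y. \<bar>s x - s y\<bar> \<le> L * norm (x - y)" "R > 0" "\<And>x. R \<le> norm x \<Longrightarrow> s x = 0"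
    "\<And>x. norm (D x) \<le> N" using lip_derivE[OF s] by blast
  note sb = lip_deriv_borel[OF s] and Db = lip_deriv_borel_D[OF s]
  have DN: "\<bar>D x \<bullet> i\<bar> \<le> N" for x
    using Cauchy_Schwarz_ineq2[of "D x" i] s1(4)[of x] i by simp
  note gu = L2_inner_Basis[OF grad_L2[OF u], of i] and gv = L2_inner_Basis[OF grad_L2[OF v], of i]
  have i1: "integrable lborel (\<lambda>x. (D x \<bullet> i) * (u x * v x))"
    by (rule integrable_bounded_mult[OF L2_mult_integrable[OF test_L2[OF u] test_L2[OF v]] _ DN]) (use Db in simp)
  have i2: "integrable lborel (\<lambda>x. s x * (u x * (grad v x \<bullet> i)))"
    by (rule integrable_bounded_mult[OF L2_mult_integrable[OF test_L2[OF u] gv] sb M])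
  have i3: "integrable lborel (\<lambda>x. s x * ((grad u x \<bullet> i) * v x))"
    by (rule integrable_bounded_mult[OF L2_mult_integrable[OF gu test_L2[OF v]] sb M])
  have "0 = (\<integral>x. (s x *\<^sub>R grad (\<lambda>x. u x * v x) x + (u x * v x) *\<^sub>R D x) \<bullet> i \<partial>lborel)"
    by (rule lip_deriv_integral_zero[symmetric, OF lip_deriv_mult[OF s lip_deriv_test[OF test_mult[OF u v]]]])
  also have "\<dots> = (\<integral>x. s x * (u x * (grad v x \<bullet> i)) + s x * ((grad u x \<bullet> i) * v x) + (D x \<bullet> i) * (u x * v x) \<partial>lborel)"
    using i by (intro Bochner_Integration.integral_cong refl)
      (simp add: inner_add_left grad_inner_Basis pd_mult[OF u v] algebra_simps)
  also have "\<dots> = (\<integral>x. s x * (u x * (grad v x \<bullet> i)) \<partial>lborel) + (\<integral>x. s x * ((grad u x \<bullet> i) * v x) \<partial>lborel)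
      + (\<integral>x. (D x \<bullet> i) * (u x * v x) \<partial>lborel)"
    using i1 i2 i3 by simp
  finally show ?thesis by linarith
qed

lemma l2_inner_Basis_tendsto:
  fixes G :: "nat \<Rightarrow> 'a::euclidean_space \<Rightarrow> 'b::euclidean_space"
  assumes G: "\<And>n. G n \<in> L2" "G' \<in> L2" "(\<lambda>n. l2 (\<lambda>x. G n x - G' x)) \<longlonglongrightarrow> 0" and i: "i \<in> Basis"
  shows "(\<lambda>n. l2 (\<lambda>x. G n x \<bullet> i - G' x \<bullet> i)) \<longlonglongrightarrow> 0"
proof -
  have "norm (l2 (\<lambda>x. G n x \<bullet> i - G' x \<bullet> i)) \<le> l2 (\<lambda>x. G n x - G' x)" for n
  proof -
    have "l2 (\<lambda>x. (G n x - G' x) \<bullet> i) \<le> l2 (\<lambda>x. G n x - G' x)"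
    proof (rule L2_dominated(2)[OF L2_diff[OF G(1,2)]])
      show "(\<lambda>x. (G n x - G' x) \<bullet> i) \<in> borel_measurable borel" using L2_borel[OF L2_diff[OF G(1,2), of n]] by simp
      show "norm ((G n x - G' x) \<bullet> i) \<le> norm (G n x - G' x)" for x
        using Basis_le_norm[OF i, of "G n x - G' x"] by simp
    qed
    then show ?thesis by (simp add: inner_diff_left l2_nonneg)
  qed
  from Lim_null_comparison[OF always_eventually[OF allI[OF this]] G(3)] show ?thesis .
qed

text \<open>Follows from test functions by density in both factors. It is stated for a product so
  that one identity serves squares, as in the Poincare inequality, and products of a solution with a
  test function.\<close>

theorem H1_integration_by_parts:
  assumes s: "lip_deriv s D" and u: "H1_pair u G" and v: "H1_pair v H" and i: "i \<in> Basis"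
  shows "(\<integral>x. (D x \<bullet> i) * (u x * v x) \<partial>lborel)
    = - ((\<integral>x. s x * (u x * (H x \<bullet> i)) \<partial>lborel) + (\<integral>x. s x * ((G x \<bullet> i) * v x) \<partial>lborel))"
proof -
  obtain M where M: "\<And>x. \<bar>s x\<bar> \<le> M" using lip_deriv_bounded[OF s] by blast
  obtain L R N where s1: "\<And>x y. \<bar>s x - s y\<bar> \<le> L * norm (x - y)" "R > 0" "\<And>x. R \<le> norm x \<Longrightarrow> s x = 0"
    "\<And>x. norm (D x) \<le> N" using lip_derivE[OF s] by blast
  have sb: "s \<in> borel_measurable borel" by (rule lip_deriv_borel[OF s])
  have Db: "(\<lambda>x. D x \<bullet> i) \<in> borel_measurable borel" using lip_deriv_borel_D[OF s] by simp
  have DN: "\<bar>D x \<bullet> i\<bar> \<le> N" for x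
    using Cauchy_Schwarz_ineq2[of "D x" i] s1(4)[of x] i by simp
  obtain \<phi> where \<phi>: "\<And>n. \<phi> n \<in> test_functions" "(\<lambda>n. l2 (\<lambda>x. \<phi> n x - u x)) \<longlonglongrightarrow> 0"
    "(\<lambda>n. l2 (\<lambda>x. grad (\<phi> n) x - G x)) \<longlonglongrightarrow> 0" using H1_density[OF u] by blast
  obtain \<psi> where \<psi>: "\<And>n. \<psi> n \<in> test_functions" "(\<lambda>n. l2 (\<lambda>x. \<psi> n x - v x)) \<longlonglongrightarrow> 0"
    "(\<lambda>n. l2 (\<lambda>x. grad (\<psi> n) x - H x)) \<longlonglongrightarrow> 0" using H1_density[OF v] by blast
  note Lu = H1_pair_L2[OF u] and Lv = H1_pair_L2[OF v]
  have fu: "\<phi> n \<in> L2" "grad (\<phi> n) \<in> L2" "\<psi> n \<in> L2" "grad (\<psi> n) \<in> L2" for n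
    using \<phi>(1) \<psi>(1) by (auto intro: test_L2 grad_L2)
  have gu: "(\<lambda>n. l2 (\<lambda>x. grad (\<phi> n) x \<bullet> i - G x \<bullet> i)) \<longlonglongrightarrow> 0"
    by (rule l2_inner_Basis_tendsto[OF fu(2) Lu(2) \<phi>(3) i])
  have gv: "(\<lambda>n. l2 (\<lambda>x. grad (\<psi> n) x \<bullet> i - H x \<bullet> i)) \<longlonglongrightarrow> 0"
    by (rule l2_inner_Basis_tendsto[OF fu(4) Lv(2) \<psi>(3) i])
  have 1: "(\<lambda>n. \<integral>x. (D x \<bullet> i) * (\<phi> n x * \<psi> n x) \<partial>lborel) \<longlonglongrightarrow> (\<integral>x. (D x \<bullet> i) * (u x * v x) \<partial>lborel)"
    using L2_trilinear_tendsto[OF fu(1) Lu(1) \<phi>(2) fu(3) Lv(1) \<psi>(2) Db DN] by simp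
  have 2: "(\<lambda>n. \<integral>x. s x * (\<phi> n x * (grad (\<psi> n) x \<bullet> i)) \<partial>lborel) \<longlonglongrightarrow> (\<integral>x. s x * (u x * (H x \<bullet> i)) \<partial>lborel)"
    using L2_trilinear_tendsto[OF fu(1) Lu(1) \<phi>(2) L2_inner_Basis[OF fu(4)] L2_inner_Basis[OF Lv(2)] gv sb M] by simp
  have 3: "(\<lambda>n. \<integral>x. s x * ((grad (\<phi> n) x \<bullet> i) * \<psi> n x) \<partial>lborel) \<longlonglongrightarrow> (\<integral>x. s x * ((G x \<bullet> i) * v x) \<partial>lborel)"
    using L2_trilinear_tendsto[OF L2_inner_Basis[OF fu(2)] L2_inner_Basis[OF Lu(2)] gu fu(3) Lv(1) \<psi>(2) sb M] by simp
  have "(\<lambda>n. \<integral>x. (D x \<bullet> i) * (\<phi> n x * \<psi> n x) \<partial>lborel)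
      \<longlonglongrightarrow> - ((\<integral>x. s x * (u x * (H x \<bullet> i)) \<partial>lborel) + (\<integral>x. s x * ((G x \<bullet> i) * v x) \<partial>lborel))"
    unfolding test_integration_by_parts[OF s \<phi>(1) \<psi>(1) i] by (intro tendsto_minus tendsto_add 2 3)
  from LIMSEQ_unique[OF 1 this] show ?thesis .
qed

lemma H1_pair_mult_lip:
  assumes s: "lip_deriv s D" and u: "H1_pair u G"
  shows "H1_pair (\<lambda>x. s x * u x) (\<lambda>x. s x *\<^sub>R G x + u x *\<^sub>R D x)"
proof (rule H1_pair_I)
  note L = H1_pair_L2[OF u]
  obtain M where M: "\<And>x. \<bar>s x\<bar> \<le> M" using lip_deriv_bounded[OF s] by blast
  obtain Lp R N where s1: "\<And>x y. \<bar>s x - s y\<bar> \<le> Lp * norm (x - y)" "R > 0" "\<And>x. R \<le> norm x \<Longrightarrow> s x = 0"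
    "\<And>x. norm (D x) \<le> N" using lip_derivE[OF s] by blast
  have sb: "s \<in> borel_measurable borel" by (rule lip_deriv_borel[OF s])
  show "(\<lambda>x. s x * u x) \<in> L2" by (rule L2_bounded_mult(1)[OF L(1) sb M])
  have L1: "(\<lambda>x. s x *\<^sub>R G x) \<in> L2" by (rule L2_bounded_scaleR(1)[OF L(2) sb M])
  have N: "N \<ge> 0" using norm_ge_zero[of "D 0"] s1(4)[of 0] by linarith
  have L2': "(\<lambda>x. u x *\<^sub>R D x) \<in> L2"
  proof (rule L2_dominated(1)[OF L2_scaleR[OF L(1), of N]])
    show "(\<lambda>x. u x *\<^sub>R D x) \<in> borel_measurable borel" using L2_borel[OF L(1)] lip_deriv_borel_D[OF s] by simp
    fix x show "norm (u x *\<^sub>R D x) \<le> norm (N *\<^sub>R u x)"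
      using mult_left_mono[OF s1(4)[of x], of "\<bar>u x\<bar>"] N by (simp add: abs_mult mult.commute)
  qed
  show LS: "(\<lambda>x. s x *\<^sub>R G x + u x *\<^sub>R D x) \<in> L2" by (rule L2_add[OF L1 L2'])
  fix \<phi> :: "'a \<Rightarrow> real" and i :: 'a assume \<phi>: "\<phi> \<in> test_functions" and i: "i \<in> Basis"
  have i2: "integrable lborel (\<lambda>x. ((s x *\<^sub>R G x) \<bullet> i) * \<phi> x)"
    by (rule L2_mult_integrable[OF L2_inner_Basis[OF L1] test_L2[OF \<phi>]])
  have i3: "integrable lborel (\<lambda>x. ((u x *\<^sub>R D x) \<bullet> i) * \<phi> x)"
    by (rule L2_mult_integrable[OF L2_inner_Basis[OF L2'] test_L2[OF \<phi>]])
  have "(\<integral>x. s x * u x * pd \<phi> i x \<partial>lborel) = (\<integral>x. s x * (u x * (grad \<phi> x \<bullet> i)) \<partial>lborel)"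
    using i by (simp add: grad_inner_Basis mult.assoc)
  also have "\<dots> = - ((\<integral>x. (D x \<bullet> i) * (u x * \<phi> x) \<partial>lborel) + (\<integral>x. s x * ((G x \<bullet> i) * \<phi> x) \<partial>lborel))"
    using H1_integration_by_parts[OF s u H1_pair_test[OF \<phi>] i] by linarith
  also have "(\<integral>x. (D x \<bullet> i) * (u x * \<phi> x) \<partial>lborel) = (\<integral>x. ((u x *\<^sub>R D x) \<bullet> i) * \<phi> x \<partial>lborel)"
    by (simp add: mult_ac)
  also have "(\<integral>x. s x * ((G x \<bullet> i) * \<phi> x) \<partial>lborel) = (\<integral>x. ((s x *\<^sub>R G x) \<bullet> i) * \<phi> x \<partial>lborel)"
    by (simp add: mult_ac)
  also have "(\<integral>x. ((u x *\<^sub>R D x) \<bullet> i) * \<phi> x \<partial>lborel) + (\<integral>x. ((s x *\<^sub>R G x) \<bullet> i) * \<phi> x \<partial>lborel)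
      = (\<integral>x. ((u x *\<^sub>R D x) \<bullet> i) * \<phi> x + ((s x *\<^sub>R G x) \<bullet> i) * \<phi> x \<partial>lborel)"
    using i2 i3 by simp
  also have "\<dots> = (\<integral>x. ((s x *\<^sub>R G x + u x *\<^sub>R D x) \<bullet> i) * \<phi> x \<partial>lborel)"
    by (simp add: inner_add_left algebra_simps)
  finally show "(\<integral>x. s x * u x * pd \<phi> i x \<partial>lborel) = - (\<integral>x. ((s x *\<^sub>R G x + u x *\<^sub>R D x) \<bullet> i) * \<phi> x \<partial>lborel)" .
qed

section \<open>Translation estimates in H1\<close>

lemma l2_translation_multiple:
  assumes v: "v \<in> L2" shows "l2 (\<lambda>x. v (x + real n *\<^sub>R k) - v x) \<le> real n * l2 (\<lambda>x. v (x + k) - v x)"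
proof (induction n)
  case (Suc n)
  have a: "(\<lambda>x. v (x + k) - v x) \<in> L2" by (intro L2_diff L2_shift v)
  have "l2 (\<lambda>x. v (x + real (Suc n) *\<^sub>R k) - v x)
      \<le> l2 (\<lambda>x. v (x + real (Suc n) *\<^sub>R k) - v (x + real n *\<^sub>R k)) + l2 (\<lambda>x. v (x + real n *\<^sub>R k) - v x)"
    by (intro l2_triangle L2_shift v)
  also have "l2 (\<lambda>x. v (x + real (Suc n) *\<^sub>R k) - v (x + real n *\<^sub>R k)) = l2 (\<lambda>x. v (x + k) - v x)"
    using l2_shift[OF a, of "real n *\<^sub>R k"] by (simp add: algebra_simps)
  finally show ?case using Suc by (simp add: algebra_simps)
qed (simp add: l2_zero)

text \<open>The step \<open>h\<close> is divided into n + 1 equal steps, each contributing the same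
  by translation invariance. As n grows the bound becomes the norm of the directional derivative, so
  no vector-valued integral along the segment is needed.\<close>

lemma test_translation_estimate:
  fixes \<phi> :: "'a::euclidean_space \<Rightarrow> real"
  assumes \<phi>: "\<phi> \<in> test_functions"
  shows "l2 (\<lambda>x. \<phi> (x + h) - \<phi> x) \<le> norm h * l2 (grad \<phi>)"
proof -
  obtain L where L: "L > 0" "\<And>x y. \<bar>\<phi> x - \<phi> y\<bar> \<le> L * norm (x - y)" using test_lipschitz[OF \<phi>] by blast
  obtain R where R: "R > 0" "\<And>x. R \<le> norm x \<Longrightarrow> \<phi> x = 0" using test_support[OF \<phi>] by blast
  note [measurable] = test_borel[OF \<phi>] grad_borel[OF \<phi>]
  define t where "t n = 1 / real (Suc n)" for n
  have t: "t n > 0" "t n \<le> 1" for n by (simp_all add: t_def)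
  have t0: "t \<longlonglongrightarrow> 0" unfolding t_def[abs_def] by (rule LIMSEQ_Suc[OF lim_1_over_n])
  define f where "f n x = (\<phi> (x + t n *\<^sub>R h) - \<phi> x) / t n" for n x
  have "(\<lambda>n. \<integral>x. (f n x)\<^sup>2 \<partial>lborel) \<longlonglongrightarrow> (\<integral>x. (grad \<phi> x \<bullet> h)\<^sup>2 \<partial>lborel)"
  proof (rule integral_dominated_convergence)
    show "integrable lborel (\<lambda>x. (L * norm h)\<^sup>2 * indicator (cball (0::'a) (R + norm h)) x)"
      by (intro integrable_mult_right integrable_real_indicator)
        (simp_all add: emeasure_lborel_cball_finite[unfolded infinity_ennreal_def] emeasure_lborel_cball_finite)
    show "(\<lambda>x. (grad \<phi> x \<bullet> h)\<^sup>2) \<in> borel_measurable lborel" by measurable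
    show "(\<lambda>x. (f n x)\<^sup>2) \<in> borel_measurable lborel" for n unfolding f_def[abs_def] by measurable
    show "AE x in lborel. (\<lambda>n. (f n x)\<^sup>2) \<longlonglongrightarrow> (grad \<phi> x \<bullet> h)\<^sup>2"
    proof (rule AE_I2)
      fix x
      have "((\<lambda>\<tau>. \<phi> (x + \<tau> *\<^sub>R h)) has_derivative (\<lambda>\<tau>. grad \<phi> x \<bullet> (\<tau> *\<^sub>R h))) (at 0)"
        by (rule has_derivative_compose[of "\<lambda>\<tau>. x + \<tau> *\<^sub>R h" "\<lambda>\<tau>. \<tau> *\<^sub>R h"])
          (use test_grad_derivative[OF \<phi>] in \<open>auto intro!: derivative_eq_intros\<close>)
      then have "((\<lambda>\<tau>. \<phi> (x + \<tau> *\<^sub>R h)) has_real_derivative (grad \<phi> x \<bullet> h)) (at 0)"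
        unfolding has_field_derivative_def by (rule has_derivative_eq_rhs) (simp add: fun_eq_iff)
      then have lim: "((\<lambda>\<tau>. (\<phi> (x + \<tau> *\<^sub>R h) - \<phi> x) / \<tau>) \<longlongrightarrow> grad \<phi> x \<bullet> h) (at 0)"
        by (simp add: DERIV_def)
      have "filterlim t (at 0) sequentially"
        using t0 t(1) by (intro filterlim_atI) (auto simp: less_imp_neq[symmetric])
      from filterlim_compose[OF lim this] have "(\<lambda>n. f n x) \<longlonglongrightarrow> grad \<phi> x \<bullet> h" by (simp add: f_def)
      then show "(\<lambda>n. (f n x)\<^sup>2) \<longlonglongrightarrow> (grad \<phi> x \<bullet> h)\<^sup>2" by (rule tendsto_power)
    qed
    show "AE x in lborel. norm ((f n x)\<^sup>2) \<le> (L * norm h)\<^sup>2 * indicator (cball 0 (R + norm h)) x" for n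
    proof (rule AE_I2)
      fix x :: 'a
      show "norm ((f n x)\<^sup>2) \<le> (L * norm h)\<^sup>2 * indicator (cball 0 (R + norm h)) x"
      proof (cases "norm x \<le> R + norm h")
        case True
        have "\<bar>\<phi> (x + t n *\<^sub>R h) - \<phi> x\<bar> \<le> L * (t n * norm h)"
          using L(2)[of "x + t n *\<^sub>R h" x] t(1)[of n] by simp
        then have "\<bar>f n x\<bar> \<le> L * norm h" using t(1)[of n] by (simp add: f_def abs_divide divide_le_eq mult_ac)
        then have "\<bar>f n x\<bar>\<^sup>2 \<le> (L * norm h)\<^sup>2" by (rule power_mono) simp
        then show ?thesis using True by simp
      next
        case False
        have "norm (t n *\<^sub>R h) \<le> norm h" using t[of n] by (simp add: mult_left_le_one_le)
        then have "R \<le> norm (x + t n *\<^sub>R h)" using False norm_diff_ineq[of x "t n *\<^sub>R h"] by linarith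
        moreover have "R \<le> norm x" using False norm_ge_zero[of h] by linarith
        ultimately show ?thesis using R(2) by (simp add: f_def)
      qed
    qed
  qed
  from tendsto_real_sqrt[OF this] have lim: "(\<lambda>n. l2 (f n)) \<longlonglongrightarrow> l2 (\<lambda>x. grad \<phi> x \<bullet> h)" by (simp add: l2_def)
  have "l2 (\<lambda>x. \<phi> (x + h) - \<phi> x) \<le> l2 (f n)" for n
  proof -
    have "real (Suc n) *\<^sub>R (t n *\<^sub>R h) = h" by (simp add: t_def)
    then have "l2 (\<lambda>x. \<phi> (x + h) - \<phi> x) \<le> real (Suc n) * l2 (\<lambda>x. \<phi> (x + t n *\<^sub>R h) - \<phi> x)"
      using l2_translation_multiple[OF test_L2[OF \<phi>], of "Suc n" "t n *\<^sub>R h"] by simp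
    also have "\<dots> = \<bar>1 / t n\<bar> * l2 (\<lambda>x. \<phi> (x + t n *\<^sub>R h) - \<phi> x)" by (simp add: t_def)
    also have "\<dots> = l2 (\<lambda>x. (1 / t n) *\<^sub>R (\<phi> (x + t n *\<^sub>R h) - \<phi> x))" by (rule l2_scaleR[symmetric])
    also have "\<dots> = l2 (f n)" by (simp add: f_def[abs_def])
    finally show ?thesis .
  qed
  then have "l2 (\<lambda>x. \<phi> (x + h) - \<phi> x) \<le> l2 (\<lambda>x. grad \<phi> x \<bullet> h)"
    by (intro LIMSEQ_le_const[OF lim]) blast
  also have "\<dots> \<le> l2 (\<lambda>x. norm h *\<^sub>R grad \<phi> x)"
  proof (rule L2_dominated(2)[OF L2_scaleR[OF grad_L2[OF \<phi>]]])
    show "norm (grad \<phi> x \<bullet> h) \<le> norm (norm h *\<^sub>R grad \<phi> x)" for x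
      using Cauchy_Schwarz_ineq2[of "grad \<phi> x" h] by (simp add: mult.commute)
  qed measurable
  finally show ?thesis by (simp add: l2_scaleR)
qed

text \<open>A quantitative substitute for compactness: in the lattice average it bounds the cost of
  replacing a function by its translates by d times the norm of its gradient.\<close>

theorem H1_translation_estimate:
  assumes p: "H1_pair u G" shows "l2 (\<lambda>x. u (x + h) - u x) \<le> norm h * l2 G"
proof -
  note L = H1_pair_L2[OF p]
  obtain \<phi> where \<phi>: "\<And>n. \<phi> n \<in> test_functions" "(\<lambda>n. l2 (\<lambda>x. \<phi> n x - u x)) \<longlonglongrightarrow> 0"
    "(\<lambda>n. l2 (\<lambda>x. grad (\<phi> n) x - G x)) \<longlonglongrightarrow> 0" using H1_density[OF p] by blast
  have le: "l2 (\<lambda>x. u (x + h) - u x) \<le> 2 * l2 (\<lambda>x. \<phi> n x - u x) + norm h * l2 (grad (\<phi> n))" for n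
  proof -
    note T = test_L2[OF \<phi>(1)]
    have d: "(\<lambda>x. \<phi> n x - u x) \<in> L2" by (rule L2_diff[OF T L(1)])
    have "l2 (\<lambda>x. u (x + h) - u x) \<le> l2 (\<lambda>x. u (x + h) - \<phi> n (x + h)) + l2 (\<lambda>x. \<phi> n (x + h) - u x)"
      by (intro l2_triangle L2_shift T L)
    also have "l2 (\<lambda>x. u (x + h) - \<phi> n (x + h)) = l2 (\<lambda>x. \<phi> n x - u x)"
      using l2_shift[OF d, of h] l2_minus[of "\<lambda>x. u (x + h)" "\<lambda>x. \<phi> n (x + h)"] by simp
    also have "l2 (\<lambda>x. \<phi> n (x + h) - u x) \<le> l2 (\<lambda>x. \<phi> n (x + h) - \<phi> n x) + l2 (\<lambda>x. \<phi> n x - u x)"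
      by (intro l2_triangle L2_shift T L)
    finally show ?thesis using test_translation_estimate[OF \<phi>(1)[of n], of h] by linarith
  qed
  have "(\<lambda>n. 2 * l2 (\<lambda>x. \<phi> n x - u x) + norm h * l2 (grad (\<phi> n))) \<longlonglongrightarrow> 2 * 0 + norm h * l2 G"
    by (intro tendsto_intros \<phi>(2) l2_tendsto[OF grad_L2[OF \<phi>(1)] L(2) \<phi>(3)])
  then have "l2 (\<lambda>x. u (x + h) - u x) \<le> 2 * 0 + norm h * l2 G"
    by (rule LIMSEQ_le_const) (use le in blast)
  then show ?thesis by simp
qed

section \<open>The variational problems\<close>

text \<open>\<open>V\<close> consists of functions and not of classes, so \<open>B\<close> is only
  semidefinite and limits exist only in the seminorm of \<open>B\<close>; hence the form of the
  completeness hypothesis. The solution minimises B(v,v) - 2F(v): the parallelogram identity makes a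
  minimising sequence Cauchy, and the first variation gives the equation.\<close>

theorem Riesz_functions:
  fixes V :: "('a \<Rightarrow> real) set" and B :: "('a \<Rightarrow> real) \<Rightarrow> ('a \<Rightarrow> real) \<Rightarrow> real"
  assumes zero: "(\<lambda>_. 0) \<in> V"
    and lin: "\<And>u v c. u \<in> V \<Longrightarrow> v \<in> V \<Longrightarrow> (\<lambda>x. u x + c * v x) \<in> V"
    and sym: "\<And>u v. B u v = B v u"
    and Blin: "\<And>u v w c. u \<in> V \<Longrightarrow> v \<in> V \<Longrightarrow> w \<in> V \<Longrightarrow> B (\<lambda>x. u x + c * v x) w = B u w + c * B v w"
    and pos: "\<And>u. u \<in> V \<Longrightarrow> 0 \<le> B u u"
    and Flin: "\<And>u v c. u \<in> V \<Longrightarrow> v \<in> V \<Longrightarrow> F (\<lambda>x. u x + c * v x) = F u + c * F v"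
    and Fbd: "\<And>u. u \<in> V \<Longrightarrow> \<bar>F u\<bar> \<le> C * sqrt (B u u)"
    and complete: "\<And>s. (\<And>n. s n \<in> V) \<Longrightarrow>
      (\<And>e. e > 0 \<Longrightarrow> \<exists>N. \<forall>m\<ge>N. \<forall>n\<ge>N. B (\<lambda>x. s m x + (-1) * s n x) (\<lambda>x. s m x + (-1) * s n x) < e) \<Longrightarrow>
      \<exists>u\<in>V. (\<lambda>n. B (\<lambda>x. s n x + (-1) * u x) (\<lambda>x. s n x + (-1) * u x)) \<longlonglongrightarrow> 0"
  shows "\<exists>u\<in>V. \<forall>v\<in>V. B u v = F v"
proof -
  have Bexp: "B (\<lambda>x. u x + c * v x) (\<lambda>x. u x + c * v x) = B u u + 2 * c * B u v + c\<^sup>2 * B v v"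
    if "u \<in> V" "v \<in> V" for u v c
  proof -
    define w where "w = (\<lambda>x. u x + c * v x)"
    have w: "w \<in> V" unfolding w_def by (rule lin[OF that])
    have "B w w = B u w + c * B v w" using Blin[OF that w, of c] by (simp only: w_def)
    moreover have "B u w = B u u + c * B u v"
      using Blin[OF that that(1), of c] sym[of u w] sym[of u v] by (simp only: w_def)
    moreover have "B v w = B u v + c * B v v"
      using Blin[OF that that(2), of c] sym[of v w] by (simp only: w_def)
    ultimately show ?thesis unfolding w_def by (simp add: power2_eq_square algebra_simps)
  qed
  have CS: "(B u v)\<^sup>2 \<le> B u u * B v v" if uv: "u \<in> V" "v \<in> V" for u v
  proof (rule quadratic_form_Cauchy_Schwarz)
    fix a b
    have au: "(\<lambda>x. 0 + a * u x) \<in> V" by (rule lin[OF zero uv(1)])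
    have z: "B (\<lambda>_. 0) w = 0" if "w \<in> V" for w using Blin[OF zero zero that, of 1] by simp
    have 1: "B (\<lambda>x. 0 + a * u x) w = a * B u w" if "w \<in> V" for w
      using Blin[OF zero uv(1) that, of a] z[OF that] by simp
    have "0 \<le> B (\<lambda>x. (0 + a * u x) + b * v x) (\<lambda>x. (0 + a * u x) + b * v x)"
      by (rule pos[OF lin[OF au uv(2)]])
    also have "\<dots> = a\<^sup>2 * B u u + 2 * a * b * B u v + b\<^sup>2 * B v v"
      unfolding Bexp[OF au uv(2)] 1[OF au] 1[OF uv(2)] sym[of u "\<lambda>x. 0 + a * u x"] 1[OF uv(1)]
      by (simp add: power2_eq_square)
    finally show "0 \<le> a\<^sup>2 * B u u + 2 * a * b * B u v + b\<^sup>2 * B v v" .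
  qed
  define J where "J v = B v v - 2 * F v" for v
  \<comment> \<open>Completing the square in sqrt (B v v) shows that the infimum is finite.\<close>
  have J_lower: "- (C\<^sup>2) \<le> J v" if "v \<in> V" for v
  proof -
    have "0 \<le> (sqrt (B v v) - C)\<^sup>2" by simp
    also have "\<dots> = B v v - 2 * (C * sqrt (B v v)) + C\<^sup>2"
      using pos[OF that] by (simp add: power2_diff)
    finally show ?thesis using Fbd[OF that] by (simp add: J_def)
  qed
  define m where "m = Inf (J ` V)"
  have bdd: "bdd_below (J ` V)" 
    by (rule bdd_belowI[of _ "- (C\<^sup>2)"]) (use J_lower in auto)
  have m_le: "m \<le> J v" if "v \<in> V" for v unfolding m_def using that bdd by (intro cInf_lower) auto
  have "\<exists>v\<in>V. J v < m + 1 / real (Suc n)" for n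
  proof -
    have "Inf (J ` V) < m + 1 / real (Suc n)" by (simp add: m_def)
    then obtain y where "y \<in> J ` V" "y < m + 1 / real (Suc n)"
      using cInf_lessD[of "J ` V"] zero by blast
    then show ?thesis by blast
  qed
  then have "\<forall>n. \<exists>v. v \<in> V \<and> J v < m + 1 / real (Suc n)" unfolding Bex_def by (rule allI)
  from choice[OF this] obtain s where s: "\<forall>n. s n \<in> V \<and> J (s n) < m + 1 / real (Suc n)" by (elim exE)
  have sV: "s n \<in> V" and sJ: "J (s n) < m + 1 / real (Suc n)" for n using s by auto
  have par: "B (\<lambda>x. u x + (-1) * v x) (\<lambda>x. u x + (-1) * v x) \<le> 2 * (J u - m) + 2 * (J v - m)"
    if uv: "u \<in> V" "v \<in> V" for u v
  proof -
    have w: "(\<lambda>x. u x + 1 * v x) \<in> V" by (rule lin[OF uv])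
    have z: "B (\<lambda>_. 0) w = 0" "F (\<lambda>_. 0) = 0" if "w \<in> V" for w
      using Blin[OF zero zero that, of 1] Flin[OF zero zero, of 1] by simp_all
    \<comment> \<open>The midpoint of \<open>u\<close> and \<open>v\<close>, written as a
      combination with 0 so that \<open>lin\<close> and \<open>Bexp\<close> apply. Comparing its
      energy with the infimum gives the parallelogram estimate.\<close>
    have wV: "(\<lambda>x. 0 + (1/2) * (u x + 1 * v x)) \<in> V" by (rule lin[OF zero w])
    have "m \<le> J (\<lambda>x. 0 + (1/2) * (u x + 1 * v x))" by (rule m_le[OF wV])
    also have "\<dots> = (B u u + 2 * B u v + B v v) / 4 - (F u + F v)"
      unfolding J_def Bexp[OF zero w] Flin[OF zero w] Flin[OF uv] z(1)[OF zero] z(1)[OF w] z(2)[OF zero] Bexp[OF uv]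
      by (simp add: power2_eq_square field_simps)
    finally have "4 * m \<le> B u u + 2 * B u v + B v v - 4 * F u - 4 * F v" by (simp add: field_simps)
    then show ?thesis unfolding Bexp[OF uv] by (simp add: J_def)
  qed
  have "\<exists>u\<in>V. (\<lambda>n. B (\<lambda>x. s n x + (-1) * u x) (\<lambda>x. s n x + (-1) * u x)) \<longlonglongrightarrow> 0"
  proof (rule complete[OF sV])
    fix e :: real assume e: "e > 0"
    obtain N :: nat where N: "4 / e < real N" using reals_Archimedean2 by blast
    have "B (\<lambda>x. s k x + (-1) * s n x) (\<lambda>x. s k x + (-1) * s n x) < e" if "k \<ge> N" "n \<ge> N" for k n
    proof -
      have le: "1 / real (Suc j) < e / 4" if "j \<ge> N" for j
      proof -
        have "4 / e < real (Suc j)" using N that by simp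
        then show ?thesis using e by (simp add: field_simps)
      qed
      have "J (s k) - m < e / 4" "J (s n) - m < e / 4"
        using sJ[of k] sJ[of n] le[OF that(1)] le[OF that(2)] by linarith+
      then have "2 * (J (s k) - m) + 2 * (J (s n) - m) < 2 * (e / 4) + 2 * (e / 4)"
        by (intro add_strict_mono mult_strict_left_mono) auto
      also have "2 * (e / 4) + 2 * (e / 4) = e" by simp
      finally have "2 * (J (s k) - m) + 2 * (J (s n) - m) < e" .
      with par[OF sV sV, of k n] show ?thesis by (rule order_le_less_trans)
    qed
    then show "\<exists>N. \<forall>k\<ge>N. \<forall>n\<ge>N. B (\<lambda>x. s k x + (-1) * s n x) (\<lambda>x. s k x + (-1) * s n x) < e" by blast
  qed
  then obtain u where u: "u \<in> V" "(\<lambda>n. B (\<lambda>x. s n x + (-1) * u x) (\<lambda>x. s n x + (-1) * u x)) \<longlonglongrightarrow> 0" by blast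
  have "B u v = F v" if v: "v \<in> V" for v
  proof -
    have lim: "(\<lambda>n. B (s n) v) \<longlonglongrightarrow> B u v"
    proof -
      have d: "(\<lambda>x. s n x + (-1) * u x) \<in> V" for n by (rule lin[OF sV u(1)])
      have "norm (B (s n) v - B u v) \<le> sqrt (B (\<lambda>x. s n x + (-1) * u x) (\<lambda>x. s n x + (-1) * u x)) * sqrt (B v v)" for n
      proof -
        have "B (\<lambda>x. s n x + (-1) * u x) v = B (s n) v + (-1) * B u v" by (rule Blin[OF sV u(1) v])
        then have "B (s n) v - B u v = B (\<lambda>x. s n x + (-1) * u x) v" by (simp only: mult_minus1 diff_conv_add_uminus)
        then show ?thesis
          using real_sqrt_le_mono[OF CS[OF d[of n] v]] by (simp only: real_sqrt_mult real_sqrt_abs real_norm_def)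
      qed
      note le = this
      have "(\<lambda>n. sqrt (B (\<lambda>x. s n x + (-1) * u x) (\<lambda>x. s n x + (-1) * u x)) * sqrt (B v v)) \<longlonglongrightarrow> sqrt 0 * sqrt (B v v)"
        by (intro tendsto_mult tendsto_real_sqrt tendsto_const u(2))
      then have "(\<lambda>n. sqrt (B (\<lambda>x. s n x + (-1) * u x) (\<lambda>x. s n x + (-1) * u x)) * sqrt (B v v)) \<longlonglongrightarrow> 0"
        by (simp only: real_sqrt_zero mult_zero_left)
      from Lim_null_comparison[OF always_eventually[OF allI[OF le]] this]
      have "(\<lambda>n. B (s n) v - B u v) \<longlonglongrightarrow> 0" .
      then show ?thesis by (rule LIM_zero_cancel)
    qed
    \<comment> \<open>A perturbation \<open>t v\<close> lowers J by at most 1/(n + 1) below J (s n).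
      In the limit the quadratic in \<open>t\<close> is nonnegative for every \<open>t\<close>,
      although \<open>u\<close> itself has not been shown to be a minimiser.\<close>
    have q: "0 \<le> 2 * t * (B u v - F v) + t\<^sup>2 * B v v" for t
    proof -
      have "0 \<le> 1 / real (Suc n) + (2 * t * (B (s n) v - F v) + t\<^sup>2 * B v v)" for n
      proof -
        have "m \<le> J (\<lambda>x. s n x + t * v x)" by (rule m_le[OF lin[OF sV v]])
        also have "\<dots> = J (s n) + 2 * t * (B (s n) v - F v) + t\<^sup>2 * B v v"
          unfolding J_def Bexp[OF sV v] Flin[OF sV v] by (simp add: algebra_simps)
        finally show ?thesis using sJ[of n] by linarith
      qed
      note le = this
      have "(\<lambda>n. 1 / real (Suc n) + (2 * t * (B (s n) v - F v) + t\<^sup>2 * B v v))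
          \<longlonglongrightarrow> 0 + (2 * t * (B u v - F v) + t\<^sup>2 * B v v)"
        by (intro tendsto_add tendsto_mult tendsto_diff tendsto_const lim LIMSEQ_Suc[OF lim_1_over_n])
      then have "0 \<le> 0 + (2 * t * (B u v - F v) + t\<^sup>2 * B v v)"
        by (rule LIMSEQ_le_const) (use le in blast)
      then show ?thesis by simp
    qed
    define D where "D = B u v - F v"
    show ?thesis
    proof (rule ccontr)
      assume "B u v \<noteq> F v"
      then have D: "D \<noteq> 0" by (simp add: D_def)
      \<comment> \<open>The optimal \<open>t\<close> would divide by \<open>B v v\<close>, which may
        be 0; adding 1 keeps the quotient meaningful and still yields a negative value.\<close>
      define b where "b = B v v + 1"
      have b: "b > 0" using pos[OF v] by (simp add: b_def)
      have "0 \<le> 2 * (- D / b) * D + (- D / b)\<^sup>2 * B v v" using q[of "- D / b"] by (simp add: D_def)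
      also have "\<dots> \<le> 2 * (- D / b) * D + (- D / b)\<^sup>2 * b"
        by (intro add_left_mono mult_left_mono) (auto simp: b_def)
      also have "\<dots> = - (D\<^sup>2 / b)" using b by (simp add: power2_eq_square field_simps)
      also have "\<dots> < 0" using D b by simp
      finally show False by simp
    qed
  qed
  with u(1) show ?thesis by blast
qed

lemma H1_complete:
  assumes s: "\<And>n. H1_pair (s n) (G n)"
    and C1: "\<And>e. e > 0 \<Longrightarrow> \<exists>N. \<forall>m\<ge>N. \<forall>n\<ge>N. l2 (\<lambda>x. s m x - s n x) < e"
    and C2: "\<And>e. e > 0 \<Longrightarrow> \<exists>N. \<forall>m\<ge>N. \<forall>n\<ge>N. l2 (\<lambda>x. G m x - G n x) < e"
  obtains u H where "H1_pair u H" "(\<lambda>n. l2 (\<lambda>x. s n x - u x)) \<longlonglongrightarrow> 0" "(\<lambda>n. l2 (\<lambda>x. G n x - H x)) \<longlonglongrightarrow> 0"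
proof -
  obtain u where u: "u \<in> L2" "(\<lambda>n. l2 (\<lambda>x. s n x - u x)) \<longlonglongrightarrow> 0"
    using L2_complete[OF H1_pair_L2(1)[OF s] C1] by blast
  obtain H where H: "H \<in> L2" "(\<lambda>n. l2 (\<lambda>x. G n x - H x)) \<longlonglongrightarrow> 0"
    using L2_complete[OF H1_pair_L2(2)[OF s] C2] by blast
  show ?thesis by (rule that[OF H1_pair_limit[OF s u(1) H(1) u(2) H(2)] u(2) H(2)])
qed

section \<open>The bilinear forms of the two problems\<close>

definition form :: "real \<Rightarrow> ('a::euclidean_space \<Rightarrow> real) \<Rightarrow> ('a \<Rightarrow> real) \<Rightarrow> real" where
  "form \<mu> u v = (\<integral>x. weak_gradient u x \<bullet> weak_gradient v x \<partial>lborel) + \<mu> * (\<integral>x. u x * v x \<partial>lborel)"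

lemma form_pair:
  assumes "H1_pair u G" "H1_pair v H"
  shows "form \<mu> u v = (\<integral>x. G x \<bullet> H x \<partial>lborel) + \<mu> * (\<integral>x. u x * v x \<partial>lborel)"
  unfolding form_def weak_gradient_inner[OF assms] by (rule refl)

lemma form_self:
  assumes "H1_pair u G" shows "form \<mu> u u = (l2 G)\<^sup>2 + \<mu> * (l2 u)\<^sup>2"
proof -
  have "(\<integral>x. u x * u x \<partial>lborel) = (l2 u)\<^sup>2" unfolding l2_sq by (simp add: power2_eq_square)
  then show ?thesis unfolding form_pair[OF assms assms] by (simp add: l2_sq power2_norm_eq_inner)
qed

lemma form_sym: "form \<mu> u v = form \<mu> v u"
  by (simp add: form_def inner_commute mult.commute)

lemma form_lin:
  assumes u: "u \<in> H1" and v: "v \<in> H1" and w: "w \<in> H1"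
  shows "form \<mu> (\<lambda>x. u x + c * v x) w = form \<mu> u w + c * form \<mu> v w"
proof -
  note p = u[THEN H1_pair_weak_gradient] v[THEN H1_pair_weak_gradient] w[THEN H1_pair_weak_gradient]
  note L = H1_pair_L2[OF p(1)] H1_pair_L2[OF p(2)] H1_pair_L2[OF p(3)]
  have 1: "(\<integral>x. (weak_gradient u x + c *\<^sub>R weak_gradient v x) \<bullet> weak_gradient w x \<partial>lborel)
     = (\<integral>x. weak_gradient u x \<bullet> weak_gradient w x \<partial>lborel) + c * (\<integral>x. weak_gradient v x \<bullet> weak_gradient w x \<partial>lborel)"
    unfolding inner_add_left inner_scaleR_left
    using L2_inner_integrable[OF L(2) L(6)] L2_inner_integrable[OF L(4) L(6)] by simp
  have 2: "(\<integral>x. (u x + c * v x) * w x \<partial>lborel) = (\<integral>x. u x * w x \<partial>lborel) + c * (\<integral>x. v x * w x \<partial>lborel)"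
    unfolding distrib_right mult.assoc
    using L2_mult_integrable[OF L(1) L(5)] L2_mult_integrable[OF L(3) L(5)] by simp
  have "form \<mu> (\<lambda>x. u x + c * v x) w
      = (\<integral>x. (weak_gradient u x + c *\<^sub>R weak_gradient v x) \<bullet> weak_gradient w x \<partial>lborel)
        + \<mu> * (\<integral>x. (u x + c * v x) * w x \<partial>lborel)"
    by (rule form_pair[OF H1_pair_lincomb[OF p(1,2)] p(3)])
  also have "\<dots> = form \<mu> u w + c * form \<mu> v w"
    unfolding 1 2 by (simp add: form_def algebra_simps)
  finally show ?thesis .
qed

lemma H1_lincomb:
  assumes "u \<in> H1" "v \<in> H1" shows "(\<lambda>x. u x + c * v x) \<in> H1"
  by (rule H1_pair_H1[OF H1_pair_lincomb[OF H1_pair_weak_gradient[OF assms(1)] H1_pair_weak_gradient[OF assms(2)]]])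

lemma H_minus1_lin:
  assumes "f \<in> H_minus1" "u \<in> H1" "v \<in> H1"
  shows "f (\<lambda>x. u x + c * v x) = f u + c * f v"
proof -
  have z: "(\<lambda>_. 0) \<in> (H1 :: ('a \<Rightarrow> real) set)" by (rule H1_pair_H1[OF H1_pair_test[OF test_zero]])
  have cv: "(\<lambda>x. c * v x) \<in> H1" using H1_lincomb[OF z assms(3), of c] by simp
  have "f (\<lambda>x. u x + c * v x) = f u + f (\<lambda>x. c * v x)"
    using assms cv by (simp add: H_minus1_def)
  also have "f (\<lambda>x. c * v x) = c * f v" using assms by (simp add: H_minus1_def)
  finally show ?thesis .
qed

text \<open>With \<open>\<mu> = 0\<close> and the functions vanishing in the holes as \<open>V\<close> this covers the perforated problem,
  with \<open>\<mu> > 0\<close> and \<open>V = H1\<close> the limit problem.\<close>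

theorem form_representation:
  fixes V :: "('a::euclidean_space \<Rightarrow> real) set"
  assumes V: "V \<subseteq> H1" "(\<lambda>_. 0) \<in> V" "\<And>u v c. u \<in> V \<Longrightarrow> v \<in> V \<Longrightarrow> (\<lambda>x. u x + c * v x) \<in> V"
    and closed: "\<And>s u. (\<And>n. s n \<in> V) \<Longrightarrow> u \<in> H1 \<Longrightarrow> (\<lambda>n. l2 (\<lambda>x. s n x - u x)) \<longlonglongrightarrow> 0 \<Longrightarrow> u \<in> V"
    and mu: "\<mu> \<ge> 0" and c: "c > 0"
    and coercive: "\<And>u G. u \<in> V \<Longrightarrow> H1_pair u G \<Longrightarrow> c * ((l2 u)\<^sup>2 + (l2 G)\<^sup>2) \<le> (l2 G)\<^sup>2 + \<mu> * (l2 u)\<^sup>2"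
    and f: "f \<in> H_minus1"
  shows "\<exists>u\<in>V. \<forall>v\<in>V. form \<mu> u v = f v"
proof -
  obtain C where C: "\<forall>u\<in>H1. \<bar>f u\<bar> \<le> C * H1_norm u" using f unfolding H_minus1_def by blast
  have co: "c * (H1_norm u)\<^sup>2 \<le> form \<mu> u u" if "u \<in> V" for u
  proof -
    have p: "H1_pair u (weak_gradient u)" using that V(1) by (intro H1_pair_weak_gradient) auto
    show ?thesis using coercive[OF that p] by (simp add: H1_norm_pair[OF p] form_self[OF p])
  qed
  have nn: "0 \<le> form \<mu> u u" if "u \<in> V" for u
    using co[OF that] c by (smt (verit) mult_nonneg_nonneg zero_le_power2)
  show ?thesis
  proof (rule Riesz_functions[where C = "\<bar>C\<bar> / sqrt c"])
    show "(\<lambda>_. 0) \<in> V" by (rule V(2))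
    show "(\<lambda>x. u x + c * v x) \<in> V" if "u \<in> V" "v \<in> V" for u v c by (rule V(3)[OF that])
    show "form \<mu> u v = form \<mu> v u" for u v by (rule form_sym)
    show "form \<mu> (\<lambda>x. u x + c * v x) w = form \<mu> u w + c * form \<mu> v w" if "u \<in> V" "v \<in> V" "w \<in> V" for u v w c
      using that V(1) by (intro form_lin) auto
    show "0 \<le> form \<mu> u u" if "u \<in> V" for u by (rule nn[OF that])
    show "f (\<lambda>x. u x + c * v x) = f u + c * f v" if "u \<in> V" "v \<in> V" for u v c
      using that V(1) by (intro H_minus1_lin[OF f]) auto
    show "\<bar>f u\<bar> \<le> \<bar>C\<bar> / sqrt c * sqrt (form \<mu> u u)" if u: "u \<in> V" for u
    proof -
      have p: "H1_norm u \<ge> 0" by (simp add: H1_norm_def)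
      have "sqrt (c * (H1_norm u)\<^sup>2) \<le> sqrt (form \<mu> u u)" by (rule real_sqrt_le_mono[OF co[OF u]])
      then have "sqrt c * H1_norm u \<le> sqrt (form \<mu> u u)" using p by (simp add: real_sqrt_mult)
      then have "H1_norm u \<le> sqrt (form \<mu> u u) / sqrt c" using c by (simp add: field_simps)
      then have "\<bar>C\<bar> * H1_norm u \<le> \<bar>C\<bar> * (sqrt (form \<mu> u u) / sqrt c)" by (rule mult_left_mono) simp
      moreover have "\<bar>f u\<bar> \<le> C * H1_norm u" using C u V(1) by blast
      moreover have "C * H1_norm u \<le> \<bar>C\<bar> * H1_norm u" using p by (intro mult_right_mono) auto
      ultimately show ?thesis by simp
    qed
    fix s :: "nat \<Rightarrow> 'a \<Rightarrow> real"
    assume sV: "\<And>n. s n \<in> V" and Ca: "\<And>e. e > 0 \<Longrightarrow> \<exists>N. \<forall>m\<ge>N. \<forall>n\<ge>N.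
       form \<mu> (\<lambda>x. s m x + (-1) * s n x) (\<lambda>x. s m x + (-1) * s n x) < e"
    define G where "G n = weak_gradient (s n)" for n
    have p: "H1_pair (s n) (G n)" for n
      unfolding G_def using sV V(1) by (intro H1_pair_weak_gradient) auto
    have pd: "H1_pair (\<lambda>x. s m x + (-1) * s n x) (\<lambda>x. G m x + (-1) *\<^sub>R G n x)" for m n
      by (rule H1_pair_lincomb[OF p p])
    have est: "c * (l2 (\<lambda>x. s m x - s n x))\<^sup>2 \<le> form \<mu> (\<lambda>x. s m x + (-1) * s n x) (\<lambda>x. s m x + (-1) * s n x)"
      "c * (l2 (\<lambda>x. G m x - G n x))\<^sup>2 \<le> form \<mu> (\<lambda>x. s m x + (-1) * s n x) (\<lambda>x. s m x + (-1) * s n x)" for m n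
    proof -
      have "0 \<le> c * (l2 (\<lambda>x. s m x - s n x))\<^sup>2" "0 \<le> c * (l2 (\<lambda>x. G m x - G n x))\<^sup>2" using c by simp_all
      then show "c * (l2 (\<lambda>x. s m x - s n x))\<^sup>2 \<le> form \<mu> (\<lambda>x. s m x + (-1) * s n x) (\<lambda>x. s m x + (-1) * s n x)"
        "c * (l2 (\<lambda>x. G m x - G n x))\<^sup>2 \<le> form \<mu> (\<lambda>x. s m x + (-1) * s n x) (\<lambda>x. s m x + (-1) * s n x)"
        using coercive[OF V(3)[OF sV sV] pd, of m n] unfolding form_self[OF pd]
        by (simp_all add: distrib_left)
    qed
    have small: "l < e" if "c * l\<^sup>2 \<le> F" "F < c * e\<^sup>2" "e > 0" for l e F :: real
    proof (rule power2_less_imp_less)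
      have "c * l\<^sup>2 < c * e\<^sup>2" using that by linarith
      then show "l\<^sup>2 < e\<^sup>2" using c by (simp only: mult_less_cancel_left_pos)
      show "0 \<le> e" using that by simp
    qed
    have 1: "\<exists>N. \<forall>m\<ge>N. \<forall>n\<ge>N. l2 (\<lambda>x. s m x - s n x) < e" if e: "e > 0" for e
    proof -
      obtain N where "\<forall>m\<ge>N. \<forall>n\<ge>N. form \<mu> (\<lambda>x. s m x + (-1) * s n x) (\<lambda>x. s m x + (-1) * s n x) < c * e\<^sup>2"
        using Ca[of "c * e\<^sup>2"] e c by auto
      then show ?thesis using small[OF est(1) _ e] by blast
    qed
    have 2: "\<exists>N. \<forall>m\<ge>N. \<forall>n\<ge>N. l2 (\<lambda>x. G m x - G n x) < e" if e: "e > 0" for e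
    proof -
      obtain N where "\<forall>m\<ge>N. \<forall>n\<ge>N. form \<mu> (\<lambda>x. s m x + (-1) * s n x) (\<lambda>x. s m x + (-1) * s n x) < c * e\<^sup>2"
        using Ca[of "c * e\<^sup>2"] e c by auto
      then show ?thesis using small[OF est(2) _ e] by blast
    qed
    obtain u H where u: "H1_pair u H" "(\<lambda>n. l2 (\<lambda>x. s n x - u x)) \<longlonglongrightarrow> 0" "(\<lambda>n. l2 (\<lambda>x. G n x - H x)) \<longlonglongrightarrow> 0"
      using H1_complete[OF p 1 2] by blast
    have "u \<in> V" by (rule closed[OF sV H1_pair_H1[OF u(1)] u(2)])
    moreover have "(\<lambda>n. form \<mu> (\<lambda>x. s n x + (-1) * u x) (\<lambda>x. s n x + (-1) * u x)) \<longlonglongrightarrow> 0"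
    proof -
      have "form \<mu> (\<lambda>x. s n x + (-1) * u x) (\<lambda>x. s n x + (-1) * u x)
          = (l2 (\<lambda>x. G n x - H x))\<^sup>2 + \<mu> * (l2 (\<lambda>x. s n x - u x))\<^sup>2" for n
        using form_self[OF H1_pair_lincomb[OF p u(1), of n "-1"], of \<mu>] by simp
      moreover have "(\<lambda>n. (l2 (\<lambda>x. G n x - H x))\<^sup>2 + \<mu> * (l2 (\<lambda>x. s n x - u x))\<^sup>2) \<longlonglongrightarrow> 0\<^sup>2 + \<mu> * 0\<^sup>2"
        by (intro tendsto_intros u)
      ultimately show ?thesis by simp
    qed
    ultimately show "\<exists>u\<in>V. (\<lambda>n. form \<mu> (\<lambda>x. s n x + (-1) * u x) (\<lambda>x. s n x + (-1) * u x)) \<longlonglongrightarrow> 0" by blast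
  qed
qed

lemma form_unique:
  assumes V: "V \<subseteq> H1" "\<And>u v c. u \<in> V \<Longrightarrow> v \<in> V \<Longrightarrow> (\<lambda>x. u x + c * v x) \<in> V"
    and c: "c > 0" and coercive: "\<And>u G. u \<in> V \<Longrightarrow> H1_pair u G \<Longrightarrow> c * ((l2 u)\<^sup>2 + (l2 G)\<^sup>2) \<le> (l2 G)\<^sup>2 + \<mu> * (l2 u)\<^sup>2"
    and u: "u \<in> V" "\<And>v. v \<in> V \<Longrightarrow> form \<mu> u v = f v" and w: "w \<in> V" "\<And>v. v \<in> V \<Longrightarrow> form \<mu> w v = f v"
  shows "AE x in lborel. u x = w x"
proof -
  define z where "z x = u x + (-1) * w x" for x
  have z: "z \<in> V" unfolding z_def[abs_def] by (rule V(2)[OF u(1) w(1)])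
  have p: "H1_pair z (weak_gradient z)" using z V(1) by (intro H1_pair_weak_gradient) auto
  have "form \<mu> z z = form \<mu> u z + (-1) * form \<mu> w z"
    unfolding z_def[abs_def] using u(1) w(1) z V(1) by (intro form_lin) (auto simp: z_def[abs_def])
  then have "form \<mu> z z = 0" using u(2)[OF z] w(2)[OF z] by simp
  then have "c * ((l2 z)\<^sup>2 + (l2 (weak_gradient z))\<^sup>2) \<le> 0" using coercive[OF z p] by (simp add: form_self[OF p])
  then have "(l2 z)\<^sup>2 + (l2 (weak_gradient z))\<^sup>2 \<le> 0" using c by (simp add: mult_le_0_iff)
  then have "(l2 z)\<^sup>2 \<le> 0" using zero_le_power2[of "l2 (weak_gradient z)"] by linarith
  then have "l2 z = 0" by simp
  then have "AE x in lborel. z x = 0" using l2_eq_0_iff[OF H1_pair_L2(1)[OF p]] by simp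
  then show ?thesis by eventually_elim (simp add: z_def)
qed

lemma weak_solution_limit_form: "weak_solution_limit \<mu> f u \<longleftrightarrow> u \<in> H1 \<and> (\<forall>v\<in>H1. form \<mu> u v = f v)"
  by (simp add: weak_solution_limit_def form_def)

lemma weak_solution_outside_form:
  "weak_solution_outside K f u \<longleftrightarrow> u \<in> H1_vanishing_in K \<and> (\<forall>v\<in>H1_vanishing_in K. form 0 u v = f v)"
  by (simp add: weak_solution_outside_def form_def)

lemma min_1_coercive:
  fixes a b \<mu> :: real assumes "\<mu> > 0" shows "min 1 \<mu> * (a\<^sup>2 + b\<^sup>2) \<le> b\<^sup>2 + \<mu> * a\<^sup>2"
proof -
  have "min 1 \<mu> * a\<^sup>2 \<le> \<mu> * a\<^sup>2" "min 1 \<mu> * b\<^sup>2 \<le> 1 * b\<^sup>2" by (intro mult_right_mono; simp)+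
  then show ?thesis by (simp add: distrib_left)
qed

theorem limit_problem_unique_solution:
  assumes "\<mu> > 0" "f \<in> H_minus1"
  shows "Ex1_ae (weak_solution_limit \<mu> f)"
  unfolding Ex1_ae_def
proof (intro conjI allI impI)
  have z: "(\<lambda>_. 0) \<in> (H1 :: ('a \<Rightarrow> real) set)" by (rule H1_pair_H1[OF H1_pair_test[OF test_zero]])
  have c: "min 1 \<mu> > 0" using assms(1) by simp
  have "\<exists>u\<in>H1. \<forall>v\<in>H1. form \<mu> u v = f v"
    by (rule form_representation[OF subset_refl z H1_lincomb _ less_imp_le[OF assms(1)] c min_1_coercive[OF assms(1)] assms(2)])
  then show "\<exists>u. weak_solution_limit \<mu> f u" unfolding weak_solution_limit_form by blast
  fix u v assume "weak_solution_limit \<mu> f u" "weak_solution_limit \<mu> f v"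
  then show "AE x in lborel. u x = v x"
    unfolding weak_solution_limit_form
    by (intro form_unique[OF subset_refl H1_lincomb c min_1_coercive[OF assms(1)], of u f v]) auto
qed

lemma H1_vanishing_lincomb:
  assumes "u \<in> H1_vanishing_in K" "v \<in> H1_vanishing_in K"
  shows "(\<lambda>x. u x + c * v x) \<in> H1_vanishing_in K"
proof -
  have "AE x in lborel. x \<in> K \<longrightarrow> u x = 0" "AE x in lborel. x \<in> K \<longrightarrow> v x = 0"
    using assms by (simp_all add: H1_vanishing_in_def)
  then have "AE x in lborel. x \<in> K \<longrightarrow> u x + c * v x = 0" by eventually_elim auto
  then show ?thesis using assms by (simp add: H1_vanishing_in_def H1_lincomb)
qed

text \<open>On \<open>K\<close> the difference \<open>s n - u\<close> equals \<open>- u\<close>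
  almost everywhere, so the norm of \<open>u\<close> restricted to \<open>K\<close> is at most every
  distance from \<open>s n\<close> to \<open>u\<close>.\<close>

lemma H1_vanishing_closed:
  assumes K: "K \<in> sets borel" and s: "\<And>n. s n \<in> H1_vanishing_in K" and u: "u \<in> H1"
    and lim: "(\<lambda>n. l2 (\<lambda>x. s n x - u x)) \<longlonglongrightarrow> 0"
  shows "u \<in> H1_vanishing_in K"
proof -
  have Lu: "u \<in> L2" using u by (simp add: H1_def)
  have Ls: "s n \<in> L2" for n using s[of n] by (simp add: H1_vanishing_in_def H1_def)
  define w where "w x = indicator K x * u x" for x
  have Kb: "(indicator K :: _ \<Rightarrow> real) \<in> borel_measurable borel" using K by simp
  have K1: "\<bar>indicator K x :: real\<bar> \<le> 1" for x by (simp add: indicator_def)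
  have Lw: "w \<in> L2" unfolding w_def[abs_def] by (rule L2_bounded_mult(1)[OF Lu Kb K1])
  have "l2 w \<le> l2 (\<lambda>x. s n x - u x)" for n
  proof -
    have L1: "(\<lambda>x. indicator K x * (s n x - u x)) \<in> L2"
      by (rule L2_bounded_mult(1)[OF L2_diff[OF Ls Lu] Kb K1])
    have "AE x in lborel. x \<in> K \<longrightarrow> s n x = 0" using s[of n] by (simp add: H1_vanishing_in_def)
    then have "AE x in lborel. (norm (w x))\<^sup>2 = (norm (indicator K x * (s n x - u x)))\<^sup>2"
      by eventually_elim (auto simp: w_def indicator_def)
    then have "l2 w = l2 (\<lambda>x. indicator K x * (s n x - u x))"
      unfolding l2_def using L2_borel[OF Lw] L2_borel[OF L1]
      by (intro arg_cong[where f = sqrt] integral_cong_AE) auto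
    also have "\<dots> \<le> 1 * l2 (\<lambda>x. s n x - u x)" by (rule L2_bounded_mult(2)[OF L2_diff[OF Ls Lu] Kb K1])
    finally show ?thesis by simp
  qed
  then have "l2 w \<le> 0" by (intro LIMSEQ_le_const[OF lim]) blast
  then have "AE x in lborel. w x = 0" using l2_eq_0_iff[OF Lw] l2_nonneg[of w] by simp
  then have "AE x in lborel. x \<in> K \<longrightarrow> u x = 0" by eventually_elim (auto simp: w_def indicator_def split: if_splits)
  then show ?thesis using u by (simp add: H1_vanishing_in_def)
qed

theorem outside_problem_unique_solution:
  assumes K: "K \<in> sets borel" and c: "c > 0" and f: "f \<in> H_minus1"
    and Poincare: "\<And>u G. u \<in> H1_vanishing_in K \<Longrightarrow> H1_pair u G \<Longrightarrow> c * ((l2 u)\<^sup>2 + (l2 G)\<^sup>2) \<le> (l2 G)\<^sup>2"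
  shows "Ex1_ae (weak_solution_outside K f)"
  unfolding Ex1_ae_def
proof (intro conjI allI impI)
  have sub: "H1_vanishing_in K \<subseteq> H1" by (auto simp: H1_vanishing_in_def)
  have "(\<lambda>_. 0) \<in> (H1 :: ('a \<Rightarrow> real) set)" by (rule H1_pair_H1[OF H1_pair_test[OF test_zero]])
  then have z: "(\<lambda>_. 0) \<in> H1_vanishing_in K" by (simp add: H1_vanishing_in_def)
  have co: "c * ((l2 u)\<^sup>2 + (l2 G)\<^sup>2) \<le> (l2 G)\<^sup>2 + 0 * (l2 u)\<^sup>2" if "u \<in> H1_vanishing_in K" "H1_pair u G" for u G
    using Poincare[OF that] by simp
  have "\<exists>u\<in>H1_vanishing_in K. \<forall>v\<in>H1_vanishing_in K. form 0 u v = f v"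
    by (rule form_representation[OF sub z H1_vanishing_lincomb H1_vanishing_closed[OF K] order_refl c co f])
  then show "\<exists>u. weak_solution_outside K f u" unfolding weak_solution_outside_form by blast
  fix u v assume "weak_solution_outside K f u" "weak_solution_outside K f v"
  then show "AE x in lborel. u x = v x"
    unfolding weak_solution_outside_form
    by (intro form_unique[OF sub H1_vanishing_lincomb c co, of u f v]) auto
qed

section \<open>Radial fields and the Poincare inequality\<close>

lemma AE_not_sphere:
  fixes c :: "'a::euclidean_space" shows "AE x in lborel. norm (x - c) \<noteq> r"
proof -
  have eq: "{x. \<not> norm (x - c) \<noteq> r} = sphere c r" by (auto simp: dist_norm norm_minus_commute)
  have "sphere c r \<in> null_sets lebesgue" using negligible_sphere by (simp add: negligible_iff_null_sets)
  then have "sphere c r \<in> null_sets lborel" by (subst (asm) null_sets_completion_iff) auto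
  then show ?thesis by (rule AE_I') (use eq in auto)
qed

definition annulus_gradient :: "real \<Rightarrow> real \<Rightarrow> 'a \<Rightarrow> (real \<Rightarrow> real) \<Rightarrow> 'a::euclidean_space \<Rightarrow> 'a" where
  "annulus_gradient r \<rho> c F' x =
    (if r < norm (x - c) \<and> norm (x - c) < \<rho> then (F' (norm (x - c)) / norm (x - c)) *\<^sub>R (x - c) else 0)"

text \<open>Freezing the profile inside radius \<open>r\<close> removes the singularity at the
  centre; profiles with \<open>F \<rho> = 0\<close> yield functions of compact support. The clamping
  creates kinks on two spheres only.\<close>

definition radial :: "real \<Rightarrow> real \<Rightarrow> 'a \<Rightarrow> (real \<Rightarrow> real) \<Rightarrow> 'a::euclidean_space \<Rightarrow> real" where
  "radial r \<rho> c F x = F (max r (min \<rho> (norm (x - c))))"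

lemma radial_lip_deriv:
  fixes c :: "'a::euclidean_space"
  assumes r: "0 < r" "r < \<rho>" and F: "\<And>t. r \<le> t \<Longrightarrow> t \<le> \<rho> \<Longrightarrow> (F has_real_derivative F' t) (at t)"
    and F': "continuous_on {r..\<rho>} F'" "F' \<in> borel_measurable borel" and z: "F \<rho> = 0"
  shows "lip_deriv (radial r \<rho> c F) (annulus_gradient r \<rho> c F')"
  unfolding lip_deriv_def
proof (intro conjI)
  have "compact (F' ` {r..\<rho>})" by (rule compact_continuous_image[OF F'(1)]) simp
  then have "bounded (F' ` {r..\<rho>})" by (rule compact_imp_bounded)
  then obtain L where L: "\<forall>y\<in>F' ` {r..\<rho>}. norm y \<le> L" unfolding bounded_iff by (elim exE)
  have L': "\<bar>F' t\<bar> \<le> L" if "r \<le> t" "t \<le> \<rho>" for t using L that by auto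
  have L0: "0 \<le> L" using L'[of r] r by auto
  have Flip: "\<bar>F a - F b\<bar> \<le> L * \<bar>a - b\<bar>" if "a \<in> {r..\<rho>}" "b \<in> {r..\<rho>}" for a b
  proof -
    have "norm (F a - F b) \<le> L * norm (a - b)"
    proof (rule field_differentiable_bound[of "{r..\<rho>}" F F'])
      show "(F has_field_derivative F' t) (at t within {r..\<rho>})" if "t \<in> {r..\<rho>}" for t
        by (rule has_field_derivative_at_within[OF F]) (use that in auto)
      show "norm (F' t) \<le> L" if "t \<in> {r..\<rho>}" for t using L'[of t] that by simp
    qed (use that in auto)
    then show ?thesis by simp
  qed
  have "\<bar>radial r \<rho> c F x - radial r \<rho> c F y\<bar> \<le> L * norm (x - y)" for x y
  proof -
    have "\<bar>radial r \<rho> c F x - radial r \<rho> c F y\<bar>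
        \<le> L * \<bar>max r (min \<rho> (norm (x - c))) - max r (min \<rho> (norm (y - c)))\<bar>"
      unfolding radial_def using r by (intro Flip) auto
    also have "\<dots> \<le> L * norm (x - y)"
    proof (intro mult_left_mono L0)
      have "\<bar>norm (x - c) - norm (y - c)\<bar> \<le> norm (x - y)"
        using norm_triangle_ineq3[of "x - c" "y - c"] by simp
      then show "\<bar>max r (min \<rho> (norm (x - c))) - max r (min \<rho> (norm (y - c)))\<bar> \<le> norm (x - y)" by linarith
    qed
    finally show ?thesis .
  qed
  then show "\<exists>L. \<forall>x y. \<bar>radial r \<rho> c F x - radial r \<rho> c F y\<bar> \<le> L * norm (x - y)" by (intro exI allI)
  have "radial r \<rho> c F x = 0" if "\<rho> + norm c \<le> norm x" for x
  proof -
    have "\<rho> \<le> norm (x - c)" using that norm_triangle_ineq2[of x c] by linarith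
    then show ?thesis using r z by (simp add: radial_def)
  qed
  then show "\<exists>R>0. \<forall>x. R \<le> norm x \<longrightarrow> radial r \<rho> c F x = 0"
    using r by (intro exI[of _ "\<rho> + norm c"]) (simp add: add_pos_nonneg)
  note [measurable] = F'(2)
  show "annulus_gradient r \<rho> c F' \<in> borel_measurable borel"
    unfolding annulus_gradient_def[abs_def] by measurable
  have "norm (annulus_gradient r \<rho> c F' x) \<le> L" for x
    using L'[of "norm (x - c)"] L0 r by (auto simp: annulus_gradient_def)
  then show "\<exists>M. \<forall>x. norm (annulus_gradient r \<rho> c F' x) \<le> M" by (intro exI allI)
  show "AE x in lborel. (radial r \<rho> c F has_derivative (\<lambda>h. annulus_gradient r \<rho> c F' x \<bullet> h)) (at x)"
    using AE_not_sphere[of c r] AE_not_sphere[of c \<rho>]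
  proof eventually_elim
    case (elim x)
    then consider "norm (x - c) < r" | "r < norm (x - c)" "norm (x - c) < \<rho>" | "\<rho> < norm (x - c)" by linarith
    then show ?case
    proof cases
      case 1
      have "(radial r \<rho> c F has_derivative (\<lambda>h. 0)) (at x)"
      proof (rule has_derivative_transform_within_open[of "\<lambda>_. F r"])
        show "open (ball c r)" by simp
        show "x \<in> ball c r" using 1 by (simp add: dist_norm norm_minus_commute)
        show "F r = radial r \<rho> c F y" if "y \<in> ball c r" for y
          using that r by (simp add: radial_def dist_norm norm_minus_commute)
      qed simp
      then show ?thesis using 1 by (simp add: annulus_gradient_def)
    next
      case 2
      have nz: "x - c \<noteq> 0" using 2 r by auto
      have d1: "((\<lambda>y. norm (y - c)) has_derivative (\<lambda>h. sgn (x - c) \<bullet> h)) (at x)"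
      proof (rule has_derivative_compose[of "\<lambda>y. y - c" "\<lambda>h. h" x UNIV norm "\<lambda>h. sgn (x - c) \<bullet> h"])
        show "((\<lambda>y. y - c) has_derivative (\<lambda>h. h)) (at x)" by (auto intro!: derivative_eq_intros)
        show "(norm has_derivative (\<lambda>h. sgn (x - c) \<bullet> h)) (at (x - c))"
          using has_derivative_norm[OF nz] by (simp only: inner_commute[of "sgn (x - c)"])
      qed
      have d2: "(F has_derivative (\<lambda>h. F' (norm (x - c)) * h)) (at (norm (x - c)))"
        using F[of "norm (x - c)"] 2 by (simp add: has_field_derivative_def)
      have "((\<lambda>y. F (norm (y - c))) has_derivative (\<lambda>h. F' (norm (x - c)) * (sgn (x - c) \<bullet> h))) (at x)"
        by (rule has_derivative_compose[OF d1 d2])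
      then have "(radial r \<rho> c F has_derivative (\<lambda>h. F' (norm (x - c)) * (sgn (x - c) \<bullet> h))) (at x)"
      proof (rule has_derivative_transform_within_open)
        show "open {y. r < norm (y - c) \<and> norm (y - c) < \<rho>}"
          by (intro open_Collect_conj open_Collect_less continuous_intros)
        show "x \<in> {y. r < norm (y - c) \<and> norm (y - c) < \<rho>}" using 2 by simp
        show "F (norm (y - c)) = radial r \<rho> c F y" if "y \<in> {y. r < norm (y - c) \<and> norm (y - c) < \<rho>}" for y
          using that by (simp add: radial_def)
      qed
      then show ?thesis using 2
        by (simp add: annulus_gradient_def sgn_div_norm divide_inverse mult.assoc)
    next
      case 3
      have "(radial r \<rho> c F has_derivative (\<lambda>h. 0)) (at x)"
      proof (rule has_derivative_transform_within_open[of "\<lambda>_. F \<rho>"])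
        show "open {y. \<rho> < norm (y - c)}" by (intro open_Collect_less continuous_intros)
        show "x \<in> {y. \<rho> < norm (y - c)}" using 3 by simp
        show "F \<rho> = radial r \<rho> c F y" if "y \<in> {y. \<rho> < norm (y - c)}" for y
          using that r by (simp add: radial_def)
      qed simp
      then show ?thesis using 3 by (simp add: annulus_gradient_def)
    qed
  qed
qed

lemma annulus_gradient_support: "norm c + \<rho> \<le> norm x \<Longrightarrow> annulus_gradient r \<rho> c F' x = 0"
  using norm_triangle_ineq2[of x c] by (auto simp: annulus_gradient_def)

text \<open>These products are the components of the radial fields s(x) (x - c). As \<open>s\<close>
  fixes \<open>D\<close> only almost everywhere, vanishing of \<open>D\<close> far out is a separate
  hypothesis; it keeps the product with the unbounded linear factor bounded everywhere.\<close>

lemma lip_deriv_mult_linear: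
  fixes c i :: "'a::euclidean_space"
  assumes s: "lip_deriv s D" and z: "\<And>x. R \<le> norm x \<Longrightarrow> D x = 0"
  shows "lip_deriv (\<lambda>x. ((x - c) \<bullet> i) * s x) (\<lambda>x. s x *\<^sub>R i + ((x - c) \<bullet> i) *\<^sub>R D x)"
  unfolding lip_deriv_def
proof (intro conjI)
  obtain L R' N where s1: "\<And>x y. \<bar>s x - s y\<bar> \<le> L * norm (x - y)" "R' > 0" "\<And>x. R' \<le> norm x \<Longrightarrow> s x = 0"
    "\<And>x. norm (D x) \<le> N" using lip_derivE[OF s] by blast
  obtain M where M: "\<And>x. \<bar>s x\<bar> \<le> M" using lip_deriv_bounded[OF s] by blast
  have pos: "0 \<le> M" "0 \<le> N" using M[of 0] norm_ge_zero[of "D 0"] s1(4)[of 0] by linarith+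
  define A where "A = (\<bar>R\<bar> + R' + norm c) * norm i"
  have A: "\<bar>(x - c) \<bullet> i\<bar> \<le> A" if "norm x < R' \<or> norm x < R" for x
  proof -
    have "norm (x - c) \<le> \<bar>R\<bar> + R' + norm c" using that s1(2) norm_triangle_ineq4[of x c] by linarith
    then have "norm (x - c) * norm i \<le> A" unfolding A_def by (intro mult_right_mono) auto
    then show ?thesis using Cauchy_Schwarz_ineq2[of "x - c" i] by linarith
  qed
  have A0: "A \<ge> 0" unfolding A_def using s1(2) by simp
  \<comment> \<open>It suffices that one of the two points lies where the linear factor is bounded:
    the increment is split so that this factor is evaluated at \<open>x\<close> alone.\<close>
  have asym: "\<bar>((x - c) \<bullet> i) * s x - ((y - c) \<bullet> i) * s y\<bar> \<le> (A * \<bar>L\<bar> + M * norm i) * norm (x - y)"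
    if x: "norm x < R'" for x y
  proof -
    have "((x - c) \<bullet> i) * s x - ((y - c) \<bullet> i) * s y = ((x - c) \<bullet> i) * (s x - s y) + ((x - y) \<bullet> i) * s y"
      by (simp add: inner_diff_left algebra_simps)
    then have "\<bar>((x - c) \<bullet> i) * s x - ((y - c) \<bullet> i) * s y\<bar> \<le> \<bar>(x - c) \<bullet> i\<bar> * \<bar>s x - s y\<bar> + \<bar>(x - y) \<bullet> i\<bar> * \<bar>s y\<bar>"
      by (simp add: abs_triangle_ineq flip: abs_mult)
    also have "\<dots> \<le> A * (\<bar>L\<bar> * norm (x - y)) + (norm (x - y) * norm i) * M"
    proof (intro add_mono mult_mono A M Cauchy_Schwarz_ineq2 A0)
      show "\<bar>s x - s y\<bar> \<le> \<bar>L\<bar> * norm (x - y)"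
        by (rule order_trans[OF s1(1)]) (intro mult_right_mono; simp)
    qed (use x in auto)
    finally show ?thesis by (simp add: algebra_simps)
  qed
  have "\<bar>((x - c) \<bullet> i) * s x - ((y - c) \<bullet> i) * s y\<bar> \<le> (A * \<bar>L\<bar> + M * norm i) * norm (x - y)" for x y
  proof -
    consider "norm x < R'" | "norm y < R'" | "R' \<le> norm x" "R' \<le> norm y" by linarith
    then show ?thesis
    proof cases
      case 1 then show ?thesis by (rule asym)
    next
      case 2
      from asym[OF this, of x] show ?thesis
        by (simp only: norm_minus_commute[of y x] abs_minus_commute[of "((y - c) \<bullet> i) * s y"])
    next
      case 3 then show ?thesis using s1(3) A0 pos by simp
    qed
  qed
  then show "\<exists>L. \<forall>x y. \<bar>((x - c) \<bullet> i) * s x - ((y - c) \<bullet> i) * s y\<bar> \<le> L * norm (x - y)" by blast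
  show "\<exists>R>0. \<forall>x. R \<le> norm x \<longrightarrow> ((x - c) \<bullet> i) * s x = 0" using s1(2,3) by (intro exI[of _ R']) simp
  show "(\<lambda>x. s x *\<^sub>R i + ((x - c) \<bullet> i) *\<^sub>R D x) \<in> borel_measurable borel"
    using lip_deriv_borel[OF s] lip_deriv_borel_D[OF s] by simp
  have "norm (s x *\<^sub>R i + ((x - c) \<bullet> i) *\<^sub>R D x) \<le> M * norm i + A * N" for x
  proof (intro norm_triangle_le add_mono)
    show "norm (s x *\<^sub>R i) \<le> M * norm i" using M[of x] by (simp add: mult_right_mono)
    show "norm (((x - c) \<bullet> i) *\<^sub>R D x) \<le> A * N"
    proof (cases "norm x < R")
      case True
      then show ?thesis using A[of x] s1(4)[of x] A0 by (simp add: mult_mono)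
    next
      case False
      then show ?thesis using z[of x] A0 pos by simp
    qed
  qed
  then show "\<exists>M. \<forall>x. norm (s x *\<^sub>R i + ((x - c) \<bullet> i) *\<^sub>R D x) \<le> M" by blast
  show "AE x in lborel. ((\<lambda>x. ((x - c) \<bullet> i) * s x) has_derivative (\<lambda>h. (s x *\<^sub>R i + ((x - c) \<bullet> i) *\<^sub>R D x) \<bullet> h)) (at x)"
    using lip_deriv_AE[OF s]
  proof eventually_elim
    case (elim x)
    have "((\<lambda>x. (x - c) \<bullet> i) has_derivative (\<lambda>h. h \<bullet> i)) (at x)" by (auto intro!: derivative_eq_intros)
    from has_derivative_mult[OF this elim] show ?case
      by (rule has_derivative_eq_rhs) (simp add: fun_eq_iff inner_add_left inner_commute[of i] mult.commute)
  qed
qed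

lemma L2_bounded_triple_integrable:
  fixes u v m :: "'a::euclidean_space \<Rightarrow> real"
  assumes "u \<in> L2" "v \<in> L2" "m \<in> borel_measurable borel" "\<And>x. \<bar>m x\<bar> \<le> M"
  shows "integrable lborel (\<lambda>x. m x * (u x * v x))"
  by (rule integrable_bounded_mult[OF L2_mult_integrable[OF assms(1,2)] assms(3,4)])

text \<open>The divergence of the field s(x) (x - c) is DIM s + (x - c) \<bullet> D; the coordinate
  identities are summed over an orthonormal basis. All radial computations below pass through this
  identity.\<close>

theorem H1_field_integration_by_parts:
  fixes c :: "'a::euclidean_space"
  assumes s: "lip_deriv s D" and z: "\<And>x. R \<le> norm x \<Longrightarrow> D x = 0"
    and u: "H1_pair u G" and v: "H1_pair v H"
  shows "(\<integral>x. (real DIM('a) * s x + (x - c) \<bullet> D x) * (u x * v x) \<partial>lborel)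
    = - ((\<integral>x. u x * (s x * (H x \<bullet> (x - c))) \<partial>lborel) + (\<integral>x. v x * (s x * (G x \<bullet> (x - c))) \<partial>lborel))"
proof -
  note Lu = H1_pair_L2[OF u] and Lv = H1_pair_L2[OF v]
  define q where "q i x = ((x - c) \<bullet> i) * s x" for i x
  define E where "E i x = s x *\<^sub>R i + ((x - c) \<bullet> i) *\<^sub>R D x" for i x
  have q: "lip_deriv (q i) (E i)" for i
    unfolding q_def[abs_def] E_def[abs_def] by (rule lip_deriv_mult_linear[OF s z])
  have i1: "integrable lborel (\<lambda>x. (E i x \<bullet> i) * (u x * v x))" if i: "i \<in> Basis" for i
  proof -
    obtain L R' N where N: "\<And>x y. \<bar>q i x - q i y\<bar> \<le> L * norm (x - y)" "R' > 0" "\<And>x. R' \<le> norm x \<Longrightarrow> q i x = 0"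
      "\<And>x. norm (E i x) \<le> N" using lip_derivE[OF q] by blast
    have "\<bar>E i x \<bullet> i\<bar> \<le> N" for x using Basis_le_norm[OF i, of "E i x"] N(4)[of x] by linarith
    then show ?thesis
      using lip_deriv_borel_D[OF q] by (intro L2_bounded_triple_integrable[OF Lu(1) Lv(1)]) auto
  qed
  have i2: "integrable lborel (\<lambda>x. q i x * (u x * (H x \<bullet> i)))" for i
  proof -
    obtain M where "\<And>x. \<bar>q i x\<bar> \<le> M" using lip_deriv_bounded[OF q] by blast
    then show ?thesis by (rule L2_bounded_triple_integrable[OF Lu(1) L2_inner_Basis[OF Lv(2)] lip_deriv_borel[OF q]])
  qed
  have i3: "integrable lborel (\<lambda>x. q i x * ((G x \<bullet> i) * v x))" for i
  proof -
    obtain M where "\<And>x. \<bar>q i x\<bar> \<le> M" using lip_deriv_bounded[OF q] by blast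
    then show ?thesis by (rule L2_bounded_triple_integrable[OF L2_inner_Basis[OF Lu(2)] Lv(1) lip_deriv_borel[OF q]])
  qed
  have div: "(\<Sum>i\<in>Basis. E i x \<bullet> i) = real DIM('a) * s x + (x - c) \<bullet> D x" for x
    by (simp add: E_def inner_add_left sum.distrib euclidean_inner[of "x - c" "D x"])
  have dotH: "(\<Sum>i\<in>Basis. q i x * (u x * (H x \<bullet> i))) = u x * (s x * (H x \<bullet> (x - c)))" for x
    by (simp add: q_def euclidean_inner[of "H x" "x - c"] sum_distrib_left mult_ac)
  have dotG: "(\<Sum>i\<in>Basis. q i x * ((G x \<bullet> i) * v x)) = v x * (s x * (G x \<bullet> (x - c)))" for x
    by (simp add: q_def euclidean_inner[of "G x" "x - c"] sum_distrib_left mult_ac)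
  have "(\<integral>x. (real DIM('a) * s x + (x - c) \<bullet> D x) * (u x * v x) \<partial>lborel)
      = (\<integral>x. (\<Sum>i\<in>Basis. (E i x \<bullet> i) * (u x * v x)) \<partial>lborel)"
    by (simp only: div[symmetric] sum_distrib_right)
  also have "\<dots> = (\<Sum>i\<in>Basis. \<integral>x. (E i x \<bullet> i) * (u x * v x) \<partial>lborel)"
    by (rule Bochner_Integration.integral_sum) (rule i1)
  also have "\<dots> = (\<Sum>i\<in>Basis. - ((\<integral>x. q i x * (u x * (H x \<bullet> i)) \<partial>lborel) + (\<integral>x. q i x * ((G x \<bullet> i) * v x) \<partial>lborel)))"
    by (intro sum.cong refl H1_integration_by_parts[OF q u v])
  also have "\<dots> = - ((\<Sum>i\<in>Basis. \<integral>x. q i x * (u x * (H x \<bullet> i)) \<partial>lborel) + (\<Sum>i\<in>Basis. \<integral>x. q i x * ((G x \<bullet> i) * v x) \<partial>lborel))"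
    by (simp only: sum.distrib sum_negf)
  also have "(\<Sum>i\<in>Basis. \<integral>x. q i x * (u x * (H x \<bullet> i)) \<partial>lborel) = (\<integral>x. u x * (s x * (H x \<bullet> (x - c))) \<partial>lborel)"
    unfolding dotH[symmetric] by (rule Bochner_Integration.integral_sum[symmetric]) (rule i2)
  also have "(\<Sum>i\<in>Basis. \<integral>x. q i x * ((G x \<bullet> i) * v x) \<partial>lborel) = (\<integral>x. v x * (s x * (G x \<bullet> (x - c))) \<partial>lborel)"
    unfolding dotG[symmetric] by (rule Bochner_Integration.integral_sum[symmetric]) (rule i3)
  finally show ?thesis .
qed

text \<open>A cutoff that is positive exactly in the ball, multiplied with a component of
  \<open>G\<close>, is orthogonal to all test functions. The corrector field is not small inside the
  holes, so the gradient has to be known to vanish there as well.\<close>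

lemma H1_gradient_vanishes:
  fixes c :: "'a::euclidean_space"
  assumes v: "H1_pair v G" and r: "r > 0" and z: "AE x in lborel. norm (x - c) < r \<longrightarrow> v x = 0"
  shows "AE x in lborel. norm (x - c) < r \<longrightarrow> G x = 0"
proof -
  define s where "s = radial (r/2) r c (\<lambda>t. r - t)"
  define D where "D = annulus_gradient (r/2) r c (\<lambda>t. - 1)"
  have s: "lip_deriv s D" unfolding s_def D_def
    by (rule radial_lip_deriv) (use r in \<open>auto intro!: derivative_eq_intros\<close>)
  have s0: "s x = 0" if "\<not> norm (x - c) < r" for x using that r by (simp add: s_def radial_def)
  have D0: "D x = 0" if "\<not> norm (x - c) < r" for x using that by (simp add: D_def annulus_gradient_def)
  have sp: "s x > 0" if "norm (x - c) < r" for x using that r by (simp add: s_def radial_def)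
  obtain M where M: "\<And>x. \<bar>s x\<bar> \<le> M" using lip_deriv_bounded[OF s] by blast
  note L = H1_pair_L2[OF v]
  have "AE x in lborel. s x * (G x \<bullet> i) = 0" if i: "i \<in> Basis" for i
  proof (rule L2_fundamental_lemma)
    show L2: "(\<lambda>x. s x * (G x \<bullet> i)) \<in> L2" by (rule L2_bounded_mult(1)[OF L2_inner_Basis[OF L(2)] lip_deriv_borel[OF s] M])
    fix \<phi> :: "'a \<Rightarrow> real" assume \<phi>: "\<phi> \<in> test_functions"
    have "AE x in lborel. (D x \<bullet> i) * (v x * \<phi> x) = 0" using z by eventually_elim (use D0 in auto)
    then have 1: "(\<integral>x. (D x \<bullet> i) * (v x * \<phi> x) \<partial>lborel) = 0" by (rule integral_eq_zero_AE)
    have "AE x in lborel. s x * (v x * (grad \<phi> x \<bullet> i)) = 0" using z by eventually_elim (use s0 in auto)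
    then have 2: "(\<integral>x. s x * (v x * (grad \<phi> x \<bullet> i)) \<partial>lborel) = 0" by (rule integral_eq_zero_AE)
    show "(\<integral>x. s x * (G x \<bullet> i) * \<phi> x \<partial>lborel) = 0"
      using H1_integration_by_parts[OF s v H1_pair_test[OF \<phi>] i] 1 2 by (simp add: mult.assoc)
  qed
  then have "AE x in lborel. \<forall>i\<in>Basis. s x * (G x \<bullet> i) = 0" by (intro AE_finite_allI) auto
  then show ?thesis
  proof eventually_elim
    case (elim x)
    show ?case
    proof
      assume x: "norm (x - c) < r"
      show "G x = 0" by (rule euclidean_eqI) (use elim sp[OF x] in auto)
    qed
  qed
qed

text \<open>With \<open>h(t) = 2 - r/t - r (t\<^sup>2 - r\<^sup>2) / (2 \<rho>\<^sup>3)\<close> the field \<open>q = \<nabla>h / h\<close> satisfies the Riccati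
  inequality \<open>div q + |q|\<^sup>2 = - 3 r / (\<rho>\<^sup>3 h) \<le> - 3 r / (2 \<rho>\<^sup>3)\<close> and has no normal component on the
  sphere of radius \<open>\<rho>\<close>; the inequality follows by expanding \<open>|\<nabla>v - v q|\<^sup>2 \<ge> 0\<close>.\<close>

theorem Poincare_ball:
  fixes c :: "'a::euclidean_space"
  assumes dim: "DIM('a) = 3" and r: "0 < r" "r < \<rho>" and p: "H1_pair v G"
    and z: "AE x in lborel. norm (x - c) \<le> r \<longrightarrow> v x = 0"
  shows "(3 * r / (2 * \<rho> ^ 3)) * (\<integral>x. indicator (ball c \<rho>) x * (v x)\<^sup>2 \<partial>lborel)
    \<le> (\<integral>x. indicator (ball c \<rho>) x * (norm (G x))\<^sup>2 \<partial>lborel)"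
proof -
  note L = H1_pair_L2[OF p]
  have \<rho>: "\<rho> > 0" using r by simp
  \<comment> \<open>\<open>h\<close> is the radial solution of \<Delta>h = - 3 r / \<rho>^3 with
    h(r) = 1 and h'(\<rho>) = 0. Below, \<open>N t\<close> is h'(t)/t, so that \<open>F\<close> is
    the factor of x - c in the field q.\<close>
  define h where "h t = 2 - r / t - r * (t\<^sup>2 - r\<^sup>2) / (2 * \<rho> ^ 3)" for t
  define N where "N t = r / t ^ 3 - r / \<rho> ^ 3" for t
  define F where "F t = N t / h t" for t
  define F' where "F' t = - (3 * r / t ^ 4) / h t - t * (F t)\<^sup>2" for t
  have h2: "h t \<le> 2" if "r \<le> t" for t
  proof -
    have "r\<^sup>2 \<le> t\<^sup>2" using that r by (intro power_mono) auto
    then have "0 \<le> r * (t\<^sup>2 - r\<^sup>2) / (2 * \<rho> ^ 3)" using r \<rho> by simp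
    moreover have "0 \<le> r / t" using that r by simp
    ultimately show ?thesis by (simp add: h_def)
  qed
  \<comment> \<open>The quadratic term and 1 - r/t both contain the factor t - r, and comparing the
    cofactors shows that the former is at most the latter.\<close>
  have h1: "1 \<le> h t" if t: "r \<le> t" "t \<le> \<rho>" for t
  proof -
    have tp: "t > 0" using t r by simp
    have "r * t\<^sup>2 \<le> \<rho> * \<rho>\<^sup>2" using t r tp by (intro mult_mono power_mono) auto
    then have rt: "r * t\<^sup>2 \<le> \<rho> ^ 3" by (simp add: power2_eq_square power3_eq_cube)
    have "r * (t\<^sup>2 - r\<^sup>2) / (2 * \<rho> ^ 3) = (t - r) * (r * (t + r) / (2 * \<rho> ^ 3))"
      by (simp add: power2_eq_square algebra_simps)
    also have "\<dots> \<le> (t - r) * (1 / t)"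
    proof (rule mult_left_mono)
      have "r * (t + r) * t \<le> r * (t + t) * t" using t r tp by (intro mult_left_mono mult_right_mono) auto
      also have "\<dots> = 2 * (r * t\<^sup>2)" by (simp add: power2_eq_square)
      also have "\<dots> \<le> 2 * \<rho> ^ 3" using rt by simp
      finally show "r * (t + r) / (2 * \<rho> ^ 3) \<le> 1 / t" using tp \<rho> by (simp add: field_simps)
    qed (use t in simp)
    also have "\<dots> = 1 - r / t" using tp by (simp add: field_simps)
    finally show ?thesis by (simp add: h_def)
  qed
  have hd: "(h has_real_derivative t * N t) (at t)" if "t > 0" for t
    unfolding h_def[abs_def] N_def
    using that \<rho> by (auto intro!: derivative_eq_intros simp: field_simps power2_eq_square power3_eq_cube)
  have Nd: "(N has_real_derivative - (3 * r / t ^ 4)) (at t)" if "t > 0" for t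
    unfolding N_def[abs_def]
    using that by (auto intro!: derivative_eq_intros simp: field_simps eval_nat_numeral)
  have Fd: "(F has_real_derivative F' t) (at t)" if t: "r \<le> t" "t \<le> \<rho>" for t
  proof -
    have tp: "t > 0" and hn: "h t \<noteq> 0" using t r h1[OF t] by auto
    have "(F has_real_derivative (- (3 * r / t ^ 4) * h t - N t * (t * N t)) / (h t * h t)) (at t)"
      unfolding F_def[abs_def] by (rule DERIV_divide[OF Nd[OF tp] hd[OF tp] hn])
    also have "(- (3 * r / t ^ 4) * h t - N t * (t * N t)) / (h t * h t) = F' t"
      using hn by (simp add: F'_def F_def diff_divide_distrib power2_eq_square)
    finally show ?thesis .
  qed
  have F'c: "continuous_on {r..\<rho>} F'"
  proof -
    have nz: "t \<noteq> 0" "h t \<noteq> 0" if "t \<in> {r..\<rho>}" for t using that r h1[of t] by auto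
    have hc: "continuous_on {r..\<rho>} h" unfolding h_def[abs_def] using nz \<rho> by (intro continuous_intros) auto
    have Nc: "continuous_on {r..\<rho>} N" unfolding N_def[abs_def] using nz \<rho> by (intro continuous_intros) auto
    have Fc: "continuous_on {r..\<rho>} F" unfolding F_def[abs_def] using nz by (intro continuous_intros hc Nc) auto
    show ?thesis unfolding F'_def[abs_def] using nz by (intro continuous_intros hc Fc) auto
  qed
  have F'b: "F' \<in> borel_measurable borel"
    unfolding F'_def[abs_def] F_def N_def h_def by measurable
  define s where "s = radial r \<rho> c F"
  define D where "D = annulus_gradient r \<rho> c F'"
  have s: "lip_deriv s D"
    unfolding s_def D_def by (rule radial_lip_deriv[OF r Fd F'c F'b]) (simp_all add: F_def N_def)
  have Dz: "D x = 0" if "norm c + \<rho> \<le> norm x" for x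
    unfolding D_def by (rule annulus_gradient_support[OF that])
  obtain M where M: "\<And>x. \<bar>s x\<bar> \<le> M" using lip_deriv_bounded[OF s] by blast
  have M0: "0 \<le> M" using M[of 0] by linarith
  obtain L' R' N' where N': "\<And>x y. \<bar>s x - s y\<bar> \<le> L' * norm (x - y)" "R' > 0" "\<And>x. R' \<le> norm x \<Longrightarrow> s x = 0"
    "\<And>x. norm (D x) \<le> N'" using lip_derivE[OF s] by blast
  have sz: "s x = 0" if "\<not> norm (x - c) < \<rho>" for x
    using that r by (simp add: s_def radial_def F_def N_def)
  have Dz': "D x = 0" if "\<not> norm (x - c) < \<rho>" for x using that by (simp add: D_def annulus_gradient_def)
  note [measurable] = lip_deriv_borel[OF s] lip_deriv_borel_D[OF s] L2_borel[OF L(1)] L2_borel[OF L(2)]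
  define Q where "Q x = s x *\<^sub>R (x - c)" for x
  have Qz: "Q x = 0" if "\<not> norm (x - c) < \<rho>" for x using sz[OF that] by (simp add: Q_def)
  have Qn: "norm (Q x) \<le> M * \<rho>" for x
  proof (cases "norm (x - c) < \<rho>")
    case True
    then show ?thesis using M[of x] M0 by (simp add: Q_def mult_mono)
  next
    case False
    then show ?thesis using Qz M0 \<rho> by simp
  qed
  have vQ: "(\<lambda>x. v x *\<^sub>R Q x) \<in> L2"
  proof (rule L2_dominated(1)[OF L2_scaleR[OF L(1), of "M * \<rho>"]])
    show "(\<lambda>x. v x *\<^sub>R Q x) \<in> borel_measurable borel" unfolding Q_def by measurable
    show "norm (v x *\<^sub>R Q x) \<le> norm ((M * \<rho>) *\<^sub>R v x)" for x
      using mult_left_mono[OF Qn[of x], of "\<bar>v x\<bar>"] M0 \<rho> by (simp add: abs_mult mult_ac)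
  qed
  define w where "w x = (v x *\<^sub>R Q x) \<bullet> G x" for x
  have iw: "integrable lborel w" unfolding w_def[abs_def] by (rule L2_inner_integrable[OF vQ L(2)])
  define k where "k x = (norm (v x *\<^sub>R Q x))\<^sup>2" for x
  have ik: "integrable lborel k" unfolding k_def[abs_def] by (rule L2_integrable[OF vQ])
  define e where "e x = (real DIM('a) * s x + (x - c) \<bullet> D x) * (v x * v x)" for x
  have ie: "integrable lborel e"
    unfolding e_def[abs_def]
  proof (rule L2_bounded_triple_integrable[OF L(1) L(1)])
    show "\<bar>real DIM('a) * s x + (x - c) \<bullet> D x\<bar> \<le> 3 * M + \<rho> * N'" for x
    proof -
      have "\<bar>(x - c) \<bullet> D x\<bar> \<le> \<rho> * N'"
      proof (cases "norm (x - c) < \<rho>")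
        case True
        then have "norm (x - c) * norm (D x) \<le> \<rho> * N'" using N'(4)[of x] \<rho> by (intro mult_mono) auto
        then show ?thesis using Cauchy_Schwarz_ineq2[of "x - c" "D x"] by linarith
      next
        case False
        have "0 \<le> N'" using N'(4)[of 0] norm_ge_zero[of "D 0"] by linarith
        then show ?thesis using Dz'[OF False] \<rho> by simp
      qed
      then show ?thesis using M[of x] dim by simp
    qed
  qed measurable
  let ?I = "\<lambda>x. indicator (ball c \<rho>) x :: real"
  have Ib: "?I \<in> borel_measurable borel" by (rule borel_measurable_indicator) simp
  have iv: "integrable lborel (\<lambda>x. ?I x * (v x)\<^sup>2)"
    by (rule integrable_bounded_mult[OF L2_integrable_real[OF L(1)] Ib, of 1]) (simp add: indicator_def)
  have iG: "integrable lborel (\<lambda>x. ?I x * (norm (G x))\<^sup>2)"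
    by (rule integrable_bounded_mult[OF L2_integrable[OF L(2)] Ib, of 1]) (simp add: indicator_def)
  have "(\<integral>x. e x \<partial>lborel) = - ((\<integral>x. v x * (s x * (G x \<bullet> (x - c))) \<partial>lborel) + (\<integral>x. v x * (s x * (G x \<bullet> (x - c))) \<partial>lborel))"
    unfolding e_def by (rule H1_field_integration_by_parts[OF s Dz p p])
  also have "(\<lambda>x. v x * (s x * (G x \<bullet> (x - c)))) = w"
    by (rule ext) (simp add: w_def Q_def inner_commute)
  finally have ew: "(\<integral>x. e x \<partial>lborel) = - 2 * (\<integral>x. w x \<partial>lborel)" by simp
  have "(3 * r / (2 * \<rho> ^ 3)) * (\<integral>x. ?I x * (v x)\<^sup>2 \<partial>lborel)
      = (\<integral>x. (3 * r / (2 * \<rho> ^ 3)) * (?I x * (v x)\<^sup>2) \<partial>lborel)"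
    by simp
  also have "\<dots> \<le> (\<integral>x. - e x - k x \<partial>lborel)"
  proof (rule integral_mono_AE)
    show "AE x in lborel. (3 * r / (2 * \<rho> ^ 3)) * (?I x * (v x)\<^sup>2) \<le> - e x - k x"
      using z
    proof eventually_elim
      case (elim x)
      consider "norm (x - c) \<le> r" | "r < norm (x - c)" "norm (x - c) < \<rho>" | "\<not> norm (x - c) < \<rho>" by linarith
      then show ?case
      proof cases
        case 1
        then show ?thesis using elim by (simp add: e_def k_def)
      next
        case 2
        define t where "t = norm (x - c)"
        have t: "r < t" "t < \<rho>" "t > 0" using 2 r by (auto simp: t_def)
        have hp: "1 \<le> h t" "h t \<le> 2" using h1[of t] h2[of t] t by auto
        have sF: "s x = F t" using t by (simp add: s_def radial_def flip: t_def)
        have xD: "(x - c) \<bullet> D x = t * F' t"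
        proof -
          have "(x - c) \<bullet> D x = (F' t / t) * (t * t)"
            using t by (simp add: D_def annulus_gradient_def power2_norm_eq_inner[symmetric] power2_eq_square flip: t_def)
          then show ?thesis using t by simp
        qed
        have kx: "k x = (t * F t)\<^sup>2 * (v x)\<^sup>2"
          by (simp add: k_def Q_def sF power_mult_distrib flip: t_def)
        \<comment> \<open>The square in |q|^2 cancels against the one contained in t F'; what is
          left is the Laplacian of \<open>h\<close> divided by \<open>h\<close>.\<close>
        have alg: "3 * F t + t * F' t + (t * F t)\<^sup>2 = - (3 * r / (\<rho> ^ 3 * h t))"
        proof -
          have "t * (- (3 * r / t ^ 4) / h t) = - (3 * (r / t ^ 3)) / h t"
            using t by (simp add: field_simps eval_nat_numeral)
          then have "3 * F t + t * F' t + (t * F t)\<^sup>2 = 3 * F t - 3 * (r / t ^ 3) / h t"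
            unfolding F'_def by (simp add: power2_eq_square algebra_simps)
          also have "\<dots> = - (3 * r / (\<rho> ^ 3 * h t))"
            unfolding F_def N_def using hp \<rho> by (simp add: field_simps)
          finally show ?thesis .
        qed
        have "- e x - k x = - ((3 * F t + t * F' t + (t * F t)\<^sup>2) * (v x)\<^sup>2)"
          unfolding e_def kx sF xD dim by (simp add: power2_eq_square algebra_simps)
        also have "\<dots> = (3 * r / (\<rho> ^ 3 * h t)) * (v x)\<^sup>2" unfolding alg by simp
        also have "\<dots> \<ge> (3 * r / (2 * \<rho> ^ 3)) * (v x)\<^sup>2"
        proof (rule mult_right_mono)
          have "\<rho> ^ 3 * h t \<le> 2 * \<rho> ^ 3" using hp \<rho> by simp
          then show "3 * r / (2 * \<rho> ^ 3) \<le> 3 * r / (\<rho> ^ 3 * h t)"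
            using hp \<rho> r by (intro divide_left_mono mult_pos_pos) auto
        qed simp
        finally show ?thesis using 2 by (simp add: dist_norm norm_minus_commute)
      next
        case 3
        then show ?thesis using sz[OF 3] Dz'[OF 3] Qz[OF 3]
          by (simp add: e_def k_def dist_norm norm_minus_commute)
      qed
    qed
  qed (use iv ie ik in auto)
  also have "\<dots> = (\<integral>x. 2 * w x - k x \<partial>lborel)"
    using ew ie ik iw by simp
  also have "\<dots> \<le> (\<integral>x. ?I x * (norm (G x))\<^sup>2 \<partial>lborel)"
  proof (rule integral_mono)
    fix x
    show "2 * w x - k x \<le> ?I x * (norm (G x))\<^sup>2"
    proof (cases "norm (x - c) < \<rho>")
      case True
      have "0 \<le> (norm (G x - v x *\<^sub>R Q x))\<^sup>2" by simp
      also have "\<dots> = (norm (G x))\<^sup>2 - 2 * w x + k x"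
        unfolding w_def k_def power2_norm_eq_inner
        by (simp add: inner_diff_left inner_diff_right inner_commute algebra_simps)
      finally show ?thesis using True by (simp add: dist_norm norm_minus_commute)
    next
      case False
      then show ?thesis using Qz[OF False] by (simp add: w_def k_def)
    qed
  qed (use iG iw ik in auto)
  finally show ?thesis .
qed

section \<open>Packing and covering by the lattice\<close>

lemma cubic_lattice_separated:
  fixes x y :: "real ^ 'n"
  assumes "x \<in> cubic_lattice d" "y \<in> cubic_lattice d" "x \<noteq> y" "d > 0"
  shows "d \<le> norm (x - y)"
proof -
  obtain i where i: "x $ i \<noteq> y $ i" using assms(3) by (auto simp: vec_eq_iff)
  obtain k l :: int where kl: "x $ i = d * of_int k" "y $ i = d * of_int l"
    using assms(1,2) unfolding cubic_lattice_def by blast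
  have "1 \<le> \<bar>k - l\<bar>" using i kl by auto
  then have "1 \<le> \<bar>real_of_int (k - l)\<bar>" by linarith
  then have "d * 1 \<le> d * \<bar>real_of_int (k - l)\<bar>" using assms(4) by (intro mult_left_mono) auto
  also have "\<dots> = \<bar>(x - y) $ i\<bar>" using kl assms(4) by (simp add: abs_mult flip: right_diff_distrib)
  also have "\<dots> \<le> norm (x - y)" by (rule component_le_norm_cart)
  finally show ?thesis by simp
qed

text \<open>A volume argument: balls of radius d/2 about the points are disjoint and lie in a ball
  of radius R + d/2. It yields finiteness of the local lattice sums, the overlap number 27, and the
  count of holes near a support.\<close>

lemma card_separated_le:
  fixes K :: "'a::euclidean_space set"
  assumes K: "finite K" "\<And>x y. x \<in> K \<Longrightarrow> y \<in> K \<Longrightarrow> x \<noteq> y \<Longrightarrow> d \<le> norm (x - y)"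
    and R: "\<And>x. x \<in> K \<Longrightarrow> norm (x - c) \<le> R" "0 \<le> R" and d: "d > 0"
  shows "real (card K) * (d / 2) ^ DIM('a) \<le> (R + d / 2) ^ DIM('a)"
proof -
  have fin: "integrable lborel (indicator (ball a \<epsilon>) :: 'a \<Rightarrow> real)" for a \<epsilon>
    by (rule integrable_real_indicator) (simp_all add: emeasure_lborel_ball_finite[unfolded infinity_ennreal_def] emeasure_lborel_ball_finite)
  have int: "(\<integral>x. indicator (ball a \<epsilon>) x \<partial>lborel) = unit_ball_vol DIM('a) * \<epsilon> ^ DIM('a)" if "\<epsilon> \<ge> 0" for a :: 'a and \<epsilon>
    using content_ball[OF that, of a] emeasure_lborel_ball_finite[of a \<epsilon>] by simp
  have "(\<Sum>k\<in>K. indicator (ball k (d / 2)) x) \<le> (indicator (ball c (R + d / 2)) x :: real)" for x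
  proof (cases "\<exists>k\<in>K. x \<in> ball k (d / 2)")
    case True
    then obtain k where k: "k \<in> K" "x \<in> ball k (d / 2)" by blast
    have "indicator (ball l (d / 2)) x = (0::real)" if l: "l \<in> K" "l \<noteq> k" for l
    proof (rule ccontr)
      assume "indicator (ball l (d / 2)) x \<noteq> (0::real)"
      then have "dist l x < d / 2" by (simp add: indicator_def split: if_splits)
      then have "norm (l - k) < d" using k(2) dist_triangle_half_l[of l x d k] by (simp add: dist_norm norm_minus_commute)
      then show False using K(2)[OF l(1) k(1) l(2)] by simp
    qed
    then have "(\<Sum>l\<in>K. indicator (ball l (d / 2)) x) = (\<Sum>l\<in>{k}. indicator (ball l (d / 2)) x :: real)"
      using K(1) k(1) by (intro sum.mono_neutral_right) auto
    moreover have "x \<in> ball c (R + d / 2)"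
      using k(2) R(1)[OF k(1)] dist_triangle[of c x k] by (simp add: dist_norm norm_minus_commute)
    ultimately show ?thesis using k(2) by simp
  next
    case False
    then have "(\<Sum>k\<in>K. indicator (ball k (d / 2)) x) = (0::real)" by (intro sum.neutral) (auto simp: indicator_def)
    then show ?thesis by simp
  qed
  then have "(\<integral>x. (\<Sum>k\<in>K. indicator (ball k (d / 2)) x) \<partial>lborel) \<le> (\<integral>x. indicator (ball c (R + d / 2)) x \<partial>lborel :: real)"
    using fin by (intro integral_mono Bochner_Integration.integrable_sum) auto
  then have "unit_ball_vol DIM('a) * (real (card K) * (d / 2) ^ DIM('a)) \<le> unit_ball_vol DIM('a) * (R + d / 2) ^ DIM('a)"
    using fin int d R(2) by (simp add: Bochner_Integration.integral_sum mult_ac)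
  then show ?thesis by (rule mult_left_le_imp_le) simp
qed

lemma finite_lattice_ball:
  fixes c :: "real ^ 'n"
  assumes d: "d > 0"
  shows "finite {k \<in> cubic_lattice d. norm (k - c) \<le> R}"
proof (cases "R \<ge> 0")
  case True
  show ?thesis
  proof (rule finite_if_finite_subsets_card_bdd[THEN conjunct1])
    fix K assume K: "K \<subseteq> {k \<in> cubic_lattice d. norm (k - c) \<le> R}" "finite K"
    have "real (card K) * (d / 2) ^ DIM(real ^ 'n) \<le> (R + d / 2) ^ DIM(real ^ 'n)"
      using K True d by (intro card_separated_le[OF K(2)]) (auto intro: cubic_lattice_separated)
    then have "real (card K) \<le> (R + d / 2) ^ DIM(real ^ 'n) / (d / 2) ^ DIM(real ^ 'n)"
      using d by (simp add: pos_le_divide_eq)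
    then show "card K \<le> nat \<lfloor>(R + d / 2) ^ DIM(real ^ 'n) / (d / 2) ^ DIM(real ^ 'n)\<rfloor>"
      by (rule le_nat_floor)
  qed
next
  case False
  have "norm (k - c) \<le> R \<Longrightarrow> False" for k using False norm_ge_zero[of "k - c"] by linarith
  then have "{k \<in> cubic_lattice d. norm (k - c) \<le> R} = {}" by blast
  then show ?thesis by (simp only: finite.emptyI)
qed

text \<open>Rounding every coordinate leaves an error of at most d/2 in each, hence a distance of at
  most (sqrt 3 / 2) d. This is why the covering uses balls of radius d, whereas the balls of radius
  d/2 are disjoint.\<close>

lemma lattice_cover:
  fixes x :: "real ^ 3"
  assumes d: "d > 0"
  obtains k where "k \<in> cubic_lattice d" "norm (x - k) < d"
proof
  define k :: "real ^ 3" where "k = (\<chi> i. d * of_int (round (x $ i / d)))"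
  show "k \<in> cubic_lattice d" by (auto simp: cubic_lattice_def k_def)
  have "((x - k) $ i)\<^sup>2 \<le> (d / 2)\<^sup>2" for i
  proof -
    have "\<bar>of_int (round (x $ i / d)) - x $ i / d\<bar> \<le> 1 / 2" by (rule of_int_round_abs_le)
    then have "d * \<bar>of_int (round (x $ i / d)) - x $ i / d\<bar> \<le> d * (1 / 2)" using d by (intro mult_left_mono) auto
    moreover have "d * \<bar>of_int (round (x $ i / d)) - x $ i / d\<bar> = \<bar>(x - k) $ i\<bar>"
    proof -
      have "d * \<bar>of_int (round (x $ i / d)) - x $ i / d\<bar> = \<bar>d * (of_int (round (x $ i / d)) - x $ i / d)\<bar>"
        using d by (simp add: abs_mult)
      also have "d * (of_int (round (x $ i / d)) - x $ i / d) = k $ i - x $ i" using d by (simp add: k_def right_diff_distrib)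
      finally show ?thesis by simp
    qed
    ultimately have "\<bar>(x - k) $ i\<bar> \<le> \<bar>d / 2\<bar>" using d by simp
    then show ?thesis by (simp only: abs_le_square_iff)
  qed
  then have "(\<Sum>i\<in>UNIV. ((x - k) $ i)\<^sup>2) \<le> of_nat (card (UNIV :: 3 set)) * (d / 2)\<^sup>2"
    by (intro sum_bounded_above) auto
  moreover have "(norm (x - k))\<^sup>2 = (\<Sum>i\<in>UNIV. ((x - k) $ i)\<^sup>2)"
    unfolding power2_norm_eq_inner inner_vec_def by (simp add: power2_eq_square)
  ultimately have "(norm (x - k))\<^sup>2 \<le> 3 * (d / 2)\<^sup>2" by simp
  also have "\<dots> < d\<^sup>2" using d by (simp add: power2_eq_square)
  finally show "norm (x - k) < d" by (rule power2_less_imp_less) (use d in simp)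
qed

text \<open>The balls of radius d about the lattice points cover the space, and by packing at most
  (3d/2)^3 / (d/2)^3 = 27 of them meet in a point. The inequality on single balls is summed over
  finitely many of them before exhausting the space.\<close>

theorem Poincare_perforated:
  fixes v :: "real ^ 3 \<Rightarrow> real"
  assumes r: "0 < r" "r < d" and p: "H1_pair v G" and z: "AE x in lborel. x \<in> holes d r \<longrightarrow> v x = 0"
  shows "(3 * r / (2 * d ^ 3)) * (l2 v)\<^sup>2 \<le> 27 * (l2 G)\<^sup>2"
proof -
  note L = H1_pair_L2[OF p]
  have d: "d > 0" using r by simp
  define \<Lambda> where "\<Lambda> = 3 * r / (2 * d ^ 3)"
  have \<Lambda>: "\<Lambda> \<ge> 0" using r d by (simp add: \<Lambda>_def)
  let ?I = "\<lambda>k x. indicator (ball (k :: real ^ 3) d) x :: real"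
  have Ib: "?I k \<in> borel_measurable borel" for k by (rule borel_measurable_indicator) simp
  have iv: "integrable lborel (\<lambda>x. ?I k x * (v x)\<^sup>2)" for k
    by (rule integrable_bounded_mult[OF L2_integrable_real[OF L(1)] Ib, of _ 1]) (simp add: indicator_def)
  have iG: "integrable lborel (\<lambda>x. ?I k x * (norm (G x))\<^sup>2)" for k
    by (rule integrable_bounded_mult[OF L2_integrable[OF L(2)] Ib, of _ 1]) (simp add: indicator_def)
  have step: "\<Lambda> * (\<integral>x. indicator (ball 0 (real n)) x * (v x)\<^sup>2 \<partial>lborel) \<le> 27 * (l2 G)\<^sup>2" for n
  proof -
    \<comment> \<open>These lattice points include all whose balls of radius d meet the ball of
      radius n about the origin.\<close>
    define K where "K = {k :: real ^ 3. k \<in> cubic_lattice d \<and> norm (k - 0) \<le> real n + d}"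
    have fK: "finite K" unfolding K_def by (rule finite_lattice_ball[OF d])
    have "\<Lambda> * (\<integral>x. indicator (ball 0 (real n)) x * (v x)\<^sup>2 \<partial>lborel) \<le> \<Lambda> * (\<integral>x. (\<Sum>k\<in>K. ?I k x * (v x)\<^sup>2) \<partial>lborel)"
    proof (intro mult_left_mono \<Lambda> integral_mono)
      have "(indicator (ball 0 (real n)) :: real ^ 3 \<Rightarrow> real) \<in> borel_measurable borel"
        by (rule borel_measurable_indicator) simp
      then show "integrable lborel (\<lambda>x. indicator (ball 0 (real n)) x * (v x)\<^sup>2)"
        by (rule integrable_bounded_mult[OF L2_integrable_real[OF L(1)], of _ 1]) (simp add: indicator_def)
      show "integrable lborel (\<lambda>x. \<Sum>k\<in>K. ?I k x * (v x)\<^sup>2)" by (rule Bochner_Integration.integrable_sum) (rule iv)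
      fix x :: "real ^ 3"
      show "indicator (ball 0 (real n)) x * (v x)\<^sup>2 \<le> (\<Sum>k\<in>K. ?I k x * (v x)\<^sup>2)"
      proof (cases "x \<in> ball 0 (real n)")
        case True
        obtain k where k: "k \<in> cubic_lattice d" "norm (x - k) < d" using lattice_cover[OF d, of x] by blast
        have "norm k \<le> norm x + norm (x - k)" using norm_triangle_ineq4[of x "x - k"] by simp
        then have "k \<in> K" using k True by (simp add: K_def)
        then have "?I k x * (v x)\<^sup>2 \<le> (\<Sum>k\<in>K. ?I k x * (v x)\<^sup>2)" using fK by (intro member_le_sum) auto
        then show ?thesis using True k(2) by (simp add: dist_norm norm_minus_commute)
      next
        case False
        then show ?thesis by (simp add: sum_nonneg)
      qed
    qed
    also have "\<dots> = (\<Sum>k\<in>K. \<Lambda> * (\<integral>x. ?I k x * (v x)\<^sup>2 \<partial>lborel))"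
      using iv by (simp add: Bochner_Integration.integral_sum sum_distrib_left)
    also have "\<dots> \<le> (\<Sum>k\<in>K. \<integral>x. ?I k x * (norm (G x))\<^sup>2 \<partial>lborel)"
    proof (rule sum_mono)
      fix k assume k: "k \<in> K"
      have "AE x in lborel. norm (x - k) \<le> r \<longrightarrow> v x = 0"
        using z
      proof eventually_elim
        case (elim x)
        show ?case
        proof
          assume "norm (x - k) \<le> r"
          then have "x \<in> holes d r" using k by (auto simp: holes_def K_def dist_norm norm_minus_commute)
          with elim show "v x = 0" by simp
        qed
      qed
      then show "\<Lambda> * (\<integral>x. ?I k x * (v x)\<^sup>2 \<partial>lborel) \<le> (\<integral>x. ?I k x * (norm (G x))\<^sup>2 \<partial>lborel)"
        unfolding \<Lambda>_def by (intro Poincare_ball[OF _ r p]) simp_all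
    qed
    also have "\<dots> = (\<integral>x. (\<Sum>k\<in>K. ?I k x * (norm (G x))\<^sup>2) \<partial>lborel)"
      using iG by (simp add: Bochner_Integration.integral_sum)
    also have "\<dots> \<le> (\<integral>x. 27 * (norm (G x))\<^sup>2 \<partial>lborel)"
    proof (rule integral_mono)
      show "integrable lborel (\<lambda>x. \<Sum>k\<in>K. ?I k x * (norm (G x))\<^sup>2)" by (rule Bochner_Integration.integrable_sum) (rule iG)
      show "integrable lborel (\<lambda>x. 27 * (norm (G x))\<^sup>2)" using L2_integrable[OF L(2)] by simp
      fix x :: "real ^ 3"
      define K' where "K' = {k \<in> K. x \<in> ball k d}"
      have "real (card K') * (d / 2) ^ DIM(real ^ 3) \<le> (d + d / 2) ^ DIM(real ^ 3)"
      proof (rule card_separated_le)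
        show "finite K'" using fK by (simp add: K'_def)
        show "d \<le> norm (a - b)" if "a \<in> K'" "b \<in> K'" "a \<noteq> b" for a b
          using that d by (intro cubic_lattice_separated) (auto simp: K'_def K_def)
        show "norm (k - x) \<le> d" if "k \<in> K'" for k using that by (auto simp: K'_def dist_norm)
      qed (use d in auto)
      moreover have "(d / 2) ^ 3 = d ^ 3 / 8" "(d + d / 2) ^ 3 = 27 * d ^ 3 / 8"
        by (simp_all add: power3_eq_cube)
      ultimately have "real (card K') * d ^ 3 \<le> 27 * d ^ 3" by simp
      then have c27: "real (card K') \<le> 27" using d by simp
      have "(\<Sum>k\<in>K. ?I k x) = (\<Sum>k\<in>K'. 1)"
        unfolding K'_def using fK by (simp add: indicator_def sum.If_cases Int_def)
      then have "(\<Sum>k\<in>K. ?I k x) \<le> 27" using c27 by simp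
      then have "(\<Sum>k\<in>K. ?I k x) * (norm (G x))\<^sup>2 \<le> 27 * (norm (G x))\<^sup>2" by (rule mult_right_mono) simp
      then show "(\<Sum>k\<in>K. ?I k x * (norm (G x))\<^sup>2) \<le> 27 * (norm (G x))\<^sup>2" by (simp only: sum_distrib_right)
    qed
    also have "\<dots> = 27 * (l2 G)\<^sup>2" by (simp add: l2_sq)
    finally show ?thesis .
  qed
  have "(\<lambda>n. \<integral>x. indicator (ball 0 (real n)) x * (v x)\<^sup>2 \<partial>lborel) \<longlonglongrightarrow> (\<integral>x. (v x)\<^sup>2 \<partial>lborel)"
  proof (rule integral_dominated_convergence[OF _ _ L2_integrable_real[OF L(1)]])
    show "AE x in lborel. (\<lambda>n. indicator (ball 0 (real n)) x * (v x)\<^sup>2) \<longlonglongrightarrow> (v x)\<^sup>2"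
    proof (rule AE_I2)
      fix x :: "real ^ 3"
      obtain m :: nat where m: "norm x < real m" using reals_Archimedean2 by blast
      have "\<forall>\<^sub>F n in sequentially. indicator (ball 0 (real n)) x * (v x)\<^sup>2 = (v x)\<^sup>2"
        using eventually_ge_at_top[of m]
      proof eventually_elim
        case (elim n)
        then have "norm x < real n" using m by (meson of_nat_mono order_less_le_trans)
        then show ?case by simp
      qed
      then show "(\<lambda>n. indicator (ball 0 (real n)) x * (v x)\<^sup>2) \<longlonglongrightarrow> (v x)\<^sup>2" by (rule tendsto_eventually)
    qed
    show "AE x in lborel. norm (indicator (ball 0 (real n)) x * (v x)\<^sup>2) \<le> (v x)\<^sup>2" for n
      by (rule AE_I2) (simp add: indicator_def)
    have [measurable]: "(indicator (ball 0 (real n)) :: real ^ 3 \<Rightarrow> real) \<in> borel_measurable borel" for n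
      by (rule borel_measurable_indicator) simp
    note [measurable] = L2_borel[OF L(1)]
    show "(\<lambda>x. indicator (ball 0 (real n)) x * (v x)\<^sup>2) \<in> borel_measurable lborel" for n by measurable
    show "(\<lambda>x. (v x)\<^sup>2) \<in> borel_measurable lborel" by measurable
  qed
  then have "(\<lambda>n. \<Lambda> * (\<integral>x. indicator (ball 0 (real n)) x * (v x)\<^sup>2 \<partial>lborel)) \<longlonglongrightarrow> \<Lambda> * (\<integral>x. (v x)\<^sup>2 \<partial>lborel)"
    by (rule tendsto_mult_left)
  then have "\<Lambda> * (\<integral>x. (v x)\<^sup>2 \<partial>lborel) \<le> 27 * (l2 G)\<^sup>2" by (rule LIMSEQ_le_const2) (use step in blast)
  then show ?thesis by (simp add: \<Lambda>_def l2_sq)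
qed

section \<open>Averages over the lattice\<close>

lemma countable_cubic_lattice:
  assumes "d > 0" shows "countable (cubic_lattice d :: (real ^ 'n) set)"
proof -
  have "cubic_lattice d = (\<Union>n::nat. {k :: real ^ 'n. k \<in> cubic_lattice d \<and> norm (k - 0) \<le> real n})"
  proof (intro set_eqI iffI)
    fix x :: "real ^ 'n" assume x: "x \<in> cubic_lattice d"
    obtain n :: nat where "norm x \<le> real n" using real_arch_simple by blast
    with x show "x \<in> (\<Union>n::nat. {k. k \<in> cubic_lattice d \<and> norm (k - 0) \<le> real n})" by auto
  qed auto
  moreover have "countable (\<Union>n::nat. {k :: real ^ 'n. k \<in> cubic_lattice d \<and> norm (k - 0) \<le> real n})"
    by (rule countable_UN) (simp, rule countable_finite[OF finite_lattice_ball[OF assms]])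
  ultimately show ?thesis by simp
qed

text \<open>Half-open, so that the lattice translates tile the space without overlap.\<close>

definition lattice_cell :: "real \<Rightarrow> (real ^ 'n) set" where
  "lattice_cell d = {y. \<forall>i. 0 \<le> y $ i \<and> y $ i < d}"

lemma lattice_cell_borel: "(lattice_cell d :: (real ^ 'n) set) \<in> sets borel"
proof -
  have "(lattice_cell d :: (real ^ 'n) set) = (\<Inter>i. {y. 0 \<le> y $ i} \<inter> {y. y $ i < d})" by (auto simp: lattice_cell_def)
  moreover have "(\<Inter>i. {y. 0 \<le> y $ i} \<inter> {y. y $ i < d}) \<in> sets (borel :: (real ^ 'n) measure)"
    by (intro sets.countable_INT' sets.Int borel_closed borel_open closed_Collect_le open_Collect_less continuous_intros) auto
  ultimately show ?thesis by simp
qed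

text \<open>Sums over the lattice are written as integrals against counting measure, so that Tonelli
  exchanges them with Lebesgue integrals. At each point only one term is nonzero.\<close>

lemma nn_integral_count_space_unique:
  assumes "k \<in> A" "\<And>l. l \<in> A \<Longrightarrow> l \<noteq> k \<Longrightarrow> f l = (0::ennreal)"
  shows "(\<integral>\<^sup>+l. f l \<partial>count_space A) = f k"
proof -
  have "(\<integral>\<^sup>+l. f l \<partial>count_space A) = (\<integral>\<^sup>+l. f k * indicator {k} l \<partial>count_space A)"
    by (intro nn_integral_cong) (use assms(2) in \<open>auto simp: indicator_def\<close>)
  also have "\<dots> = f k * emeasure (count_space A) {k}"
    using assms(1) by (intro nn_integral_cmult_indicator) auto
  also have "\<dots> = f k" using assms(1) by simp
  finally show ?thesis .
qed

lemma lattice_cell_tiling: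
  fixes w :: "real ^ 'n"
  assumes d: "d > 0"
  shows "(\<integral>\<^sup>+k. indicator (lattice_cell d) (w + k) \<partial>count_space (cubic_lattice d)) = 1"
proof -
  define k :: "real ^ 'n" where "k = (\<chi> i. d * of_int (- \<lfloor>w $ i / d\<rfloor>))"
  have k: "k \<in> cubic_lattice d" 
  proof -
    have "k $ i = d * of_int (- \<lfloor>w $ i / d\<rfloor>)" for i by (simp add: k_def)
    then show ?thesis unfolding cubic_lattice_def by blast
  qed
  have kc: "w + k \<in> lattice_cell d"
    unfolding lattice_cell_def
  proof (intro CollectI allI)
    fix i
    have f: "of_int \<lfloor>w $ i / d\<rfloor> \<le> w $ i / d" "w $ i / d < of_int \<lfloor>w $ i / d\<rfloor> + 1" by linarith+
    have "d * of_int \<lfloor>w $ i / d\<rfloor> \<le> d * (w $ i / d)" by (rule mult_left_mono[OF f(1)]) (use d in simp)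
    moreover have "d * (w $ i / d) < d * (of_int \<lfloor>w $ i / d\<rfloor> + 1)" by (rule mult_strict_left_mono[OF f(2) d])
    ultimately
    show "0 \<le> (w + k) $ i \<and> (w + k) $ i < d" using d by (simp add: k_def algebra_simps)
  qed
  have uniq: "l = k" if l: "l \<in> cubic_lattice d" "w + l \<in> lattice_cell d" for l
  proof (rule ccontr)
    assume "l \<noteq> k"
    then obtain i where i: "l $ i \<noteq> k $ i" by (auto simp: vec_eq_iff)
    obtain a b :: int where ab: "l $ i = d * of_int a" "k $ i = d * of_int b"
      using l(1) k unfolding cubic_lattice_def by blast
    have "1 \<le> \<bar>a - b\<bar>" using i ab by auto
    then have "1 \<le> \<bar>real_of_int (a - b)\<bar>" by linarith
    then have "d * 1 \<le> d * \<bar>real_of_int (a - b)\<bar>" using d by (intro mult_left_mono) auto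
    also have "\<dots> = \<bar>l $ i - k $ i\<bar>" using ab d by (simp add: abs_mult flip: right_diff_distrib)
    also have "\<dots> < d"
    proof -
      have "0 \<le> w $ i + l $ i" "w $ i + l $ i < d" "0 \<le> w $ i + k $ i" "w $ i + k $ i < d"
        using l(2) kc by (auto simp: lattice_cell_def)
      then show ?thesis by linarith
    qed
    finally show False by simp
  qed
  have "(\<integral>\<^sup>+l. indicator (lattice_cell d) (w + l) \<partial>count_space (cubic_lattice d)) = indicator (lattice_cell d) (w + k)"
    by (rule nn_integral_count_space_unique[OF k]) (use uniq in \<open>auto simp: indicator_def\<close>)
  then show ?thesis using kc by simp
qed

definition lattice_balls :: "real \<Rightarrow> (real ^ 'n) set" where
  "lattice_balls d = (\<Union>k\<in>cubic_lattice d. ball k (d / 2))"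

lemma lattice_balls_borel: "(lattice_balls d :: (real ^ 'n) set) \<in> sets borel"
  unfolding lattice_balls_def by (intro borel_open open_UN) auto

lemma lattice_balls_disjoint:
  fixes k l :: "real ^ 'n"
  assumes "k \<in> cubic_lattice d" "l \<in> cubic_lattice d" "x \<in> ball k (d / 2)" "x \<in> ball l (d / 2)" "d > 0"
  shows "k = l"
proof (rule ccontr)
  assume "k \<noteq> l"
  then have "d \<le> norm (k - l)" using assms by (intro cubic_lattice_separated) auto
  moreover have "dist k l < d" using assms(3,4) dist_triangle_half_l[of k x d l] by (simp add: dist_commute)
  ultimately show False by (simp add: dist_norm)
qed

lemma indicator_lattice_balls:
  fixes x :: "real ^ 'n"
  assumes d: "d > 0"
  shows "(\<integral>\<^sup>+k. indicator (ball k (d / 2)) x \<partial>count_space (cubic_lattice d)) = indicator (lattice_balls d) x"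
proof (cases "x \<in> lattice_balls d")
  case True
  then obtain k where k: "k \<in> cubic_lattice d" "x \<in> ball k (d / 2)" unfolding lattice_balls_def by blast
  have "indicator (ball l (d / 2)) x = (0::ennreal)" if l: "l \<in> cubic_lattice d" "l \<noteq> k" for l
  proof (rule ccontr)
    assume "indicator (ball l (d / 2)) x \<noteq> (0::ennreal)"
    then have "x \<in> ball l (d / 2)" by (simp add: indicator_def split: if_splits)
    from lattice_balls_disjoint[OF k(1) l(1) k(2) this d] l(2) show False by simp
  qed
  from nn_integral_count_space_unique[OF k(1), of "\<lambda>k. indicator (ball k (d / 2)) x", OF this]
  show ?thesis using k(2) True by simp
next
  case False
  then have "(\<integral>\<^sup>+k. indicator (ball k (d / 2)) x \<partial>count_space (cubic_lattice d))
      = (\<integral>\<^sup>+k. 0 \<partial>count_space (cubic_lattice d :: (real ^ 'n) set))"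
    by (intro nn_integral_cong) (auto simp: lattice_balls_def indicator_def)
  then show ?thesis using False by simp
qed

text \<open>Unfolding: each ball is moved to the origin, which moves the cell by a lattice vector
  instead. The translated cells tile the space, so the sum is the volume of a single ball,
  independently of \<open>x\<close>.\<close>

lemma lattice_balls_mean:
  fixes x :: "real ^ 3"
  assumes d: "d > 0"
  shows "(\<integral>y. indicator (lattice_cell d) y * indicator (lattice_balls d) (x + y) \<partial>lborel) = 4 / 3 * pi * (d / 2) ^ 3"
proof -
  let ?c = "indicator (lattice_cell d) :: real ^ 3 \<Rightarrow> ennreal"
  let ?L = "cubic_lattice d :: (real ^ 3) set"
  have cb: "?c \<in> borel_measurable borel" by (rule borel_measurable_indicator[OF lattice_cell_borel])
  have bm: "(\<lambda>y. indicator (ball k (d / 2)) (x + y) :: ennreal) \<in> borel_measurable borel" for k x :: "real ^ 3"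
    by (rule measurable_compose[where N = borel, OF _ borel_measurable_indicator]) auto
  have cm: "(\<lambda>y. ?c ((y - x) + k)) \<in> borel_measurable borel" for k
    by (rule measurable_compose[OF _ cb]) simp
  have m1: "(\<lambda>y. ?c y * indicator (ball k (d / 2)) (x + y)) \<in> borel_measurable borel" for k
    by (intro borel_measurable_times_ennreal cb bm)
  have m2: "(\<lambda>y. ?c ((y - x) + k) * indicator (ball 0 (d / 2)) y) \<in> borel_measurable borel" for k
    using borel_measurable_times_ennreal[OF cm bm[of 0 0]] by simp
  have "(\<integral>\<^sup>+y. ?c y * indicator (lattice_balls d) (x + y) \<partial>lborel)
      = (\<integral>\<^sup>+y. (\<integral>\<^sup>+k. ?c y * indicator (ball k (d / 2)) (x + y) \<partial>count_space ?L) \<partial>lborel)"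
    by (simp add: indicator_lattice_balls[OF d, symmetric] nn_integral_cmult)
  also have "\<dots> = (\<integral>\<^sup>+k. (\<integral>\<^sup>+y. ?c y * indicator (ball k (d / 2)) (x + y) \<partial>lborel) \<partial>count_space ?L)"
    by (rule nn_integral_count_space_nn_integral[OF countable_cubic_lattice[OF d]]) (simp add: m1)
  also have "\<dots> = (\<integral>\<^sup>+k. (\<integral>\<^sup>+y. ?c ((y - x) + k) * indicator (ball 0 (d / 2)) y \<partial>lborel) \<partial>count_space ?L)"
  proof (rule nn_integral_cong)
    fix k :: "real ^ 3"
    from nn_integral_shift[OF m1[of k], of "k - x"]
    have "(\<integral>\<^sup>+y. ?c y * indicator (ball k (d / 2)) (x + y) \<partial>lborel)
        = (\<integral>\<^sup>+y. ?c (y + (k - x)) * indicator (ball k (d / 2)) (x + (y + (k - x))) \<partial>lborel)" by simp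
    also have "\<dots> = (\<integral>\<^sup>+y. ?c ((y - x) + k) * indicator (ball 0 (d / 2)) y \<partial>lborel)"
    proof (rule nn_integral_cong)
      fix y :: "real ^ 3"
      have "dist k (x + (y + (k - x))) = dist 0 y" by (simp add: dist_norm)
      then have "(indicator (ball k (d / 2)) (x + (y + (k - x))) :: ennreal) = indicator (ball 0 (d / 2)) y"
        by (simp add: indicator_def)
      moreover have "y + (k - x) = (y - x) + k" by simp
      ultimately show "?c (y + (k - x)) * indicator (ball k (d / 2)) (x + (y + (k - x))) = ?c ((y - x) + k) * indicator (ball 0 (d / 2)) y"
        by (intro arg_cong2[where f = "(*)"] arg_cong[where f = ?c])
    qed
    finally show "(\<integral>\<^sup>+y. ?c y * indicator (ball k (d / 2)) (x + y) \<partial>lborel)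
        = (\<integral>\<^sup>+y. ?c ((y - x) + k) * indicator (ball 0 (d / 2)) y \<partial>lborel)" .
  qed
  also have "\<dots> = (\<integral>\<^sup>+y. (\<integral>\<^sup>+k. ?c ((y - x) + k) * indicator (ball 0 (d / 2)) y \<partial>count_space ?L) \<partial>lborel)"
    by (rule nn_integral_count_space_nn_integral[OF countable_cubic_lattice[OF d], symmetric]) (simp add: m2)
  also have "\<dots> = (\<integral>\<^sup>+y. indicator (ball 0 (d / 2)) y \<partial>(lborel :: (real ^ 3) measure))"
    by (simp add: nn_integral_multc lattice_cell_tiling[OF d])
  also have "\<dots> = emeasure lborel (ball (0 :: real ^ 3) (d / 2))" by simp
  also have "\<dots> = ennreal (4 / 3 * pi * (d / 2) ^ 3)"
    using d emeasure_ball[of "d / 2" "0 :: real ^ 3"] by (simp add: unit_ball_vol_3)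
  finally have nn: "(\<integral>\<^sup>+y. ?c y * indicator (lattice_balls d) (x + y) \<partial>lborel) = ennreal (4 / 3 * pi * (d / 2) ^ 3)" .
  have lb: "(indicator (lattice_balls d) :: real ^ 3 \<Rightarrow> real) \<in> borel_measurable borel"
    by (rule borel_measurable_indicator[OF lattice_balls_borel])
  have cr: "(indicator (lattice_cell d) :: real ^ 3 \<Rightarrow> real) \<in> borel_measurable borel"
    by (rule borel_measurable_indicator[OF lattice_cell_borel])
  show ?thesis
  proof (rule integral_eq_nn_integral[THEN trans])
    have "(\<lambda>y. ennreal (indicator (lattice_cell d) y * indicator (lattice_balls d) (x + y)))
        = (\<lambda>y. ?c y * indicator (lattice_balls d) (x + y))"
      by (rule ext) (simp add: indicator_def)
    then show "enn2real (\<integral>\<^sup>+y. ennreal (indicator (lattice_cell d) y * indicator (lattice_balls d) (x + y)) \<partial>lborel)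
        = 4 / 3 * pi * (d / 2) ^ 3"
      using nn d by simp
    have "(\<lambda>y. indicator (lattice_balls d) (x + y) :: real) \<in> borel_measurable borel"
      by (rule measurable_compose[OF _ lb]) simp
    from borel_measurable_times[OF cr this]
    show "(\<lambda>y. indicator (lattice_cell d) y * indicator (lattice_balls d) (x + y) :: real) \<in> borel_measurable (lborel :: (real ^ 3) measure)"
      by simp
  qed simp
qed

lemma emeasure_lattice_cell:
  assumes d: "d > 0" shows "emeasure lborel (lattice_cell d :: (real ^ 3) set) = ennreal (d ^ 3)"
proof -
  define b :: "real ^ 3" where "b = (\<chi> i. d)"
  have le: "(0 :: real ^ 3) \<bullet> i \<le> b \<bullet> i" if "i \<in> Basis" for i
    using that d by (auto simp: Basis_vec_def b_def inner_axis)
  have "(\<Prod>i\<in>Basis. (b - 0) \<bullet> i) = (\<Prod>i\<in>(Basis :: (real ^ 3) set). d)"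
    by (intro prod.cong refl) (auto simp: Basis_vec_def b_def inner_axis)
  then have p: "(\<Prod>i\<in>Basis. (b - 0) \<bullet> i) = d ^ 3" by simp
  have 1: "emeasure lborel (box 0 b) = ennreal (d ^ 3)" using emeasure_lborel_box[OF le] p by simp
  have 2: "emeasure lborel (cbox 0 b) = ennreal (d ^ 3)" using emeasure_lborel_cbox[OF le] p by simp
  have "box 0 b \<subseteq> lattice_cell d" by (auto simp: mem_box_cart lattice_cell_def b_def less_imp_le)
  then have "emeasure lborel (box 0 b) \<le> emeasure lborel (lattice_cell d :: (real ^ 3) set)"
    by (rule emeasure_mono) (simp add: lattice_cell_borel)
  moreover have "lattice_cell d \<subseteq> cbox 0 b" by (auto simp: mem_box_cart lattice_cell_def b_def less_imp_le)
  then have "emeasure lborel (lattice_cell d :: (real ^ 3) set) \<le> emeasure lborel (cbox 0 b)"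
    by (intro emeasure_mono) auto
  ultimately show ?thesis unfolding 1 2 by (rule antisym[rotated])
qed

lemma norm_lattice_cell:
  fixes y :: "real ^ 3" assumes "y \<in> lattice_cell d" shows "norm y \<le> 3 * d"
proof -
  have "norm y \<le> (\<Sum>i\<in>UNIV. \<bar>y $ i\<bar>)" by (rule norm_le_l1_cart)
  also have "\<dots> \<le> of_nat (card (UNIV :: 3 set)) * d"
    using assms by (intro sum_bounded_above) (auto simp: lattice_cell_def less_imp_le)
  finally show ?thesis by simp
qed

text \<open>Averaging a lattice-periodic function over a cell amounts to averaging translates of the
  other factor, which the translation estimate in \<open>H\<^sup>1\<close> compares with the factor itself.\<close>

theorem lattice_averaging:
  fixes u \<phi> :: "real ^ 3 \<Rightarrow> real"
  assumes d: "d > 0" and u: "H1_pair u G" and \<phi>: "H1_pair \<phi> H"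
  shows "\<bar>(\<integral>x. indicator (lattice_balls d) x * (u x * \<phi> x) \<partial>lborel) - pi / 6 * (\<integral>x. u x * \<phi> x \<partial>lborel)\<bar>
    \<le> 3 * d * (l2 u * l2 H + l2 G * l2 \<phi>)"
proof -
  note Lu = H1_pair_L2[OF u] and L\<phi> = H1_pair_L2[OF \<phi>]
  define c :: "real ^ 3 \<Rightarrow> real" where "c = indicator (lattice_cell d)"
  define B :: "real ^ 3 \<Rightarrow> real" where "B = indicator (lattice_balls d)"
  define \<psi> where "\<psi> x = u x * \<phi> x" for x
  define \<gamma> where "\<gamma> = 4 / 3 * pi * (d / 2) ^ 3"
  have \<gamma>0: "\<gamma> \<ge> 0" using d by (simp add: \<gamma>_def)
  have cb: "c \<in> borel_measurable borel" unfolding c_def by (rule borel_measurable_indicator[OF lattice_cell_borel])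
  have Bb: "B \<in> borel_measurable borel" unfolding B_def by (rule borel_measurable_indicator[OF lattice_balls_borel])
  have c1: "0 \<le> c y" "\<bar>c y\<bar> \<le> 1" and B1: "0 \<le> B y" "\<bar>B y\<bar> \<le> 1" for y
    by (simp_all add: c_def B_def indicator_def)
  note [measurable] = cb Bb L2_borel[OF Lu(1)] L2_borel[OF L\<phi>(1)]
  have \<psi>b [measurable]: "\<psi> \<in> borel_measurable borel" unfolding \<psi>_def[abs_def] by measurable
  have i\<psi>: "integrable lborel \<psi>" unfolding \<psi>_def[abs_def] by (rule L2_mult_integrable[OF Lu(1) L\<phi>(1)])
  have ic: "integrable lborel c"
    unfolding c_def by (rule integrable_real_indicator) (simp_all add: emeasure_lattice_cell[OF d] lattice_cell_borel)
  have Ic: "(\<integral>y. c y \<partial>lborel) = d ^ 3"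
    unfolding c_def using d by (simp add: measure_def emeasure_lattice_cell[OF d] lattice_cell_borel)
  have mean: "(\<integral>y. c y * B (x + y) \<partial>lborel) = \<gamma>" for x
    unfolding c_def B_def \<gamma>_def by (rule lattice_balls_mean[OF d])
  have icB: "integrable lborel (\<lambda>y. c y * B (x + y))" for x
  proof -
    have "(\<lambda>y. B (x + y)) \<in> borel_measurable borel" by measurable
    from integrable_bounded_mult[OF ic this B1(2)] show ?thesis by (simp add: mult.commute)
  qed
  define f where "f x y = \<psi> x * (c y * B (x + y))" for x y
  have int2: "integrable (lborel \<Otimes>\<^sub>M lborel) (case_prod f)"
  proof (rule lborel_pair.Fubini_integrable)
    show "case_prod f \<in> borel_measurable (lborel \<Otimes>\<^sub>M lborel)" unfolding f_def by measurable
    have "(\<lambda>x. \<integral>y. norm (case_prod f (x, y)) \<partial>lborel) = (\<lambda>x. \<bar>\<psi> x\<bar> * \<gamma>)"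
    proof
      fix x
      have "(\<integral>y. norm (case_prod f (x, y)) \<partial>lborel) = (\<integral>y. \<bar>\<psi> x\<bar> * (c y * B (x + y)) \<partial>lborel)"
        by (simp add: f_def abs_mult c1 B1)
      also have "\<dots> = \<bar>\<psi> x\<bar> * \<gamma>" using mean by simp
      finally show "(\<integral>y. norm (case_prod f (x, y)) \<partial>lborel) = \<bar>\<psi> x\<bar> * \<gamma>" .
    qed
    then show "integrable lborel (\<lambda>x. \<integral>y. norm (case_prod f (x, y)) \<partial>lborel)" using i\<psi> by simp
    show "AE x in lborel. integrable lborel (\<lambda>y. case_prod f (x, y))"
      using icB by (intro AE_I2) (simp add: f_def)
  qed
  have sh: "integrable lborel (\<lambda>x. B x * \<psi> (x + - y))" for y
    by (rule integrable_bounded_mult[OF integrable_shift[OF i\<psi>] Bb B1(2)])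
  have iB\<psi>: "integrable lborel (\<lambda>x. B x * \<psi> x)" by (rule integrable_bounded_mult[OF i\<psi> Bb B1(2)])
  \<comment> \<open>The change of variables moves the translation from the periodic indicator to
    \<psi>, where H1 regularity can act on it.\<close>
  have inner: "(\<integral>x. f x y \<partial>lborel) = c y * (\<integral>x. B x * \<psi> (x + - y) \<partial>lborel)" for y
  proof -
    have "(\<lambda>x. B x * \<psi> (x + - y)) \<in> borel_measurable borel" by measurable
    from integral_shift[OF this, of y]
    have "(\<integral>x. B x * \<psi> (x + - y) \<partial>lborel) = (\<integral>x. B (x + y) * \<psi> x \<partial>lborel)" by simp
    moreover have "(\<integral>x. f x y \<partial>lborel) = c y * (\<integral>x. B (x + y) * \<psi> x \<partial>lborel)"
      by (simp add: f_def mult_ac flip: integral_mult_right_zero)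
    ultimately show ?thesis by simp
  qed
  have "\<gamma> * (\<integral>x. \<psi> x \<partial>lborel) = (\<integral>x. (\<integral>y. f x y \<partial>lborel) \<partial>lborel)"
    unfolding f_def using mean by simp
  also have "\<dots> = (\<integral>y. (\<integral>x. f x y \<partial>lborel) \<partial>lborel)"
    by (rule lborel_pair.Fubini_integral[OF int2, symmetric])
  also have "\<dots> = (\<integral>y. c y * (\<integral>x. B x * \<psi> (x + - y) \<partial>lborel) \<partial>lborel)" by (simp only: inner)
  finally have e1: "\<gamma> * (\<integral>x. \<psi> x \<partial>lborel) = (\<integral>y. c y * (\<integral>x. B x * \<psi> (x + - y) \<partial>lborel) \<partial>lborel)" .
  have i1: "integrable lborel (\<lambda>y. c y * (\<integral>x. B x * \<psi> (x + - y) \<partial>lborel))"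
    using lborel_pair.integrable_snd[OF int2] by (simp only: inner)
  have "d ^ 3 * (\<integral>x. B x * \<psi> x \<partial>lborel) - \<gamma> * (\<integral>x. \<psi> x \<partial>lborel)
      = (\<integral>y. c y * (\<integral>x. B x * \<psi> x \<partial>lborel) - c y * (\<integral>x. B x * \<psi> (x + - y) \<partial>lborel) \<partial>lborel)"
    unfolding e1 using i1 ic Ic by simp
  also have "\<bar>\<dots>\<bar> \<le> (\<integral>y. c y * (3 * d * (l2 u * l2 H + l2 G * l2 \<phi>)) \<partial>lborel)"
  proof (rule integral_abs_bound[THEN order_trans], rule integral_mono)
    show "integrable lborel (\<lambda>y. \<bar>c y * (\<integral>x. B x * \<psi> x \<partial>lborel) - c y * (\<integral>x. B x * \<psi> (x + - y) \<partial>lborel)\<bar>)"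
      using i1 ic by auto
    show "integrable lborel (\<lambda>y. c y * (3 * d * (l2 u * l2 H + l2 G * l2 \<phi>)))" using ic by simp
    fix y
    show "\<bar>c y * (\<integral>x. B x * \<psi> x \<partial>lborel) - c y * (\<integral>x. B x * \<psi> (x + - y) \<partial>lborel)\<bar>
        \<le> c y * (3 * d * (l2 u * l2 H + l2 G * l2 \<phi>))"
    proof (cases "y \<in> lattice_cell d")
      case False
      then show ?thesis by (simp add: c_def)
    next
      case True
      then have y: "norm (- y) \<le> 3 * d" using norm_lattice_cell by simp
      have d\<phi>: "(\<lambda>x. \<phi> (x + - y) - \<phi> x) \<in> L2" by (rule L2_diff[OF L2_shift[OF L\<phi>(1)] L\<phi>(1)])
      have du: "(\<lambda>x. u (x + - y) - u x) \<in> L2" by (rule L2_diff[OF L2_shift[OF Lu(1)] Lu(1)])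
      have Bu: "(\<lambda>x. B x * u x) \<in> L2" "l2 (\<lambda>x. B x * u x) \<le> 1 * l2 u"
        by (rule L2_bounded_mult[OF Lu(1) Bb B1(2)])+
      have Bd: "(\<lambda>x. B x * (u (x + - y) - u x)) \<in> L2" "l2 (\<lambda>x. B x * (u (x + - y) - u x)) \<le> 1 * l2 (\<lambda>x. u (x + - y) - u x)"
        by (rule L2_bounded_mult[OF du Bb B1(2)])+
      have sp: "(\<lambda>x. \<phi> (x + - y)) \<in> L2" by (rule L2_shift[OF L\<phi>(1)])
      have j1: "integrable lborel (\<lambda>x. (B x * u x) * (\<phi> (x + - y) - \<phi> x))" by (rule L2_mult_integrable[OF Bu(1) d\<phi>])
      have j2: "integrable lborel (\<lambda>x. (B x * (u (x + - y) - u x)) * \<phi> (x + - y))" by (rule L2_mult_integrable[OF Bd(1) sp])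
      have "(\<integral>x. B x * \<psi> (x + - y) \<partial>lborel) - (\<integral>x. B x * \<psi> x \<partial>lborel)
          = (\<integral>x. B x * \<psi> (x + - y) - B x * \<psi> x \<partial>lborel)" using sh[of y] iB\<psi> by simp
      \<comment> \<open>The product is shifted one factor at a time, which leaves one translation
        increment in each term.\<close>
      also have "\<dots> = (\<integral>x. (B x * u x) * (\<phi> (x + - y) - \<phi> x) + (B x * (u (x + - y) - u x)) * \<phi> (x + - y) \<partial>lborel)"
        by (intro Bochner_Integration.integral_cong refl) (simp add: \<psi>_def algebra_simps)
      also have "\<dots> = (\<integral>x. (B x * u x) * (\<phi> (x + - y) - \<phi> x) \<partial>lborel) + (\<integral>x. (B x * (u (x + - y) - u x)) * \<phi> (x + - y) \<partial>lborel)"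
        using j1 j2 by simp
      finally have eq: "(\<integral>x. B x * \<psi> (x + - y) \<partial>lborel) - (\<integral>x. B x * \<psi> x \<partial>lborel)
        = (\<integral>x. (B x * u x) * (\<phi> (x + - y) - \<phi> x) \<partial>lborel) + (\<integral>x. (B x * (u (x + - y) - u x)) * \<phi> (x + - y) \<partial>lborel)" .
      have "\<bar>\<integral>x. (B x * u x) * (\<phi> (x + - y) - \<phi> x) \<partial>lborel\<bar> \<le> l2 (\<lambda>x. B x * u x) * l2 (\<lambda>x. \<phi> (x + - y) - \<phi> x)"
        by (rule L2_mult_Cauchy_Schwarz[OF Bu(1) d\<phi>])
      also have "\<dots> \<le> l2 u * (norm (- y) * l2 H)"
        using Bu(2) by (intro mult_mono H1_translation_estimate[OF \<phi>] l2_nonneg) simp_all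
      also have "\<dots> \<le> l2 u * (3 * d * l2 H)" using y by (intro mult_left_mono mult_right_mono l2_nonneg)
      finally have b1: "\<bar>\<integral>x. (B x * u x) * (\<phi> (x + - y) - \<phi> x) \<partial>lborel\<bar> \<le> l2 u * (3 * d * l2 H)" .
      have tu: "l2 (\<lambda>x. B x * (u (x + - y) - u x)) \<le> norm (- y) * l2 G"
        using Bd(2) H1_translation_estimate[OF u, of "- y"] by simp
      have "\<bar>\<integral>x. (B x * (u (x + - y) - u x)) * \<phi> (x + - y) \<partial>lborel\<bar> \<le> l2 (\<lambda>x. B x * (u (x + - y) - u x)) * l2 (\<lambda>x. \<phi> (x + - y))"
        by (rule L2_mult_Cauchy_Schwarz[OF Bd(1) sp])
      also have "\<dots> \<le> (norm (- y) * l2 G) * l2 \<phi>"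
        unfolding l2_shift[OF L\<phi>(1)] by (intro mult_right_mono tu l2_nonneg)
      also have "\<dots> \<le> (3 * d * l2 G) * l2 \<phi>" using y by (intro mult_right_mono l2_nonneg)
      finally have b2: "\<bar>\<integral>x. (B x * (u (x + - y) - u x)) * \<phi> (x + - y) \<partial>lborel\<bar> \<le> (3 * d * l2 G) * l2 \<phi>" .
      have "\<bar>(\<integral>x. B x * \<psi> x \<partial>lborel) - (\<integral>x. B x * \<psi> (x + - y) \<partial>lborel)\<bar> \<le> l2 u * (3 * d * l2 H) + (3 * d * l2 G) * l2 \<phi>"
        using eq b1 b2 by linarith
      also have "\<dots> = 3 * d * (l2 u * l2 H + l2 G * l2 \<phi>)" by (simp add: algebra_simps)
      finally show ?thesis using True by (simp add: c_def)
    qed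
  qed
  also have "\<dots> = d ^ 3 * (3 * d * (l2 u * l2 H + l2 G * l2 \<phi>))" using Ic by simp
  finally have fin: "\<bar>d ^ 3 * (\<integral>x. B x * \<psi> x \<partial>lborel) - \<gamma> * (\<integral>x. \<psi> x \<partial>lborel)\<bar> \<le> d ^ 3 * (3 * d * (l2 u * l2 H + l2 G * l2 \<phi>))" .
  \<comment> \<open>\<pi>/6 is the fraction of a cube of side d that the ball of radius d/2
    fills.\<close>
  have "\<gamma> = d ^ 3 * (pi / 6)" by (simp add: \<gamma>_def power3_eq_cube)
  then have "d ^ 3 * (\<integral>x. B x * \<psi> x \<partial>lborel) - \<gamma> * (\<integral>x. \<psi> x \<partial>lborel)
      = d ^ 3 * ((\<integral>x. B x * \<psi> x \<partial>lborel) - pi / 6 * (\<integral>x. \<psi> x \<partial>lborel))" by (simp add: algebra_simps)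
  then have "d ^ 3 * \<bar>(\<integral>x. B x * \<psi> x \<partial>lborel) - pi / 6 * (\<integral>x. \<psi> x \<partial>lborel)\<bar> \<le> d ^ 3 * (3 * d * (l2 u * l2 H + l2 G * l2 \<phi>))"
    using fin d by (simp add: abs_mult)
  then have "\<bar>(\<integral>x. B x * \<psi> x \<partial>lborel) - pi / 6 * (\<integral>x. \<psi> x \<partial>lborel)\<bar> \<le> 3 * d * (l2 u * l2 H + l2 G * l2 \<phi>)"
    by (rule mult_left_le_imp_le) (use d in simp)
  then show ?thesis by (simp only: B_def \<psi>_def)
qed

lemma lip_deriv_sum:
  fixes s :: "'k \<Rightarrow> 'a::euclidean_space \<Rightarrow> real"
  assumes "finite K" "\<And>k. k \<in> K \<Longrightarrow> lip_deriv (s k) (D k)"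
  shows "lip_deriv (\<lambda>x. \<Sum>k\<in>K. s k x) (\<lambda>x. \<Sum>k\<in>K. D k x)"
  using assms
proof (induction K rule: finite_induct)
  case empty
  have "lip_deriv (\<lambda>_ :: 'a. 0) (grad (\<lambda>_. 0))" by (rule lip_deriv_test[OF test_zero])
  moreover have "grad (\<lambda>_ :: 'a. 0) = (\<lambda>_. 0)"
    using test_derivative[OF test_zero] by (intro ext) (simp add: grad_def pd_eqI[OF has_derivative_const])
  ultimately show ?case by simp
next
  case (insert k K)
  have s: "lip_deriv (s k) (D k)" using insert by simp
  have t: "lip_deriv (\<lambda>x. \<Sum>k\<in>K. s k x) (\<lambda>x. \<Sum>k\<in>K. D k x)" using insert by simp
  obtain L R N where s1: "\<And>x y. \<bar>s k x - s k y\<bar> \<le> L * norm (x - y)" "R > 0" "\<And>x. R \<le> norm x \<Longrightarrow> s k x = 0"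
    "\<And>x. norm (D k x) \<le> N" using lip_derivE[OF s] by blast
  obtain L' R' N' where t1: "\<And>x y. \<bar>(\<Sum>k\<in>K. s k x) - (\<Sum>k\<in>K. s k y)\<bar> \<le> L' * norm (x - y)" "R' > 0"
    "\<And>x. R' \<le> norm x \<Longrightarrow> (\<Sum>k\<in>K. s k x) = 0" "\<And>x. norm (\<Sum>k\<in>K. D k x) \<le> N'" using lip_derivE[OF t] by blast
  have "lip_deriv (\<lambda>x. s k x + (\<Sum>k\<in>K. s k x)) (\<lambda>x. D k x + (\<Sum>k\<in>K. D k x))"
    unfolding lip_deriv_def
  proof (intro conjI)
    have "\<bar>s k x + (\<Sum>k\<in>K. s k x) - (s k y + (\<Sum>k\<in>K. s k y))\<bar> \<le> (L + L') * norm (x - y)" for x y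
      using s1(1)[of x y] t1(1)[of x y] unfolding distrib_right by linarith
    then show "\<exists>L. \<forall>x y. \<bar>s k x + (\<Sum>k\<in>K. s k x) - (s k y + (\<Sum>k\<in>K. s k y))\<bar> \<le> L * norm (x - y)" by (intro exI allI)
    show "\<exists>R>0. \<forall>x. R \<le> norm x \<longrightarrow> s k x + (\<Sum>k\<in>K. s k x) = 0"
      using s1(2,3) t1(2,3) by (intro exI[of _ "max R R'"]) simp
    show "(\<lambda>x. D k x + (\<Sum>k\<in>K. D k x)) \<in> borel_measurable borel"
      using lip_deriv_borel_D[OF s] lip_deriv_borel_D[OF t] by (rule borel_measurable_add)
    have "norm (D k x + (\<Sum>k\<in>K. D k x)) \<le> N + N'" for x
      by (intro norm_triangle_le add_mono s1 t1)
    then show "\<exists>M. \<forall>x. norm (D k x + (\<Sum>k\<in>K. D k x)) \<le> M" by (intro exI allI)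
    show "AE x in lborel. ((\<lambda>x. s k x + (\<Sum>k\<in>K. s k x)) has_derivative (\<lambda>h. (D k x + (\<Sum>k\<in>K. D k x)) \<bullet> h)) (at x)"
      using lip_deriv_AE[OF s] lip_deriv_AE[OF t]
    proof eventually_elim
      case (elim x)
      from has_derivative_add[OF elim] show ?case by (simp only: inner_add_left)
    qed
  qed
  then show ?case using insert by simp
qed

section \<open>The corrector\<close>

text \<open>\<open>1 - cap\<close> is the capacitary potential of the ball of radius \<open>r\<close> in the ball of radius \<open>a\<close>, and
  \<open>flux s x (x - k)\<close> extends \<open>- \<nabla>cap\<close> to a Lipschitz field with constant divergence between the radii
  \<open>r\<close> and \<open>d/2\<close>. The extension beyond \<open>a\<close> and into the hole costs nothing in the limit.\<close>

definition strength :: "real \<Rightarrow> real \<Rightarrow> real" where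
  "strength r a = r * a / (a - r)"

definition cap :: "real \<Rightarrow> real \<Rightarrow> real ^ 3 \<Rightarrow> real ^ 3 \<Rightarrow> real" where
  "cap r a k = radial r a k (\<lambda>t. strength r a * (1 / t - 1 / a))"

definition cap_grad :: "real \<Rightarrow> real \<Rightarrow> real ^ 3 \<Rightarrow> real ^ 3 \<Rightarrow> real ^ 3" where
  "cap_grad r a k = annulus_gradient r a k (\<lambda>t. - strength r a / t\<^sup>2)"

definition flux :: "real \<Rightarrow> real \<Rightarrow> real \<Rightarrow> real ^ 3 \<Rightarrow> real ^ 3 \<Rightarrow> real" where
  "flux r a d k = radial r (d / 2) k (\<lambda>t. strength r a * (1 / t ^ 3 - 8 / d ^ 3))"

definition flux_grad :: "real \<Rightarrow> real \<Rightarrow> real \<Rightarrow> real ^ 3 \<Rightarrow> real ^ 3 \<Rightarrow> real ^ 3" where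
  "flux_grad r a d k = annulus_gradient r (d / 2) k (\<lambda>t. - (3 * strength r a / t ^ 4))"

lemma cap_lip:
  assumes "0 < r" "r < a" shows "lip_deriv (cap r a k) (cap_grad r a k)"
  unfolding cap_def cap_grad_def
proof (rule radial_lip_deriv[OF assms])
  fix t assume "r \<le> t" "t \<le> a"
  then have "t > 0" using assms by simp
  then show "((\<lambda>t. strength r a * (1 / t - 1 / a)) has_real_derivative - strength r a / t\<^sup>2) (at t)"
    by (auto intro!: derivative_eq_intros simp: power2_eq_square)
next
  show "continuous_on {r..a} (\<lambda>t. - strength r a / t\<^sup>2)" using assms by (intro continuous_intros) auto
  show "(\<lambda>t. - strength r a / t\<^sup>2) \<in> borel_measurable borel" by measurable
qed simp

lemma flux_lip:
  assumes "0 < r" "r < d / 2" shows "lip_deriv (flux r a d k) (flux_grad r a d k)"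
  unfolding flux_def flux_grad_def
proof (rule radial_lip_deriv[OF assms])
  fix t assume "r \<le> t" "t \<le> d / 2"
  then have "t > 0" using assms by simp
  then show "((\<lambda>t. strength r a * (1 / t ^ 3 - 8 / d ^ 3)) has_real_derivative - (3 * strength r a / t ^ 4)) (at t)"
    by (auto intro!: derivative_eq_intros simp: field_simps eval_nat_numeral)
next
  show "continuous_on {r..d / 2} (\<lambda>t. - (3 * strength r a / t ^ 4))" using assms by (intro continuous_intros) auto
  show "(\<lambda>t. - (3 * strength r a / t ^ 4)) \<in> borel_measurable borel" by measurable
qed (simp add: power_divide)

lemma strength_pos: "0 < r \<Longrightarrow> r < a \<Longrightarrow> 0 < strength r a"
  by (simp add: strength_def)

lemma cap_hole:
  assumes "0 < r" "r < a" "norm (x - k) \<le> r" shows "cap r a k x = 1"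
proof -
  have "max r (min a (norm (x - k))) = r" using assms by simp
  then have "cap r a k x = strength r a * (1 / r - 1 / a)" by (simp add: cap_def radial_def)
  also have "\<dots> = 1" using assms by (simp add: strength_def field_simps)
  finally show ?thesis .
qed

lemma cap_bounds:
  assumes "0 < r" "r < a" shows "0 \<le> cap r a k x" "cap r a k x \<le> 1"
proof -
  define t where "t = max r (min a (norm (x - k)))"
  have t: "r \<le> t" "t \<le> a" "t > 0" using assms by (auto simp: t_def)
  have c: "cap r a k x = strength r a * (1 / t - 1 / a)" by (simp add: cap_def radial_def t_def)
  have "1 / a \<le> 1 / t" using t assms by (intro divide_left_mono mult_pos_pos) auto
  then show "0 \<le> cap r a k x" unfolding c using strength_pos[OF assms] by simp
  have "1 / t \<le> 1 / r" using t assms by (intro divide_left_mono mult_pos_pos) auto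
  then have "cap r a k x \<le> strength r a * (1 / r - 1 / a)"
    unfolding c using strength_pos[OF assms] by (intro mult_left_mono) auto
  also have "\<dots> = 1" using assms by (simp add: strength_def field_simps)
  finally show "cap r a k x \<le> 1" .
qed

lemma cap_outside:
  assumes "r < a" "a \<le> norm (x - k)" shows "cap r a k x = 0" "cap_grad r a k x = 0"
  using assms by (simp_all add: cap_def radial_def cap_grad_def annulus_gradient_def)

lemma flux_outside:
  assumes "r < d / 2" "d / 2 \<le> norm (x - k)" shows "flux r a d k x = 0" "flux_grad r a d k x = 0"
  using assms by (simp_all add: flux_def radial_def flux_grad_def annulus_gradient_def power_divide)

text \<open>The field (x - k)/t^3 is divergence free, so only the linear part contributes.
  Equivalently, the total flux 4\<pi> \<open>strength r a\<close> is spread evenly over the volume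
  \<pi> d^3 / 6 of the ball of radius d/2.\<close>

lemma flux_divergence:
  assumes "0 < r" "r < norm (x - k)" "norm (x - k) < d / 2"
  shows "3 * flux r a d k x + (x - k) \<bullet> flux_grad r a d k x = - (24 * strength r a / d ^ 3)"
proof -
  define t where "t = norm (x - k)"
  have t: "0 < t" "r < t" "t < d / 2" using assms by (auto simp: t_def)
  have "(x - k) \<bullet> flux_grad r a d k x = (- (3 * strength r a / t ^ 4) / t) * (t * t)"
    using t by (simp add: flux_grad_def annulus_gradient_def power2_norm_eq_inner[symmetric] power2_eq_square flip: t_def)
  also have "\<dots> = - (3 * strength r a / t ^ 3)" using t by (simp add: field_simps eval_nat_numeral)
  finally have fg: "(x - k) \<bullet> flux_grad r a d k x = - (3 * strength r a / t ^ 3)" .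
  have fl: "flux r a d k x = strength r a * (1 / t ^ 3 - 8 / d ^ 3)"
    using t by (simp add: flux_def radial_def flip: t_def)
  show ?thesis unfolding fg fl by (simp add: right_diff_distrib)
qed

text \<open>Inside radius a the singular parts cancel and only the linear field of size 8 \<kappa> t
  / d^3 remains. Beyond a the potential is flat and the flux field is at most \<kappa> / t^2. As
  \<kappa> is comparable to r and d^3 to r, these terms have sizes a and r/a^2.\<close>

lemma corrector_field_bound:
  assumes r: "0 < r" "r < a" "a < d / 2" and x: "r < norm (x - k)"
  shows "norm (cap_grad r a k x + flux r a d k x *\<^sub>R (x - k)) \<le> 8 * strength r a * a / d ^ 3 + strength r a / a\<^sup>2"
proof -
  define t where "t = norm (x - k)"
  define \<kappa> where "\<kappa> = strength r a"
  have \<kappa>: "\<kappa> > 0" unfolding \<kappa>_def by (rule strength_pos[OF r(1,2)])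
  have t: "0 < t" "r < t" using r x by (auto simp: t_def)
  have d: "d > 0" using r by simp
  have p1: "0 \<le> 8 * \<kappa> * a / d ^ 3" "0 \<le> \<kappa> / a\<^sup>2" using \<kappa> r d by auto
  consider "t < a" | "a \<le> t" "t < d / 2" | "d / 2 \<le> t" by linarith
  then show ?thesis
  proof cases
    case 1
    have fl: "flux r a d k x = \<kappa> * (1 / t ^ 3 - 8 / d ^ 3)"
      using t 1 r by (simp add: flux_def radial_def \<kappa>_def flip: t_def)
    have cg: "cap_grad r a k x = (- \<kappa> / t ^ 3) *\<^sub>R (x - k)"
      using t 1 by (simp add: cap_grad_def annulus_gradient_def \<kappa>_def power2_eq_square power3_eq_cube mult.assoc flip: t_def)
    have "cap_grad r a k x + flux r a d k x *\<^sub>R (x - k) = (- \<kappa> / t ^ 3 + \<kappa> * (1 / t ^ 3 - 8 / d ^ 3)) *\<^sub>R (x - k)"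
      unfolding fl cg by (simp only: scaleR_add_left)
    also have "- \<kappa> / t ^ 3 + \<kappa> * (1 / t ^ 3 - 8 / d ^ 3) = - (8 * \<kappa> / d ^ 3)" by (simp add: algebra_simps)
    finally have "norm (cap_grad r a k x + flux r a d k x *\<^sub>R (x - k)) = (8 * \<kappa> / d ^ 3) * t"
      using \<kappa> d by (simp add: t_def)
    also have "\<dots> \<le> (8 * \<kappa> / d ^ 3) * a" using 1 \<kappa> d by (intro mult_left_mono) auto
    finally show ?thesis using p1 by (simp add: \<kappa>_def)
  next
    case 2
    have fl: "flux r a d k x = \<kappa> * (1 / t ^ 3 - 8 / d ^ 3)"
      using t 2 r by (simp add: flux_def radial_def \<kappa>_def flip: t_def)
    have cg: "cap_grad r a k x = 0" using cap_outside(2)[OF r(2)] 2 by (simp add: t_def)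
    have "t ^ 3 \<le> (d / 2) ^ 3" using 2 t by (intro power_mono) auto
    then have "8 * t ^ 3 \<le> d ^ 3" by (simp add: power_divide)
    then have "8 / d ^ 3 \<le> 1 / t ^ 3" using t d by (simp add: field_simps)
    then have nn: "0 \<le> \<kappa> * (1 / t ^ 3 - 8 / d ^ 3)" using \<kappa> by simp
    have "norm (cap_grad r a k x + flux r a d k x *\<^sub>R (x - k)) = \<kappa> * (1 / t ^ 3 - 8 / d ^ 3) * t"
      unfolding fl cg using nn by (simp add: t_def abs_of_nonneg)
    also have "\<dots> \<le> (\<kappa> * (1 / t ^ 3)) * t"
      using \<kappa> t d by (intro mult_right_mono mult_left_mono) auto
    also have "\<dots> = \<kappa> / t\<^sup>2" using t by (simp add: power2_eq_square power3_eq_cube)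
    also have "\<dots> \<le> \<kappa> / a\<^sup>2" using 2 r \<kappa> t by (intro divide_left_mono power_mono mult_pos_pos) auto
    finally show ?thesis using p1 by (simp add: \<kappa>_def)
  next
    case 3
    have "cap_grad r a k x = 0" using cap_outside(2)[OF r(2)] 3 r by (simp add: t_def)
    moreover have "flux r a d k x = 0" using flux_outside(1)[of r d] 3 r by (simp add: t_def)
    ultimately show ?thesis using p1 by (simp add: \<kappa>_def)
  qed
qed

text \<open>The energy density of the potential is integrated without polar coordinates. The field
  m(x) (x - k), with profile t^-4 - a^-4 frozen inside r, has total divergence 0; its divergence is
  below - t^-4 in the annulus and below 3/r^4 in the inner ball. Multiplying 3/r^4 by the volume of
  that ball gives 4\<pi>/r.\<close>

lemma inverse_fourth_power_annulus:
  fixes k :: "real ^ 3"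
  assumes r: "0 < r" "r < a"
  shows "integrable lborel (\<lambda>x. if r < norm (x - k) \<and> norm (x - k) < a then 1 / norm (x - k) ^ 4 else 0)"
    "(\<integral>x. (if r < norm (x - k) \<and> norm (x - k) < a then 1 / norm (x - k) ^ 4 else 0) \<partial>lborel) \<le> 4 * pi / r"
proof -
  define m where "m = radial r a k (\<lambda>t. 1 / t ^ 4 - 1 / a ^ 4)"
  define D where "D = annulus_gradient r a k (\<lambda>t. - (4 / t ^ 5))"
  have m: "lip_deriv m D"
    unfolding m_def D_def
  proof (rule radial_lip_deriv[OF r])
    fix t assume "r \<le> t" "t \<le> a"
    then have "t > 0" using r by simp
    then show "((\<lambda>t. 1 / t ^ 4 - 1 / a ^ 4) has_real_derivative - (4 / t ^ 5)) (at t)"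
      by (auto intro!: derivative_eq_intros simp: field_simps eval_nat_numeral)
  next
    show "continuous_on {r..a} (\<lambda>t. - (4 / t ^ 5))" using r by (intro continuous_intros) auto
    show "(\<lambda>t :: real. - (4 / t ^ 5)) \<in> borel_measurable borel" by measurable
  qed simp
  have Dz: "D x = 0" if "norm k + a \<le> norm x" for x unfolding D_def by (rule annulus_gradient_support[OF that])
  define q where "q i x = m x *\<^sub>R i + ((x - k) \<bullet> i) *\<^sub>R D x" for i x
  have q: "lip_deriv (\<lambda>x. ((x - k) \<bullet> i) * m x) (q i)" for i
    unfolding q_def[abs_def] by (rule lip_deriv_mult_linear[OF m Dz])
  define w where "w x = (if r < norm (x - k) \<and> norm (x - k) < a then 1 / norm (x - k) ^ 4 else 0)" for x :: "real ^ 3"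
  have wn: "0 \<le> w x" "w x \<le> 1 / r ^ 4" for x
    using r by (auto simp: w_def intro!: divide_left_mono power_mono mult_pos_pos)
  have wz: "w x = 0" if "norm k + a \<le> norm x" for x
    using that norm_triangle_ineq2[of x k] by (auto simp: w_def)
  have wb: "w \<in> borel_measurable borel" unfolding w_def[abs_def] by measurable
  have iw: "integrable lborel w" using wn by (intro integrable_bounded_support[OF wb _ wz, of "1 / r ^ 4"]) simp_all
  then show "integrable lborel (\<lambda>x. if r < norm (x - k) \<and> norm (x - k) < a then 1 / norm (x - k) ^ 4 else 0)"
    by (simp only: w_def[abs_def])
  have iq: "integrable lborel (\<lambda>x. q i x \<bullet> i)" if i: "i \<in> Basis" for i
  proof -
    obtain L R N where N: "\<And>x y. \<bar>((x - k) \<bullet> i) * m x - ((y - k) \<bullet> i) * m y\<bar> \<le> L * norm (x - y)" "R > 0"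
      "\<And>x. R \<le> norm x \<Longrightarrow> ((x - k) \<bullet> i) * m x = 0" "\<And>x. norm (q i x) \<le> N" using lip_derivE[OF q] by blast
    show ?thesis
    proof (rule integrable_bounded_support)
      show "(\<lambda>x. q i x \<bullet> i) \<in> borel_measurable borel" using lip_deriv_borel_D[OF q, of i] by simp
      show "\<bar>q i x \<bullet> i\<bar> \<le> N" for x using Basis_le_norm[OF i, of "q i x"] N(4)[of x] by linarith
      show "q i x \<bullet> i = 0" if "norm k + a \<le> norm x" for x
      proof -
        have "a \<le> norm (x - k)" using that norm_triangle_ineq2[of x k] by linarith
        then have "m x = 0" using r by (simp add: m_def radial_def)
        then show ?thesis using Dz[OF that] by (simp add: q_def)
      qed
    qed
  qed
  have "0 = (\<Sum>i\<in>Basis. \<integral>x. q i x \<bullet> i \<partial>lborel)"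
    by (intro sum.neutral[symmetric] ballI lip_deriv_integral_zero[OF q])
  also have "\<dots> = (\<integral>x. (\<Sum>i\<in>Basis. q i x \<bullet> i) \<partial>lborel)"
    by (rule Bochner_Integration.integral_sum[symmetric]) (rule iq)
  finally have z: "(\<integral>x. (\<Sum>i\<in>Basis. q i x \<bullet> i) \<partial>lborel) = 0" by simp
  have div: "(\<Sum>i\<in>Basis. q i x \<bullet> i) = 3 * m x + (x - k) \<bullet> D x" for x
    by (simp add: q_def inner_add_left sum.distrib euclidean_inner[of "x - k" "D x"])
  let ?I = "indicator (cball k r) :: real ^ 3 \<Rightarrow> real"
  have iI: "integrable lborel ?I"
    by (rule integrable_real_indicator) (simp_all add: emeasure_lborel_cball_finite[unfolded infinity_ennreal_def] emeasure_lborel_cball_finite)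
  have isum: "integrable lborel (\<lambda>x. \<Sum>i\<in>Basis. q i x \<bullet> i)" by (rule Bochner_Integration.integrable_sum) (rule iq)
  have pw: "w x \<le> (3 / r ^ 4) * ?I x - (\<Sum>i\<in>Basis. q i x \<bullet> i)" for x
  proof -
      define t where "t = norm (x - k)"
      consider "t \<le> r" | "r < t" "t < a" | "a \<le> t" by linarith
      then have "w x \<le> (3 / r ^ 4) * ?I x - (3 * m x + (x - k) \<bullet> D x)"
      proof cases
        case 1
        have "m x = 1 / r ^ 4 - 1 / a ^ 4" using 1 r by (simp add: m_def radial_def flip: t_def)
        moreover have "D x = 0" "w x = 0" using 1 by (simp_all add: D_def annulus_gradient_def w_def flip: t_def)
        moreover have "?I x = 1" using 1 by (simp add: t_def dist_norm norm_minus_commute)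
        moreover have "0 \<le> 3 / a ^ 4" using r by simp
        ultimately show ?thesis by simp
      next
        case 2
        have tp: "t > 0" using 2 r by simp
        have "(x - k) \<bullet> D x = (- (4 / t ^ 5) / t) * (t * t)"
          using 2 by (simp add: D_def annulus_gradient_def power2_norm_eq_inner[symmetric] power2_eq_square flip: t_def)
        also have "\<dots> = - (4 / t ^ 4)" using tp by (simp add: field_simps eval_nat_numeral)
        finally have 1: "(x - k) \<bullet> D x = - (4 / t ^ 4)" .
        have mw: "m x = 1 / t ^ 4 - 1 / a ^ 4" "w x = 1 / t ^ 4"
          using 2 by (simp_all add: m_def radial_def w_def flip: t_def)
        have "0 \<le> 3 / a ^ 4" "0 \<le> (3 / r ^ 4) * ?I x" using r by simp_all
        then show ?thesis unfolding 1 mw by (simp add: algebra_simps)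
      next
        case 3
        then have "m x = 0" "D x = 0" "w x = 0" using r by (simp_all add: m_def radial_def D_def annulus_gradient_def w_def flip: t_def)
        then show ?thesis using r by simp
      qed
    then show ?thesis unfolding div .
  qed
  have "(\<integral>x. w x \<partial>lborel) \<le> (\<integral>x. (3 / r ^ 4) * ?I x - (\<Sum>i\<in>Basis. q i x \<bullet> i) \<partial>lborel)"
    by (rule integral_mono[OF _ _ pw]) (use iw iI isum in auto)
  also have "\<dots> = (3 / r ^ 4) * measure lborel (cball k r)"
    using iI isum z by (simp add: emeasure_lborel_cball_finite[unfolded infinity_ennreal_def])
  also have "measure lborel (cball k r) = 4 / 3 * pi * r ^ 3"
    using content_cball[of r k] r by (simp add: unit_ball_vol_3)
  also have "(3 / r ^ 4) * (4 / 3 * pi * r ^ 3) = 4 * pi / r" using r by (simp add: field_simps eval_nat_numeral)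
  finally show "(\<integral>x. (if r < norm (x - k) \<and> norm (x - k) < a then 1 / norm (x - k) ^ 4 else 0) \<partial>lborel) \<le> 4 * pi / r"
    by (simp only: w_def)
qed

lemma L2_bounded_field:
  assumes f: "f \<in> L2" and W: "W \<in> borel_measurable borel" "\<And>x. norm (W x) \<le> N"
  shows "(\<lambda>x. f x *\<^sub>R W x) \<in> L2" "l2 (\<lambda>x. f x *\<^sub>R W x) \<le> N * l2 f"
proof -
  have N: "N \<ge> 0" using W(2)[of undefined] norm_ge_zero[of "W undefined"] by linarith
  have b: "(\<lambda>x. f x *\<^sub>R W x) \<in> borel_measurable borel" using L2_borel[OF f] W(1) by simp
  have le: "norm (f x *\<^sub>R W x) \<le> norm (N *\<^sub>R f x)" for x
    using mult_left_mono[OF W(2)[of x], of "\<bar>f x\<bar>"] N by (simp add: abs_mult mult.commute)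
  show "(\<lambda>x. f x *\<^sub>R W x) \<in> L2" by (rule L2_dominated(1)[OF L2_scaleR[OF f] b le])
  show "l2 (\<lambda>x. f x *\<^sub>R W x) \<le> N * l2 f"
    using L2_dominated(2)[OF L2_scaleR[OF f] b le] N l2_scaleR[of N f] by simp
qed

lemma L2_field_integrable:
  assumes "f \<in> L2" "H \<in> L2" "W \<in> borel_measurable borel" "\<And>x. norm (W x) \<le> N"
  shows "integrable lborel (\<lambda>x. f x * (H x \<bullet> W x))"
  using L2_inner_integrable[OF L2_bounded_field(1)[OF assms(1,3,4)] assms(2)] by (simp add: inner_commute)

text \<open>A crude bound that degenerates as r tends to 0; it serves integrability. The bound used
  in the limit is that of \<open>corrector_field_bound\<close>.\<close>

lemma flux_field_bound:
  assumes r: "0 < r" "r < a" "r < d / 2"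
  shows "norm (flux r a d k x *\<^sub>R (x - k)) \<le> strength r a / r ^ 3 * (d / 2)"
proof (cases "norm (x - k) < d / 2")
  case True
  define t where "t = max r (min (d / 2) (norm (x - k)))"
  have t: "r \<le> t" "t \<le> d / 2" "t > 0" using r by (auto simp: t_def)
  have d: "d > 0" using r by simp
  have fl: "flux r a d k x = strength r a * (1 / t ^ 3 - 8 / d ^ 3)" by (simp add: flux_def radial_def t_def)
  have "t ^ 3 \<le> (d / 2) ^ 3" using t by (intro power_mono) auto
  then have "8 * t ^ 3 \<le> d ^ 3" by (simp add: power_divide)
  then have lo: "8 / d ^ 3 \<le> 1 / t ^ 3" using t d by (simp add: field_simps)
  have "1 / t ^ 3 \<le> 1 / r ^ 3" using t r by (intro divide_left_mono power_mono mult_pos_pos) auto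
  moreover have "0 \<le> 8 / d ^ 3" using d by simp
  ultimately have hi: "1 / t ^ 3 - 8 / d ^ 3 \<le> 1 / r ^ 3" by linarith
  have "\<bar>flux r a d k x\<bar> = strength r a * (1 / t ^ 3 - 8 / d ^ 3)"
    unfolding fl using lo strength_pos[OF r(1,2)] by (simp add: abs_mult)
  also have "\<dots> \<le> strength r a * (1 / r ^ 3)" using hi strength_pos[OF r(1,2)] by (intro mult_left_mono) auto
  finally have "\<bar>flux r a d k x\<bar> \<le> strength r a / r ^ 3" by simp
  then have "\<bar>flux r a d k x\<bar> * norm (x - k) \<le> strength r a / r ^ 3 * (d / 2)"
    using True r strength_pos[OF r(1,2)] by (intro mult_mono) auto
  then show ?thesis by simp
next
  case False
  then have "flux r a d k x = 0" using flux_outside(1)[OF r(3), of x k a] by simp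
  then show ?thesis using r strength_pos[OF r(1,2)] by simp
qed

section \<open>The corrector identity\<close>

definition laplacian :: "('a::euclidean_space \<Rightarrow> real) \<Rightarrow> 'a \<Rightarrow> real" where
  "laplacian \<phi> x = (\<Sum>i\<in>Basis. grad (pd \<phi> i) x \<bullet> i)"

lemma laplacian_bounded:
  assumes "\<phi> \<in> test_functions"
  shows "laplacian \<phi> \<in> borel_measurable borel" "\<exists>M. \<forall>x. \<bar>laplacian \<phi> x\<bar> \<le> M"
proof -
  have b: "grad (pd \<phi> i) \<in> borel_measurable borel" if "i \<in> Basis" for i by (rule grad_borel[OF test_pd[OF assms that]])
  show "laplacian \<phi> \<in> borel_measurable borel"
    unfolding laplacian_def[abs_def] using b by (intro borel_measurable_sum borel_measurable_inner borel_measurable_const)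
  have "\<exists>M. \<forall>x. norm (grad (pd \<phi> i) x) \<le> M" if i: "i \<in> Basis" for i
  proof -
    obtain M where M: "M > 0" "\<And>x. norm (grad (pd \<phi> i) x) \<le> M" using grad_bounded[OF test_pd[OF assms i]] by blast
    then show ?thesis by (intro exI allI)
  qed
  then have "\<forall>i\<in>Basis. \<exists>M. \<forall>x. norm (grad (pd \<phi> i) x) \<le> M" by (rule ballI)
  from bchoice[OF this] obtain M where M: "\<forall>i\<in>Basis. \<forall>x. norm (grad (pd \<phi> i) x) \<le> M i" by (elim exE)
  have "\<bar>laplacian \<phi> x\<bar> \<le> (\<Sum>i\<in>Basis. M i)" for x
    unfolding laplacian_def
  proof (rule order_trans[OF sum_abs], rule sum_mono)
    fix i :: 'a assume i: "i \<in> Basis"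
    show "\<bar>grad (pd \<phi> i) x \<bullet> i\<bar> \<le> M i"
      by (rule order_trans[OF Basis_le_norm[OF i] M[rule_format, OF i]])
  qed
  then show "\<exists>M. \<forall>x. \<bar>laplacian \<phi> x\<bar> \<le> M" by (intro exI allI)
qed

text \<open>Moves the derivative off the multiplier. For the sum of the potentials this is a gain,
  because the sum becomes small in L2 while its gradient is merely bounded.\<close>

lemma H1_laplacian_by_parts:
  assumes s: "lip_deriv s D" and u: "H1_pair u G" and \<phi>: "\<phi> \<in> test_functions"
  shows "(\<integral>x. u x * (grad \<phi> x \<bullet> D x) \<partial>lborel)
    = - ((\<integral>x. s x * (u x * laplacian \<phi> x) \<partial>lborel) + (\<integral>x. s x * (G x \<bullet> grad \<phi> x) \<partial>lborel))"
proof -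
  note L = H1_pair_L2[OF u]
  obtain M where M: "\<And>x. \<bar>s x\<bar> \<le> M" using lip_deriv_bounded[OF s] by blast
  obtain Lp R N where N: "\<And>x y. \<bar>s x - s y\<bar> \<le> Lp * norm (x - y)" "R > 0" "\<And>x. R \<le> norm x \<Longrightarrow> s x = 0"
    "\<And>x. norm (D x) \<le> N" using lip_derivE[OF s] by blast
  have i1: "integrable lborel (\<lambda>x. (D x \<bullet> i) * (u x * pd \<phi> i x))" if i: "i \<in> Basis" for i
  proof (rule L2_bounded_triple_integrable[OF L(1) test_L2[OF test_pd[OF \<phi> i]]])
    show "(\<lambda>x. D x \<bullet> i) \<in> borel_measurable borel" using lip_deriv_borel_D[OF s] by simp
    show "\<bar>D x \<bullet> i\<bar> \<le> N" for x using Basis_le_norm[OF i, of "D x"] N(4)[of x] by linarith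
  qed
  have i2: "integrable lborel (\<lambda>x. s x * (u x * (grad (pd \<phi> i) x \<bullet> i)))" if i: "i \<in> Basis" for i
    by (rule L2_bounded_triple_integrable[OF L(1) L2_inner_Basis[OF grad_L2[OF test_pd[OF \<phi> i]]] lip_deriv_borel[OF s] M])
  have i3: "integrable lborel (\<lambda>x. s x * ((G x \<bullet> i) * pd \<phi> i x))" if i: "i \<in> Basis" for i
    by (rule L2_bounded_triple_integrable[OF L2_inner_Basis[OF L(2)] test_L2[OF test_pd[OF \<phi> i]] lip_deriv_borel[OF s] M])
  have e1: "u x * (grad \<phi> x \<bullet> D x) = (\<Sum>i\<in>Basis. (D x \<bullet> i) * (u x * pd \<phi> i x))" for x
    by (simp add: euclidean_inner[of "grad \<phi> x" "D x"] grad_inner_Basis sum_distrib_left mult_ac cong: sum.cong)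
  have e2: "s x * (u x * laplacian \<phi> x) = (\<Sum>i\<in>Basis. s x * (u x * (grad (pd \<phi> i) x \<bullet> i)))" for x
    by (simp add: laplacian_def sum_distrib_left)
  have e3: "s x * (G x \<bullet> grad \<phi> x) = (\<Sum>i\<in>Basis. s x * ((G x \<bullet> i) * pd \<phi> i x))" for x
    by (simp add: euclidean_inner[of "G x" "grad \<phi> x"] grad_inner_Basis sum_distrib_left cong: sum.cong)
  have "(\<integral>x. u x * (grad \<phi> x \<bullet> D x) \<partial>lborel) = (\<Sum>i\<in>Basis. \<integral>x. (D x \<bullet> i) * (u x * pd \<phi> i x) \<partial>lborel)"
    unfolding e1 by (rule Bochner_Integration.integral_sum) (rule i1)
  also have "\<dots> = (\<Sum>i\<in>Basis. - ((\<integral>x. s x * (u x * (grad (pd \<phi> i) x \<bullet> i)) \<partial>lborel) + (\<integral>x. s x * ((G x \<bullet> i) * pd \<phi> i x) \<partial>lborel)))"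
    by (intro sum.cong refl H1_integration_by_parts[OF s u H1_pair_test[OF test_pd[OF \<phi>]]])
  also have "\<dots> = - ((\<Sum>i\<in>Basis. \<integral>x. s x * (u x * (grad (pd \<phi> i) x \<bullet> i)) \<partial>lborel) + (\<Sum>i\<in>Basis. \<integral>x. s x * ((G x \<bullet> i) * pd \<phi> i x) \<partial>lborel))"
    by (simp only: sum.distrib sum_negf)
  also have "(\<Sum>i\<in>Basis. \<integral>x. s x * (u x * (grad (pd \<phi> i) x \<bullet> i)) \<partial>lborel) = (\<integral>x. s x * (u x * laplacian \<phi> x) \<partial>lborel)"
    unfolding e2 by (rule Bochner_Integration.integral_sum[symmetric]) (rule i2)
  also have "(\<Sum>i\<in>Basis. \<integral>x. s x * ((G x \<bullet> i) * pd \<phi> i x) \<partial>lborel) = (\<integral>x. s x * (G x \<bullet> grad \<phi> x) \<partial>lborel)"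
    unfolding e3 by (rule Bochner_Integration.integral_sum[symmetric]) (rule i3)
  finally show ?thesis .
qed

text \<open>The flux profile is frozen inside the hole, so the divergence is not the constant there;
  the vanishing of \<open>u\<close> in the hole removes that region from the integral.\<close>

lemma flux_by_parts:
  fixes u :: "real ^ 3 \<Rightarrow> real"
  assumes r: "0 < r" "r < d / 2" and u: "H1_pair u G" and \<phi>: "H1_pair \<phi> H"
    and z: "AE x in lborel. norm (x - k) \<le> r \<longrightarrow> u x = 0"
  shows "24 * strength r a / d ^ 3 * (\<integral>x. indicator (ball k (d / 2)) x * (u x * \<phi> x) \<partial>lborel)
    = (\<integral>x. u x * (H x \<bullet> (flux r a d k x *\<^sub>R (x - k))) \<partial>lborel) + (\<integral>x. \<phi> x * (G x \<bullet> (flux r a d k x *\<^sub>R (x - k))) \<partial>lborel)"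
proof -
  note fl = flux_lip[OF r, of a k]
  have Dz: "flux_grad r a d k x = 0" if "norm k + d / 2 \<le> norm x" for x
    unfolding flux_grad_def by (rule annulus_gradient_support[OF that])
  have "(\<integral>x. (real DIM(real ^ 3) * flux r a d k x + (x - k) \<bullet> flux_grad r a d k x) * (u x * \<phi> x) \<partial>lborel)
      = (\<integral>x. - (24 * strength r a / d ^ 3) * (indicator (ball k (d / 2)) x * (u x * \<phi> x)) \<partial>lborel)"
  proof (rule integral_cong_AE)
    note [measurable] = lip_deriv_borel[OF fl] lip_deriv_borel_D[OF fl] L2_borel[OF H1_pair_L2(1)[OF u]] L2_borel[OF H1_pair_L2(1)[OF \<phi>]]
    have [measurable]: "(indicator (ball k (d / 2)) :: real ^ 3 \<Rightarrow> real) \<in> borel_measurable borel"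
      by (rule borel_measurable_indicator) simp
    show "(\<lambda>x. (real DIM(real ^ 3) * flux r a d k x + (x - k) \<bullet> flux_grad r a d k x) * (u x * \<phi> x)) \<in> borel_measurable lborel"
      by measurable
    show "(\<lambda>x. - (24 * strength r a / d ^ 3) * (indicator (ball k (d / 2)) x * (u x * \<phi> x))) \<in> borel_measurable lborel"
      by measurable
    show "AE x in lborel. (real DIM(real ^ 3) * flux r a d k x + (x - k) \<bullet> flux_grad r a d k x) * (u x * \<phi> x)
        = - (24 * strength r a / d ^ 3) * (indicator (ball k (d / 2)) x * (u x * \<phi> x))"
      using z
    proof eventually_elim
      case (elim x)
      consider "norm (x - k) \<le> r" | "r < norm (x - k)" "norm (x - k) < d / 2" | "d / 2 \<le> norm (x - k)" by linarith
      then show ?case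
      proof cases
        case 1
        then show ?thesis using elim by simp
      next
        case 2
        have "real DIM(real ^ 3) * flux r a d k x + (x - k) \<bullet> flux_grad r a d k x = - (24 * strength r a / d ^ 3)"
          using flux_divergence[OF r(1) 2] by simp
        moreover have "x \<in> ball k (d / 2)" using 2 by (simp add: dist_norm norm_minus_commute)
        ultimately show ?thesis by simp
      next
        case 3
        then have "x \<notin> ball k (d / 2)" by (simp add: dist_norm norm_minus_commute)
        then show ?thesis using flux_outside[OF r(2) 3] by simp
      qed
    qed
  qed
  moreover have "(\<integral>x. (real DIM(real ^ 3) * flux r a d k x + (x - k) \<bullet> flux_grad r a d k x) * (u x * \<phi> x) \<partial>lborel)
      = - ((\<integral>x. u x * (flux r a d k x * (H x \<bullet> (x - k))) \<partial>lborel) + (\<integral>x. \<phi> x * (flux r a d k x * (G x \<bullet> (x - k))) \<partial>lborel))"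
    by (rule H1_field_integration_by_parts[OF fl Dz u \<phi>])
  ultimately show ?thesis by (simp only: integral_mult_right_zero inner_scaleR_right)
qed

text \<open>All finite sums below have at most one nonzero term at each point, because the balls of radius
  \<open>d/2\<close> about the lattice points are disjoint.\<close>

lemma lattice_sum_eq_term:
  fixes g :: "real ^ 3 \<Rightarrow> real ^ 3 \<Rightarrow> 'b::comm_monoid_add"
  assumes K: "finite K" "K \<subseteq> cubic_lattice d" and d: "d > 0" and k: "k \<in> K" "norm (x - k) < d / 2"
    and g: "\<And>l. d / 2 \<le> norm (x - l) \<Longrightarrow> g l x = 0"
  shows "(\<Sum>l\<in>K. g l x) = g k x"
proof -
  have "g l x = 0" if l: "l \<in> K" "l \<noteq> k" for l
  proof (rule g, rule ccontr)
    assume "\<not> d / 2 \<le> norm (x - l)"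
    then have "x \<in> ball l (d / 2)" "x \<in> ball k (d / 2)" using k(2) by (simp_all add: dist_norm norm_minus_commute)
    then have "l = k" using K(2) l(1) k(1) d by (intro lattice_balls_disjoint[of l d k x]) auto
    with l(2) show False by simp
  qed
  then have "(\<Sum>l\<in>K. g l x) = (\<Sum>l\<in>{k}. g l x)"
    using K(1) k(1) by (intro sum.mono_neutral_right) auto
  then show ?thesis by simp
qed

lemma lattice_sum_cases:
  fixes x :: "real ^ 3"
  obtains k where "k \<in> K" "norm (x - k) < d / 2" | "\<And>k. k \<in> K \<Longrightarrow> d / 2 \<le> norm (x - k)"
  using not_le by blast

text \<open>\<open>E\<close> is \<open>DS\<close> plus the sum of the flux fields. By
  \<open>flux_by_parts\<close> the two integrals with flux fields add up to the volume term, and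
  \<open>H1_laplacian_by_parts\<close> rewrites the integral of u grad \<phi> \<bullet> DS. Hence
  \<open>DS\<close> itself survives only on the left, and all else is a main term or multiplied by
  something small.\<close>

theorem corrector_identity:
  fixes u \<phi> :: "real ^ 3 \<Rightarrow> real"
  assumes r: "0 < r" "r < a" "a < d / 2" and K: "finite K" "K \<subseteq> cubic_lattice d"
    and cover: "\<And>k x. k \<in> cubic_lattice d \<Longrightarrow> k \<notin> K \<Longrightarrow> norm (x - k) \<le> d / 2 \<Longrightarrow> \<phi> x = 0"
    and u: "H1_pair u G" and z: "AE x in lborel. x \<in> holes d r \<longrightarrow> u x = 0" and \<phi>: "\<phi> \<in> test_functions"
  defines "S \<equiv> \<lambda>x. \<Sum>k\<in>K. cap r a k x" and "DS \<equiv> \<lambda>x. \<Sum>k\<in>K. cap_grad r a k x"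
    and "E \<equiv> \<lambda>x. (\<Sum>k\<in>K. cap_grad r a k x) + (\<Sum>k\<in>K. flux r a d k x *\<^sub>R (x - k))"
  shows "(\<integral>x. \<phi> x * (G x \<bullet> DS x) \<partial>lborel)
    = - (24 * strength r a / d ^ 3) * (\<integral>x. indicator (lattice_balls d) x * (u x * \<phi> x) \<partial>lborel)
      + (\<integral>x. \<phi> x * (G x \<bullet> E x) + u x * (grad \<phi> x \<bullet> E x) \<partial>lborel)
      + ((\<integral>x. S x * (u x * laplacian \<phi> x) \<partial>lborel) + (\<integral>x. S x * (G x \<bullet> grad \<phi> x) \<partial>lborel))"
proof -
  note L = H1_pair_L2[OF u] and T = test_L2[OF \<phi>] grad_L2[OF \<phi>]
  have rd: "r < d / 2" and d: "d > 0" using r by simp_all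
  define P where "P x = (\<Sum>k\<in>K. flux r a d k x *\<^sub>R (x - k))" for x
  have S: "lip_deriv S DS" unfolding S_def DS_def by (rule lip_deriv_sum[OF K(1)]) (rule cap_lip[OF r(1,2)])
  obtain Lp R N where N: "\<And>x y. \<bar>S x - S y\<bar> \<le> Lp * norm (x - y)" "R > 0" "\<And>x. R \<le> norm x \<Longrightarrow> S x = 0"
    "\<And>x. norm (DS x) \<le> N" using lip_derivE[OF S] by blast
  have Pb: "P \<in> borel_measurable borel"
    unfolding P_def[abs_def]
    by (intro borel_measurable_sum borel_measurable_scaleR lip_deriv_borel[OF flux_lip[OF r(1) rd]]) simp
  have PN: "norm (P x) \<le> (\<Sum>k\<in>K. strength r a / r ^ 3 * (d / 2))" for x
    unfolding P_def by (rule order_trans[OF norm_sum]) (intro sum_mono flux_field_bound[OF r(1,2) rd])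
  note DSb = lip_deriv_borel_D[OF S]
  have fb: "(\<lambda>x. flux r a d k x *\<^sub>R (x - k)) \<in> borel_measurable borel" for k
    by (intro borel_measurable_scaleR lip_deriv_borel[OF flux_lip[OF r(1) rd]]) simp
  have j1: "integrable lborel (\<lambda>x. u x * (grad \<phi> x \<bullet> (flux r a d k x *\<^sub>R (x - k))))" for k
    by (rule L2_field_integrable[OF L(1) T(2) fb flux_field_bound[OF r(1,2) rd]])
  have j2: "integrable lborel (\<lambda>x. \<phi> x * (G x \<bullet> (flux r a d k x *\<^sub>R (x - k))))" for k
    by (rule L2_field_integrable[OF T(1) L(2) fb flux_field_bound[OF r(1,2) rd]])
  have j3: "integrable lborel (\<lambda>x. indicator (ball k (d / 2)) x * (u x * \<phi> x))" for k :: "real ^ 3"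
    by (rule L2_bounded_triple_integrable[OF L(1) T(1) borel_measurable_indicator, of _ 1]) (simp_all add: indicator_def)
  have ind: "indicator (lattice_balls d) x * (u x * \<phi> x) = (\<Sum>k\<in>K. indicator (ball k (d / 2)) x * (u x * \<phi> x))" for x
  proof (cases rule: lattice_sum_cases[of K x d])
    case (1 k)
    have "(\<Sum>k\<in>K. indicator (ball k (d / 2)) x * (u x * \<phi> x)) = indicator (ball k (d / 2)) x * (u x * \<phi> x)"
      by (rule lattice_sum_eq_term[OF K d 1]) (simp add: dist_norm norm_minus_commute)
    moreover have "x \<in> ball k (d / 2)" using 1(2) by (simp add: dist_norm norm_minus_commute)
    moreover have "x \<in> lattice_balls d" using calculation(2) 1(1) K(2) by (auto simp: lattice_balls_def)
    ultimately show ?thesis by simp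
  next
    case 2
    have "(\<Sum>k\<in>K. indicator (ball k (d / 2)) x * (u x * \<phi> x)) = 0"
    proof (intro sum.neutral ballI)
      fix k assume "k \<in> K"
      then have "x \<notin> ball k (d / 2)" using 2[of k] by (simp add: dist_norm norm_minus_commute)
      then show "indicator (ball k (d / 2)) x * (u x * \<phi> x) = 0" by simp
    qed
    \<comment> \<open>The point may lie in a ball about a lattice point outside \<open>K\<close>;
      there \<open>cover\<close> makes \<phi> vanish.\<close>
    moreover have "indicator (lattice_balls d) x * (u x * \<phi> x) = 0"
    proof (cases "x \<in> lattice_balls d")
      case True
      then obtain k where k: "k \<in> cubic_lattice d" "x \<in> ball k (d / 2)" unfolding lattice_balls_def by blast
      then have nk: "norm (x - k) < d / 2" by (simp add: dist_norm norm_minus_commute)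
      then have "k \<notin> K" using 2 by fastforce
      then show ?thesis using cover[OF k(1), of x] nk by simp
    qed simp
    ultimately show ?thesis by simp
  qed
  have holes: "AE x in lborel. norm (x - k) \<le> r \<longrightarrow> u x = 0" if "k \<in> K" for k
    using z
  proof eventually_elim
    case (elim x)
    show ?case
    proof
      assume "norm (x - k) \<le> r"
      then have "x \<in> holes d r" using that K(2) by (auto simp: holes_def dist_norm norm_minus_commute)
      with elim show "u x = 0" by simp
    qed
  qed
  have sumP: "f x * (H x \<bullet> P x) = (\<Sum>k\<in>K. f x * (H x \<bullet> (flux r a d k x *\<^sub>R (x - k))))" for f :: "real ^ 3 \<Rightarrow> real" and H x
    unfolding P_def by (simp only: inner_sum_right sum_distrib_left)
  have I1: "24 * strength r a / d ^ 3 * (\<integral>x. indicator (lattice_balls d) x * (u x * \<phi> x) \<partial>lborel)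
      = (\<integral>x. u x * (grad \<phi> x \<bullet> P x) \<partial>lborel) + (\<integral>x. \<phi> x * (G x \<bullet> P x) \<partial>lborel)"
  proof -
    have "24 * strength r a / d ^ 3 * (\<integral>x. indicator (lattice_balls d) x * (u x * \<phi> x) \<partial>lborel)
       = 24 * strength r a / d ^ 3 * (\<Sum>k\<in>K. \<integral>x. indicator (ball k (d / 2)) x * (u x * \<phi> x) \<partial>lborel)"
      unfolding ind by (subst Bochner_Integration.integral_sum[OF j3]) (rule refl)
    also have "\<dots> = (\<Sum>k\<in>K. (\<integral>x. u x * (grad \<phi> x \<bullet> (flux r a d k x *\<^sub>R (x - k))) \<partial>lborel)
        + (\<integral>x. \<phi> x * (G x \<bullet> (flux r a d k x *\<^sub>R (x - k))) \<partial>lborel))"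
      unfolding sum_distrib_left
      by (intro sum.cong refl flux_by_parts[OF r(1) rd u H1_pair_test[OF \<phi>] holes])
    also have "\<dots> = (\<integral>x. u x * (grad \<phi> x \<bullet> P x) \<partial>lborel) + (\<integral>x. \<phi> x * (G x \<bullet> P x) \<partial>lborel)"
      unfolding sumP sum.distrib by (simp only: Bochner_Integration.integral_sum[OF j1] Bochner_Integration.integral_sum[OF j2])
    finally show ?thesis .
  qed
  have I2: "(\<integral>x. u x * (grad \<phi> x \<bullet> DS x) \<partial>lborel)
    = - ((\<integral>x. S x * (u x * laplacian \<phi> x) \<partial>lborel) + (\<integral>x. S x * (G x \<bullet> grad \<phi> x) \<partial>lborel))"
    by (rule H1_laplacian_by_parts[OF S u \<phi>])
  have EP: "E x = DS x + P x" for x by (simp add: E_def DS_def P_def)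
  have a1: "integrable lborel (\<lambda>x. u x * (grad \<phi> x \<bullet> DS x))" by (rule L2_field_integrable[OF L(1) T(2) DSb N(4)])
  have a2: "integrable lborel (\<lambda>x. u x * (grad \<phi> x \<bullet> P x))" by (rule L2_field_integrable[OF L(1) T(2) Pb PN])
  have a3: "integrable lborel (\<lambda>x. \<phi> x * (G x \<bullet> DS x))" by (rule L2_field_integrable[OF T(1) L(2) DSb N(4)])
  have a4: "integrable lborel (\<lambda>x. \<phi> x * (G x \<bullet> P x))" by (rule L2_field_integrable[OF T(1) L(2) Pb PN])
  have "(\<integral>x. \<phi> x * (G x \<bullet> E x) + u x * (grad \<phi> x \<bullet> E x) \<partial>lborel)
      = (\<integral>x. \<phi> x * (G x \<bullet> DS x) \<partial>lborel) + (\<integral>x. \<phi> x * (G x \<bullet> P x) \<partial>lborel)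
        + ((\<integral>x. u x * (grad \<phi> x \<bullet> DS x) \<partial>lborel) + (\<integral>x. u x * (grad \<phi> x \<bullet> P x) \<partial>lborel))"
    unfolding EP inner_add_right distrib_left using a1 a2 a3 a4 by simp
  then show ?thesis using I1 I2 by linarith
qed

lemma lip_deriv_L2:
  assumes "lip_deriv s D" shows "s \<in> L2"
proof (rule L2_I[OF lip_deriv_borel[OF assms]])
  obtain M where M: "\<And>x. \<bar>s x\<bar> \<le> M" using lip_deriv_bounded[OF assms] by blast
  obtain L R N where N: "\<And>x y. \<bar>s x - s y\<bar> \<le> L * norm (x - y)" "R > 0" "\<And>x. R \<le> norm x \<Longrightarrow> s x = 0"
    "\<And>x. norm (D x) \<le> N" using lip_derivE[OF assms] by blast
  show "integrable lborel (\<lambda>x. (norm (s x))\<^sup>2)"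
  proof (rule integrable_bounded_support)
    show "(\<lambda>x. (norm (s x))\<^sup>2) \<in> borel_measurable borel" using lip_deriv_borel[OF assms] by simp
    show "\<bar>(norm (s x))\<^sup>2\<bar> \<le> M\<^sup>2" for x using power_mono[OF M[of x], of 2] by simp
    show "(norm (s x))\<^sup>2 = 0" if "R \<le> norm x" for x using N(3)[OF that] by simp
  qed
qed

text \<open>The squared norm of \<open>Q\<close> is cut at a height n: the excess has small
  integral, and the rest contributes at most n times the measure of \<open>A\<close>. This
  compensates for a corrector gradient that is bounded but not small.\<close>

lemma L2_absolutely_continuous:
  fixes Q :: "'a::euclidean_space \<Rightarrow> 'b::euclidean_space"
  assumes Q: "Q \<in> L2" and e: "e > 0"
  shows "\<exists>\<delta>>0. \<forall>A \<in> sets borel. integrable lborel (indicator A :: 'a \<Rightarrow> real) \<longrightarrow> (\<integral>x. indicator A x \<partial>(lborel :: 'a measure)) \<le> (\<delta> :: real)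
    \<longrightarrow> l2 (\<lambda>x. indicator A x *\<^sub>R Q x) \<le> e"
proof -
  note [measurable] = L2_borel[OF Q]
  define g where "g x = (norm (Q x))\<^sup>2" for x
  have ig: "integrable lborel g" unfolding g_def[abs_def] by (rule L2_integrable[OF Q])
  have gb [measurable]: "g \<in> borel_measurable borel" unfolding g_def[abs_def] by measurable
  have im: "integrable lborel (\<lambda>x. g x - min (g x) (real n))" for n
    by (rule Bochner_Integration.integrable_bound[OF ig]) (auto simp: g_def min_def)
  have "(\<lambda>n. \<integral>x. g x - min (g x) (real n) \<partial>lborel) \<longlonglongrightarrow> (\<integral>x. 0 \<partial>(lborel :: 'a measure))"
  proof (rule integral_dominated_convergence[OF _ _ ig])
    show "AE x in lborel. (\<lambda>n. g x - min (g x) (real n)) \<longlonglongrightarrow> 0"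
    proof (rule AE_I2)
      fix x :: 'a
      obtain m :: nat where m: "g x \<le> real m" using real_arch_simple by blast
      have "\<forall>\<^sub>F n in sequentially. g x - min (g x) (real n) = 0"
        using eventually_ge_at_top[of m]
      proof eventually_elim
        case (elim n)
        then have "g x \<le> real n" using m by linarith
        then show ?case by simp
      qed
      then show "(\<lambda>n. g x - min (g x) (real n)) \<longlonglongrightarrow> 0" by (rule tendsto_eventually)
    qed
    show "AE x in lborel. norm (g x - min (g x) (real n)) \<le> g x" for n
      by (rule AE_I2) (auto simp: g_def min_def)
  qed measurable
  then have "\<forall>\<^sub>F n in sequentially. (\<integral>x. g x - min (g x) (real n) \<partial>lborel) < e\<^sup>2 / 2"
    using e by (intro order_tendstoD(2)) auto
  then obtain n where n: "(\<integral>x. g x - min (g x) (real n) \<partial>lborel) < e\<^sup>2 / 2"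
    by (auto simp: eventually_sequentially)
  \<comment> \<open>Dividing by n + 1 instead of n covers n = 0.\<close>
  define \<delta> where "\<delta> = e\<^sup>2 / 2 / (real n + 1)"
  have n1: "real n + 1 > 0" by linarith
  have \<delta>: "\<delta> > 0" using e n1 by (simp add: \<delta>_def)
  have "l2 (\<lambda>x. indicator A x *\<^sub>R Q x) \<le> e"
    if A: "A \<in> sets borel" and iA: "integrable lborel (indicator A :: 'a \<Rightarrow> real)"
      and le: "(\<integral>x. indicator A x \<partial>(lborel :: 'a measure)) \<le> \<delta>" for A
  proof (rule power2_le_imp_le)
    have sq: "(norm (indicator A x *\<^sub>R Q x))\<^sup>2 = indicator A x * g x" for x
      by (simp add: g_def indicator_def)
    have iAg: "integrable lborel (\<lambda>x. indicator A x * g x)"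
      by (rule integrable_bounded_mult[OF ig borel_measurable_indicator[OF A], of 1]) (simp add: indicator_def)
    have "(l2 (\<lambda>x. indicator A x *\<^sub>R Q x))\<^sup>2 = (\<integral>x. indicator A x * g x \<partial>lborel)"
      unfolding l2_sq sq by (rule refl)
    also have "\<dots> \<le> (\<integral>x. (g x - min (g x) (real n)) + real n * indicator A x \<partial>lborel)"
    proof (rule integral_mono[OF iAg])
      show "integrable lborel (\<lambda>x. (g x - min (g x) (real n)) + real n * indicator A x)" using im iA by simp
      show "indicator A x * g x \<le> (g x - min (g x) (real n)) + real n * indicator A x" for x
        by (cases "x \<in> A") (auto simp: g_def min_def)
    qed
    also have "\<dots> = (\<integral>x. g x - min (g x) (real n) \<partial>lborel) + real n * (\<integral>x. indicator A x \<partial>lborel)"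
      using im iA by simp
    also have "\<dots> \<le> e\<^sup>2 / 2 + real n * \<delta>" using n le by (intro add_mono mult_left_mono) auto
    also have "real n * \<delta> \<le> (real n + 1) * \<delta>" using \<delta> by simp
    also have "(real n + 1) * \<delta> = e\<^sup>2 / 2"
    proof -
      have "p * (q / p) = q" if "p > 0" for p q :: real using that by simp
      from this[OF n1] show ?thesis unfolding \<delta>_def .
    qed
    finally show "(l2 (\<lambda>x. indicator A x *\<^sub>R Q x))\<^sup>2 \<le> e\<^sup>2" by simp
  qed (use e in simp)
  with \<delta> show ?thesis by blast
qed

lemma norm_cap_grad_sq:
  assumes "0 < r" "r < a"
  shows "(norm (cap_grad r a k x))\<^sup>2
    = (strength r a)\<^sup>2 * (if r < norm (x - k) \<and> norm (x - k) < a then 1 / norm (x - k) ^ 4 else 0)"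
proof (cases "r < norm (x - k) \<and> norm (x - k) < a")
  case True
  define t where "t = norm (x - k)"
  have t: "t > 0" unfolding t_def using True assms by linarith
  have "norm (cap_grad r a k x) = strength r a / t\<^sup>2 / t * t"
    using True t strength_pos[OF assms] by (simp add: cap_grad_def annulus_gradient_def flip: t_def)
  also have "\<dots> = strength r a / t\<^sup>2" using t by simp
  finally show ?thesis using True by (simp add: power_divide t_def flip: power_mult)
next
  case False
  have "cap_grad r a k x = 0" unfolding cap_grad_def annulus_gradient_def by (rule if_not_P[OF False])
  then show ?thesis unfolding if_not_P[OF False] by simp
qed

section \<open>Estimates for the finite sum of potentials\<close>

context
  fixes r a d :: real and K :: "(real ^ 3) set" and n :: real
  assumes r: "0 < r" "r < a" "a < d / 2" and K: "finite K" "K \<subseteq> cubic_lattice d" and n: "real (card K) \<le> n"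
begin

private lemma d: "d > 0" using r by simp

lemma cap_sum_cases:
  fixes x :: "real ^ 3"
  obtains k where "k \<in> K" "norm (x - k) < d / 2" "(\<Sum>k\<in>K. cap r a k x) = cap r a k x" "(\<Sum>k\<in>K. cap_grad r a k x) = cap_grad r a k x"
      "(\<Sum>k\<in>K. flux r a d k x *\<^sub>R (x - k)) = flux r a d k x *\<^sub>R (x - k)"
  | "\<And>k. k \<in> K \<Longrightarrow> d / 2 \<le> norm (x - k)" "(\<Sum>k\<in>K. cap r a k x) = 0" "(\<Sum>k\<in>K. cap_grad r a k x) = 0"
      "(\<Sum>k\<in>K. flux r a d k x *\<^sub>R (x - k)) = 0"
proof (cases rule: lattice_sum_cases[of K x d])
  case (1 k)
  have out: "cap r a l x = 0" "cap_grad r a l x = 0" "flux r a d l x *\<^sub>R (x - l) = 0" if "d / 2 \<le> norm (x - l)" for l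
    using that r cap_outside[OF r(2), of x l] flux_outside(1)[OF _ that, of r a] by auto
  have e1: "(\<Sum>k\<in>K. cap r a k x) = cap r a k x"
    by (rule lattice_sum_eq_term[of K d k x "cap r a", OF K d 1]) (rule out(1))
  have e2: "(\<Sum>k\<in>K. cap_grad r a k x) = cap_grad r a k x"
    by (rule lattice_sum_eq_term[of K d k x "cap_grad r a", OF K d 1]) (rule out(2))
  have e3: "(\<Sum>k\<in>K. flux r a d k x *\<^sub>R (x - k)) = flux r a d k x *\<^sub>R (x - k)"
    by (rule lattice_sum_eq_term[of K d k x "\<lambda>k x. flux r a d k x *\<^sub>R (x - k)", OF K d 1]) (rule out(3))
  show ?thesis by (rule that(1)[OF 1 e1 e2 e3])
next
  case 2
  have out: "cap r a l x = 0" "cap_grad r a l x = 0" "flux r a d l x *\<^sub>R (x - l) = 0" if "l \<in> K" for l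
    using 2[OF that] r cap_outside[OF r(2), of x l] flux_outside(1)[OF _ 2[OF that], of r a] by auto
  show ?thesis by (rule that(2)[OF 2]) (simp_all add: out)
qed

lemma cap_sum_lip: "lip_deriv (\<lambda>x. \<Sum>k\<in>K. cap r a k x) (\<lambda>x. \<Sum>k\<in>K. cap_grad r a k x)"
  by (rule lip_deriv_sum[OF K(1)]) (rule cap_lip[OF r(1,2)])

definition cap_region :: "(real ^ 3) set" where
  "cap_region = (\<Union>k\<in>K. ball k a)"

lemma cap_region_borel: "cap_region \<in> sets borel"
  unfolding cap_region_def by (intro borel_open open_UN) auto

lemma cap_region_measure:
  "integrable lborel (indicator cap_region :: real ^ 3 \<Rightarrow> real)"
  "(\<integral>x. indicator cap_region x \<partial>lborel) \<le> n * (4 / 3 * pi * a ^ 3)"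
proof -
  have iI: "integrable lborel (indicator (ball k a) :: real ^ 3 \<Rightarrow> real)" for k
    by (rule integrable_real_indicator) (simp_all add: emeasure_lborel_ball_finite[unfolded infinity_ennreal_def] emeasure_lborel_ball_finite)
  have isum: "integrable lborel (\<lambda>x. \<Sum>k\<in>K. indicator (ball k a) x :: real)"
    by (rule Bochner_Integration.integrable_sum) (rule iI)
  have le: "indicator cap_region x \<le> (\<Sum>k\<in>K. indicator (ball k a) x :: real)" for x
  proof (cases "x \<in> cap_region")
    case True
    then obtain k where k: "k \<in> K" "x \<in> ball k a" unfolding cap_region_def by blast
    have "(indicator (ball k a) x :: real) \<le> (\<Sum>k\<in>K. indicator (ball k a) x)"
      using k(1) K(1) by (intro member_le_sum) auto
    then show ?thesis using True k(2) by simp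
  next
    case False
    then show ?thesis by (simp add: sum_nonneg)
  qed
  show i: "integrable lborel (indicator cap_region :: real ^ 3 \<Rightarrow> real)"
  proof (rule Bochner_Integration.integrable_bound[OF isum])
    show "(indicator cap_region :: real ^ 3 \<Rightarrow> real) \<in> borel_measurable lborel"
      using borel_measurable_indicator[OF cap_region_borel] by simp
    show "AE x in lborel. norm (indicator cap_region x :: real) \<le> norm (\<Sum>k\<in>K. indicator (ball k a) x :: real)"
      using le by (intro AE_I2) (simp add: sum_nonneg)
  qed
  have "(\<integral>x. indicator cap_region x \<partial>lborel) \<le> (\<integral>x. (\<Sum>k\<in>K. indicator (ball k a) x) \<partial>lborel :: real)"
    by (rule integral_mono[OF i isum le])
  also have "\<dots> = (\<Sum>k\<in>K. \<integral>x. indicator (ball k a) x \<partial>lborel)"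
    by (rule Bochner_Integration.integral_sum) (rule iI)
  also have "\<dots> = real (card K) * (4 / 3 * pi * a ^ 3)"
  proof -
    have "(\<integral>x. indicator (ball k a) x \<partial>lborel) = 4 / 3 * pi * a ^ 3" for k :: "real ^ 3"
      using content_ball[of a k] r emeasure_lborel_ball_finite[of k a] by (simp add: unit_ball_vol_3)
    then show ?thesis by (simp only: sum_constant)
  qed
  also have "\<dots> \<le> n * (4 / 3 * pi * a ^ 3)" using n r by (intro mult_right_mono) auto
  finally show "(\<integral>x. indicator cap_region x \<partial>lborel) \<le> n * (4 / 3 * pi * a ^ 3)" .
qed

lemma outside_cap_region:
  assumes "x \<notin> cap_region"
  shows "(\<Sum>k\<in>K. cap r a k x) = 0" "(\<Sum>k\<in>K. cap_grad r a k x) = 0"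
proof -
  have "cap r a k x = 0" "cap_grad r a k x = 0" if "k \<in> K" for k
    using assms that cap_outside[OF r(2), of x k] by (auto simp: cap_region_def dist_norm norm_minus_commute)
  then show "(\<Sum>k\<in>K. cap r a k x) = 0" "(\<Sum>k\<in>K. cap_grad r a k x) = 0" by simp_all
qed

lemma cap_sum_bounds: "\<bar>\<Sum>k\<in>K. cap r a k x\<bar> \<le> indicator cap_region x"
proof (cases "x \<in> cap_region")
  case True
  show ?thesis
    by (cases rule: cap_sum_cases[of x]) (use True cap_bounds[OF r(1,2)] in \<open>auto simp: abs_of_nonneg\<close>)
next
  case False
  then show ?thesis using outside_cap_region(1) by simp
qed

lemma l2_cap_sum: "l2 (\<lambda>x. \<Sum>k\<in>K. cap r a k x) \<le> sqrt (n * (4 / 3 * pi * a ^ 3))"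
proof (rule real_le_rsqrt)
  have "(l2 (\<lambda>x. \<Sum>k\<in>K. cap r a k x))\<^sup>2 = (\<integral>x. (norm (\<Sum>k\<in>K. cap r a k x))\<^sup>2 \<partial>lborel)" by (rule l2_sq)
  also have "\<dots> \<le> (\<integral>x. indicator cap_region x \<partial>lborel)"
  proof (rule integral_mono[OF L2_integrable[OF lip_deriv_L2[OF cap_sum_lip]] cap_region_measure(1)])
    fix x
    have "(norm (\<Sum>k\<in>K. cap r a k x))\<^sup>2 \<le> (indicator cap_region x)\<^sup>2"
      using cap_sum_bounds[of x] by (intro power_mono) auto
    moreover have "(indicator cap_region x :: real)\<^sup>2 = indicator cap_region x"
      by (cases "x \<in> cap_region") simp_all
    ultimately show "(norm (\<Sum>k\<in>K. cap r a k x))\<^sup>2 \<le> indicator cap_region x" by (simp only:)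
  qed
  also have "\<dots> \<le> n * (4 / 3 * pi * a ^ 3)" by (rule cap_region_measure(2))
  finally show "(l2 (\<lambda>x. \<Sum>k\<in>K. cap r a k x))\<^sup>2 \<le> n * (4 / 3 * pi * a ^ 3)" .
qed

text \<open>The annuli are disjoint, so the energies of the single potentials add. With n of order
  d^-3 and \<open>strength r a\<close> of order r the bound stays of order 1, matching the extra
  term \<mu> u in the limit equation.\<close>

lemma cap_grad_sum_L2:
  "(\<lambda>x. \<Sum>k\<in>K. cap_grad r a k x) \<in> L2"
  "l2 (\<lambda>x. \<Sum>k\<in>K. cap_grad r a k x) \<le> sqrt (n * ((strength r a)\<^sup>2 * (4 * pi / r)))"
proof -
  define w where "w k x = (if r < norm (x - k) \<and> norm (x - k) < a then 1 / norm (x - k) ^ 4 else 0)" for k x :: "real ^ 3"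
  have iw: "integrable lborel (w k)" and Iw: "(\<integral>x. w k x \<partial>lborel) \<le> 4 * pi / r" for k
    unfolding w_def[abs_def] by (rule inverse_fourth_power_annulus[OF r(1,2)])+
  have wn: "0 \<le> w k x" for k x by (simp add: w_def)
  have isum: "integrable lborel (\<lambda>x. \<Sum>k\<in>K. (strength r a)\<^sup>2 * w k x)"
    using iw by (intro Bochner_Integration.integrable_sum) simp
  have pw: "(norm (\<Sum>k\<in>K. cap_grad r a k x))\<^sup>2 \<le> (\<Sum>k\<in>K. (strength r a)\<^sup>2 * w k x)" for x
  proof (cases rule: cap_sum_cases[of x])
    case (1 k)
    have "(norm (cap_grad r a k x))\<^sup>2 = (strength r a)\<^sup>2 * w k x"
      unfolding w_def by (rule norm_cap_grad_sq[OF r(1,2)])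
    also have "\<dots> \<le> (\<Sum>k\<in>K. (strength r a)\<^sup>2 * w k x)"
      using 1(1) K(1) wn by (intro member_le_sum) auto
    finally show ?thesis unfolding 1(4) .
  next
    case 2
    then show ?thesis using wn by (simp add: sum_nonneg)
  qed
  have b: "(\<lambda>x. \<Sum>k\<in>K. cap_grad r a k x) \<in> borel_measurable borel" by (rule lip_deriv_borel_D[OF cap_sum_lip])
  have sqb: "(\<lambda>x. (norm (\<Sum>k\<in>K. cap_grad r a k x))\<^sup>2) \<in> borel_measurable lborel"
    using b by (auto intro: borel_measurable_power borel_measurable_norm)
  have i: "integrable lborel (\<lambda>x. (norm (\<Sum>k\<in>K. cap_grad r a k x))\<^sup>2)"
  proof (rule Bochner_Integration.integrable_bound[OF isum sqb])
    show "AE x in lborel. norm ((norm (\<Sum>k\<in>K. cap_grad r a k x))\<^sup>2) \<le> norm (\<Sum>k\<in>K. (strength r a)\<^sup>2 * w k x)"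
      using pw wn by (intro AE_I2) (simp add: sum_nonneg)
  qed
  show "(\<lambda>x. \<Sum>k\<in>K. cap_grad r a k x) \<in> L2" by (rule L2_I[OF b i])
  show "l2 (\<lambda>x. \<Sum>k\<in>K. cap_grad r a k x) \<le> sqrt (n * ((strength r a)\<^sup>2 * (4 * pi / r)))"
  proof (rule real_le_rsqrt)
    have "(l2 (\<lambda>x. \<Sum>k\<in>K. cap_grad r a k x))\<^sup>2 \<le> (\<integral>x. (\<Sum>k\<in>K. (strength r a)\<^sup>2 * w k x) \<partial>lborel)"
      unfolding l2_sq by (rule integral_mono[OF i isum pw])
    also have "\<dots> = (\<Sum>k\<in>K. \<integral>x. (strength r a)\<^sup>2 * w k x \<partial>lborel)"
      using iw by (intro Bochner_Integration.integral_sum) simp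
    also have "\<dots> \<le> (\<Sum>k\<in>K. (strength r a)\<^sup>2 * (4 * pi / r))"
    proof (rule sum_mono)
      fix k
      have "(\<integral>x. (strength r a)\<^sup>2 * w k x \<partial>lborel) = (strength r a)\<^sup>2 * (\<integral>x. w k x \<partial>lborel)" by simp
      also have "\<dots> \<le> (strength r a)\<^sup>2 * (4 * pi / r)" by (intro mult_left_mono Iw) simp
      finally show "(\<integral>x. (strength r a)\<^sup>2 * w k x \<partial>lborel) \<le> (strength r a)\<^sup>2 * (4 * pi / r)" .
    qed
    also have "\<dots> = real (card K) * ((strength r a)\<^sup>2 * (4 * pi / r))" by simp
    also have "\<dots> \<le> n * ((strength r a)\<^sup>2 * (4 * pi / r))" using n r by (intro mult_right_mono) auto
    finally show "(l2 (\<lambda>x. \<Sum>k\<in>K. cap_grad r a k x))\<^sup>2 \<le> n * ((strength r a)\<^sup>2 * (4 * pi / r))" .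
  qed
qed

text \<open>Inside a hole \<open>E\<close> is not small, but there \<open>u\<close> and
  \<open>G\<close> vanish almost everywhere; outside, \<open>corrector_field_bound\<close> applies.
  It is used with \<open>f = \<phi>\<close> and \<open>F = grad \<phi>\<close>.\<close>

lemma corrector_error_bound:
  assumes u: "H1_pair u G" and z: "AE x in lborel. x \<in> holes d r \<longrightarrow> u x = 0" and f: "f \<in> L2" "F \<in> L2"
  defines "E \<equiv> \<lambda>x. (\<Sum>k\<in>K. cap_grad r a k x) + (\<Sum>k\<in>K. flux r a d k x *\<^sub>R (x - k))"
  defines "\<epsilon> \<equiv> 8 * strength r a * a / d ^ 3 + strength r a / a\<^sup>2"
  shows "\<bar>\<integral>x. f x * (G x \<bullet> E x) + u x * (F x \<bullet> E x) \<partial>lborel\<bar> \<le> \<epsilon> * (l2 f * l2 G + l2 u * l2 F)"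
proof -
  note L = H1_pair_L2[OF u]
  have \<epsilon>: "\<epsilon> \<ge> 0" using strength_pos[OF r(1,2)] r d by (simp add: \<epsilon>_def)
  have hk: "AE x in lborel. norm (x - k) < r \<longrightarrow> u x = 0 \<and> G x = 0" if k: "k \<in> K" for k
  proof -
    have 1: "AE x in lborel. norm (x - k) < r \<longrightarrow> u x = 0"
      using z
    proof eventually_elim
      case (elim x)
      show ?case
      proof
        assume "norm (x - k) < r"
        then have "x \<in> holes d r" using k K(2) by (auto simp: holes_def dist_norm norm_minus_commute intro!: bexI[of _ k])
        with elim show "u x = 0" by simp
      qed
    qed
    from 1 H1_gradient_vanishes[OF u r(1) 1] show ?thesis by eventually_elim simp
  qed
  \<comment> \<open>The bounding sphere of each hole is discarded as a null set: gradients are known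
    to vanish only in the open ball, and the field bound holds only strictly outside.\<close>
  have all: "AE x in lborel. \<forall>k\<in>K. (norm (x - k) < r \<longrightarrow> u x = 0 \<and> G x = 0) \<and> norm (x - k) \<noteq> r"
    using K(1) hk AE_not_sphere[of _ r] by (intro AE_finite_allI AE_conjI) auto
  have ib: "integrable lborel (\<lambda>x. \<epsilon> * (norm (f x) * norm (G x) + norm (u x) * norm (F x)))"
    using L2_norm_mult_integrable[OF f(1) L(2)] L2_norm_mult_integrable[OF L(1) f(2)] by simp
  have "\<bar>\<integral>x. f x * (G x \<bullet> E x) + u x * (F x \<bullet> E x) \<partial>lborel\<bar>
      \<le> (\<integral>x. \<epsilon> * (norm (f x) * norm (G x) + norm (u x) * norm (F x)) \<partial>lborel)"
  proof (rule order_trans[OF integral_abs_bound], rule integral_mono_AE[OF _ ib])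
    have mono: "AE x in lborel. \<bar>f x * (G x \<bullet> E x) + u x * (F x \<bullet> E x)\<bar> \<le> \<epsilon> * (norm (f x) * norm (G x) + norm (u x) * norm (F x))"
      using all
    proof eventually_elim
      case (elim x)
      have "E x = 0 \<or> (u x = 0 \<and> G x = 0) \<or> norm (E x) \<le> \<epsilon>"
      proof (cases rule: cap_sum_cases[of x])
        case (1 k)
        show ?thesis
        proof (cases "norm (x - k) < r")
          case True
          then show ?thesis using elim 1(1) by simp
        next
          case False
          then have "r < norm (x - k)" using elim 1(1) by force
          from corrector_field_bound[OF r this] show ?thesis by (simp add: E_def 1 \<epsilon>_def)
        qed
      next
        case 2
        then show ?thesis by (simp add: E_def)
      qed
      then show ?case
      proof (elim disjE)
        assume E: "norm (E x) \<le> \<epsilon>"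
        have "\<bar>G x \<bullet> E x\<bar> \<le> norm (G x) * \<epsilon>" "\<bar>F x \<bullet> E x\<bar> \<le> norm (F x) * \<epsilon>"
          using E by (intro order_trans[OF Cauchy_Schwarz_ineq2] mult_left_mono; simp)+
        then have "\<bar>f x\<bar> * \<bar>G x \<bullet> E x\<bar> \<le> \<bar>f x\<bar> * (norm (G x) * \<epsilon>)" "\<bar>u x\<bar> * \<bar>F x \<bullet> E x\<bar> \<le> \<bar>u x\<bar> * (norm (F x) * \<epsilon>)"
          by (auto intro: mult_left_mono)
        then have "\<bar>f x * (G x \<bullet> E x)\<bar> + \<bar>u x * (F x \<bullet> E x)\<bar> \<le> \<epsilon> * (norm (f x) * norm (G x) + norm (u x) * norm (F x))"
          by (simp add: abs_mult algebra_simps)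
        then show ?thesis using abs_triangle_ineq order_trans by blast
      qed (use \<epsilon> in auto)
    qed
    have Eb: "E \<in> borel_measurable borel"
      unfolding E_def using r
      by (intro borel_measurable_add borel_measurable_sum borel_measurable_scaleR lip_deriv_borel_D[OF cap_lip[OF r(1,2)]]
            lip_deriv_borel[OF flux_lip[OF r(1)]]) auto
    note [measurable] = Eb L2_borel[OF L(1)] L2_borel[OF L(2)] L2_borel[OF f(1)] L2_borel[OF f(2)]
    show "integrable lborel (\<lambda>x. \<bar>f x * (G x \<bullet> E x) + u x * (F x \<bullet> E x)\<bar>)"
    proof (rule integrable_abs, rule Bochner_Integration.integrable_bound[OF ib])
      show "(\<lambda>x. f x * (G x \<bullet> E x) + u x * (F x \<bullet> E x)) \<in> borel_measurable lborel" by measurable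
      show "AE x in lborel. norm (f x * (G x \<bullet> E x) + u x * (F x \<bullet> E x))
          \<le> norm (\<epsilon> * (norm (f x) * norm (G x) + norm (u x) * norm (F x)))"
        using mono by eventually_elim (use \<epsilon> in \<open>simp add: abs_of_nonneg\<close>)
    qed
    show "AE x in lborel. \<bar>f x * (G x \<bullet> E x) + u x * (F x \<bullet> E x)\<bar> \<le> \<epsilon> * (norm (f x) * norm (G x) + norm (u x) * norm (F x))"
      by (rule mono)
  qed
  also have "\<dots> = \<epsilon> * ((\<integral>x. norm (f x) * norm (G x) \<partial>lborel) + (\<integral>x. norm (u x) * norm (F x) \<partial>lborel))"
    using L2_norm_mult_integrable[OF f(1) L(2)] L2_norm_mult_integrable[OF L(1) f(2)] by simp
  also have "\<dots> \<le> \<epsilon> * (l2 f * l2 G + l2 u * l2 F)"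
    by (intro mult_left_mono add_mono L2_norm_Cauchy_Schwarz f L \<epsilon>)
  finally show ?thesis .
qed

end

text \<open>Here \<open>n\<close> bounds the number of holes near the support, \<sigma> and \<tau>
  bound the sum of the potentials and its gradient in L2, and \<epsilon> bounds the corrector field.
  Only \<tau> stays away from 0 in the limit, which is why its term keeps the factor with
  \<open>Q\<close> restricted to \<open>A\<close>, the union of the balls of radius a. The remaining
  errors come from the mismatch of \<mu> with the relative capacity and from the lattice
  average.\<close>

lemma corrector_estimate:
  fixes u \<phi> q :: "real ^ 3 \<Rightarrow> real"
  assumes r: "0 < r" "r < a" "a < d / 2" and d1: "d \<le> 1" and \<phi>: "\<phi> \<in> test_functions"
    and R0: "R0 > 0" "\<And>x. R0 \<le> norm x \<Longrightarrow> \<phi> x = 0" and M0: "\<And>x. \<bar>\<phi> x\<bar> \<le> M0"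
    and M1: "\<And>x. norm (grad \<phi> x) \<le> M1" and M2: "\<And>x. \<bar>laplacian \<phi> x\<bar> \<le> M2"
    and f: "f \<in> H_minus1" and sol: "weak_solution_outside (holes d r) f u"
    and p: "H1_pair u G" and Mu: "l2 u \<le> Mu" and Mg: "l2 G \<le> Mg"
    and q: "H1_pair q Q" "\<And>v. v \<in> H1 \<Longrightarrow> form \<mu> q v = f v" and mu: "\<mu> > 0"
  defines "n \<equiv> (2 * (R0 + 2) / d) ^ 3"
  defines "\<sigma> \<equiv> sqrt (n * (4 / 3 * pi * a ^ 3))"
    and "\<tau> \<equiv> sqrt (n * ((strength r a)\<^sup>2 * (4 * pi / r)))"
    and "\<epsilon> \<equiv> 8 * strength r a * a / d ^ 3 + strength r a / a\<^sup>2"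
  shows "\<exists>A\<in>sets borel. integrable lborel (indicator A :: real ^ 3 \<Rightarrow> real) \<and>
    (\<integral>x. indicator A x \<partial>lborel) \<le> n * (4 / 3 * pi * a ^ 3) \<and>
    \<bar>form \<mu> \<phi> u - f \<phi>\<bar> \<le> l2 (\<lambda>x. indicator A x *\<^sub>R Q x) * (M1 * \<sigma> + M0 * \<tau>) + \<mu> * (l2 q * (M0 * \<sigma>))
      + 2 * (M1 * \<sigma> * Mg) + M2 * \<sigma> * Mu + \<epsilon> * (l2 \<phi> * Mg + Mu * l2 (grad \<phi>))
      + \<bar>\<mu> - 4 * pi * strength r a / d ^ 3\<bar> * (Mu * l2 \<phi>)
      + 24 * strength r a / d ^ 3 * (3 * d * (Mu * l2 (grad \<phi>) + Mg * l2 \<phi>))"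
proof -
  have d: "d > 0" using r by simp
  define \<kappa> where "\<kappa> = strength r a"
  have \<kappa>: "\<kappa> > 0" unfolding \<kappa>_def by (rule strength_pos[OF r(1,2)])
  \<comment> \<open>Since \<open>d \<le> 1\<close>, balls of radius d/2 about omitted lattice points
    do not meet the support of \<phi>. The packing ball of radius R0 + 1 + d/2 then lies within R0 +
    2, whence the constant in \<open>n\<close>.\<close>
  define K where "K = {k :: real ^ 3. k \<in> cubic_lattice d \<and> norm (k - 0) \<le> R0 + 1}"
  have K1: "finite K" unfolding K_def by (rule finite_lattice_ball[OF d])
  have K2: "K \<subseteq> cubic_lattice d" unfolding K_def by blast
  note K = K1 K2
  have nK: "real (card K) \<le> n"
  proof -
    have "real (card K) * (d / 2) ^ DIM(real ^ 3) \<le> (R0 + 1 + d / 2) ^ DIM(real ^ 3)"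
      by (rule card_separated_le[OF K(1), where c = 0])
        (use d R0(1) in \<open>auto simp: K_def intro: cubic_lattice_separated\<close>)
    also have "\<dots> \<le> (R0 + 2) ^ DIM(real ^ 3)" using d d1 R0(1) by (intro power_mono) auto
    finally have "real (card K) * (d / 2) ^ 3 \<le> (R0 + 2) ^ 3" by simp
    moreover have e: "2 * (R0 + 2) / d * (d / 2) = R0 + 2" using d by simp
    have "n * (d / 2) ^ 3 = (R0 + 2) ^ 3"
      unfolding n_def by (simp only: e power_mult_distrib[symmetric])
    ultimately have "real (card K) * (d / 2) ^ 3 \<le> n * (d / 2) ^ 3" by (simp only:)
    then show ?thesis by (rule mult_right_le_imp_le) (use d in simp)
  qed
  have cover: "\<phi> x = 0" if "k \<in> cubic_lattice d" "k \<notin> K" "norm (x - k) \<le> d / 2" for k x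
  proof -
    have "norm k > R0 + 1" using that(1,2) by (simp add: K_def)
    then have "R0 \<le> norm x" using that(3) d1 norm_triangle_ineq2[of k x] by (simp add: norm_minus_commute)
    then show ?thesis by (rule R0(2))
  qed
  define S where "S x = (\<Sum>k\<in>K. cap r a k x)" for x
  define DS where "DS x = (\<Sum>k\<in>K. cap_grad r a k x)" for x
  define E where "E x = (\<Sum>k\<in>K. cap_grad r a k x) + (\<Sum>k\<in>K. flux r a d k x *\<^sub>R (x - k))" for x
  define A where "A = cap_region a K"
  have S: "lip_deriv S DS" unfolding S_def[abs_def] DS_def[abs_def] by (rule cap_sum_lip[OF r K nK])
  have SL: "S \<in> L2" by (rule lip_deriv_L2[OF S])
  have S\<sigma>: "l2 S \<le> \<sigma>" unfolding S_def[abs_def] \<sigma>_def by (rule l2_cap_sum[OF r K nK])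
  have DSL: "DS \<in> L2" unfolding DS_def[abs_def] by (rule cap_grad_sum_L2(1)[OF r K nK])
  have DS\<tau>: "l2 DS \<le> \<tau>" unfolding DS_def[abs_def] \<tau>_def by (rule cap_grad_sum_L2(2)[OF r K nK])
  have AB: "A \<in> sets borel" unfolding A_def by (rule cap_region_borel[OF r K nK])
  have Ai: "integrable lborel (indicator A :: real ^ 3 \<Rightarrow> real)" "(\<integral>x. indicator A x \<partial>lborel) \<le> n * (4 / 3 * pi * a ^ 3)"
    unfolding A_def by (rule cap_region_measure[OF r K nK])+
  have Aout: "S x = 0" "DS x = 0" if "x \<notin> A" for x
    using outside_cap_region[OF r K nK, of x] that by (simp_all add: A_def S_def DS_def)
  note L = H1_pair_L2[OF p] and T = test_L2[OF \<phi>] grad_L2[OF \<phi>] and LQ = H1_pair_L2[OF q(1)]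
  have M00: "0 \<le> M0" using M0[of 0] by linarith
  have M10: "0 \<le> M1" using M1[of 0] norm_ge_zero[of "grad \<phi> 0"] by linarith
  have M20: "0 \<le> M2" using M2[of 0] by linarith
  have Mu0: "0 \<le> Mu" using Mu l2_nonneg[of u] by linarith
  have Mg0: "0 \<le> Mg" using Mg l2_nonneg[of G] by linarith
  have \<sigma>0: "0 \<le> \<sigma>" using S\<sigma> l2_nonneg[of S] by linarith
  have \<tau>0: "0 \<le> \<tau>" using DS\<tau> l2_nonneg[of DS] by linarith
  define W where "W x = S x *\<^sub>R grad \<phi> x + \<phi> x *\<^sub>R DS x" for x
  have pS: "H1_pair (\<lambda>x. S x * \<phi> x) W"
    unfolding W_def[abs_def] by (rule H1_pair_mult_lip[OF S H1_pair_test[OF \<phi>]])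
  have sg: "(\<lambda>x. S x *\<^sub>R grad \<phi> x) \<in> L2" "l2 (\<lambda>x. S x *\<^sub>R grad \<phi> x) \<le> M1 * l2 S"
    by (rule L2_bounded_field[OF SL grad_borel[OF \<phi>] M1])+
  have pD: "(\<lambda>x. \<phi> x *\<^sub>R DS x) \<in> L2" "l2 (\<lambda>x. \<phi> x *\<^sub>R DS x) \<le> M0 * l2 DS"
    by (rule L2_bounded_scaleR[OF DSL test_borel[OF \<phi>] M0])+
  \<comment> \<open>This is (1 - S) \<phi>, an admissible test function: S equals 1 on each hole
    with centre in \<open>K\<close>, and \<phi> vanishes on the other holes.\<close>
  define v0 where "v0 x = \<phi> x + (-1) * (S x * \<phi> x)" for x
  have pv0: "H1_pair v0 (\<lambda>x. grad \<phi> x + (-1) *\<^sub>R W x)"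
    unfolding v0_def[abs_def] by (rule H1_pair_lincomb[OF H1_pair_test[OF \<phi>] pS])
  have "v0 x = 0" if x: "x \<in> holes d r" for x
  proof -
    obtain k where k: "k \<in> cubic_lattice d" "norm (x - k) \<le> r"
      using x by (auto simp: holes_def dist_norm norm_minus_commute)
    show ?thesis
    proof (cases "k \<in> K")
      case True
      have "S x = cap r a k x"
        unfolding S_def by (rule lattice_sum_eq_term[of K d k x "cap r a", OF K d True])
          (use k(2) r cap_outside(1)[OF r(2)] in auto)
      then show ?thesis using cap_hole[OF r(1,2) k(2)] by (simp add: v0_def)
    next
      case False
      then show ?thesis using cover[OF k(1) False, of x] k(2) r by (simp add: v0_def)
    qed
  qed
  then have "v0 \<in> H1_vanishing_in (holes d r)"
    using H1_pair_H1[OF pv0] by (simp add: H1_vanishing_in_def)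
  then have fv0: "form 0 u v0 = f v0" using sol by (simp add: weak_solution_outside_form)
  have uz: "AE x in lborel. x \<in> holes d r \<longrightarrow> u x = 0"
    using sol by (simp add: weak_solution_outside_form H1_vanishing_in_def)
  have fl: "f v0 = f \<phi> + (-1) * f (\<lambda>x. S x * \<phi> x)"
    unfolding v0_def[abs_def] by (rule H_minus1_lin[OF f H1_pair_H1[OF H1_pair_test[OF \<phi>]] H1_pair_H1[OF pS]])
  define Z where "Z = (\<integral>x. S x * (G x \<bullet> grad \<phi> x) \<partial>lborel)"
  define Y where "Y = (\<integral>x. S x * (u x * laplacian \<phi> x) \<partial>lborel)"
  define X where "X = (\<integral>x. \<phi> x * (G x \<bullet> E x) + u x * (grad \<phi> x \<bullet> E x) \<partial>lborel)"
  define J where "J = (\<integral>x. indicator (lattice_balls d) x * (u x * \<phi> x) \<partial>lborel)"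
  define I where "I = (\<integral>x. u x * \<phi> x \<partial>lborel)"
  define V where "V = (\<integral>x. \<phi> x * (G x \<bullet> DS x) \<partial>lborel)"
  have i1: "integrable lborel (\<lambda>x. G x \<bullet> grad \<phi> x)" by (rule L2_inner_integrable[OF L(2) T(2)])
  have i2: "integrable lborel (\<lambda>x. S x * (G x \<bullet> grad \<phi> x))"
    using L2_inner_integrable[OF L(2) sg(1)] by simp
  have i3: "integrable lborel (\<lambda>x. \<phi> x * (G x \<bullet> DS x))"
    using L2_inner_integrable[OF L(2) pD(1)] by simp
  have "form 0 u v0 = (\<integral>x. G x \<bullet> (grad \<phi> x + (-1) *\<^sub>R W x) \<partial>lborel)"
    unfolding form_pair[OF p pv0] by simp
  also have "\<dots> = (\<integral>x. G x \<bullet> grad \<phi> x - S x * (G x \<bullet> grad \<phi> x) - \<phi> x * (G x \<bullet> DS x) \<partial>lborel)"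
    by (intro Bochner_Integration.integral_cong refl) (simp add: W_def inner_add_right algebra_simps inner_diff_right)
  also have "\<dots> = (\<integral>x. G x \<bullet> grad \<phi> x \<partial>lborel) - Z - V"
    unfolding Z_def V_def using i1 i2 i3 by simp
  finally have e1: "form 0 u v0 = (\<integral>x. G x \<bullet> grad \<phi> x \<partial>lborel) - Z - V" .
  have e2: "form \<mu> \<phi> u = (\<integral>x. G x \<bullet> grad \<phi> x \<partial>lborel) + \<mu> * I"
    unfolding form_pair[OF H1_pair_test[OF \<phi>] p] I_def by (simp add: inner_commute mult.commute)
  have e3: "V = - (24 * \<kappa> / d ^ 3) * J + X + (Y + Z)"
    unfolding V_def J_def X_def Y_def Z_def \<kappa>_def S_def DS_def E_def
    by (rule corrector_identity[OF r K cover p uz \<phi>])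
  \<comment> \<open>\<open>Z\<close> occurs twice: once from the gradient of the test function and
    once from the integration by parts in \<open>corrector_identity\<close>.\<close>
  have main: "form \<mu> \<phi> u - f \<phi> = - f (\<lambda>x. S x * \<phi> x) + 2 * Z + Y + X + (\<mu> * I - 24 * \<kappa> / d ^ 3 * J)"
    using e1 e2 e3 fv0 fl by simp
  have bZ: "\<bar>Z\<bar> \<le> M1 * \<sigma> * Mg"
  proof -
    have "Z = (\<integral>x. (S x *\<^sub>R grad \<phi> x) \<bullet> G x \<partial>lborel)" by (simp add: Z_def inner_commute)
    then have "\<bar>Z\<bar> \<le> l2 (\<lambda>x. S x *\<^sub>R grad \<phi> x) * l2 G" using L2_inner_Cauchy_Schwarz[OF sg(1) L(2)] by simp
    also have "\<dots> \<le> (M1 * l2 S) * Mg" by (intro mult_mono mult_nonneg_nonneg l2_nonneg sg(2) Mg M10)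
    also have "\<dots> \<le> (M1 * \<sigma>) * Mg" using S\<sigma> M10 Mg0 by (intro mult_right_mono mult_left_mono)
    finally show ?thesis .
  qed
  have bY: "\<bar>Y\<bar> \<le> M2 * \<sigma> * Mu"
  proof -
    have lS: "(\<lambda>x. laplacian \<phi> x * S x) \<in> L2" "l2 (\<lambda>x. laplacian \<phi> x * S x) \<le> M2 * l2 S"
      by (rule L2_bounded_mult[OF SL laplacian_bounded(1)[OF \<phi>] M2])+
    have "Y = (\<integral>x. (laplacian \<phi> x * S x) * u x \<partial>lborel)" by (simp add: Y_def mult_ac)
    then have "\<bar>Y\<bar> \<le> l2 (\<lambda>x. laplacian \<phi> x * S x) * l2 u" using L2_mult_Cauchy_Schwarz[OF lS(1) L(1)] by simp
    also have "\<dots> \<le> (M2 * l2 S) * Mu" by (intro mult_mono mult_nonneg_nonneg l2_nonneg lS(2) Mu M20)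
    also have "\<dots> \<le> (M2 * \<sigma>) * Mu" using S\<sigma> M20 Mu0 by (intro mult_right_mono mult_left_mono)
    finally show ?thesis .
  qed
  have \<epsilon>0: "\<epsilon> \<ge> 0" unfolding \<epsilon>_def using \<kappa> r d by (simp add: \<kappa>_def)
  have bX: "\<bar>X\<bar> \<le> \<epsilon> * (l2 \<phi> * Mg + Mu * l2 (grad \<phi>))"
  proof -
    have "\<bar>X\<bar> \<le> \<epsilon> * (l2 \<phi> * l2 G + l2 u * l2 (grad \<phi>))"
      unfolding X_def E_def \<epsilon>_def by (rule corrector_error_bound[OF r K nK p uz T])
    also have "\<dots> \<le> \<epsilon> * (l2 \<phi> * Mg + Mu * l2 (grad \<phi>))"
      by (intro mult_left_mono add_mono mult_right_mono l2_nonneg Mu Mg \<epsilon>0)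
    finally show ?thesis .
  qed
  have bI: "\<bar>I\<bar> \<le> Mu * l2 \<phi>"
    unfolding I_def by (rule order_trans[OF L2_mult_Cauchy_Schwarz[OF L(1) T(1)]]) (intro mult_right_mono Mu l2_nonneg)
  have bJ: "\<bar>J - pi / 6 * I\<bar> \<le> 3 * d * (Mu * l2 (grad \<phi>) + Mg * l2 \<phi>)"
  proof -
    have "\<bar>J - pi / 6 * I\<bar> \<le> 3 * d * (l2 u * l2 (grad \<phi>) + l2 G * l2 \<phi>)"
      unfolding J_def I_def by (rule lattice_averaging[OF d p H1_pair_test[OF \<phi>]])
    also have "\<dots> \<le> 3 * d * (Mu * l2 (grad \<phi>) + Mg * l2 \<phi>)"
      using d by (intro mult_left_mono add_mono mult_right_mono l2_nonneg Mu Mg) simp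
    finally show ?thesis .
  qed
  have bIJ: "\<bar>\<mu> * I - 24 * \<kappa> / d ^ 3 * J\<bar> \<le> \<bar>\<mu> - 4 * pi * \<kappa> / d ^ 3\<bar> * (Mu * l2 \<phi>)
      + 24 * \<kappa> / d ^ 3 * (3 * d * (Mu * l2 (grad \<phi>) + Mg * l2 \<phi>))"
  proof -
    \<comment> \<open>The density \<pi>/6 of the balls turns the divergence 24 \<kappa> / d^3 into 4
      \<pi> \<kappa> / d^3, the capacity of the holes per unit volume.\<close>
    have "\<mu> * I - 24 * \<kappa> / d ^ 3 * J = (\<mu> - 4 * pi * \<kappa> / d ^ 3) * I - 24 * \<kappa> / d ^ 3 * (J - pi / 6 * I)"
      by (simp add: algebra_simps diff_divide_distrib)
    then have "\<bar>\<mu> * I - 24 * \<kappa> / d ^ 3 * J\<bar> \<le> \<bar>(\<mu> - 4 * pi * \<kappa> / d ^ 3) * I\<bar> + \<bar>24 * \<kappa> / d ^ 3 * (J - pi / 6 * I)\<bar>"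
      by (simp only: abs_triangle_ineq4)
    also have "\<dots> = \<bar>\<mu> - 4 * pi * \<kappa> / d ^ 3\<bar> * \<bar>I\<bar> + 24 * \<kappa> / d ^ 3 * \<bar>J - pi / 6 * I\<bar>"
      using \<kappa> d by (simp add: abs_mult)
    also have "\<dots> \<le> \<bar>\<mu> - 4 * pi * \<kappa> / d ^ 3\<bar> * (Mu * l2 \<phi>) + 24 * \<kappa> / d ^ 3 * (3 * d * (Mu * l2 (grad \<phi>) + Mg * l2 \<phi>))"
      using \<kappa> d by (intro add_mono mult_left_mono bI bJ) auto
    finally show ?thesis .
  qed
  have bf: "\<bar>f (\<lambda>x. S x * \<phi> x)\<bar> \<le> l2 (\<lambda>x. indicator A x *\<^sub>R Q x) * (M1 * \<sigma> + M0 * \<tau>) + \<mu> * (l2 q * (M0 * \<sigma>))"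
  proof -
    have Ab: "(indicator A :: real ^ 3 \<Rightarrow> real) \<in> borel_measurable borel" by (rule borel_measurable_indicator[OF AB])
    have AQ: "(\<lambda>x. indicator A x *\<^sub>R Q x) \<in> L2"
      by (rule L2_bounded_scaleR(1)[OF LQ(2) Ab, of 1]) (simp add: indicator_def)
    have WL: "W \<in> L2" by (rule H1_pair_L2(2)[OF pS])
    have lW: "l2 W \<le> M1 * \<sigma> + M0 * \<tau>"
    proof -
      have "l2 W \<le> l2 (\<lambda>x. S x *\<^sub>R grad \<phi> x) + l2 (\<lambda>x. \<phi> x *\<^sub>R DS x)"
        unfolding W_def[abs_def] by (rule l2_add_le[OF sg(1) pD(1)])
      also have "\<dots> \<le> M1 * l2 S + M0 * l2 DS" by (intro add_mono sg(2) pD(2))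
      also have "\<dots> \<le> M1 * \<sigma> + M0 * \<tau>" by (intro add_mono mult_left_mono S\<sigma> DS\<tau> M10 M00)
      finally show ?thesis .
    qed
    \<comment> \<open>\<open>W\<close> vanishes off \<open>A\<close> because both the potential and
      its gradient do, so \<open>Q\<close> may be cut down to \<open>A\<close> before
      Cauchy-Schwarz.\<close>
    have "Q x \<bullet> W x = (indicator A x *\<^sub>R Q x) \<bullet> W x" for x
      using Aout[of x] by (cases "x \<in> A") (simp_all add: W_def)
    then have "(\<integral>x. Q x \<bullet> W x \<partial>lborel) = (\<integral>x. (indicator A x *\<^sub>R Q x) \<bullet> W x \<partial>lborel)"
      by (intro Bochner_Integration.integral_cong refl)
    then have 1: "\<bar>\<integral>x. Q x \<bullet> W x \<partial>lborel\<bar> \<le> l2 (\<lambda>x. indicator A x *\<^sub>R Q x) * (M1 * \<sigma> + M0 * \<tau>)"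
      using order_trans[OF L2_inner_Cauchy_Schwarz[OF AQ WL] mult_left_mono[OF lW l2_nonneg]] by simp
    have S\<phi>: "(\<lambda>x. \<phi> x * S x) \<in> L2" "l2 (\<lambda>x. \<phi> x * S x) \<le> M0 * l2 S"
      by (rule L2_bounded_mult[OF SL test_borel[OF \<phi>] M0])+
    have "l2 (\<lambda>x. \<phi> x * S x) \<le> M0 * \<sigma>" using S\<phi>(2) mult_left_mono[OF S\<sigma> M00] by linarith
    then have "l2 q * l2 (\<lambda>x. \<phi> x * S x) \<le> l2 q * (M0 * \<sigma>)" by (rule mult_left_mono) (rule l2_nonneg)
    then have 2: "\<bar>\<integral>x. q x * (S x * \<phi> x) \<partial>lborel\<bar> \<le> l2 q * (M0 * \<sigma>)"
      using L2_mult_Cauchy_Schwarz[OF LQ(1) S\<phi>(1)] by (simp add: mult.commute[of "S _"])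
    have "f (\<lambda>x. S x * \<phi> x) = (\<integral>x. Q x \<bullet> W x \<partial>lborel) + \<mu> * (\<integral>x. q x * (S x * \<phi> x) \<partial>lborel)"
      using q(2)[OF H1_pair_H1[OF pS]] form_pair[OF q(1) pS, of \<mu>] by simp
    moreover have "\<bar>\<mu> * (\<integral>x. q x * (S x * \<phi> x) \<partial>lborel)\<bar> \<le> \<mu> * (l2 q * (M0 * \<sigma>))"
      using 2 mu by (simp add: abs_mult)
    ultimately show ?thesis using 1 by linarith
  qed
  have five: "\<bar>- x + 2 * z + y + w + t\<bar> \<le> \<bar>x\<bar> + 2 * \<bar>z\<bar> + \<bar>y\<bar> + \<bar>w\<bar> + \<bar>t\<bar>" for x y z w t :: real
    by linarith
  have "\<bar>form \<mu> \<phi> u - f \<phi>\<bar> \<le> \<bar>f (\<lambda>x. S x * \<phi> x)\<bar> + 2 * \<bar>Z\<bar> + \<bar>Y\<bar> + \<bar>X\<bar> + \<bar>\<mu> * I - 24 * \<kappa> / d ^ 3 * J\<bar>"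
    unfolding main by (rule five)
  also have "\<dots> \<le> l2 (\<lambda>x. indicator A x *\<^sub>R Q x) * (M1 * \<sigma> + M0 * \<tau>) + \<mu> * (l2 q * (M0 * \<sigma>))
      + 2 * (M1 * \<sigma> * Mg) + M2 * \<sigma> * Mu + \<epsilon> * (l2 \<phi> * Mg + Mu * l2 (grad \<phi>))
      + (\<bar>\<mu> - 4 * pi * \<kappa> / d ^ 3\<bar> * (Mu * l2 \<phi>) + 24 * \<kappa> / d ^ 3 * (3 * d * (Mu * l2 (grad \<phi>) + Mg * l2 \<phi>)))"
    by (intro add_mono bf bY bX bIJ mult_left_mono[OF bZ]) simp
  finally show ?thesis using AB Ai by (intro bexI[of _ A] conjI) (simp_all only: \<kappa>_def add.assoc)
qed

lemma holes_borel:
  assumes "d > 0" shows "(holes d r :: (real ^ 'n) set) \<in> sets borel"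
  unfolding holes_def by (intro sets.countable_UN'' countable_cubic_lattice assms) auto

text \<open>The Poincare constant involves r and d only through r / d^3, hence only through \<mu>;
  this makes it uniform in r. The factor 72 is 27 times 8/3.\<close>

lemma perforated_coercive:
  fixes v :: "real ^ 3 \<Rightarrow> real"
  assumes r: "0 < r" "r < d" and \<mu>: "\<mu> = 4 * pi * r / d ^ 3" and v: "v \<in> H1_vanishing_in (holes d r)" and p: "H1_pair v G"
  shows "(l2 v)\<^sup>2 \<le> 72 * pi / \<mu> * (l2 G)\<^sup>2"
proof -
  have d: "d > 0" using r by simp
  have m: "\<mu> > 0" unfolding \<mu> using r d by simp
  have "(3 * r / (2 * d ^ 3)) * (l2 v)\<^sup>2 \<le> 27 * (l2 G)\<^sup>2"
    by (rule Poincare_perforated[OF r p]) (use v in \<open>simp add: H1_vanishing_in_def\<close>)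
  moreover have "3 * r / (2 * d ^ 3) = 3 * \<mu> / (8 * pi)" unfolding \<mu> using d by (simp add: field_simps)
  ultimately have "3 * \<mu> / (8 * pi) * (l2 v)\<^sup>2 \<le> 27 * (l2 G)\<^sup>2" by simp
  then have "8 * pi / (3 * \<mu>) * (3 * \<mu> / (8 * pi) * (l2 v)\<^sup>2) \<le> 8 * pi / (3 * \<mu>) * (27 * (l2 G)\<^sup>2)"
    using m by (intro mult_left_mono) auto
  then show ?thesis using m by simp
qed

section \<open>The limit\<close>

lemma eq_divide_swap:
  fixes c D \<mu> :: real assumes "\<mu> > 0" "\<mu> = c / D" shows "D = c / \<mu>"
proof -
  have "D \<noteq> 0" using assms by auto
  then have "\<mu> * D = c" using assms(2) by simp
  then show ?thesis using assms(1) by (simp add: field_simps)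
qed

text \<open>The choice \<open>a = r\<^bsup>2/5\<^esup>\<close> of the intermediate radius is written as \<open>r = b\<^sup>5\<close>, \<open>a = b\<^sup>2\<close>.\<close>

lemma corrector_scaling:
  fixes b d \<mu> R :: real
  assumes b: "0 < b" "b < 1 / 2" "b < pi / (2 * \<mu>)" and d: "d > 0" and \<mu>: "\<mu> > 0" "\<mu> = 4 * pi * b ^ 5 / d ^ 3" and R: "R > 0"
  shows "b ^ 5 < b\<^sup>2" "b\<^sup>2 < d / 2"
    "(R / d) ^ 3 * (4 / 3 * pi * (b\<^sup>2) ^ 3) = R ^ 3 * \<mu> / 3 * b"
    "(R / d) ^ 3 * ((strength (b ^ 5) (b\<^sup>2))\<^sup>2 * (4 * pi / b ^ 5)) \<le> 4 * R ^ 3 * \<mu>"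
    "8 * strength (b ^ 5) (b\<^sup>2) * b\<^sup>2 / d ^ 3 + strength (b ^ 5) (b\<^sup>2) / (b\<^sup>2)\<^sup>2 \<le> 4 * \<mu> / pi * b\<^sup>2 + 2 * b"
    "\<bar>\<mu> - 4 * pi * strength (b ^ 5) (b\<^sup>2) / d ^ 3\<bar> \<le> 2 * \<mu> * b ^ 3"
    "24 * strength (b ^ 5) (b\<^sup>2) / d ^ 3 \<le> 12 * \<mu> / pi"
proof -
  have d3: "d ^ 3 > 0" and b5: "b ^ 5 > 0" using d b(1) by simp_all
  have k: "b ^ 5 / d ^ 3 = \<mu> / (4 * pi)" unfolding \<mu>(2) by simp
  have dk: "d ^ 3 = 4 * pi * b ^ 5 / \<mu>" by (rule eq_divide_swap[OF \<mu>])
  \<comment> \<open>Here r/a = b^3, and b < 1/2 keeps it below 1/2.\<close>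
  have "b ^ 3 \<le> (1 / 2) ^ 3" using b by (intro power_mono) auto
  then have b3: "b ^ 3 < 1 / 2" by (simp add: power3_eq_cube)
  define s where "s = strength (b ^ 5) (b\<^sup>2)"
  have bb: "b ^ 5 = b\<^sup>2 * b ^ 3" by (simp flip: power_add)
  \<comment> \<open>The strength is r / (1 - r/a), so it exceeds r by a factor that is at most 2 and
    tends to 1.\<close>
  have s: "s = b ^ 5 / (1 - b ^ 3)"
  proof -
    have "b\<^sup>2 - b ^ 5 = b\<^sup>2 * (1 - b ^ 3)" unfolding bb by (simp only: right_diff_distrib mult_1_right)
    then have "s = b\<^sup>2 * b ^ 5 / (b\<^sup>2 * (1 - b ^ 3))" unfolding s_def strength_def by (simp only: mult.commute)
    also have "\<dots> = b ^ 5 / (1 - b ^ 3)" by (rule mult_divide_mult_cancel_left) (use b(1) in simp)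
    finally show ?thesis .
  qed
  have half: "x / (1 - b ^ 3) \<le> 2 * x" if "x \<ge> 0" for x
  proof -
    have "1 * x \<le> (2 * (1 - b ^ 3)) * x" using b3 that by (intro mult_right_mono) auto
    then have "x \<le> 2 * x * (1 - b ^ 3)" by (simp add: algebra_simps)
    then show ?thesis by (subst pos_divide_le_eq) (use b3 in simp_all)
  qed
  have s2: "s \<le> 2 * b ^ 5" unfolding s by (rule half) (use b5 in simp)
  have s0: "s \<ge> 0" unfolding s using b3 b5 by simp
  have sd: "s / d ^ 3 \<le> \<mu> / (2 * pi)"
  proof -
    have "s / d ^ 3 \<le> 2 * b ^ 5 / d ^ 3" using s2 d3 by (intro divide_right_mono) auto
    also have "\<dots> = 2 * (b ^ 5 / d ^ 3)" by simp
    also have "\<dots> = \<mu> / (2 * pi)" unfolding k by simp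
    finally show ?thesis .
  qed
  have sb: "s / b ^ 5 \<le> 2" using s2 b5 by (simp add: pos_divide_le_eq)
  have sd0: "0 \<le> s / d ^ 3" using s0 d3 by simp
  have "b\<^sup>2 * b ^ 3 < b\<^sup>2 * 1" using b3 b(1) by (intro mult_strict_left_mono) auto
  then show "b ^ 5 < b\<^sup>2" unfolding bb by (simp only: mult_1_right)
  have b6: "(b\<^sup>2) ^ 3 = b * b ^ 5" by (simp only: power_mult[symmetric] power_Suc[symmetric]) simp
  have b4: "b * (b\<^sup>2)\<^sup>2 = b ^ 5" by (simp only: power_mult[symmetric] power_Suc[symmetric]) simp
  show "b\<^sup>2 < d / 2"
  proof (rule ccontr)
    assume "\<not> b\<^sup>2 < d / 2"
    \<comment> \<open>After cubing, b^5 cancels, since d^3 is a multiple of it. The surviving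
      inequality contradicts b < \<pi> / (2 \<mu>), which is the origin of that hypothesis.\<close>
    then have "d ^ 3 \<le> (2 * b\<^sup>2) ^ 3" using d by (intro power_mono) auto
    also have "\<dots> = b ^ 5 * (8 * b)" by (simp only: power_mult_distrib b6) simp
    finally have "b ^ 5 * (4 * pi / \<mu>) \<le> b ^ 5 * (8 * b)" unfolding dk by (simp only: times_divide_eq_right mult_ac)
    then have "4 * pi / \<mu> \<le> 8 * b" using b5 by (rule mult_left_le_imp_le)
    then show False using b(3) \<mu>(1) by (simp add: field_simps)
  qed
  have "(R / d) ^ 3 * (4 / 3 * pi * (b\<^sup>2) ^ 3) = R ^ 3 * (4 / 3 * pi * b) * (b ^ 5 / d ^ 3)"
    unfolding b6 power_divide by simp
  also have "\<dots> = R ^ 3 * \<mu> / 3 * b" unfolding k by simp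
  finally show "(R / d) ^ 3 * (4 / 3 * pi * (b\<^sup>2) ^ 3) = R ^ 3 * \<mu> / 3 * b" .
  have "(R / d) ^ 3 * (s\<^sup>2 * (4 * pi / b ^ 5)) = R ^ 3 * 4 * pi * (s / d ^ 3 * (s / b ^ 5))"
    unfolding power_divide by (simp add: power2_eq_square)
  also have "\<dots> \<le> R ^ 3 * 4 * pi * (\<mu> / (2 * pi) * 2)"
    using sd sb sd0 s0 b5 R \<mu>(1) by (intro mult_left_mono mult_mono) auto
  also have "\<dots> = 4 * R ^ 3 * \<mu>" by simp
  finally show "(R / d) ^ 3 * ((strength (b ^ 5) (b\<^sup>2))\<^sup>2 * (4 * pi / b ^ 5)) \<le> 4 * R ^ 3 * \<mu>" unfolding s_def .
  have 1: "8 * s * b\<^sup>2 / d ^ 3 \<le> 4 * \<mu> / pi * b\<^sup>2"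
  proof -
    have "8 * s * b\<^sup>2 / d ^ 3 = 8 * b\<^sup>2 * (s / d ^ 3)" by simp
    also have "\<dots> \<le> 8 * b\<^sup>2 * (\<mu> / (2 * pi))" using sd by (intro mult_left_mono) auto
    finally show ?thesis by simp
  qed
  have 2: "s / (b\<^sup>2)\<^sup>2 \<le> 2 * b"
  proof -
    have "s \<le> 2 * b * (b\<^sup>2)\<^sup>2" using s2 by (simp only: mult.assoc b4)
    then show ?thesis using b(1) by (simp add: pos_divide_le_eq)
  qed
  show "8 * strength (b ^ 5) (b\<^sup>2) * b\<^sup>2 / d ^ 3 + strength (b ^ 5) (b\<^sup>2) / (b\<^sup>2)\<^sup>2 \<le> 4 * \<mu> / pi * b\<^sup>2 + 2 * b"
    using add_mono[OF 1 2] unfolding s_def .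
  have "4 * pi * s / d ^ 3 = 4 * pi * (b ^ 5 / d ^ 3) / (1 - b ^ 3)" unfolding s by simp
  also have "\<dots> = \<mu> / (1 - b ^ 3)" unfolding k by simp
  finally have "\<mu> - 4 * pi * s / d ^ 3 = - (\<mu> * b ^ 3 / (1 - b ^ 3))" using b3 by (simp add: field_simps)
  then have "\<bar>\<mu> - 4 * pi * s / d ^ 3\<bar> = \<mu> * b ^ 3 / (1 - b ^ 3)" using b3 b(1) \<mu>(1) by simp
  also have "\<dots> \<le> 2 * (\<mu> * b ^ 3)" by (rule half) (use b(1) \<mu>(1) in simp)
  also have "\<dots> = 2 * \<mu> * b ^ 3" by simp
  finally show "\<bar>\<mu> - 4 * pi * strength (b ^ 5) (b\<^sup>2) / d ^ 3\<bar> \<le> 2 * \<mu> * b ^ 3" unfolding s_def .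
  show "24 * strength (b ^ 5) (b\<^sup>2) / d ^ 3 \<le> 12 * \<mu> / pi" using mult_left_mono[OF sd, of 24] unfolding s_def[symmetric] by simp
qed

text \<open>All errors tend to 0 explicitly except the product involving \<open>Q\<close>; the
  others are collected in \<open>rest\<close>. In that product one factor stays bounded by
  \<open>N\<close>, and the other falls below e / (2 N) once the total volume of the balls of radius
  a is less than \<delta>.\<close>

lemma perforated_test_convergence:
  fixes w :: "real \<Rightarrow> real ^ 3 \<Rightarrow> real"
  assumes \<mu>: "\<mu> > 0" and d: "\<And>r. r > 0 \<Longrightarrow> d r > 0 \<and> \<mu> = 4 * pi * r / (d r) ^ 3"
    and f: "f \<in> H_minus1" and q: "H1_pair q Q" "\<And>v. v \<in> H1 \<Longrightarrow> form \<mu> q v = f v" and r0: "r0 > 0"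
    and w: "\<And>r. 0 < r \<Longrightarrow> r < r0 \<Longrightarrow> weak_solution_outside (holes (d r) r) f (w r)"
      "\<And>r. 0 < r \<Longrightarrow> r < r0 \<Longrightarrow> H1_pair (w r) (G r)"
      "\<And>r. 0 < r \<Longrightarrow> r < r0 \<Longrightarrow> l2 (w r) \<le> Mu" "\<And>r. 0 < r \<Longrightarrow> r < r0 \<Longrightarrow> l2 (G r) \<le> Mg"
    and \<phi>: "\<phi> \<in> test_functions"
  shows "((\<lambda>r. form \<mu> \<phi> (w r)) \<longlongrightarrow> f \<phi>) (at_right 0)"
proof (rule tendstoI)
  fix e :: real assume e: "e > 0"
  obtain R0 where R0: "R0 > 0" "\<And>x. R0 \<le> norm x \<Longrightarrow> \<phi> x = 0" using test_support[OF \<phi>] by auto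
  obtain M0 where M0: "M0 > 0" "\<And>x. \<bar>\<phi> x\<bar> \<le> M0" using test_bounded[OF \<phi>] by blast
  obtain M1 where M1: "M1 > 0" "\<And>x. norm (grad \<phi> x) \<le> M1" using grad_bounded[OF \<phi>] by blast
  obtain M2 where M2: "\<And>x. \<bar>laplacian \<phi> x\<bar> \<le> M2" using laplacian_bounded(2)[OF \<phi>] by auto
  define R where "R = 2 * (R0 + 2)"
  have R: "R > 0" using R0(1) by (simp add: R_def)
  define T where "T = sqrt (4 * R ^ 3 * \<mu>)"
  have T: "T \<ge> 0" using R \<mu> by (simp add: T_def)
  define \<sigma> where "\<sigma> r = sqrt (R ^ 3 * \<mu> / 3 * root 5 r)" for r
  define rest where "rest r = \<mu> * (l2 q * (M0 * \<sigma> r)) + 2 * (M1 * \<sigma> r * Mg) + M2 * \<sigma> r * Mu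
    + (4 * \<mu> / pi * (root 5 r)\<^sup>2 + 2 * root 5 r) * (l2 \<phi> * Mg + Mu * l2 (grad \<phi>))
    + 2 * \<mu> * root 5 r ^ 3 * (Mu * l2 \<phi>)
    + 12 * \<mu> / pi * (3 * d r * (Mu * l2 (grad \<phi>) + Mg * l2 \<phi>))" for r
  have D: "N > 0" "e / (2 * N) > 0" if "N = M1 + M0 * T + 1" for N
    using that M0(1) M1(1) T e by (simp_all add: add_nonneg_pos add_pos_nonneg)
  \<comment> \<open>Bounds the norm of the gradient of the corrector times \<phi> as soon as
    \<sigma> is at most 1; independent of r, so that \<delta> can be chosen before r.\<close>
  define N where "N = M1 + M0 * T + 1"
  obtain \<delta> :: real where \<delta>': "\<delta> > 0 \<and> (\<forall>A \<in> sets borel. integrable lborel (indicator A :: real ^ 3 \<Rightarrow> real) \<longrightarrow>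
      (\<integral>x. indicator A x \<partial>(lborel :: (real ^ 3) measure)) \<le> \<delta> \<longrightarrow> l2 (\<lambda>x. indicator A x *\<^sub>R Q x) \<le> e / (2 * N))"
    using L2_absolutely_continuous[OF H1_pair_L2(2)[OF q(1)] D(2)[OF N_def]] by (rule exE)
  note \<delta> = conjunct1[OF \<delta>'] conjunct2[OF \<delta>']
  have b0: "(root 5 \<longlongrightarrow> 0) (at_right 0)"
    using tendsto_real_root[OF tendsto_ident_at, of 5 0 "{0<..}"] by simp
  have \<sigma>0: "(\<sigma> \<longlongrightarrow> 0) (at_right 0)"
    unfolding \<sigma>_def[abs_def] using tendsto_real_sqrt[OF tendsto_mult_left[OF b0, of "R ^ 3 * \<mu> / 3"]] by simp
  \<comment> \<open>The relation with \<mu> determines d as a cube root, from which d tends to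
    0.\<close>
  have deq: "d r = root 3 (4 * pi / \<mu> * r)" if "r > 0" for r
  proof (rule real_root_pos_unique[symmetric])
    show "0 \<le> d r" using d[OF that] by simp
    have "d r ^ 3 = 4 * pi * r / \<mu>" by (rule eq_divide_swap[OF \<mu>]) (use d[OF that] in blast)
    then show "d r ^ 3 = 4 * pi / \<mu> * r" by simp
  qed simp
  have d0: "(d \<longlongrightarrow> 0) (at_right 0)"
  proof (rule Lim_transform_eventually)
    show "((\<lambda>r. root 3 (4 * pi / \<mu> * r)) \<longlongrightarrow> 0) (at_right 0)"
      using tendsto_real_root[OF tendsto_mult_left[OF tendsto_ident_at], of 3 "4 * pi / \<mu>" 0 "{0<..}"] by simp
    show "\<forall>\<^sub>F r in at_right 0. root 3 (4 * pi / \<mu> * r) = d r"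
      using eventually_at_right_less by (rule eventually_mono) (simp add: deq)
  qed
  have rest0: "(rest \<longlongrightarrow> 0) (at_right 0)"
  proof -
    have "(rest \<longlongrightarrow> \<mu> * (l2 q * (M0 * 0)) + 2 * (M1 * 0 * Mg) + M2 * 0 * Mu
      + (4 * \<mu> / pi * 0\<^sup>2 + 2 * 0) * (l2 \<phi> * Mg + Mu * l2 (grad \<phi>))
      + 2 * \<mu> * 0 ^ 3 * (Mu * l2 \<phi>)
      + 12 * \<mu> / pi * (3 * 0 * (Mu * l2 (grad \<phi>) + Mg * l2 \<phi>))) (at_right 0)"
      unfolding rest_def[abs_def] by (intro tendsto_intros b0 \<sigma>0 d0)
    then show ?thesis by simp
  qed
  have C0: "((\<lambda>r. R ^ 3 * \<mu> / 3 * root 5 r) \<longlongrightarrow> 0) (at_right 0)"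
    using tendsto_mult_left[OF b0, of "R ^ 3 * \<mu> / 3"] by simp
  have small: "\<forall>\<^sub>F r in at_right 0. r < r0" using eventually_at_right_field r0 by blast
  have half: "pi / (2 * \<mu>) > 0" using \<mu> by simp
  have "\<forall>\<^sub>F r in at_right 0. 0 < r \<and> r < r0 \<and> root 5 r < 1 / 2 \<and> root 5 r < pi / (2 * \<mu>) \<and> d r < 1
      \<and> \<sigma> r < 1 \<and> R ^ 3 * \<mu> / 3 * root 5 r < \<delta> \<and> rest r < e / 2"
    using e \<delta>(1) half
    by (intro eventually_conj eventually_at_right_less small order_tendstoD(2)[OF b0] order_tendstoD(2)[OF d0]
      order_tendstoD(2)[OF \<sigma>0] order_tendstoD(2)[OF C0] order_tendstoD(2)[OF rest0]) auto
  then show "\<forall>\<^sub>F r in at_right 0. dist (form \<mu> \<phi> (w r)) (f \<phi>) < e"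
  proof (rule eventually_mono)
    fix r assume *: "0 < r \<and> r < r0 \<and> root 5 r < 1 / 2 \<and> root 5 r < pi / (2 * \<mu>) \<and> d r < 1
      \<and> \<sigma> r < 1 \<and> R ^ 3 * \<mu> / 3 * root 5 r < \<delta> \<and> rest r < e / 2"
    define b where "b = root 5 r"
    have b: "0 < b" "b < 1 / 2" "b < pi / (2 * \<mu>)" and br: "b ^ 5 = r" using * by (simp_all add: b_def)
    have r: "0 < r" "r < r0" and dr1: "d r \<le> 1" and \<sigma>1: "\<sigma> r \<le> 1" and C\<delta>: "R ^ 3 * \<mu> / 3 * b \<le> \<delta>" and re: "rest r < e / 2"
      using * by (simp_all add: b_def)
    have dr: "d r > 0" "\<mu> = 4 * pi * b ^ 5 / d r ^ 3" using d[OF r(1)] by (simp_all add: br)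
    note sc = corrector_scaling[OF b dr(1) \<mu> dr(2) R]
    have Mu0: "0 \<le> Mu" using order_trans[OF l2_nonneg w(3)[OF r]] .
    have Mg0: "0 \<le> Mg" using order_trans[OF l2_nonneg w(4)[OF r]] .
    have pos: "0 < b ^ 5" using b by simp
    have sol: "weak_solution_outside (holes (d r) (b ^ 5)) f (w r)" unfolding br by (rule w(1)[OF r])
    have \<sigma>r: "sqrt ((R / d r) ^ 3 * (4 / 3 * pi * (b\<^sup>2) ^ 3)) = \<sigma> r" unfolding \<sigma>_def b_def[symmetric] sc(3) ..
    define \<tau> where "\<tau> = sqrt ((R / d r) ^ 3 * ((strength (b ^ 5) (b\<^sup>2))\<^sup>2 * (4 * pi / b ^ 5)))"
    have \<tau>: "\<tau> \<le> T" unfolding \<tau>_def T_def by (rule real_sqrt_le_mono[OF sc(4)])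
    define \<epsilon> where "\<epsilon> = 8 * strength (b ^ 5) (b\<^sup>2) * b\<^sup>2 / d r ^ 3 + strength (b ^ 5) (b\<^sup>2) / (b\<^sup>2)\<^sup>2"
    obtain A where A0: "A \<in> sets borel" and A': "integrable lborel (indicator A :: real ^ 3 \<Rightarrow> real) \<and>
      (\<integral>x. indicator A x \<partial>(lborel :: (real ^ 3) measure)) \<le> (R / d r) ^ 3 * (4 / 3 * pi * (b\<^sup>2) ^ 3) \<and>
        \<bar>form \<mu> \<phi> (w r) - f \<phi>\<bar> \<le> l2 (\<lambda>x. indicator A x *\<^sub>R Q x) * (M1 * \<sigma> r + M0 * \<tau>) + \<mu> * (l2 q * (M0 * \<sigma> r))
        + 2 * (M1 * \<sigma> r * Mg) + M2 * \<sigma> r * Mu + \<epsilon> * (l2 \<phi> * Mg + Mu * l2 (grad \<phi>))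
        + \<bar>\<mu> - 4 * pi * strength (b ^ 5) (b\<^sup>2) / d r ^ 3\<bar> * (Mu * l2 \<phi>)
        + 24 * strength (b ^ 5) (b\<^sup>2) / d r ^ 3 * (3 * d r * (Mu * l2 (grad \<phi>) + Mg * l2 \<phi>))"
      using corrector_estimate[OF pos sc(1,2) dr1 \<phi> R0 M0(2) M1(2) M2 f sol w(2)[OF r] w(3)[OF r] w(4)[OF r] q \<mu>,
        folded R_def, unfolded \<sigma>r, folded \<tau>_def \<epsilon>_def] by (rule bexE)
    note A = A0 conjunct1[OF A'] conjunct1[OF conjunct2[OF A']] and main = conjunct2[OF conjunct2[OF A']]
    have lA: "l2 (\<lambda>x. indicator A x *\<^sub>R Q x) \<le> e / (2 * N)"
      using \<delta>(2) A C\<delta> unfolding sc(3) by simp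
    have NN: "M1 * \<sigma> r + M0 * \<tau> \<le> N"
    proof -
      have "M1 * \<sigma> r \<le> M1 * 1" using \<sigma>1 M1(1) by (intro mult_left_mono) auto
      moreover have "M0 * \<tau> \<le> M0 * T" using \<tau> M0(1) by (intro mult_left_mono) auto
      ultimately show ?thesis by (simp add: N_def)
    qed
    have N0: "N > 0" by (rule D(1)[OF N_def])
    have "l2 (\<lambda>x. indicator A x *\<^sub>R Q x) * (M1 * \<sigma> r + M0 * \<tau>) \<le> l2 (\<lambda>x. indicator A x *\<^sub>R Q x) * N"
      by (rule mult_left_mono[OF NN l2_nonneg])
    also have "\<dots> \<le> e / (2 * N) * N" by (rule mult_right_mono[OF lA]) (use N0 in simp)
    also have "\<dots> = e / 2" using N0 by simp
    finally have 1: "l2 (\<lambda>x. indicator A x *\<^sub>R Q x) * (M1 * \<sigma> r + M0 * \<tau>) \<le> e / 2" .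
    have 2: "\<epsilon> * (l2 \<phi> * Mg + Mu * l2 (grad \<phi>)) \<le> (4 * \<mu> / pi * b\<^sup>2 + 2 * b) * (l2 \<phi> * Mg + Mu * l2 (grad \<phi>))"
      unfolding \<epsilon>_def by (rule mult_right_mono[OF sc(5)]) (intro add_nonneg_nonneg mult_nonneg_nonneg l2_nonneg Mu0 Mg0)
    have 3: "\<bar>\<mu> - 4 * pi * strength (b ^ 5) (b\<^sup>2) / d r ^ 3\<bar> * (Mu * l2 \<phi>) \<le> 2 * \<mu> * b ^ 3 * (Mu * l2 \<phi>)"
      by (rule mult_right_mono[OF sc(6)]) (intro mult_nonneg_nonneg l2_nonneg Mu0)
    have 4: "24 * strength (b ^ 5) (b\<^sup>2) / d r ^ 3 * (3 * d r * (Mu * l2 (grad \<phi>) + Mg * l2 \<phi>))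
        \<le> 12 * \<mu> / pi * (3 * d r * (Mu * l2 (grad \<phi>) + Mg * l2 \<phi>))"
      by (rule mult_right_mono[OF sc(7)]) (use dr(1) in \<open>intro add_nonneg_nonneg mult_nonneg_nonneg l2_nonneg Mu0 Mg0; simp\<close>)
    have "\<bar>form \<mu> \<phi> (w r) - f \<phi>\<bar> \<le> e / 2 + rest r"
      using main 1 2 3 4 unfolding rest_def b_def[symmetric] by linarith
    then show "dist (form \<mu> \<phi> (w r)) (f \<phi>) < e" using re unfolding dist_real_def by linarith
  qed
qed

section \<open>From test functions to all functionals\<close>

lemma form_diff_bound:
  assumes u: "H1_pair u G" "H1_pair v H" "H1_pair z Z" and \<mu>: "\<mu> \<ge> 0"
  shows "\<bar>form \<mu> u z - form \<mu> v z\<bar> \<le> l2 (\<lambda>x. G x - H x) * l2 Z + \<mu> * (l2 (\<lambda>x. u x - v x) * l2 z)"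
proof -
  note p = H1_pair_lincomb[OF u(1,2), of "-1"] and L = H1_pair_L2[OF u(1)] H1_pair_L2[OF u(2)] H1_pair_L2[OF u(3)]
  have "form \<mu> (\<lambda>x. u x + (-1) * v x) z = form \<mu> u z + (-1) * form \<mu> v z"
    by (rule form_lin) (rule H1_pair_H1[OF u(1)] H1_pair_H1[OF u(2)] H1_pair_H1[OF u(3)])+
  then have "form \<mu> u z - form \<mu> v z = (\<integral>x. (G x - H x) \<bullet> Z x \<partial>lborel) + \<mu> * (\<integral>x. (u x - v x) * z x \<partial>lborel)"
    unfolding form_pair[OF p u(3)] by simp
  then have "\<bar>form \<mu> u z - form \<mu> v z\<bar> \<le> \<bar>\<integral>x. (G x - H x) \<bullet> Z x \<partial>lborel\<bar> + \<mu> * \<bar>\<integral>x. (u x - v x) * z x \<partial>lborel\<bar>"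
    using abs_triangle_ineq[of "\<integral>x. (G x - H x) \<bullet> Z x \<partial>lborel" "\<mu> * (\<integral>x. (u x - v x) * z x \<partial>lborel)"] \<mu> by (simp only: abs_mult abs_of_nonneg)
  also have "\<dots> \<le> l2 (\<lambda>x. G x - H x) * l2 Z + \<mu> * (l2 (\<lambda>x. u x - v x) * l2 z)"
    by (intro add_mono mult_left_mono \<mu> L2_inner_Cauchy_Schwarz L2_mult_Cauchy_Schwarz L2_diff L)
  finally show ?thesis .
qed
 
lemma perforated_weak_convergence:
  fixes w :: "real \<Rightarrow> real ^ 3 \<Rightarrow> real"
  assumes \<mu>: "\<mu> > 0" and u: "H1_pair u U" and r0: "r0 > 0"
    and w: "\<And>r. 0 < r \<Longrightarrow> r < r0 \<Longrightarrow> H1_pair (w r) (G r)"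
      "\<And>r. 0 < r \<Longrightarrow> r < r0 \<Longrightarrow> l2 (w r) \<le> Mu" "\<And>r. 0 < r \<Longrightarrow> r < r0 \<Longrightarrow> l2 (G r) \<le> Mg"
    and lim: "\<And>\<phi>. \<phi> \<in> test_functions \<Longrightarrow> ((\<lambda>r. form \<mu> \<phi> (w r)) \<longlongrightarrow> form \<mu> \<phi> u) (at_right 0)"
  shows "H1_weakly_tendsto w u (at_right 0)"
  unfolding H1_weakly_tendsto_def
proof (intro ballI tendstoI)
  fix F :: "(real ^ 3 \<Rightarrow> real) \<Rightarrow> real" and e :: real assume F: "F \<in> H_minus1" and e: "e > 0"
  have "\<exists>p. weak_solution_limit \<mu> F p"
    using limit_problem_unique_solution[OF \<mu> F] unfolding Ex1_ae_def by (rule conjunct1)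
  then obtain p where "weak_solution_limit \<mu> F p" by (rule exE)
  then have p: "p \<in> H1" "\<And>v. v \<in> H1 \<Longrightarrow> form \<mu> p v = F v" by (simp_all add: weak_solution_limit_form)
  define P where "P = weak_gradient p"
  have pp: "H1_pair p P" unfolding P_def by (rule H1_pair_weak_gradient[OF p(1)])
  obtain \<phi> where \<phi>: "\<And>n. \<phi> n \<in> test_functions" "(\<lambda>n. l2 (\<lambda>x. \<phi> n x - p x)) \<longlonglongrightarrow> 0"
    "(\<lambda>n. l2 (\<lambda>x. grad (\<phi> n) x - P x)) \<longlonglongrightarrow> 0" using H1_density[OF pp] by blast
  define B where "B n Lz LZ = l2 (\<lambda>x. grad (\<phi> n) x - P x) * LZ + \<mu> * (l2 (\<lambda>x. \<phi> n x - p x) * Lz)" for n Lz LZ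
  have B0: "(\<lambda>n. B n Lz LZ) \<longlonglongrightarrow> 0" for Lz LZ
  proof -
    have "(\<lambda>n. B n Lz LZ) \<longlonglongrightarrow> 0 * LZ + \<mu> * (0 * Lz)" unfolding B_def[abs_def] by (intro tendsto_intros \<phi>(2,3))
    then show ?thesis by simp
  qed
  have Bb: "\<bar>form \<mu> (\<phi> n) z - F z\<bar> \<le> B n Lz LZ" if "H1_pair z Z" "l2 z \<le> Lz" "l2 Z \<le> LZ" for n z Z Lz LZ
  proof -
    have "\<bar>form \<mu> (\<phi> n) z - F z\<bar> \<le> l2 (\<lambda>x. grad (\<phi> n) x - P x) * l2 Z + \<mu> * (l2 (\<lambda>x. \<phi> n x - p x) * l2 z)"
      using form_diff_bound[OF H1_pair_test[OF \<phi>(1)] pp that(1), of \<mu>] \<mu> p(2)[OF H1_pair_H1[OF that(1)]] by simp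
    also have "\<dots> \<le> B n Lz LZ"
      unfolding B_def using \<mu> by (intro add_mono mult_left_mono that l2_nonneg) auto
    finally show ?thesis .
  qed
  have e3: "e / 3 > 0" using e by simp
  have "\<forall>\<^sub>F n in sequentially. B n Mu Mg < e / 3 \<and> B n (l2 u) (l2 U) < e / 3"
    by (intro eventually_conj order_tendstoD(2)[OF B0] e3)
  \<comment> \<open>One index \<open>n\<close> serves all r: the approximation error for
    \<open>w r\<close> is bounded through \<open>Mu\<close> and \<open>Mg\<close> alone. Only
    afterwards is r made small.\<close>
  then obtain n where n: "B n Mu Mg < e / 3" "B n (l2 u) (l2 U) < e / 3"
    using eventually_happens'[OF sequentially_bot] by blast
  have small: "\<forall>\<^sub>F r in at_right 0. r < r0" using eventually_at_right_field r0 by blast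
  have "\<forall>\<^sub>F r in at_right 0. (0 < r \<and> r < r0) \<and> dist (form \<mu> (\<phi> n) (w r)) (form \<mu> (\<phi> n) u) < e / 3"
    by (intro eventually_conj eventually_at_right_less small tendstoD[OF lim[OF \<phi>(1)] e3])
  then show "\<forall>\<^sub>F r in at_right 0. dist (F (w r)) (F u) < e"
  proof (rule eventually_mono)
    fix r assume *: "(0 < r \<and> r < r0) \<and> dist (form \<mu> (\<phi> n) (w r)) (form \<mu> (\<phi> n) u) < e / 3"
    then have r: "0 < r" "r < r0" by simp_all
    have "\<bar>form \<mu> (\<phi> n) (w r) - F (w r)\<bar> \<le> B n Mu Mg" by (rule Bb[OF w(1)[OF r] w(2)[OF r] w(3)[OF r]])
    moreover have "\<bar>form \<mu> (\<phi> n) u - F u\<bar> \<le> B n (l2 u) (l2 U)" by (rule Bb[OF u order_refl order_refl])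
    ultimately show "dist (F (w r)) (F u) < e" using * n unfolding dist_real_def by linarith
  qed
qed

text \<open>Testing the equation with its solution gives l2(G)^2 = f(u), and the Poincare inequality
  bounds the H1 norm of \<open>u\<close> by that of \<open>G\<close>; one factor cancels.\<close>

lemma coercive_solution_bound:
  assumes f: "\<And>v. v \<in> H1 \<Longrightarrow> \<bar>f v\<bar> \<le> C * H1_norm v" and C: "C \<ge> 0" and p: "H1_pair u G"
    and sol: "form 0 u u = f u" and k: "k \<ge> 0" "(l2 u)\<^sup>2 \<le> k * (l2 G)\<^sup>2"
  shows "l2 G \<le> C * sqrt (k + 1)" "l2 u \<le> sqrt k * (C * sqrt (k + 1))"
proof -
  have n: "H1_norm u \<le> sqrt (k + 1) * l2 G"
  proof -
    have "(l2 u)\<^sup>2 + (l2 G)\<^sup>2 \<le> (k + 1) * (l2 G)\<^sup>2" using k(2) by (simp add: algebra_simps)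
    then have "H1_norm u \<le> sqrt ((k + 1) * (l2 G)\<^sup>2)" unfolding H1_norm_pair[OF p] by (rule real_sqrt_le_mono)
    then show ?thesis by (simp add: real_sqrt_mult l2_nonneg)
  qed
  have "(l2 G)\<^sup>2 = f u" using sol unfolding form_self[OF p] by simp
  also have "\<dots> \<le> C * H1_norm u" using f[OF H1_pair_H1[OF p]] by linarith
  also have "\<dots> \<le> C * (sqrt (k + 1) * l2 G)" by (rule mult_left_mono[OF n C])
  finally have q: "l2 G * l2 G \<le> (C * sqrt (k + 1)) * l2 G" by (simp add: power2_eq_square)
  show g: "l2 G \<le> C * sqrt (k + 1)"
  proof (cases "l2 G = 0")
    case True
    then show ?thesis using C k(1) by simp
  next
    case False
    then have "l2 G > 0" using l2_nonneg[of G] by linarith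
    with q show ?thesis by (rule mult_right_le_imp_le)
  qed
  have "l2 u \<le> sqrt (k * (l2 G)\<^sup>2)" by (rule real_le_rsqrt[OF k(2)])
  also have "\<dots> = sqrt k * l2 G" by (simp add: real_sqrt_mult l2_nonneg)
  also have "\<dots> \<le> sqrt k * (C * sqrt (k + 1))" by (rule mult_left_mono[OF g]) (use k(1) in simp)
  finally show "l2 u \<le> sqrt k * (C * sqrt (k + 1))" .
qed

theorem theorem1p5:
  fixes \<mu> :: real and d :: "real \<Rightarrow> real"
  assumes "\<mu> > 0"
    and "\<And>r. r > 0 \<Longrightarrow> d r > 0 \<and> \<mu> = 4 * pi * r / (d r) ^ 3"
  shows "\<exists>r0>0. \<forall>f \<in> (H_minus1 :: ((real ^ 3 \<Rightarrow> real) \<Rightarrow> real) set).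
    (\<forall>r. 0 < r \<and> r < r0 \<longrightarrow> Ex1_ae (weak_solution_outside (holes (d r) r) f)) \<and>
    Ex1_ae (weak_solution_limit \<mu> f) \<and>
    (\<forall>w u. (\<forall>r. 0 < r \<and> r < r0 \<longrightarrow> weak_solution_outside (holes (d r) r) f (w r)) \<longrightarrow>
       weak_solution_limit \<mu> f u \<longrightarrow> H1_weakly_tendsto w u (at_right 0))"
proof -
  note \<mu> = assms(1) and d = assms(2)
  \<comment> \<open>Since d^3 = 4\<pi> r / \<mu>, any r with r^2 < 4\<pi>/\<mu> satisfies r < d, as
    the Poincare inequality requires; r0 is half of that threshold. It depends on \<mu> alone and
    thus serves every \<open>f\<close>.\<close>
  define r0 where "r0 = sqrt (pi / \<mu>)"
  have r0: "r0 > 0" using \<mu> by (simp add: r0_def)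
  have rd: "r < d r" if r: "0 < r" "r < r0" for r
  proof (rule ccontr)
    assume "\<not> r < d r"
    then have "d r ^ 3 \<le> r ^ 3" using d[OF r(1)] by (intro power_mono) auto
    moreover have "d r ^ 3 = 4 * pi * r / \<mu>" by (rule eq_divide_swap[OF \<mu>]) (use d[OF r(1)] in blast)
    ultimately have "4 * pi * r / \<mu> \<le> r ^ 3" by (simp only:)
    moreover have "4 * pi * r / \<mu> = r * (4 * (pi / \<mu>))" "r ^ 3 = r * r\<^sup>2"
      by (simp_all add: power3_eq_cube power2_eq_square)
    ultimately have "r * (4 * (pi / \<mu>)) \<le> r * r\<^sup>2" by (simp only:)
    then have "4 * (pi / \<mu>) \<le> r\<^sup>2" using r(1) by (rule mult_left_le_imp_le)
    moreover have "r\<^sup>2 < r0\<^sup>2" using r by (intro power_strict_mono) auto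
    moreover have "r0\<^sup>2 = pi / \<mu>" "pi / \<mu> > 0" using \<mu> by (simp_all add: r0_def)
    ultimately show False by linarith
  qed
  \<comment> \<open>A constant independent of r, so the solutions share one bound in H1.\<close>
  define k where "k = 72 * pi / \<mu>"
  have k: "k > 0" using \<mu> by (simp add: k_def)
  have coercive: "(l2 v)\<^sup>2 \<le> k * (l2 G)\<^sup>2" if "0 < r" "r < r0" "v \<in> H1_vanishing_in (holes (d r) r)" "H1_pair v G" for r G and v :: "real ^ 3 \<Rightarrow> real"
    unfolding k_def by (rule perforated_coercive[OF that(1) rd[OF that(1,2)] _ that(3,4)]) (use d[OF that(1)] in blast)
  have outside: "Ex1_ae (weak_solution_outside (holes (d r) r) f)"
    if f: "f \<in> H_minus1" and r: "0 < r" "r < r0" for f :: "(real ^ 3 \<Rightarrow> real) \<Rightarrow> real" and r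
  proof (rule outside_problem_unique_solution[OF holes_borel _ f])
    show "d r > 0" using d[OF r(1)] by blast
    show "1 / (k + 1) > 0" using k by simp
    fix v :: "real ^ 3 \<Rightarrow> real" and G assume "v \<in> H1_vanishing_in (holes (d r) r)" "H1_pair v G"
    from coercive[OF r this] have "(l2 v)\<^sup>2 + (l2 G)\<^sup>2 \<le> (l2 G)\<^sup>2 * (k + 1)" by (simp add: algebra_simps)
    then show "1 / (k + 1) * ((l2 v)\<^sup>2 + (l2 G)\<^sup>2) \<le> (l2 G)\<^sup>2" using k by (simp add: pos_divide_le_eq)
  qed
  have conv: "H1_weakly_tendsto w u (at_right 0)"
    if f: "f \<in> H_minus1" and w: "\<And>r. 0 < r \<Longrightarrow> r < r0 \<Longrightarrow> weak_solution_outside (holes (d r) r) f (w r)"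
      and u: "weak_solution_limit \<mu> f u"
    for f and w :: "real \<Rightarrow> real ^ 3 \<Rightarrow> real" and u
  proof -
    have u1: "u \<in> H1" "\<And>v. v \<in> H1 \<Longrightarrow> form \<mu> u v = f v" using u by (simp_all add: weak_solution_limit_form)
    note pu = H1_pair_weak_gradient[OF u1(1)]
    obtain C where C: "\<And>v. v \<in> H1 \<Longrightarrow> \<bar>f v\<bar> \<le> C * H1_norm v" using f unfolding H_minus1_def by blast
    have C': "\<bar>f v\<bar> \<le> \<bar>C\<bar> * H1_norm v" if "v \<in> H1" for v
    proof -
      have "0 \<le> H1_norm v" unfolding H1_norm_pair[OF H1_pair_weak_gradient[OF that]] by simp
      then have "C * H1_norm v \<le> \<bar>C\<bar> * H1_norm v" by (intro mult_right_mono) auto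
      with C[OF that] show ?thesis by linarith
    qed
    define Mg where "Mg = \<bar>C\<bar> * sqrt (k + 1)"
    have wH: "w r \<in> H1_vanishing_in (holes (d r) r)" "form 0 (w r) (w r) = f (w r)" if "0 < r" "r < r0" for r
      using w[OF that] by (simp_all add: weak_solution_outside_form)
    have pw: "H1_pair (w r) (weak_gradient (w r))" if "0 < r" "r < r0" for r
      using wH(1)[OF that] by (intro H1_pair_weak_gradient) (simp add: H1_vanishing_in_def)
    have bg: "l2 (weak_gradient (w r)) \<le> Mg" and bu: "l2 (w r) \<le> sqrt k * Mg" if r: "0 < r" "r < r0" for r
      unfolding Mg_def
      by (rule coercive_solution_bound[OF C' abs_ge_zero pw[OF r] wH(2)[OF r] less_imp_le[OF k] coercive[OF r wH(1)[OF r] pw[OF r]]]; assumption)+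
    show ?thesis
    proof (rule perforated_weak_convergence[OF \<mu> pu r0 pw bu bg])
      fix \<phi> :: "real ^ 3 \<Rightarrow> real" assume \<phi>: "\<phi> \<in> test_functions"
      have "form \<mu> \<phi> u = f \<phi>" using u1(2)[OF H1_pair_H1[OF H1_pair_test[OF \<phi>]]] by (simp add: form_sym)
      then show "((\<lambda>r. form \<mu> \<phi> (w r)) \<longlongrightarrow> form \<mu> \<phi> u) (at_right 0)"
        using perforated_test_convergence[OF \<mu> d f pu u1(2) r0 w pw bu bg \<phi>] by simp
    qed
  qed
  show ?thesis
  proof (intro exI[of _ r0] conjI ballI allI impI r0)
    fix f :: "(real ^ 3 \<Rightarrow> real) \<Rightarrow> real" assume f: "f \<in> H_minus1"
    show "Ex1_ae (weak_solution_outside (holes (d r) r) f)" if "0 < r \<and> r < r0" for r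
      using outside[OF f] that by blast
    show "Ex1_ae (weak_solution_limit \<mu> f)" by (rule limit_problem_unique_solution[OF \<mu> f])
    show "H1_weakly_tendsto w u (at_right 0)"
      if "\<forall>r. 0 < r \<and> r < r0 \<longrightarrow> weak_solution_outside (holes (d r) r) f (w r)" "weak_solution_limit \<mu> f u" for w u
      by (rule conv[OF f _ that(2)]) (use that(1) in blast)
  qed
qed

end
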